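(* Let $K_0\in\mathcal K$ be arbitrary and consider the gradient flow $\dot K_t=-\nabla J(K_t)$ started at $K_0$. Then there exists a solution $K_t$ for all $t\ge 0$, and the following hold. (a) The cost $J(K_t)$ is monotone non-increasing in $t$, and the trajectory $\{K_t\}_{t\ge 0}$ is contained in the sublevel set $\mathcal K_0$. (b) $\nabla J(K_t)\to 0$ as $t\to+\infty$, and for every $T>0$ $$\min_{0\le t\le T}\|\nabla J(K_t)\|_F^2\le \frac{J(K_0)}{T}.$$ (c) $K_t$ converges, as $t\to+\infty$, to the global minimum point $K_*$ of $J$ at exponential rates: for all $t\ge 0$, $$J(K_t)-J(K_* )\le \bigl(J(K_0)-J(K_* )\bigr)e^{-t/\mu},$$ $$\|K_t-K_*\|_F\le 4\mu\sqrt{L\,(J(K_0)-J(K_* ))}\;e^{-t/(2\mu)}.$$ Here $$\mu=\frac{4J(K_0)}{\lambda_1(R)\lambda_1(Q)\lambda_1(\Sigma_0)^2}\left(\|A\|+\frac{\|B\|^2J(K_0)}{\lambda_1(R)\lambda_1(\Sigma_0)}\right)^2$$ and $$L=\frac{2J(K_0)}{\lambda_1(Q)}\left[\lambda_n(R)+\frac{J(K_0)\|D\|^2}{\lambda_1(\Sigma_0)}+\left(\|B\|+\|C\|\|D\|+\frac{2\|B\|\|D\|_F^2J(K_0)}{\lambda_1(\Sigma_0)\lambda_1(R)}+\frac{\|A\|\|D\|_F^2}{\|B\|}\right)\xi\right],$$ with $$\xi=\frac{\sqrt n\,J(K_0)}{\lambda_1(\Sigma_0)}\left(\frac{\tilde\mu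 J(K_0)}{\lambda_1(\Sigma_0)\lambda_1(Q)}+\sqrt{\left(\frac{\tilde\mu J(K_0)}{\lambda_1(\Sigma_0)\lambda_1(Q)}\right)^2+\frac{\lambda_n(R)}{\lambda_1(Q)}}\right),$$ $$\tilde\mu=\|B\|+\|D\|\|C\|_F+\frac{2\|B\|J(K_0)\|D\|^2}{\lambda_1(\Sigma_0)\lambda_1(R)}+\frac{\|A\|\|D\|^2}{\|B\|}.$$
   Context: Data: $A,C\in\mathbb R^{n\times n}$, $B,D\in\mathbb R^{n\times m}$ with $B\neq 0$; $Q\in\mathbb R^{n\times n}$ and $R\in\mathbb R^{m\times m}$ symmetric positive definite. On a complete filtered probability space carrying a standard one-dimensional Brownian motion $B(t)$ and an independent $\sigma$-algebra $\mathcal F_0$, the initial state $X(0)$ is an $\mathcal F_0$-measurable $\mathbb R^n$-valued random variable, and $\Sigma_0:=\mathbb E[X(0)X(0)^\top]$ is assumed positive definite. For $K\in\mathbb R^{m\times n}$ (linear feedback $u=KX$) the state satisfies $$dX(t)=(A+BK)X(t)\,dt+(C+DK)X(t)\,dB(t).$$ $K$ is a mean-square stabilizer if $\lim_{t\to\infty}\mathbb E[X(t)^\top X(t)]=0$ for every initial state; $\mathcal K\subset\mathbb R^{m\times n}$ is the set of mean-square stabilizers, assumed nonempty (the system $[A,C;B,D]$ is mean-square stabilizable). The cost is $$J(K)=\mathbb E\int_0^{+\infty}X(t)^\top(Q+K^\top RK)X(t)\,dt,$$ which is finite exactly for $K\in\mathcal K$; for $K\in\mathcal K$ one has $J(K)=\mathrm{Tr}(P_K\Sigma_0)$,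 where $P_K$ is the unique (positive definite) solution of $$(A+BK)^\top P_K+P_K(A+BK)+(C+DK)^\top P_K(C+DK)+Q+K^\top RK=0.$$ $\nabla J$ is the gradient with respect to the inner product $\langle U,V\rangle=\mathrm{Tr}(U^\top V)$. For $K_0\in\mathcal K$, $\mathcal K_0:=\{K: J(K)\le J(K_0)\}$. $\|\cdot\|$ is the spectral norm, $\|\cdot\|_F$ the Frobenius norm; $\lambda_1(\cdot)$ denotes the minimal eigenvalue and $\lambda_n(\cdot)$ the maximal eigenvalue of a symmetric matrix (of whatever order, so $\lambda_n(R)$ is the largest eigenvalue of $R$). *)

theory Defs
  imports "HOL-Probability.Probability"
begin

section \<open>Matrices\<close>

text \<open>An \<open>m \<times> n\<close> matrix is an element of \<^typ>\<open>real^'n^'m\<close>. On this type \<^const>\<open>norm\<close> is the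
  Frobenius norm and \<^const>\<open>inner\<close> is \<open>\<langle>U, V\<rangle> = Tr(U\<^sup>T V)\<close>.\<close>

definition spectral_norm :: "real^'n^'m \<Rightarrow> real" where
  "spectral_norm A = onorm (\<lambda>v. A *v v)"

definition sym_pos_def :: "real^'n^'n \<Rightarrow> bool" where
  "sym_pos_def A \<longleftrightarrow> transpose A = A \<and> (\<forall>v. v \<noteq> 0 \<longrightarrow> 0 < v \<bullet> (A *v v))"

definition eigenvalues :: "real^'n^'n \<Rightarrow> real set" where
  "eigenvalues A = {c. \<exists>v. v \<noteq> 0 \<and> A *v v = c *\<^sub>R v}"

definition min_eigenvalue :: "real^'n^'n \<Rightarrow> real" where
  "min_eigenvalue A = Min (eigenvalues A)"

definition max_eigenvalue :: "real^'n^'n \<Rightarrow> real" where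
  "max_eigenvalue A = Max (eigenvalues A)"

section \<open>Gradient flows\<close>

definition gradient :: "('v::real_inner \<Rightarrow> real) \<Rightarrow> 'v \<Rightarrow> 'v" where
  "gradient f x = (THE g. GDERIV f x :> g)"

definition gradient_flow :: "('v::real_inner \<Rightarrow> real) \<Rightarrow> (real \<Rightarrow> 'v) \<Rightarrow> bool" where
  "gradient_flow f x \<longleftrightarrow>
     (\<forall>t\<ge>0. GDERIV f (x t) :> gradient f (x t) \<and>
            (x has_vector_derivative - gradient f (x t)) (at t within {0..}))"

section \<open>Brownian motion and the Ito integral\<close>

text \<open>A complete filtered probability space with a standard one-dimensional Brownian motion \<open>W\<close>
  relative to the filtration. Time runs over \<open>t \<ge> 0\<close>; the values of \<open>F\<close> and \<open>W\<close> at negative times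
  play no role. Since the increments after time 0 are independent of the past, the
  sigma-algebra \<^term>\<open>F 0\<close> of initial events is independent of \<open>W\<close>.\<close>

locale brownian_basis =
  prob_space M + complete_measure M + filtration "space M" F
  for M :: "'a measure" and F :: "real \<Rightarrow> 'a measure" +
  fixes W :: "real \<Rightarrow> 'a \<Rightarrow> real"
  assumes subalgebra_F: "0 \<le> t \<Longrightarrow> subalgebra M (F t)"
    and null_sets_F: "null_sets M \<subseteq> sets (F 0)"
    and W_adapted: "0 \<le> t \<Longrightarrow> W t \<in> borel_measurable (F t)"
    and W_0: "AE \<omega> in M. W 0 \<omega> = 0"
    and W_increment_normal: "0 \<le> s \<Longrightarrow> s < t \<Longrightarrow>
      distributed M lborel (\<lambda>\<omega>. W t \<omega> - W s \<omega>) (normal_density 0 (sqrt (t - s)))"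
    and W_increment_indep: "0 \<le> s \<Longrightarrow> s < t \<Longrightarrow>
      indep_set (sets (F s)) (sets (vimage_algebra (space M) (\<lambda>\<omega>. W t \<omega> - W s \<omega>) borel))"
    and W_continuous: "AE \<omega> in M. continuous_on {0..} (\<lambda>t. W t \<omega>)"

text \<open>A simple integrand on \<open>[0, t]\<close> is given by a partition \<open>0 = p 0 \<le> \<dots> \<le> p N = t\<close> and square
  integrable coefficients \<open>h i\<close>, known at time \<open>p i\<close>, that it takes as values on \<open>(p i, p (i+1)]\<close>.\<close>

definition simple_integrand ::
  "'a measure \<Rightarrow> (real \<Rightarrow> 'a measure) \<Rightarrow> real \<Rightarrow> nat \<Rightarrow> (nat \<Rightarrow> real) \<Rightarrow>
   (nat \<Rightarrow> 'a \<Rightarrow> 'v::euclidean_space) \<Rightarrow> bool" where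
  "simple_integrand M F t N p h \<longleftrightarrow>
     p 0 = 0 \<and> p N = t \<and> (\<forall>i<N. p i \<le> p (Suc i)) \<and>
     (\<forall>i<N. h i \<in> borel_measurable (F (p i)) \<and> integrable M (\<lambda>\<omega>. (norm (h i \<omega>))\<^sup>2))"

definition simple_process ::
  "nat \<Rightarrow> (nat \<Rightarrow> real) \<Rightarrow> (nat \<Rightarrow> 'a \<Rightarrow> 'v::euclidean_space) \<Rightarrow> real \<Rightarrow> 'a \<Rightarrow> 'v" where
  "simple_process N p h s \<omega> = (\<Sum>i<N. indicator {p i<..p (Suc i)} s *\<^sub>R h i \<omega>)"

definition simple_ito_integral ::
  "(real \<Rightarrow> 'a \<Rightarrow> real) \<Rightarrow> nat \<Rightarrow> (nat \<Rightarrow> real) \<Rightarrow> (nat \<Rightarrow> 'a \<Rightarrow> 'v::euclidean_space) \<Rightarrow> 'a \<Rightarrow> 'v" where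
  "simple_ito_integral W N p h \<omega> = (\<Sum>i<N. (W (p (Suc i)) \<omega> - W (p i) \<omega>) *\<^sub>R h i \<omega>)"

text \<open>\<open>I\<close> is (a version of) the Ito integral of \<open>Y\<close> over \<open>[0, t]\<close>: the limit in mean square of the
  integrals of simple integrands that approximate \<open>Y\<close> in the norm of \<open>L\<^sup>2([0, t] \<times> \<Omega>)\<close>.\<close>

definition has_ito_integral ::
  "'a measure \<Rightarrow> (real \<Rightarrow> 'a measure) \<Rightarrow> (real \<Rightarrow> 'a \<Rightarrow> real) \<Rightarrow> real \<Rightarrow>
   (real \<Rightarrow> 'a \<Rightarrow> 'v::euclidean_space) \<Rightarrow> ('a \<Rightarrow> 'v) \<Rightarrow> bool" where
  "has_ito_integral M F W t Y I \<longleftrightarrow>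
     I \<in> borel_measurable M \<and>
     (\<exists>N p h. (\<forall>k. simple_integrand M F t (N k) (p k) (h k)) \<and>
        (\<lambda>k. \<integral>\<^sup>+\<omega>. (\<integral>\<^sup>+s\<in>{0..t}. ennreal ((norm (simple_process (N k) (p k) (h k) s \<omega> - Y s \<omega>))\<^sup>2) \<partial>lborel) \<partial>M)
          \<longlonglongrightarrow> 0 \<and>
        (\<lambda>k. \<integral>\<^sup>+\<omega>. ennreal ((norm (simple_ito_integral W (N k) (p k) (h k) \<omega> - I \<omega>))\<^sup>2) \<partial>M)
          \<longlonglongrightarrow> 0)"

section \<open>The controlled system\<close>

definition initial_state ::
  "'a measure \<Rightarrow> (real \<Rightarrow> 'a measure) \<Rightarrow> ('a \<Rightarrow> real^'n) \<Rightarrow> bool" where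
  "initial_state M F \<xi> \<longleftrightarrow>
     \<xi> \<in> borel_measurable (F 0) \<and> integrable M (\<lambda>\<omega>. (norm (\<xi> \<omega>))\<^sup>2)"

definition second_moment :: "'a measure \<Rightarrow> ('a \<Rightarrow> real^'n) \<Rightarrow> real^'n^'n" where
  "second_moment M \<xi> = (\<chi> i j. \<integral>\<omega>. \<xi> \<omega> $ i * \<xi> \<omega> $ j \<partial>M)"

text \<open>Strong solutions \<open>X\<close> of \<open>dX = (A + BK) X dt + (C + DK) X dW\<close>, \<open>X(0) = \<xi>\<close>: adapted and
  continuous, with \<open>X\<close> in \<open>L\<^sup>2([0, T] \<times> \<Omega>)\<close> for all \<open>T\<close> so that the Ito integral above applies.
  The initial condition is the equation at \<open>t = 0\<close>.\<close>

definition closed_loop_solution ::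
  "'a measure \<Rightarrow> (real \<Rightarrow> 'a measure) \<Rightarrow> (real \<Rightarrow> 'a \<Rightarrow> real) \<Rightarrow>
   real^'n^'n \<Rightarrow> real^'m^'n \<Rightarrow> real^'n^'n \<Rightarrow> real^'m^'n \<Rightarrow> real^'n^'m \<Rightarrow>
   ('a \<Rightarrow> real^'n) \<Rightarrow> (real \<Rightarrow> 'a \<Rightarrow> real^'n) \<Rightarrow> bool" where
  "closed_loop_solution M F W A B C D K \<xi> X \<longleftrightarrow>
     (\<forall>t\<ge>0. X t \<in> borel_measurable (F t)) \<and>
     (AE \<omega> in M. continuous_on {0..} (\<lambda>t. X t \<omega>)) \<and>
     (\<forall>T\<ge>0. (\<integral>\<^sup>+\<omega>. (\<integral>\<^sup>+s\<in>{0..T}. ennreal ((norm (X s \<omega>))\<^sup>2) \<partial>lborel) \<partial>M) < \<infinity>) \<and>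
     (\<forall>t\<ge>0. \<exists>I. has_ito_integral M F W t (\<lambda>s \<omega>. (C + D ** K) *v X s \<omega>) I \<and>
        (AE \<omega> in M. X t \<omega> = \<xi> \<omega> + integral {0..t} (\<lambda>s. (A + B ** K) *v X s \<omega>) + I \<omega>))"

text \<open>The linear equation has exactly one solution up to indistinguishability, so the choice below
  does not matter.\<close>

definition closed_loop_state ::
  "'a measure \<Rightarrow> (real \<Rightarrow> 'a measure) \<Rightarrow> (real \<Rightarrow> 'a \<Rightarrow> real) \<Rightarrow>
   real^'n^'n \<Rightarrow> real^'m^'n \<Rightarrow> real^'n^'n \<Rightarrow> real^'m^'n \<Rightarrow> real^'n^'m \<Rightarrow>
   ('a \<Rightarrow> real^'n) \<Rightarrow> real \<Rightarrow> 'a \<Rightarrow> real^'n" where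
  "closed_loop_state M F W A B C D K \<xi> = (SOME X. closed_loop_solution M F W A B C D K \<xi> X)"

definition mean_square_stabilizers ::
  "'a measure \<Rightarrow> (real \<Rightarrow> 'a measure) \<Rightarrow> (real \<Rightarrow> 'a \<Rightarrow> real) \<Rightarrow>
   real^'n^'n \<Rightarrow> real^'m^'n \<Rightarrow> real^'n^'n \<Rightarrow> real^'m^'n \<Rightarrow> (real^'n^'m) set" where
  "mean_square_stabilizers M F W A B C D =
     {K. \<forall>\<xi>. initial_state M F \<xi> \<longrightarrow>
        ((\<lambda>t. \<integral>\<^sup>+\<omega>. ennreal (closed_loop_state M F W A B C D K \<xi> t \<omega> \<bullet>
                             closed_loop_state M F W A B C D K \<xi> t \<omega>) \<partial>M) \<longlongrightarrow> 0) at_top}"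

text \<open>For positive definite \<open>Q\<close> and \<open>R\<close> the integrand is nonnegative; the cost may be infinite.\<close>

definition lq_cost ::
  "'a measure \<Rightarrow> (real \<Rightarrow> 'a measure) \<Rightarrow> (real \<Rightarrow> 'a \<Rightarrow> real) \<Rightarrow>
   real^'n^'n \<Rightarrow> real^'m^'n \<Rightarrow> real^'n^'n \<Rightarrow> real^'m^'n \<Rightarrow> real^'n^'n \<Rightarrow> real^'m^'m \<Rightarrow>
   ('a \<Rightarrow> real^'n) \<Rightarrow> real^'n^'m \<Rightarrow> ennreal" where
  "lq_cost M F W A B C D Q R \<xi> K =
     (\<integral>\<^sup>+\<omega>. (\<integral>\<^sup>+t\<in>{0..}.
        ennreal (closed_loop_state M F W A B C D K \<xi> t \<omega> \<bullet>
          ((Q + transpose K ** R ** K) *v closed_loop_state M F W A B C D K \<xi> t \<omega>)) \<partial>lborel) \<partial>M)"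

end

theory Submission
  imports Defs "HOL-Real_Asymp.Real_Asymp"
begin

text \<open>By the Ito isometry the matrix \<open>S t\<close> of second moments of the closed-loop state solves the linear
  equation \<open>S' = a S + S a\<^sup>T + c S c\<^sup>T\<close> with \<open>a = A + B K\<close> and \<open>c = C + D K\<close>, so stability of \<open>K\<close> and the
  cost reduce to this Lyapunov operator and its adjoint: \<open>J K = \<langle>Q + K\<^sup>T R K, G\<rangle> = \<langle>P, \<Sigma>0\<rangle>\<close>, where \<open>G\<close> and
  \<open>P\<close> solve the two Lyapunov equations. An exact formula for \<open>J K' - J K\<close> in terms of the residual
  \<open>E = R K + B\<^sup>T P + D\<^sup>T P c\<close> yields the gradient \<open>2 E G\<close>, the gradient dominance inequality
  \<open>J K - J K\<^sub>* \<le> \<mu> \<parallel>\<nabla>J K\<parallel>\<^sup>2\<close> and quadratic growth around the minimizer. Sublevel sets are compact and the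
  gradient is Lipschitz on them, so the gradient flow cannot leave the initial sublevel set and exists
  for all times. Gradient dominance makes the cost decay exponentially along the flow, and quadratic
  growth turns this into a rate for the distance.\<close>

section \<open>Square integrable functions\<close>

text \<open>\<open>closed_loop_state\<close> is a choice among solutions, so nothing can be said
  about it before one exists; the Euler scheme supplies it, and the moment equation is derived for
  an arbitrary solution. For that the state is split into initial value plus stochastic integral,
  governed by isometry and orthogonality of increments, and a drift that is differentiable in time,
  governed by the pathwise product rule. The cost formula is exact because it pairs
  \<open>PK\<close> at one feedback with \<open>GK\<close> at the other. Both rates hinge on a lower
  bound for the least eigenvalue of \<open>GK\<close> on a sublevel set: testing the Lyapunov
  equation on its eigenvector bounds it by the inverse of the norm of \<open>A + B ** K\<close>, and
  the cost in turn bounds that norm. The bracket in \<open>\<mu>\<close> is half of the resulting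
  norm bound. The obstacle for the flow is that the gradient makes sense only at stable feedbacks
  and is Lipschitz only on sublevel sets. The field is therefore extended from a slightly larger
  sublevel set, and the decrease of the cost shows that the trajectory never meets the
  extension.\<close>

definition square_integrable :: "'a measure \<Rightarrow> ('a \<Rightarrow> 'v::euclidean_space) \<Rightarrow> bool" where
  "square_integrable M f \<longleftrightarrow> f \<in> borel_measurable M \<and> integrable M (\<lambda>\<omega>. (norm (f \<omega>))\<^sup>2)"

lemma square_integrable_measurable [measurable_dest]:
  "square_integrable M f \<Longrightarrow> f \<in> borel_measurable M"
  by (simp add: square_integrable_def)

lemma square_integrable_integrable:
  "square_integrable M f \<Longrightarrow> integrable M (\<lambda>\<omega>. (norm (f \<omega>))\<^sup>2)"
  by (simp add: square_integrable_def)

lemma square_integrable_bound: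
  fixes f :: "'a \<Rightarrow> 'v::euclidean_space" and g :: "'a \<Rightarrow> real"
  assumes "integrable M g" "f \<in> borel_measurable M" "AE \<omega> in M. (norm (f \<omega>))\<^sup>2 \<le> g \<omega>"
  shows "square_integrable M f"
  unfolding square_integrable_def
proof (intro conjI)
  show "integrable M (\<lambda>\<omega>. (norm (f \<omega>))\<^sup>2)"
    by (rule Bochner_Integration.integrable_bound[OF assms(1)])
      (use assms in \<open>auto elim!: eventually_mono\<close>)
qed (use assms in auto)

lemma square_integrable_nn:
  fixes f :: "'a \<Rightarrow> 'v::euclidean_space"
  shows "square_integrable M f \<longleftrightarrow>
    f \<in> borel_measurable M \<and> (\<integral>\<^sup>+\<omega>. ennreal ((norm (f \<omega>))\<^sup>2) \<partial>M) < \<infinity>"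
  unfolding square_integrable_def by (auto simp: integrable_iff_bounded)

lemma norm_add_sq_le:
  fixes a b :: "'v::real_inner"
  shows "(norm (a + b))\<^sup>2 \<le> 2 * (norm a)\<^sup>2 + 2 * (norm b)\<^sup>2"
proof -
  have "0 \<le> (norm (a - b))\<^sup>2" by simp
  then show ?thesis
    by (simp add: power2_norm_eq_inner inner_add_left inner_add_right inner_diff_left inner_diff_right inner_commute)
qed

lemma square_integrable_add:
  assumes "square_integrable M f" "square_integrable M g"
  shows "square_integrable M (\<lambda>\<omega>. f \<omega> + g \<omega>)"
  by (rule square_integrable_bound[of _ "\<lambda>\<omega>. 2 * (norm (f \<omega>))\<^sup>2 + 2 * (norm (g \<omega>))\<^sup>2"])
    (use assms in \<open>auto simp: square_integrable_def norm_add_sq_le intro!: Bochner_Integration.integrable_add\<close>)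

lemma square_integrable_scaleR:
  "square_integrable M f \<Longrightarrow> square_integrable M (\<lambda>\<omega>. c *\<^sub>R f \<omega>)"
  by (auto simp: square_integrable_def power_mult_distrib)

lemma square_integrable_uminus:
  "square_integrable M f \<Longrightarrow> square_integrable M (\<lambda>\<omega>. - f \<omega>)"
  using square_integrable_scaleR[of M f "-1"] by simp

lemma square_integrable_diff:
  assumes "square_integrable M f" "square_integrable M g"
  shows "square_integrable M (\<lambda>\<omega>. f \<omega> - g \<omega>)"
  using square_integrable_add[OF assms(1) square_integrable_uminus[OF assms(2)]] by simp

lemma square_integrable_zero [simp]: "square_integrable M (\<lambda>\<omega>. 0)"
  by (simp add: square_integrable_def)

lemma square_integrable_sum:
  "(\<And>i. i \<in> I \<Longrightarrow> square_integrable M (f i)) \<Longrightarrow> square_integrable M (\<lambda>\<omega>. \<Sum>i\<in>I. f i \<omega>)"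
  by (induction I rule: infinite_finite_induct) (auto intro: square_integrable_add)

lemma square_integrable_linear:
  fixes T :: "'v::euclidean_space \<Rightarrow> 'w::euclidean_space"
  assumes "bounded_linear T" "square_integrable M f"
  shows "square_integrable M (\<lambda>\<omega>. T (f \<omega>))"
proof -
  obtain B where B: "\<And>x. norm (T x) \<le> norm x * B" "B > 0"
    using bounded_linear.pos_bounded[OF assms(1)] by metis
  have sq: "(norm (T x))\<^sup>2 \<le> (norm x)\<^sup>2 * B\<^sup>2" for x
    using power_mono[OF B(1)[of x], of 2] by (simp add: power_mult_distrib)
  have "T \<in> borel_measurable borel"
    by (intro borel_measurable_continuous_onI linear_continuous_on assms)
  then have "(\<lambda>\<omega>. T (f \<omega>)) \<in> borel_measurable M"
    using assms(2) by (auto simp: square_integrable_def)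
  then show ?thesis
    using assms(2) B
    by (intro square_integrable_bound[of _ "\<lambda>\<omega>. (norm (f \<omega>))\<^sup>2 * B\<^sup>2"])
      (auto simp: square_integrable_def sq)
qed

lemma square_integrable_inner_left:
  "square_integrable M f \<Longrightarrow> square_integrable M (\<lambda>\<omega>. u \<bullet> f \<omega>)"
  by (rule square_integrable_linear[OF bounded_linear_inner_right])

lemma integrable_inner:
  fixes f g :: "'a \<Rightarrow> 'v::euclidean_space"
  assumes "square_integrable M f" "square_integrable M g"
  shows "integrable M (\<lambda>\<omega>. f \<omega> \<bullet> g \<omega>)"
proof (rule Bochner_Integration.integrable_bound)
  show "integrable M (\<lambda>\<omega>. (norm (f \<omega>))\<^sup>2 + (norm (g \<omega>))\<^sup>2)"
    using assms by (auto simp: square_integrable_def)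
  have "\<bar>x \<bullet> y\<bar> \<le> (norm x)\<^sup>2 + (norm y)\<^sup>2" for x y :: 'v
    using Cauchy_Schwarz_ineq2[of x y] sum_squares_bound[of "norm x" "norm y"]
      mult_nonneg_nonneg[OF norm_ge_zero[of x] norm_ge_zero[of y]]
    by linarith
  then show "AE \<omega> in M. norm (f \<omega> \<bullet> g \<omega>) \<le> norm ((norm (f \<omega>))\<^sup>2 + (norm (g \<omega>))\<^sup>2)"
    by auto
qed (use assms in \<open>auto simp: square_integrable_def\<close>)

lemma integrable_mult_sq:
  fixes f g :: "'a \<Rightarrow> real"
  assumes "square_integrable M f" "square_integrable M g"
  shows "integrable M (\<lambda>\<omega>. f \<omega> * g \<omega>)"
  using integrable_inner[OF assms] by simp

lemma square_integrable_indicator_mult: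
  fixes f :: "'a \<Rightarrow> 'v::euclidean_space"
  assumes "square_integrable M f" "A \<in> sets M"
  shows "square_integrable M (\<lambda>\<omega>. indicator A \<omega> *\<^sub>R f \<omega>)"
  by (rule square_integrable_bound[of _ "\<lambda>\<omega>. (norm (f \<omega>))\<^sup>2"])
    (use assms in \<open>auto simp: square_integrable_def indicator_def\<close>)

text \<open>Weighted Young inequality in place of Cauchy-Schwarz. The free weight \<open>r\<close>
  splits the product of an error and a fixed function so that the fixed function carries a small
  weight and the error its inverse.\<close>

lemma integral_inner_bound:
  fixes f g :: "'a \<Rightarrow> 'v::euclidean_space"
  assumes f: "square_integrable M f" and g: "square_integrable M g" and r: "r > 0"
  shows "\<bar>\<integral>\<omega>. f \<omega> \<bullet> g \<omega> \<partial>M\<bar> \<le> r * (\<integral>\<omega>. (norm (f \<omega>))\<^sup>2 \<partial>M) + (\<integral>\<omega>. (norm (g \<omega>))\<^sup>2 \<partial>M) / r"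
proof -
  have *: "\<bar>x \<bullet> y\<bar> \<le> r * (norm x)\<^sup>2 + (norm y)\<^sup>2 / r" for x y :: 'v
  proof -
    have "2 * (sqrt r * norm x) * (norm y / sqrt r) \<le> (sqrt r * norm x)\<^sup>2 + (norm y / sqrt r)\<^sup>2"
      by (rule sum_squares_bound)
    then have "2 * (norm x * norm y) \<le> r * (norm x)\<^sup>2 + (norm y)\<^sup>2 / r"
      using r by (simp add: power_mult_distrib power_divide)
    then show ?thesis
      using Cauchy_Schwarz_ineq2[of x y] mult_nonneg_nonneg[OF norm_ge_zero[of x] norm_ge_zero[of y]]
      by linarith
  qed
  have "\<bar>\<integral>\<omega>. f \<omega> \<bullet> g \<omega> \<partial>M\<bar> \<le> (\<integral>\<omega>. r * (norm (f \<omega>))\<^sup>2 + (norm (g \<omega>))\<^sup>2 / r \<partial>M)"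
    using integrable_inner[OF f g] f g *
    by (intro order_trans[OF integral_abs_bound] integral_mono)
       (auto simp: square_integrable_def)
  also have "\<dots> = r * (\<integral>\<omega>. (norm (f \<omega>))\<^sup>2 \<partial>M) + (\<integral>\<omega>. (norm (g \<omega>))\<^sup>2 \<partial>M) / r"
    using f g by (subst Bochner_Integration.integral_add) (auto simp: square_integrable_def)
  finally show ?thesis .
qed

lemma tendsto_integral_inner:
  fixes f g :: "'a \<Rightarrow> 'v::euclidean_space"
  assumes f: "square_integrable M f" and g: "square_integrable M g"
    and fk: "\<And>k. square_integrable M (fk k)" and gk: "\<And>k. square_integrable M (gk k)"
    and lf: "(\<lambda>k. \<integral>\<^sup>+\<omega>. ennreal ((norm (fk k \<omega> - f \<omega>))\<^sup>2) \<partial>M) \<longlonglongrightarrow> 0"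
    and lg: "(\<lambda>k. \<integral>\<^sup>+\<omega>. ennreal ((norm (gk k \<omega> - g \<omega>))\<^sup>2) \<partial>M) \<longlonglongrightarrow> 0"
  shows "(\<lambda>k. \<integral>\<omega>. fk k \<omega> \<bullet> gk k \<omega> \<partial>M) \<longlonglongrightarrow> (\<integral>\<omega>. f \<omega> \<bullet> g \<omega> \<partial>M)"
proof -
  define df where "df k = (\<integral>\<omega>. (norm (fk k \<omega> - f \<omega>))\<^sup>2 \<partial>M)" for k
  define dg where "dg k = (\<integral>\<omega>. (norm (gk k \<omega> - g \<omega>))\<^sup>2 \<partial>M)" for k
  have *: "(\<lambda>k. \<integral>\<omega>. (norm (fk k \<omega> - f \<omega>))\<^sup>2 \<partial>M) \<longlonglongrightarrow> 0"
    if f: "square_integrable M f" and fk: "\<And>k. square_integrable M (fk k)"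
    and lf: "(\<lambda>k. \<integral>\<^sup>+\<omega>. ennreal ((norm (fk k \<omega> - f \<omega>))\<^sup>2) \<partial>M) \<longlonglongrightarrow> 0" for fk and f :: "'a \<Rightarrow> 'v"
  proof -
    have "(\<lambda>k. ennreal (\<integral>\<omega>. (norm (fk k \<omega> - f \<omega>))\<^sup>2 \<partial>M)) \<longlonglongrightarrow> ennreal 0"
      using lf square_integrable_integrable[OF square_integrable_diff[OF fk f]]
      by (simp add: nn_integral_eq_integral)
    then show ?thesis by (subst (asm) tendsto_ennreal_iff) auto
  qed
  have ldf: "df \<longlonglongrightarrow> 0" and ldg: "dg \<longlonglongrightarrow> 0"
    unfolding df_def dg_def by (intro * f g fk gk lf lg)+
  define F where "F = (\<integral>\<omega>. (norm (f \<omega>))\<^sup>2 \<partial>M)"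
  define G where "G = (\<integral>\<omega>. (norm (g \<omega>))\<^sup>2 \<partial>M)"
  have F0: "F \<ge> 0" "G \<ge> 0" unfolding F_def G_def by auto
  have d0: "df k \<ge> 0" "dg k \<ge> 0" for k unfolding df_def dg_def by auto
  have split: "(\<integral>\<omega>. fk k \<omega> \<bullet> gk k \<omega> \<partial>M) - (\<integral>\<omega>. f \<omega> \<bullet> g \<omega> \<partial>M)
      = (\<integral>\<omega>. (fk k \<omega> - f \<omega>) \<bullet> (gk k \<omega> - g \<omega>) \<partial>M) + (\<integral>\<omega>. (fk k \<omega> - f \<omega>) \<bullet> g \<omega> \<partial>M)
        + (\<integral>\<omega>. f \<omega> \<bullet> (gk k \<omega> - g \<omega>) \<partial>M)" for k
  proof -
    note i = integrable_inner[OF fk[of k] gk[of k]] integrable_inner[OF f g]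
      integrable_inner[OF square_integrable_diff[OF fk[of k] f] square_integrable_diff[OF gk[of k] g]]
      integrable_inner[OF square_integrable_diff[OF fk[of k] f] g]
      integrable_inner[OF f square_integrable_diff[OF gk[of k] g]]
    have "(\<integral>\<omega>. fk k \<omega> \<bullet> gk k \<omega> \<partial>M) =
      (\<integral>\<omega>. (fk k \<omega> - f \<omega>) \<bullet> (gk k \<omega> - g \<omega>) + (fk k \<omega> - f \<omega>) \<bullet> g \<omega> + f \<omega> \<bullet> (gk k \<omega> - g \<omega>) + f \<omega> \<bullet> g \<omega> \<partial>M)"
      by (rule Bochner_Integration.integral_cong) (auto simp: inner_diff_left inner_diff_right)
    then show ?thesis using i by simp
  qed
  have bnd: "\<bar>(\<integral>\<omega>. fk k \<omega> \<bullet> gk k \<omega> \<partial>M) - (\<integral>\<omega>. f \<omega> \<bullet> g \<omega> \<partial>M)\<bar>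
     \<le> (df k + dg k) + (df k / r + r * G) + (r * F + dg k / r)" if r: "r > 0" for k r
  proof -
    have a: "\<bar>\<integral>\<omega>. (fk k \<omega> - f \<omega>) \<bullet> (gk k \<omega> - g \<omega>) \<partial>M\<bar> \<le> df k + dg k"
      using integral_inner_bound[OF square_integrable_diff[OF fk[of k] f] square_integrable_diff[OF gk[of k] g], of 1]
      by (simp add: df_def dg_def)
    have b: "\<bar>\<integral>\<omega>. (fk k \<omega> - f \<omega>) \<bullet> g \<omega> \<partial>M\<bar> \<le> df k / r + r * G"
      using integral_inner_bound[OF square_integrable_diff[OF fk[of k] f] g, of "1/r"] r
      by (simp add: df_def G_def mult.commute)
    have c: "\<bar>\<integral>\<omega>. f \<omega> \<bullet> (gk k \<omega> - g \<omega>) \<partial>M\<bar> \<le> r * F + dg k / r"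
      using integral_inner_bound[OF f square_integrable_diff[OF gk[of k] g], of "r"] r
      by (simp add: dg_def F_def)
    show ?thesis unfolding split using a b c by linarith
  qed
  show ?thesis
  proof (rule LIMSEQ_I)
    fix e :: real assume e: "e > 0"
    \<comment> \<open>The weight is fixed before \<open>k\<close>: it makes
      \<open>r * (F + G)\<close> less than \<open>e / 2\<close>, and the summand 1 covers
      \<open>F = G = 0\<close>. The remaining terms contain only \<open>df k\<close> and
      \<open>dg k\<close>, divided by this fixed \<open>r\<close>, and tend to zero.\<close>
    define r where "r = e / (2 * (F + G + 1))"
    have r: "r > 0" using e F0 by (auto simp: r_def)
    have rFG: "r * F + r * G < e / 2 + e/4"
    proof -
      have "r * (F + G) < r * (F + G + 1)" using r by simp
      also have "\<dots> = e/2" using F0 by (simp add: r_def field_simps)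
      finally show ?thesis using e by (simp add: algebra_simps)
    qed
    have "(\<lambda>k. (df k + dg k) + df k / r + dg k / r) \<longlonglongrightarrow> 0 + 0 + 0 / r + 0 / r"
      by (intro tendsto_intros ldf ldg) (use r in auto)
    then have "\<forall>\<^sub>F k in sequentially. (df k + dg k) + df k / r + dg k / r < e/4"
      using e by (intro order_tendstoD(2)[of _ 0]) auto
    then obtain no where no: "\<And>k. k \<ge> no \<Longrightarrow> (df k + dg k) + df k / r + dg k / r < e/4"
      unfolding eventually_sequentially by blast
    have "norm ((\<integral>\<omega>. fk k \<omega> \<bullet> gk k \<omega> \<partial>M) - (\<integral>\<omega>. f \<omega> \<bullet> g \<omega> \<partial>M)) < e" if "k \<ge> no" for k
      using bnd[OF r, of k] rFG no[OF that] unfolding real_norm_def by linarith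
    then show "\<exists>no. \<forall>k\<ge>no. norm ((\<integral>\<omega>. fk k \<omega> \<bullet> gk k \<omega> \<partial>M) - (\<integral>\<omega>. f \<omega> \<bullet> g \<omega> \<partial>M)) < e"
      by blast
  qed
qed

section \<open>Simple Ito integrals\<close>

context brownian_basis
begin

definition adapted_L2 :: "real \<Rightarrow> ('a \<Rightarrow> 'v::euclidean_space) \<Rightarrow> bool" where
  "adapted_L2 t h \<longleftrightarrow> h \<in> borel_measurable (F t) \<and> square_integrable M h"

lemma measurable_F_mono:
  assumes "h \<in> measurable (F s) N" "s \<le> t"
  shows "h \<in> measurable (F t) N"
  using assms sets_F_mono[OF assms(2)] by (auto simp: measurable_def space_F)

lemma measurable_F_M:
  assumes "h \<in> measurable (F t) N" "0 \<le> t"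
  shows "h \<in> measurable M N"
  using assms measurable_from_subalg subalgebra_F by blast

lemma adapted_L2_mono: "adapted_L2 s h \<Longrightarrow> s \<le> t \<Longrightarrow> adapted_L2 t h"
  by (auto simp: adapted_L2_def intro: measurable_F_mono)

lemma adapted_L2_square_integrable: "adapted_L2 s h \<Longrightarrow> square_integrable M h"
  by (simp add: adapted_L2_def)

lemma adapted_L2_inner: "adapted_L2 s h \<Longrightarrow> adapted_L2 s (\<lambda>\<omega>. u \<bullet> h \<omega>)"
  by (auto simp: adapted_L2_def square_integrable_inner_left)

text \<open>From time 0 on \<open>F t\<close> is a subalgebra of \<open>M\<close>, so measurability
  with respect to \<open>F t\<close> carries over to \<open>M\<close>; negative times are
  unconstrained.\<close>

lemma adapted_L2_iff:
  "0 \<le> t \<Longrightarrow> adapted_L2 t h \<longleftrightarrow>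
     h \<in> borel_measurable (F t) \<and> integrable M (\<lambda>\<omega>. (norm (h \<omega>))\<^sup>2)"
  by (auto simp: adapted_L2_def square_integrable_def measurable_F_M)

lemma W_measurable_M: "0 \<le> t \<Longrightarrow> W t \<in> borel_measurable M"
  using W_adapted measurable_F_M by blast

lemma increment_moments:
  assumes "0 \<le> s" "s \<le> t"
  shows "square_integrable M (\<lambda>\<omega>. W t \<omega> - W s \<omega>)"
    and "(\<integral>\<omega>. W t \<omega> - W s \<omega> \<partial>M) = 0"
    and "(\<integral>\<omega>. (W t \<omega> - W s \<omega>)\<^sup>2 \<partial>M) = t - s"
proof -
  have "square_integrable M (\<lambda>\<omega>. W t \<omega> - W s \<omega>) \<and> (\<integral>\<omega>. W t \<omega> - W s \<omega> \<partial>M) = 0 \<and>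
     (\<integral>\<omega>. (W t \<omega> - W s \<omega>)\<^sup>2 \<partial>M) = t - s"
  proof (cases "s = t")
    case False
    then have st: "s < t" and sd: "0 < sqrt (t - s)" using assms by auto
    note D = W_increment_normal[OF assms(1) st]
    have "integrable M (\<lambda>\<omega>. (W t \<omega> - W s \<omega>)\<^sup>2)"
      using integrable_normal_moment[OF sd, of 0 2] distributed_integrable[OF D, of "\<lambda>x. x^2"] by simp
    moreover have "(\<integral>\<omega>. W t \<omega> - W s \<omega> \<partial>M) = 0"
      by (rule normal_distributed_expectation[OF sd D])
    moreover have "(\<integral>\<omega>. (W t \<omega> - W s \<omega>)\<^sup>2 \<partial>M) = t - s"
      using normal_distributed_variance[OF sd D] calculation(2) assms by simp
    ultimately show ?thesis
      using W_measurable_M assms by (auto simp: square_integrable_def)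
  qed (simp add: square_integrable_def)
  then show "square_integrable M (\<lambda>\<omega>. W t \<omega> - W s \<omega>)"
    "(\<integral>\<omega>. W t \<omega> - W s \<omega> \<partial>M) = 0" "(\<integral>\<omega>. (W t \<omega> - W s \<omega>)\<^sup>2 \<partial>M) = t - s" by auto
qed

text \<open>The filtration provides independence for \<open>s < t\<close>. For \<open>s = t\<close>
  the increment vanishes identically and generates the trivial sigma-algebra, which is independent
  of everything; with this case, degenerate cells of a partition need no separate treatment.\<close>

lemma increment_indep:
  assumes "0 \<le> s" "s \<le> t" "Z \<in> borel_measurable (F s)"
  shows "indep_var borel Z borel (\<lambda>\<omega>. W t \<omega> - W s \<omega>)"
proof (cases "s = t")
  case False
  then have st: "s < t" using assms by simp
  have Z: "Z \<in> borel_measurable M" using measurable_F_M[OF assms(3,1)] .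
  have dW: "(\<lambda>\<omega>. W t \<omega> - W s \<omega>) \<in> borel_measurable M"
    using W_measurable_M assms by auto
  note ind = W_increment_indep[OF assms(1) st]
  have "sigma_sets (space M) {Z -` A \<inter> space M |A. A \<in> sets borel} \<subseteq> sets (F s)"
  proof -
    have "{Z -` A \<inter> space M |A. A \<in> sets borel} \<subseteq> sets (F s)"
      using measurable_sets[OF assms(3)] by (auto simp: space_F)
    from sets.sigma_sets_subset[OF this] show ?thesis by (simp add: space_F)
  qed
  then show ?thesis
    using ind Z dW unfolding indep_var_eq indep_sets2_eq
    by (force simp: sets_vimage_algebra)
next
  case True
  have Z: "Z \<in> borel_measurable M" using measurable_F_M[OF assms(3,1)] .
  have sZ: "sigma_sets (space M) {Z -` A \<inter> space M |A. A \<in> sets borel} \<subseteq> events"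
    by (intro sets.sigma_sets_subset) (use Z in \<open>auto simp: measurable_sets\<close>)
  have "prob (a \<inter> b) = prob a * prob b"
    if "a \<in> sigma_sets (space M) {Z -` A \<inter> space M |A. A \<in> sets borel}"
       "b \<in> sigma_sets (space M) {(\<lambda>\<omega>. 0::real) -` A \<inter> space M |A. A \<in> sets borel}" for a b
  proof -
    have "{(\<lambda>\<omega>. 0::real) -` A \<inter> space M |A. A \<in> sets borel} \<subseteq> {{}, space M}"
      by auto
    then have "sigma_sets (space M) {(\<lambda>\<omega>. 0::real) -` A \<inter> space M |A. A \<in> sets borel} \<subseteq> sigma_sets (space M) {{}, space M}"
      by (rule sigma_sets_mono')
    also have "\<dots> \<subseteq> {{}, space M}"
      using sigma_algebra.sigma_sets_subset[OF sigma_algebra_trivial, of "{{}, space M}" "space M"] by simp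
    finally have "b = {} \<or> b = space M" using that(2) by auto
    moreover have "a \<in> events" using that(1) sZ by auto
    ultimately show ?thesis by (auto simp: prob_space)
  qed
  moreover note sZ
  moreover have "sigma_sets (space M) {(\<lambda>\<omega>. 0::real) -` A \<inter> space M |A. A \<in> sets borel} \<subseteq> events"
    by (intro sets.sigma_sets_subset) auto
  ultimately show ?thesis
    using Z True unfolding indep_var_eq indep_sets2_eq by auto
qed

lemma increment_mult:
  assumes "0 \<le> s" "s \<le> t" "Z \<in> borel_measurable (F s)" "integrable M Z"
  shows "integrable M (\<lambda>\<omega>. Z \<omega> * (W t \<omega> - W s \<omega>))"
    and "(\<integral>\<omega>. Z \<omega> * (W t \<omega> - W s \<omega>) \<partial>M) = 0"
    and "integrable M (\<lambda>\<omega>. Z \<omega> * (W t \<omega> - W s \<omega>)\<^sup>2)"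
    and "(\<integral>\<omega>. Z \<omega> * (W t \<omega> - W s \<omega>)\<^sup>2 \<partial>M) = (\<integral>\<omega>. Z \<omega> \<partial>M) * (t - s)"
proof -
  note m = increment_moments[OF assms(1,2)]
  note ind = increment_indep[OF assms(1-3)]
  have i1: "integrable M (\<lambda>\<omega>. W t \<omega> - W s \<omega>)"
    using square_integrable_imp_integrable[OF square_integrable_measurable[OF m(1)]]
      square_integrable_integrable[OF m(1)] by simp
  have i2: "integrable M (\<lambda>\<omega>. (W t \<omega> - W s \<omega>)\<^sup>2)"
    using square_integrable_integrable[OF m(1)] by simp
  have ind2: "indep_var borel Z borel (\<lambda>\<omega>. (W t \<omega> - W s \<omega>)\<^sup>2)"
    using indep_var_compose[OF ind, of id borel "\<lambda>x. x^2" borel] by (simp add: o_def)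
  show "integrable M (\<lambda>\<omega>. Z \<omega> * (W t \<omega> - W s \<omega>))" "(\<integral>\<omega>. Z \<omega> * (W t \<omega> - W s \<omega>) \<partial>M) = 0"
    using indep_var_integrable[OF ind assms(4) i1] indep_var_lebesgue_integral[OF ind assms(4) i1] m(2)
    by auto
  show "integrable M (\<lambda>\<omega>. Z \<omega> * (W t \<omega> - W s \<omega>)\<^sup>2)"
     "(\<integral>\<omega>. Z \<omega> * (W t \<omega> - W s \<omega>)\<^sup>2 \<partial>M) = (\<integral>\<omega>. Z \<omega> \<partial>M) * (t - s)"
    using indep_var_integrable[OF ind2 assms(4) i2] indep_var_lebesgue_integral[OF ind2 assms(4) i2] m(3)
    by auto
qed

text \<open>Second moments of \<open>h\<close> suffice, without fourth moments: the squared norm of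
  \<open>h\<close> and the squared increment are independent integrable variables, so their product
  is integrable.\<close>

lemma square_integrable_increment_mult:
  assumes "0 \<le> s" "s \<le> t" "adapted_L2 s h"
  shows "square_integrable M (\<lambda>\<omega>. (W t \<omega> - W s \<omega>) *\<^sub>R h \<omega>)"
proof -
  have "integrable M (\<lambda>\<omega>. (norm (h \<omega>))\<^sup>2 * (W t \<omega> - W s \<omega>)\<^sup>2)"
    using assms by (intro increment_mult(3)) (auto simp: adapted_L2_def square_integrable_def)
  moreover have "(\<lambda>\<omega>. (W t \<omega> - W s \<omega>) *\<^sub>R h \<omega>) \<in> borel_measurable M"
    using assms W_measurable_M by (auto simp: adapted_L2_def square_integrable_def)
  ultimately show ?thesis
    by (auto simp: square_integrable_def power_mult_distrib mult.commute)
qed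

lemma adapted_L2_increment_mult:
  assumes "0 \<le> s" "s \<le> t" "t \<le> u" "adapted_L2 s h"
  shows "adapted_L2 u (\<lambda>\<omega>. (W t \<omega> - W s \<omega>) *\<^sub>R h \<omega>)"
proof -
  have "W t \<in> borel_measurable (F u)" "W s \<in> borel_measurable (F u)" "h \<in> borel_measurable (F u)"
    using assms W_adapted measurable_F_mono[of _ _ borel u]
    by (auto simp: adapted_L2_def intro: order_trans)
  then show ?thesis
    using square_integrable_increment_mult[OF assms(1,2,4)] by (auto simp: adapted_L2_def)
qed

lemma adapted_increment_orthogonal:
  assumes "0 \<le> s" "s \<le> t" "adapted_L2 s h" "adapted_L2 s h'"
  shows "integrable M (\<lambda>\<omega>. h \<omega> * ((W t \<omega> - W s \<omega>) * h' \<omega>))"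
    "(\<integral>\<omega>. h \<omega> * ((W t \<omega> - W s \<omega>) * h' \<omega>) \<partial>M) = 0"
proof -
  have m: "(\<lambda>\<omega>. h \<omega> * h' \<omega>) \<in> borel_measurable (F s)" and i: "integrable M (\<lambda>\<omega>. h \<omega> * h' \<omega>)"
    using assms(3,4) by (auto simp: adapted_L2_def intro!: integrable_mult_sq)
  show "integrable M (\<lambda>\<omega>. h \<omega> * ((W t \<omega> - W s \<omega>) * h' \<omega>))"
    "(\<integral>\<omega>. h \<omega> * ((W t \<omega> - W s \<omega>) * h' \<omega>) \<partial>M) = 0"
    using increment_mult(1,2)[OF assms(1,2) m i] by (simp_all add: mult_ac)
qed

text \<open>The last factor is the length of the overlap of the two intervals. Arbitrary positions
  are allowed so that simple integrands over different partitions can be compared without a common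
  refinement.\<close>

lemma increment_covariance:
  fixes h h' :: "'a \<Rightarrow> real"
  assumes "0 \<le> a" "a \<le> b" "0 \<le> c" "c \<le> d" "adapted_L2 a h" "adapted_L2 c h'"
  shows "(\<integral>\<omega>. ((W b \<omega> - W a \<omega>) * h \<omega>) * ((W d \<omega> - W c \<omega>) * h' \<omega>) \<partial>M)
    = (\<integral>\<omega>. h \<omega> * h' \<omega> \<partial>M) * max 0 (min b d - max a c)"
proof -
  have main: "(\<integral>\<omega>. ((W b \<omega> - W a \<omega>) * h \<omega>) * ((W d \<omega> - W c \<omega>) * h' \<omega>) \<partial>M)
    = (\<integral>\<omega>. h \<omega> * h' \<omega> \<partial>M) * max 0 (min b d - max a c)"
    if *: "0 \<le> a" "a \<le> b" "a \<le> c" "c \<le> d" "adapted_L2 a h" "adapted_L2 c h'"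
    for a b c d and h h' :: "'a \<Rightarrow> real"
  proof -
    have disj: "integrable M (\<lambda>\<omega>. ((W q \<omega> - W p \<omega>) * k \<omega>) * ((W s \<omega> - W r \<omega>) * l \<omega>))"
      "(\<integral>\<omega>. ((W q \<omega> - W p \<omega>) * k \<omega>) * ((W s \<omega> - W r \<omega>) * l \<omega>) \<partial>M) = 0"
      if "0 \<le> p" "p \<le> q" "q \<le> r" "r \<le> s" "adapted_L2 p k" "adapted_L2 r l" for p q r s k l
      using adapted_increment_orthogonal[of r s "\<lambda>\<omega>. (W q \<omega> - W p \<omega>) * k \<omega>" l]
        adapted_L2_increment_mult[of p q r k] that by auto
    show ?thesis
    proof (cases "b \<le> c")
      case True
      then show ?thesis using disj(2)[of a b c d h h'] * by simp
    next
      case False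
      \<comment> \<open>The overlap is the interval from \<open>c\<close> to \<open>e\<close>. Both
        increments are cut at \<open>c\<close> and \<open>e\<close>; products of increments over
        disjoint pieces have mean zero, the squared increment over the overlap contributes its
        length, and one of the pieces beyond \<open>e\<close> is empty because \<open>e\<close> is
        \<open>b\<close> or \<open>d\<close>.\<close>
      define e where "e = min b d"
      have e: "c \<le> e" "e \<le> b" "e \<le> d" using * False by (auto simp: e_def)
      have hc: "adapted_L2 c h" using * adapted_L2_mono by blast
      have he: "adapted_L2 e h" "adapted_L2 e h'" using hc e adapted_L2_mono * by blast+
      have i: "integrable M (\<lambda>\<omega>. h \<omega> * h' \<omega>)" "(\<lambda>\<omega>. h \<omega> * h' \<omega>) \<in> borel_measurable (F c)"
        using *(6) hc by (auto simp: adapted_L2_def intro!: integrable_mult_sq)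
      note sq = increment_mult(3,4)[OF _ e(1) i(2,1)]
      let ?t = "\<lambda>p q r s k l \<omega>. ((W q \<omega> - W p \<omega>) * k \<omega>) * ((W s \<omega> - W r \<omega>) * l \<omega>)"
      have z: "(W b \<omega> - W e \<omega>) * (W d \<omega> - W e \<omega>) = 0" for \<omega> by (auto simp: e_def min_def)
      have eq: "((W b \<omega> - W a \<omega>) * h \<omega>) * ((W d \<omega> - W c \<omega>) * h' \<omega>)
         = ?t a c c d h h' \<omega> + h \<omega> * h' \<omega> * (W e \<omega> - W c \<omega>)\<^sup>2 + ?t c e e d h h' \<omega> + ?t c e e b h' h \<omega>" for \<omega>
      proof -
        have "((W b \<omega> - W a \<omega>) * h \<omega>) * ((W d \<omega> - W c \<omega>) * h' \<omega>)
         = ?t a c c d h h' \<omega> + h \<omega> * h' \<omega> * (W e \<omega> - W c \<omega>)\<^sup>2 + ?t c e e d h h' \<omega> + ?t c e e b h' h \<omega>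
           + h \<omega> * h' \<omega> * ((W b \<omega> - W e \<omega>) * (W d \<omega> - W e \<omega>))"
          by (simp add: algebra_simps power2_eq_square)
        then show ?thesis unfolding z by simp
      qed
      have "(\<integral>\<omega>. ((W b \<omega> - W a \<omega>) * h \<omega>) * ((W d \<omega> - W c \<omega>) * h' \<omega>) \<partial>M)
         = (\<integral>\<omega>. h \<omega> * h' \<omega> * (W e \<omega> - W c \<omega>)\<^sup>2 \<partial>M)"
        unfolding eq using disj(1)[of a c c d h h'] disj(1)[of c e e d h h'] disj(1)[of c e e b h' h] sq
          disj(2)[of a c c d h h'] disj(2)[of c e e d h h'] disj(2)[of c e e b h' h]
          * e he hc
        by simp
      also have "\<dots> = (\<integral>\<omega>. h \<omega> * h' \<omega> \<partial>M) * (e - c)" using sq(2) * by simp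
      finally show ?thesis using * e by (simp add: e_def max_def)
    qed
  qed
  show ?thesis
  proof (cases "a \<le> c")
    case True then show ?thesis using main[of a b c d h h'] assms by simp
  next
    case False then show ?thesis using main[of c d a b h' h] assms
      by (simp add: mult.commute max.commute min.commute)
  qed
qed

end

section \<open>The Ito isometry\<close>

context brownian_basis
begin

abbreviation path_measure :: "('a \<times> real) measure" where
  "path_measure \<equiv> M \<Otimes>\<^sub>M lborel"

lemma pair_sigma_finite_path: "pair_sigma_finite M lborel"
  by standard

lemma simple_integrand_facts:
  assumes "simple_integrand M F t N p h"
  shows "0 \<le> t" "i \<le> N \<Longrightarrow> 0 \<le> p i" "i \<le> N \<Longrightarrow> p i \<le> t" "i < N \<Longrightarrow> p i \<le> p (Suc i)"
    "i < N \<Longrightarrow> adapted_L2 (p i) (h i)"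
proof -
  have step: "\<And>i. i < N \<Longrightarrow> p i \<le> p (Suc i)" and p0: "p 0 = 0" and pN: "p N = t"
    using assms by (auto simp: simple_integrand_def)
  have mono: "p i \<le> p j" if "i \<le> j" "j \<le> N" for i j
    using that by (induction j rule: dec_induct) (auto intro: order_trans[OF _ step])
  show "0 \<le> t" using mono[of 0 N] p0 pN by simp
  show a: "i \<le> N \<Longrightarrow> 0 \<le> p i" for i using mono[of 0 i] p0 by simp
  show "i \<le> N \<Longrightarrow> p i \<le> t" using mono[of i N] pN by simp
  show "i < N \<Longrightarrow> p i \<le> p (Suc i)" by (rule step)
  show "i < N \<Longrightarrow> adapted_L2 (p i) (h i)"
    using assms a[of i] by (subst adapted_L2_iff) (auto simp: simple_integrand_def)
qed

lemma simple_ito_square_integrable: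
  assumes "simple_integrand M F t N p h"
  shows "square_integrable M (simple_ito_integral W N p h)"
  unfolding simple_ito_integral_def
  using simple_integrand_facts[OF assms]
  by (intro square_integrable_sum square_integrable_increment_mult) auto

lemma square_integrable_path_indicator:
  fixes h :: "'a \<Rightarrow> 'v::euclidean_space"
  assumes h: "square_integrable M h" and ab: "a \<le> b"
  shows "square_integrable path_measure (\<lambda>(\<omega>, s). indicator {a<..b} s *\<^sub>R h \<omega>)"
proof -
  have [measurable]: "h \<in> borel_measurable M" using h by (simp add: square_integrable_def)
  have "(\<integral>\<^sup>+x. ennreal ((norm (case x of (\<omega>, s) \<Rightarrow> indicator {a<..b} s *\<^sub>R h \<omega>))\<^sup>2) \<partial>path_measure)
    = (\<integral>\<^sup>+\<omega>. \<integral>\<^sup>+s. ennreal ((norm (indicator {a<..b} s *\<^sub>R h \<omega>))\<^sup>2) \<partial>lborel \<partial>M)"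
    by (subst lborel.nn_integral_fst[symmetric]) (auto simp: split_beta')
  also have "\<dots> = (\<integral>\<^sup>+\<omega>. \<integral>\<^sup>+s. ennreal ((norm (h \<omega>))\<^sup>2) * indicator {a<..b} s \<partial>lborel \<partial>M)"
    by (intro nn_integral_cong) (auto simp: indicator_def)
  also have "\<dots> = (\<integral>\<^sup>+\<omega>. ennreal ((norm (h \<omega>))\<^sup>2) * ennreal (b - a) \<partial>M)"
    using ab by (intro nn_integral_cong) (simp add: nn_integral_cmult_indicator)
  also have "\<dots> = (\<integral>\<^sup>+\<omega>. ennreal ((norm (h \<omega>))\<^sup>2) \<partial>M) * ennreal (b - a)"
    by (rule nn_integral_multc) auto
  also have "\<dots> < \<infinity>"
    using h by (auto simp: square_integrable_nn ennreal_mult_less_top)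
  finally show ?thesis
    unfolding square_integrable_nn by (simp add: split_beta')
qed

lemma simple_process_square_integrable:
  fixes h :: "nat \<Rightarrow> 'a \<Rightarrow> 'v::euclidean_space"
  assumes "simple_integrand M F t N p h"
  shows "square_integrable path_measure (\<lambda>(\<omega>, s). simple_process N p h s \<omega>)"
proof -
  have "square_integrable path_measure (\<lambda>x. \<Sum>i<N. case x of (\<omega>, s) \<Rightarrow> indicator {p i<..p (Suc i)} s *\<^sub>R h i \<omega>)"
    using simple_integrand_facts(4)[OF assms] adapted_L2_square_integrable[OF simple_integrand_facts(5)[OF assms]]
    by (intro square_integrable_sum square_integrable_path_indicator) auto
  then show ?thesis by (simp add: simple_process_def split_beta')
qed

lemma integral_overlap:
  fixes a b c d :: real
  shows "(\<integral>s. indicator {a<..b} s * indicator {c<..d} s \<partial>lborel) = max 0 (min b d - max a c)"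
proof -
  have "(\<lambda>s::real. indicator {a<..b} s * indicator {c<..d} s :: real) = indicator {max a c<..min b d}"
    by (auto simp: indicator_def fun_eq_iff)
  then have "(\<integral>s. indicator {a<..b} s * indicator {c<..d} s \<partial>lborel) = measure lborel {max a c<..min b d}"
    by simp
  also have "\<dots> = max 0 (min b d - max a c)"
    by (cases "max a c \<le> min b d") (auto simp: max_def min_def)
  finally show ?thesis .
qed

lemma path_covariance:
  fixes h h' :: "'a \<Rightarrow> real"
  assumes h: "square_integrable M h" "square_integrable M h'" and ab: "a \<le> b" "c \<le> d"
  shows "integrable path_measure (\<lambda>(\<omega>, s). (indicator {a<..b} s * h \<omega>) * (indicator {c<..d} s * h' \<omega>))"
    "(\<integral>(\<omega>, s). (indicator {a<..b} s * h \<omega>) * (indicator {c<..d} s * h' \<omega>) \<partial>path_measure)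
      = (\<integral>\<omega>. h \<omega> * h' \<omega> \<partial>M) * max 0 (min b d - max a c)"
proof -
  interpret P: pair_sigma_finite M lborel by (rule pair_sigma_finite_path)
  let ?f = "\<lambda>\<omega> s. (indicator {a<..b} s * h \<omega>) * (indicator {c<..d} s * h' \<omega>)"
  show i: "integrable path_measure (\<lambda>(\<omega>, s). ?f \<omega> s)"
    using integrable_mult_sq[OF square_integrable_path_indicator[OF h(1) ab(1)] square_integrable_path_indicator[OF h(2) ab(2)]]
    by (simp add: split_beta')
  have "(\<integral>(\<omega>, s). ?f \<omega> s \<partial>path_measure) = (\<integral>\<omega>. (\<integral>s. ?f \<omega> s \<partial>lborel) \<partial>M)"
    using P.integral_fst[OF i] by simp
  also have "\<dots> = (\<integral>\<omega>. h \<omega> * h' \<omega> * max 0 (min b d - max a c) \<partial>M)"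
  proof (rule Bochner_Integration.integral_cong[OF refl])
    fix \<omega>
    have "(\<integral>s. ?f \<omega> s \<partial>lborel) = (\<integral>s. (h \<omega> * h' \<omega>) * (indicator {a<..b} s * indicator {c<..d} s) \<partial>lborel)"
      by (rule Bochner_Integration.integral_cong) auto
    also have "\<dots> = h \<omega> * h' \<omega> * max 0 (min b d - max a c)"
      using integral_overlap[of a b c d] by simp
    finally show "(\<integral>s. ?f \<omega> s \<partial>lborel) = h \<omega> * h' \<omega> * max 0 (min b d - max a c)" .
  qed
  finally show "(\<integral>(\<omega>, s). ?f \<omega> s \<partial>path_measure) = (\<integral>\<omega>. h \<omega> * h' \<omega> \<partial>M) * max 0 (min b d - max a c)"
    by simp
qed

text \<open>Polarized Ito isometry. After both sums are expanded, each pair of cells contributes on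
  either side the mean product of the coefficients times the length of the overlap. The vectors
  \<open>u\<close> and \<open>v\<close> read off arbitrary entries of the covariance matrix.\<close>

lemma simple_ito_covariance:
  fixes h h' :: "nat \<Rightarrow> 'a \<Rightarrow> 'v::euclidean_space"
  assumes s: "simple_integrand M F t N p h" "simple_integrand M F t' N' p' h'"
  shows "(\<integral>\<omega>. (u \<bullet> simple_ito_integral W N p h \<omega>) * (v \<bullet> simple_ito_integral W N' p' h' \<omega>) \<partial>M)
    = (\<integral>(\<omega>, s). (u \<bullet> simple_process N p h s \<omega>) * (v \<bullet> simple_process N' p' h' s \<omega>) \<partial>path_measure)"
proof -
  note f = simple_integrand_facts[OF s(1)] and f' = simple_integrand_facts[OF s(2)]
  have uh: "adapted_L2 (p i) (\<lambda>\<omega>. u \<bullet> h i \<omega>)" if "i < N" for i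
    using f(5)[OF that] by (rule adapted_L2_inner)
  have vh: "adapted_L2 (p' j) (\<lambda>\<omega>. v \<bullet> h' j \<omega>)" if "j < N'" for j
    using f'(5)[OF that] by (rule adapted_L2_inner)
  let ?T = "\<lambda>i j \<omega>. ((W (p (Suc i)) \<omega> - W (p i) \<omega>) * (u \<bullet> h i \<omega>)) * ((W (p' (Suc j)) \<omega> - W (p' j) \<omega>) * (v \<bullet> h' j \<omega>))"
  let ?P = "\<lambda>i j \<omega> s. (indicator {p i<..p (Suc i)} s * (u \<bullet> h i \<omega>)) * (indicator {p' j<..p' (Suc j)} s * (v \<bullet> h' j \<omega>))"
  have iT: "integrable M (?T i j)" if "i < N" "j < N'" for i j
    using square_integrable_increment_mult[OF f(2) f(4) uh] square_integrable_increment_mult[OF f'(2) f'(4) vh] that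
    by (intro integrable_mult_sq) auto
  have iP: "integrable path_measure (\<lambda>(\<omega>, s). ?P i j \<omega> s)"
    and eP: "(\<integral>(\<omega>, s). ?P i j \<omega> s \<partial>path_measure) = (\<integral>\<omega>. ?T i j \<omega> \<partial>M)" if "i < N" "j < N'" for i j
    using path_covariance[of "\<lambda>\<omega>. u \<bullet> h i \<omega>" "\<lambda>\<omega>. v \<bullet> h' j \<omega>" "p i" "p (Suc i)" "p' j" "p' (Suc j)"]
      increment_covariance[of "p i" "p (Suc i)" "p' j" "p' (Suc j)" "\<lambda>\<omega>. u \<bullet> h i \<omega>" "\<lambda>\<omega>. v \<bullet> h' j \<omega>"]
      uh vh f f' that by (auto intro: adapted_L2_square_integrable)
  have "(\<integral>\<omega>. (u \<bullet> simple_ito_integral W N p h \<omega>) * (v \<bullet> simple_ito_integral W N' p' h' \<omega>) \<partial>M)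
     = (\<integral>\<omega>. (\<Sum>i<N. \<Sum>j<N'. ?T i j \<omega>) \<partial>M)"
    by (simp add: simple_ito_integral_def inner_sum_right sum_product)
  also have "\<dots> = (\<Sum>i<N. \<Sum>j<N'. \<integral>\<omega>. ?T i j \<omega> \<partial>M)"
    using iT by (subst Bochner_Integration.integral_sum)
      (auto intro!: sum.cong Bochner_Integration.integral_sum Bochner_Integration.integrable_sum)
  also have "\<dots> = (\<Sum>i<N. \<Sum>j<N'. (\<integral>(\<omega>, s). ?P i j \<omega> s \<partial>path_measure))"
    using eP by simp
  also have "\<dots> = (\<integral>x. (\<Sum>i<N. \<Sum>j<N'. case x of (\<omega>, s) \<Rightarrow> ?P i j \<omega> s) \<partial>path_measure)"
    using iP by (subst Bochner_Integration.integral_sum)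
      (auto intro!: sum.cong Bochner_Integration.integral_sum[symmetric] Bochner_Integration.integrable_sum)
  also have "\<dots> = (\<integral>(\<omega>, s). (u \<bullet> simple_process N p h s \<omega>) * (v \<bullet> simple_process N' p' h' s \<omega>) \<partial>path_measure)"
    unfolding simple_process_def inner_sum_right inner_scaleR_right sum_product split_beta' ..
  finally show ?thesis .
qed

lemma integral_inner_Basis:
  fixes f g :: "'c \<Rightarrow> 'v::euclidean_space"
  assumes "square_integrable N f" "square_integrable N g"
  shows "(\<integral>x. f x \<bullet> g x \<partial>N) = (\<Sum>b\<in>Basis. \<integral>x. (b \<bullet> f x) * (b \<bullet> g x) \<partial>N)"
proof -
  have "(\<integral>x. f x \<bullet> g x \<partial>N) = (\<integral>x. (\<Sum>b\<in>Basis. (b \<bullet> f x) * (b \<bullet> g x)) \<partial>N)"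
    by (rule Bochner_Integration.integral_cong) (auto simp: euclidean_inner[of "f _"] inner_commute)
  also have "\<dots> = (\<Sum>b\<in>Basis. \<integral>x. (b \<bullet> f x) * (b \<bullet> g x) \<partial>N)"
    using assms by (intro Bochner_Integration.integral_sum integrable_mult_sq square_integrable_inner_left)
  finally show ?thesis .
qed

lemma simple_ito_inner:
  fixes h h' :: "nat \<Rightarrow> 'a \<Rightarrow> 'v::euclidean_space"
  assumes s: "simple_integrand M F t N p h" "simple_integrand M F t' N' p' h'"
  shows "(\<integral>\<omega>. simple_ito_integral W N p h \<omega> \<bullet> simple_ito_integral W N' p' h' \<omega> \<partial>M)
    = (\<integral>x. (case x of (\<omega>, s) \<Rightarrow> simple_process N p h s \<omega>) \<bullet> (case x of (\<omega>, s) \<Rightarrow> simple_process N' p' h' s \<omega>) \<partial>path_measure)"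
  unfolding integral_inner_Basis[OF simple_ito_square_integrable[OF s(1)] simple_ito_square_integrable[OF s(2)]]
     integral_inner_Basis[OF simple_process_square_integrable[OF s(1)] simple_process_square_integrable[OF s(2)]]
  using simple_ito_covariance[OF s] by (simp add: split_beta')

lemma integral_norm_diff_sq:
  fixes f g :: "'c \<Rightarrow> 'v::euclidean_space"
  assumes "square_integrable N f" "square_integrable N g"
  shows "(\<integral>x. (norm (f x - g x))\<^sup>2 \<partial>N)
    = (\<integral>x. f x \<bullet> f x \<partial>N) - 2 * (\<integral>x. f x \<bullet> g x \<partial>N) + (\<integral>x. g x \<bullet> g x \<partial>N)"
proof -
  have "(\<integral>x. (norm (f x - g x))\<^sup>2 \<partial>N) = (\<integral>x. f x \<bullet> f x - 2 * (f x \<bullet> g x) + g x \<bullet> g x \<partial>N)"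
    by (rule Bochner_Integration.integral_cong)
      (auto simp: power2_norm_eq_inner inner_diff_left inner_diff_right inner_commute)
  also have "\<dots> = (\<integral>x. f x \<bullet> f x \<partial>N) - 2 * (\<integral>x. f x \<bullet> g x \<partial>N) + (\<integral>x. g x \<bullet> g x \<partial>N)"
    using assms by (simp add: integrable_inner)
  finally show ?thesis .
qed

text \<open>Expanding the squared norm reduces the claim to three instances of the polarized
  isometry; the difference never has to be written as a single simple integrand.\<close>

lemma simple_ito_isometry_diff:
  fixes h h' :: "nat \<Rightarrow> 'a \<Rightarrow> 'v::euclidean_space"
  assumes s: "simple_integrand M F t N p h" "simple_integrand M F t' N' p' h'"
  shows "(\<integral>\<^sup>+\<omega>. ennreal ((norm (simple_ito_integral W N p h \<omega> - simple_ito_integral W N' p' h' \<omega>))\<^sup>2) \<partial>M)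
    = (\<integral>\<^sup>+(\<omega>, s). ennreal ((norm (simple_process N p h s \<omega> - simple_process N' p' h' s \<omega>))\<^sup>2) \<partial>path_measure)"
proof -
  note i = simple_ito_square_integrable[OF s(1)] simple_ito_square_integrable[OF s(2)]
  note r = simple_process_square_integrable[OF s(1)] simple_process_square_integrable[OF s(2)]
  have eq: "(\<integral>\<omega>. (norm (simple_ito_integral W N p h \<omega> - simple_ito_integral W N' p' h' \<omega>))\<^sup>2 \<partial>M)
    = (\<integral>x. (norm ((case x of (\<omega>, s) \<Rightarrow> simple_process N p h s \<omega>) - (case x of (\<omega>, s) \<Rightarrow> simple_process N' p' h' s \<omega>)))\<^sup>2 \<partial>path_measure)"
    unfolding integral_norm_diff_sq[OF i] integral_norm_diff_sq[OF r]
    by (simp add: simple_ito_inner[OF s] simple_ito_inner[OF s(1) s(1)] simple_ito_inner[OF s(2) s(2)])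
  show ?thesis
    using eq square_integrable_integrable[OF square_integrable_diff[OF i]]
      square_integrable_integrable[OF square_integrable_diff[OF r]]
    by (subst nn_integral_eq_integral, simp, simp)
      (simp add: nn_integral_eq_integral split_beta')
qed

text \<open>Capping the partition at \<open>s\<close> turns the later cells into degenerate ones at
  \<open>s\<close>. Their coefficients are replaced by 0, since a coefficient known only after
  \<open>s\<close> would not be admissible there. What the integral loses is built from increments
  after \<open>s\<close>, hence orthogonal to everything known at \<open>s\<close>.\<close>

lemma simple_integrand_restrict:
  fixes h :: "nat \<Rightarrow> 'a \<Rightarrow> 'v::euclidean_space"
  assumes s: "simple_integrand M F t N p h" and st: "0 \<le> s" "s \<le> t"
  defines "p' \<equiv> \<lambda>i. min (p i) s" and "h' \<equiv> \<lambda>i. if p i \<le> s then h i else (\<lambda>_. 0)"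
  shows "simple_integrand M F s N p' h'"
    and "r \<le> s \<Longrightarrow> simple_process N p' h' r \<omega> = simple_process N p h r \<omega>"
    and "r > s \<Longrightarrow> simple_process N p' h' r \<omega> = 0"
    and "adapted_L2 s Z \<Longrightarrow>
      (\<integral>\<omega>. Z \<omega> * (u \<bullet> (simple_ito_integral W N p h \<omega> - simple_ito_integral W N p' h' \<omega>)) \<partial>M) = 0"
proof -
  note f = simple_integrand_facts[OF s]
  show "simple_integrand M F s N p' h'"
    using s st f(4,5) unfolding simple_integrand_def p'_def h'_def
    by (auto simp: min_def intro: order_trans)
  show "simple_process N p' h' r \<omega> = simple_process N p h r \<omega>" if "r \<le> s"
    unfolding simple_process_def p'_def h'_def
    using that by (intro sum.cong) (auto simp: indicator_def)
  show "simple_process N p' h' r \<omega> = 0" if "r > s"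
    unfolding simple_process_def p'_def h'_def
    using that by (intro sum.neutral) (auto simp: indicator_def)
  assume Z: "adapted_L2 s Z"
  \<comment> \<open>The complementary truncation: increments from \<open>max (p i) s\<close> to
    \<open>max (p (Suc i)) s\<close> are what remains of each cell after its part before
    \<open>s\<close> is removed.\<close>
  let ?q = "\<lambda>i. max (p i) s"
  have d: "simple_ito_integral W N p h \<omega> - simple_ito_integral W N p' h' \<omega>
     = (\<Sum>i<N. (W (?q (Suc i)) \<omega> - W (?q i) \<omega>) *\<^sub>R h i \<omega>)" for \<omega>
    unfolding simple_ito_integral_def p'_def h'_def sum_subtractf[symmetric]
    using f(4) by (intro sum.cong) (force simp: min_def max_def algebra_simps)+
  have q: "0 \<le> ?q i" "?q i \<le> ?q (Suc i)" "adapted_L2 (?q i) (\<lambda>\<omega>. u \<bullet> h i \<omega>)" "adapted_L2 (?q i) Z"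
    if "i < N" for i
  proof -
    show "0 \<le> ?q i" "?q i \<le> ?q (Suc i)" using st f(4)[OF that] by auto
    show "adapted_L2 (?q i) (\<lambda>\<omega>. u \<bullet> h i \<omega>)"
      using adapted_L2_mono[OF adapted_L2_inner[OF f(5)[OF that]]] by simp
    show "adapted_L2 (?q i) Z" using adapted_L2_mono[OF Z] by simp
  qed
  note o = adapted_increment_orthogonal[OF q(1) q(2) q(4) q(3)]
  have "(\<integral>\<omega>. Z \<omega> * (u \<bullet> (simple_ito_integral W N p h \<omega> - simple_ito_integral W N p' h' \<omega>)) \<partial>M)
    = (\<integral>\<omega>. (\<Sum>i<N. Z \<omega> * ((W (?q (Suc i)) \<omega> - W (?q i) \<omega>) * (u \<bullet> h i \<omega>))) \<partial>M)"
    unfolding d by (simp add: inner_sum_right sum_distrib_left)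
  also have "\<dots> = (\<Sum>i<N. \<integral>\<omega>. Z \<omega> * ((W (?q (Suc i)) \<omega> - W (?q i) \<omega>) * (u \<bullet> h i \<omega>)) \<partial>M)"
    using o by (intro Bochner_Integration.integral_sum) auto
  also have "\<dots> = 0" using o by simp
  finally show "(\<integral>\<omega>. Z \<omega> * (u \<bullet> (simple_ito_integral W N p h \<omega> - simple_ito_integral W N p' h' \<omega>)) \<partial>M) = 0" .
qed

end

section \<open>Properties of the Ito integral\<close>

text \<open>Stated with the nonnegative integral, so that it is meaningful before the limit is known
  to be square integrable.\<close>

definition L2_lim :: "'a measure \<Rightarrow> (nat \<Rightarrow> 'a \<Rightarrow> 'v::euclidean_space) \<Rightarrow> ('a \<Rightarrow> 'v) \<Rightarrow> bool" where
  "L2_lim N fk f \<longleftrightarrow> (\<lambda>k. \<integral>\<^sup>+x. ennreal ((norm (fk k x - f x))\<^sup>2) \<partial>N) \<longlonglongrightarrow> 0"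

lemma ennreal_tendsto_0_le:
  fixes f g :: "nat \<Rightarrow> ennreal"
  assumes "\<And>k. f k \<le> g k" "g \<longlonglongrightarrow> 0"
  shows "f \<longlonglongrightarrow> 0"
  by (rule tendsto_sandwich[OF _ _ tendsto_const assms(2)]) (auto simp: assms(1))

lemma nn_integral_norm_add_sq_le:
  fixes f g :: "'c \<Rightarrow> 'v::euclidean_space"
  assumes "f \<in> borel_measurable N" "g \<in> borel_measurable N"
  shows "(\<integral>\<^sup>+x. ennreal ((norm (f x + g x))\<^sup>2) \<partial>N)
    \<le> 2 * (\<integral>\<^sup>+x. ennreal ((norm (f x))\<^sup>2) \<partial>N) + 2 * (\<integral>\<^sup>+x. ennreal ((norm (g x))\<^sup>2) \<partial>N)"
proof -
  have "(\<integral>\<^sup>+x. ennreal ((norm (f x + g x))\<^sup>2) \<partial>N)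
    \<le> (\<integral>\<^sup>+x. 2 * ennreal ((norm (f x))\<^sup>2) + 2 * ennreal ((norm (g x))\<^sup>2) \<partial>N)"
  proof (rule nn_integral_mono)
    fix x
    have "ennreal ((norm (f x + g x))\<^sup>2) \<le> ennreal (2 * (norm (f x))\<^sup>2 + 2 * (norm (g x))\<^sup>2)"
      by (intro ennreal_leI norm_add_sq_le)
    also have "\<dots> = 2 * ennreal ((norm (f x))\<^sup>2) + 2 * ennreal ((norm (g x))\<^sup>2)"
      by (simp add: ennreal_plus ennreal_mult)
    finally show "ennreal ((norm (f x + g x))\<^sup>2) \<le> 2 * ennreal ((norm (f x))\<^sup>2) + 2 * ennreal ((norm (g x))\<^sup>2)" .
  qed
  also have "\<dots> = 2 * (\<integral>\<^sup>+x. ennreal ((norm (f x))\<^sup>2) \<partial>N) + 2 * (\<integral>\<^sup>+x. ennreal ((norm (g x))\<^sup>2) \<partial>N)"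
    using assms by (simp add: nn_integral_add nn_integral_cmult)
  finally show ?thesis .
qed

lemma L2_lim_add_null:
  fixes f :: "'c \<Rightarrow> 'v::euclidean_space"
  assumes [measurable]: "\<And>k. fk k \<in> borel_measurable N" "\<And>k. gk k \<in> borel_measurable N" "f \<in> borel_measurable N"
    and "L2_lim N fk f" "L2_lim N gk fk'" and fk': "fk' = (\<lambda>_. 0)"
  shows "L2_lim N (\<lambda>k x. fk k x + gk k x) f"
  unfolding L2_lim_def
proof (rule ennreal_tendsto_0_le)
  fix k
  have "(\<integral>\<^sup>+x. ennreal ((norm ((fk k x - f x) + gk k x))\<^sup>2) \<partial>N)
    \<le> 2 * (\<integral>\<^sup>+x. ennreal ((norm (fk k x - f x))\<^sup>2) \<partial>N) + 2 * (\<integral>\<^sup>+x. ennreal ((norm (gk k x))\<^sup>2) \<partial>N)"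
    by (rule nn_integral_norm_add_sq_le) auto
  then show "(\<integral>\<^sup>+x. ennreal ((norm ((fk k x + gk k x) - f x))\<^sup>2) \<partial>N)
    \<le> 2 * (\<integral>\<^sup>+x. ennreal ((norm (fk k x - f x))\<^sup>2) \<partial>N) + 2 * (\<integral>\<^sup>+x. ennreal ((norm (gk k x))\<^sup>2) \<partial>N)"
    by (simp add: algebra_simps)
next
  have "(\<lambda>k. 2 * (\<integral>\<^sup>+x. ennreal ((norm (fk k x - f x))\<^sup>2) \<partial>N) + 2 * (\<integral>\<^sup>+x. ennreal ((norm (gk k x))\<^sup>2) \<partial>N))
      \<longlonglongrightarrow> 2 * 0 + 2 * 0"
    using assms(4,5) unfolding L2_lim_def fk'
    by (intro tendsto_add ennreal_tendsto_cmult) auto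
  then show "(\<lambda>k. 2 * (\<integral>\<^sup>+x. ennreal ((norm (fk k x - f x))\<^sup>2) \<partial>N) + 2 * (\<integral>\<^sup>+x. ennreal ((norm (gk k x))\<^sup>2) \<partial>N))
      \<longlonglongrightarrow> 0" by simp
qed

lemma L2_lim_inner:
  assumes "\<And>k. fk k \<in> borel_measurable N" "f \<in> borel_measurable N" "L2_lim N fk f"
  shows "L2_lim N (\<lambda>k x. u \<bullet> fk k x) (\<lambda>x. u \<bullet> f x)"
  unfolding L2_lim_def
proof (rule ennreal_tendsto_0_le)
  fix k
  have "(\<integral>\<^sup>+x. ennreal ((norm (u \<bullet> fk k x - u \<bullet> f x))\<^sup>2) \<partial>N)
    \<le> (\<integral>\<^sup>+x. ennreal ((norm u)\<^sup>2) * ennreal ((norm (fk k x - f x))\<^sup>2) \<partial>N)"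
  proof (rule nn_integral_mono)
    fix x
    have "norm (u \<bullet> fk k x - u \<bullet> f x) \<le> norm u * norm (fk k x - f x)"
      unfolding inner_diff_right[symmetric] real_norm_def by (rule Cauchy_Schwarz_ineq2)
    from power_mono[OF this, of 2]
    show "ennreal ((norm (u \<bullet> fk k x - u \<bullet> f x))\<^sup>2) \<le> ennreal ((norm u)\<^sup>2) * ennreal ((norm (fk k x - f x))\<^sup>2)"
      by (simp add: power_mult_distrib ennreal_leI flip: ennreal_mult)
  qed
  also have "\<dots> = ennreal ((norm u)\<^sup>2) * (\<integral>\<^sup>+x. ennreal ((norm (fk k x - f x))\<^sup>2) \<partial>N)"
    using assms(1,2) by (intro nn_integral_cmult) measurable
  finally show "(\<integral>\<^sup>+x. ennreal ((norm (u \<bullet> fk k x - u \<bullet> f x))\<^sup>2) \<partial>N)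
    \<le> ennreal ((norm u)\<^sup>2) * (\<integral>\<^sup>+x. ennreal ((norm (fk k x - f x))\<^sup>2) \<partial>N)" .
next
  have "(\<lambda>k. ennreal ((norm u)\<^sup>2) * (\<integral>\<^sup>+x. ennreal ((norm (fk k x - f x))\<^sup>2) \<partial>N)) \<longlonglongrightarrow> ennreal ((norm u)\<^sup>2) * 0"
    using assms(3) unfolding L2_lim_def by (intro ennreal_tendsto_cmult) auto
  then show "(\<lambda>k. ennreal ((norm u)\<^sup>2) * (\<integral>\<^sup>+x. ennreal ((norm (fk k x - f x))\<^sup>2) \<partial>N)) \<longlonglongrightarrow> 0" by simp
qed

text \<open>Some approximant lies at finite distance from \<open>f\<close>, and \<open>f\<close> is
  that approximant minus a square integrable error.\<close>

lemma L2_lim_square_integrable: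
  fixes f :: "'c \<Rightarrow> 'v::euclidean_space"
  assumes fk: "\<And>k. square_integrable N (fk k)" and f: "f \<in> borel_measurable N" and l: "L2_lim N fk f"
  shows "square_integrable N f"
proof -
  have "\<forall>\<^sub>F k in sequentially. (\<integral>\<^sup>+x. ennreal ((norm (fk k x - f x))\<^sup>2) \<partial>N) < 1"
    using l unfolding L2_lim_def by (rule order_tendstoD(2)) simp
  then obtain k where k: "(\<integral>\<^sup>+x. ennreal ((norm (fk k x - f x))\<^sup>2) \<partial>N) < 1"
    by (auto simp: eventually_sequentially)
  then have "square_integrable N (\<lambda>x. fk k x - f x)"
    using fk[of k] f by (auto simp: square_integrable_nn intro: order.strict_trans)
  from square_integrable_diff[OF fk[of k] this] show ?thesis by simp
qed

text \<open>Extension by zero outside \<open>[0, t]\<close>, read as one function on the product of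
  path space and time: integrals over \<open>[0, t]\<close> become integrals over the whole product,
  and joint measurability becomes a single statement.\<close>

definition cut_process :: "real \<Rightarrow> (real \<Rightarrow> 'a \<Rightarrow> 'v::real_vector) \<Rightarrow> 'a \<times> real \<Rightarrow> 'v" where
  "cut_process t Y = (\<lambda>(\<omega>, s). indicator {0..t} s *\<^sub>R Y s \<omega>)"

context brownian_basis
begin

lemma simple_process_outside:
  assumes "simple_integrand M F t N p h" "s \<notin> {0..t}"
  shows "simple_process N p h s \<omega> = 0"
  unfolding simple_process_def
proof (rule sum.neutral, rule ballI)
  fix i assume "i \<in> {..<N}"
  then have "0 \<le> p i" "p (Suc i) \<le> t" using simple_integrand_facts(2,3)[OF assms(1)] by auto
  then show "indicator {p i<..p (Suc i)} s *\<^sub>R h i \<omega> = 0"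
    using assms(2) by (auto simp: indicator_def)
qed

lemma nn_integral_cut_process:
  assumes "cut_process t Y \<in> borel_measurable path_measure"
  shows "(\<integral>\<^sup>+x. ennreal ((norm (cut_process t Y x))\<^sup>2) \<partial>path_measure)
    = (\<integral>\<^sup>+\<omega>. (\<integral>\<^sup>+s\<in>{0..t}. ennreal ((norm (Y s \<omega>))\<^sup>2) \<partial>lborel) \<partial>M)"
  using assms by (subst lborel.nn_integral_fst[symmetric])
    (auto simp: cut_process_def indicator_def intro!: nn_integral_cong)

lemma nn_integral_simple_cut:
  assumes s: "simple_integrand M F t N p h" and m: "cut_process t Y \<in> borel_measurable path_measure"
  shows "(\<integral>\<^sup>+x. ennreal ((norm ((\<lambda>(\<omega>, s). simple_process N p h s \<omega>) x - cut_process t Y x))\<^sup>2) \<partial>path_measure)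
    = (\<integral>\<^sup>+\<omega>. (\<integral>\<^sup>+s\<in>{0..t}. ennreal ((norm (simple_process N p h s \<omega> - Y s \<omega>))\<^sup>2) \<partial>lborel) \<partial>M)"
  using m square_integrable_measurable[OF simple_process_square_integrable[OF s]]
  by (subst lborel.nn_integral_fst[symmetric])
    (auto simp: cut_process_def indicator_def simple_process_outside[OF s] intro!: nn_integral_cong)

text \<open>The Ito integral is defined through an iterated nonnegative integral. Joint
  measurability of the cut process turns this into mean square convergence on the product space, and
  square integrability of integrand and integral is inherited from the approximants.\<close>

lemma has_ito_integralE:
  fixes Y :: "real \<Rightarrow> 'a \<Rightarrow> 'v::euclidean_space"
  assumes "has_ito_integral M F W t Y I" "cut_process t Y \<in> borel_measurable path_measure"
  obtains N p h where "\<And>k. simple_integrand M F t (N k) (p k) (h k)"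
    "L2_lim path_measure (\<lambda>k (\<omega>, s). simple_process (N k) (p k) (h k) s \<omega>) (cut_process t Y)"
    "L2_lim M (\<lambda>k. simple_ito_integral W (N k) (p k) (h k)) I"
    "square_integrable path_measure (cut_process t Y)" "square_integrable M I"
proof -
  obtain N p h where 1: "\<And>k. simple_integrand M F t (N k) (p k) (h k)" and
    2: "(\<lambda>k. \<integral>\<^sup>+\<omega>. (\<integral>\<^sup>+s\<in>{0..t}. ennreal ((norm (simple_process (N k) (p k) (h k) s \<omega> - Y s \<omega>))\<^sup>2) \<partial>lborel) \<partial>M)
          \<longlonglongrightarrow> 0" and
    3: "(\<lambda>k. \<integral>\<^sup>+\<omega>. ennreal ((norm (simple_ito_integral W (N k) (p k) (h k) \<omega> - I \<omega>))\<^sup>2) \<partial>M)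
          \<longlonglongrightarrow> 0" and 4: "I \<in> borel_measurable M"
    using assms(1) by (auto simp: has_ito_integral_def)
  have 5: "L2_lim path_measure (\<lambda>k (\<omega>, s). simple_process (N k) (p k) (h k) s \<omega>) (cut_process t Y)"
    unfolding L2_lim_def using 2 by (simp only: nn_integral_simple_cut[OF 1 assms(2)])
  have 6: "L2_lim M (\<lambda>k. simple_ito_integral W (N k) (p k) (h k)) I"
    using 3 by (simp add: L2_lim_def)
  show ?thesis
    using L2_lim_square_integrable[OF simple_process_square_integrable[OF 1] assms(2) 5]
      L2_lim_square_integrable[OF simple_ito_square_integrable[OF 1] 4 6]
    by (rule that[OF 1 5 6])
qed

lemma tendsto_integral_mult_L2_lim:
  fixes f g :: "'c \<Rightarrow> real"
  assumes "square_integrable N f" "square_integrable N g"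
    "\<And>k. square_integrable N (fk k)" "\<And>k. square_integrable N (gk k)"
    "L2_lim N fk f" "L2_lim N gk g"
  shows "(\<lambda>k. \<integral>x. fk k x * gk k x \<partial>N) \<longlonglongrightarrow> (\<integral>x. f x * g x \<partial>N)"
  using tendsto_integral_inner[OF assms(1-4)] assms(5,6) by (simp add: L2_lim_def)

lemma ito_covariance:
  fixes Y :: "real \<Rightarrow> 'a \<Rightarrow> 'v::euclidean_space"
  assumes "has_ito_integral M F W t Y I" "cut_process t Y \<in> borel_measurable path_measure"
  shows "(\<integral>\<omega>. (u \<bullet> I \<omega>) * (v \<bullet> I \<omega>) \<partial>M)
    = (\<integral>x. (u \<bullet> cut_process t Y x) * (v \<bullet> cut_process t Y x) \<partial>path_measure)"
proof -
  obtain N p h where s: "\<And>k. simple_integrand M F t (N k) (p k) (h k)"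
    "L2_lim path_measure (\<lambda>k (\<omega>, s). simple_process (N k) (p k) (h k) s \<omega>) (cut_process t Y)"
    "L2_lim M (\<lambda>k. simple_ito_integral W (N k) (p k) (h k)) I"
    "square_integrable path_measure (cut_process t Y)" "square_integrable M I"
    using has_ito_integralE[OF assms] by blast
  note S = simple_ito_square_integrable[OF s(1)] and H = simple_process_square_integrable[OF s(1)]
  note mS = square_integrable_measurable[OF S] and mH = square_integrable_measurable[OF H]
  have "(\<lambda>k. \<integral>\<omega>. (u \<bullet> simple_ito_integral W (N k) (p k) (h k) \<omega>) * (v \<bullet> simple_ito_integral W (N k) (p k) (h k) \<omega>) \<partial>M)
     \<longlonglongrightarrow> (\<integral>\<omega>. (u \<bullet> I \<omega>) * (v \<bullet> I \<omega>) \<partial>M)"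
    by (intro tendsto_integral_mult_L2_lim square_integrable_inner_left L2_lim_inner s S mS
        square_integrable_measurable[OF s(5)])
  moreover have "(\<lambda>k. \<integral>x. (u \<bullet> (\<lambda>(\<omega>, s). simple_process (N k) (p k) (h k) s \<omega>) x) * (v \<bullet> (\<lambda>(\<omega>, s). simple_process (N k) (p k) (h k) s \<omega>) x) \<partial>path_measure)
     \<longlonglongrightarrow> (\<integral>x. (u \<bullet> cut_process t Y x) * (v \<bullet> cut_process t Y x) \<partial>path_measure)"
    by (intro tendsto_integral_mult_L2_lim square_integrable_inner_left L2_lim_inner s H mH assms)
  ultimately show ?thesis
    by (intro LIMSEQ_unique) (simp_all add: simple_ito_covariance[OF s(1) s(1)] split_beta')
qed

text \<open>The martingale property in weak form. The difficulty is that \<open>I\<close> and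
  \<open>J\<close> come with unrelated approximating sequences. The approximants of \<open>I\<close>
  are restricted to \<open>[0, s]\<close>; there they approximate the same integrand as those of
  \<open>J\<close>, so by the isometry their integrals converge to \<open>J\<close>, while the part
  removed is orthogonal to \<open>Z\<close>.\<close>

lemma ito_orthogonal:
  fixes Y :: "real \<Rightarrow> 'a \<Rightarrow> 'v::euclidean_space"
  assumes It: "has_ito_integral M F W t Y I" "cut_process t Y \<in> borel_measurable path_measure"
    and Is: "has_ito_integral M F W s Y J" "cut_process s Y \<in> borel_measurable path_measure"
    and st: "0 \<le> s" "s \<le> t" and Z: "adapted_L2 s Z"
  shows "(\<integral>\<omega>. Z \<omega> * (u \<bullet> (I \<omega> - J \<omega>)) \<partial>M) = 0"
proof -
  obtain N p h where s: "\<And>k. simple_integrand M F t (N k) (p k) (h k)"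
    "L2_lim path_measure (\<lambda>k (\<omega>, s). simple_process (N k) (p k) (h k) s \<omega>) (cut_process t Y)"
    "L2_lim M (\<lambda>k. simple_ito_integral W (N k) (p k) (h k)) I"
    "square_integrable path_measure (cut_process t Y)" "square_integrable M I"
    using has_ito_integralE[OF It] by blast
  obtain N' p' h' where s': "\<And>k. simple_integrand M F s (N' k) (p' k) (h' k)"
    "L2_lim path_measure (\<lambda>k (\<omega>, s). simple_process (N' k) (p' k) (h' k) s \<omega>) (cut_process s Y)"
    "L2_lim M (\<lambda>k. simple_ito_integral W (N' k) (p' k) (h' k)) J"
    "square_integrable path_measure (cut_process s Y)" "square_integrable M J"
    using has_ito_integralE[OF Is] by blast
  define q where "q k = (\<lambda>i. min (p k i) s)" for k
  define g where "g k = (\<lambda>i. if p k i \<le> s then h k i else (\<lambda>_. 0))" for k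
  note r = simple_integrand_restrict[OF s(1) st, folded q_def g_def]
  note S = simple_ito_square_integrable[OF s(1)] and S' = simple_ito_square_integrable[OF s'(1)]
   and Sr = simple_ito_square_integrable[OF r(1)]
  note H = simple_process_square_integrable[OF s(1)] and H' = simple_process_square_integrable[OF s'(1)]
   and Hr = simple_process_square_integrable[OF r(1)]
  let ?H = "\<lambda>k (\<omega>, r). simple_process (N k) (p k) (h k) r \<omega>"
  let ?H' = "\<lambda>k (\<omega>, r). simple_process (N' k) (p' k) (h' k) r \<omega>"
  let ?R = "\<lambda>k (\<omega>, r). simple_process (N k) (q k) (g k) r \<omega>"
  let ?S = "\<lambda>k. simple_ito_integral W (N k) (p k) (h k)"
  let ?S' = "\<lambda>k. simple_ito_integral W (N' k) (p' k) (h' k)"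
  let ?Sr = "\<lambda>k. simple_ito_integral W (N k) (q k) (g k)"
  have [measurable]: "?H k \<in> borel_measurable path_measure" "?H' k \<in> borel_measurable path_measure" "?R k \<in> borel_measurable path_measure"
    "?S k \<in> borel_measurable M" "?S' k \<in> borel_measurable M" "?Sr k \<in> borel_measurable M" for k
    using H H' Hr S S' Sr by (auto simp: square_integrable_def)
  note [measurable] = It(2) Is(2) square_integrable_measurable[OF s(5)] square_integrable_measurable[OF s'(5)]
  have lR: "L2_lim path_measure ?R (cut_process s Y)"
    unfolding L2_lim_def
  proof (rule ennreal_tendsto_0_le[OF _ s(2)[unfolded L2_lim_def]], rule nn_integral_mono)
    fix k and x :: "'a \<times> real"
    obtain \<omega> r' where x: "x = (\<omega>, r')" by force
    have "?R k x - cut_process s Y x = (if r' \<le> s then ?H k x - cut_process t Y x else 0)"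
      using st r(2)[of r' k \<omega>] r(3)[of r' k \<omega>] by (auto simp: x cut_process_def indicator_def)
    then show "ennreal ((norm (?R k x - cut_process s Y x))\<^sup>2) \<le> ennreal ((norm (?H k x - cut_process t Y x))\<^sup>2)"
      by auto
  qed
  have "L2_lim path_measure (\<lambda>k x. ?R k x + - ?H' k x) (\<lambda>_. 0)"
    unfolding L2_lim_def
  proof (rule ennreal_tendsto_0_le)
    fix k
    have "(\<integral>\<^sup>+x. ennreal ((norm ((?R k x - cut_process s Y x) + (cut_process s Y x - ?H' k x)))\<^sup>2) \<partial>path_measure)
      \<le> 2 * (\<integral>\<^sup>+x. ennreal ((norm (?R k x - cut_process s Y x))\<^sup>2) \<partial>path_measure)
        + 2 * (\<integral>\<^sup>+x. ennreal ((norm (cut_process s Y x - ?H' k x))\<^sup>2) \<partial>path_measure)"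
      by (rule nn_integral_norm_add_sq_le) measurable
    then show "(\<integral>\<^sup>+x. ennreal ((norm (?R k x + - ?H' k x - 0))\<^sup>2) \<partial>path_measure)
      \<le> 2 * (\<integral>\<^sup>+x. ennreal ((norm (?R k x - cut_process s Y x))\<^sup>2) \<partial>path_measure)
        + 2 * (\<integral>\<^sup>+x. ennreal ((norm (?H' k x - cut_process s Y x))\<^sup>2) \<partial>path_measure)"
      by (simp add: norm_minus_commute)
  next
    have "(\<lambda>k. 2 * (\<integral>\<^sup>+x. ennreal ((norm (?R k x - cut_process s Y x))\<^sup>2) \<partial>path_measure)
        + 2 * (\<integral>\<^sup>+x. ennreal ((norm (?H' k x - cut_process s Y x))\<^sup>2) \<partial>path_measure)) \<longlonglongrightarrow> 2 * 0 + 2 * 0"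
      using lR s'(2) unfolding L2_lim_def by (intro tendsto_add ennreal_tendsto_cmult) auto
    then show "(\<lambda>k. 2 * (\<integral>\<^sup>+x. ennreal ((norm (?R k x - cut_process s Y x))\<^sup>2) \<partial>path_measure)
        + 2 * (\<integral>\<^sup>+x. ennreal ((norm (?H' k x - cut_process s Y x))\<^sup>2) \<partial>path_measure)) \<longlonglongrightarrow> 0" by simp
  qed
  \<comment> \<open>The isometry carries the vanishing distance of the two integrands on the product
    space over to their stochastic integrals.\<close>
  then have "L2_lim M (\<lambda>k \<omega>. ?Sr k \<omega> - ?S' k \<omega>) (\<lambda>_. 0)"
    using simple_ito_isometry_diff[OF r(1) s'(1)] by (simp add: L2_lim_def split_beta')
  from L2_lim_add_null[OF _ _ _ s'(3) this refl]
  have lSr: "L2_lim M ?Sr J" by simp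
  have Z2: "square_integrable M Z" using Z by (rule adapted_L2_square_integrable)
  have zl: "L2_lim M (\<lambda>k. Z) Z" by (simp add: L2_lim_def)
  have 1: "(\<lambda>k. \<integral>\<omega>. Z \<omega> * (u \<bullet> ?S k \<omega>) \<partial>M) \<longlonglongrightarrow> (\<integral>\<omega>. Z \<omega> * (u \<bullet> I \<omega>) \<partial>M)"
    by (intro tendsto_integral_mult_L2_lim square_integrable_inner_left L2_lim_inner s S Z2 zl) measurable
  have 2: "(\<lambda>k. \<integral>\<omega>. Z \<omega> * (u \<bullet> ?Sr k \<omega>) \<partial>M) \<longlonglongrightarrow> (\<integral>\<omega>. Z \<omega> * (u \<bullet> J \<omega>) \<partial>M)"
    by (intro tendsto_integral_mult_L2_lim square_integrable_inner_left L2_lim_inner s' Sr Z2 zl lSr) measurable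
  have iZ: "integrable M (\<lambda>\<omega>. Z \<omega> * (u \<bullet> f \<omega>))" if "square_integrable M f" for f :: "'a \<Rightarrow> 'v"
    by (intro integrable_mult_sq Z2 square_integrable_inner_left that)
  have "(\<integral>\<omega>. Z \<omega> * (u \<bullet> ?S k \<omega>) \<partial>M) = (\<integral>\<omega>. Z \<omega> * (u \<bullet> ?Sr k \<omega>) \<partial>M)" for k
    using r(4)[OF Z, of u k] iZ[OF S, of k] iZ[OF Sr, of k] by (simp add: inner_diff_right right_diff_distrib)
  then have "(\<integral>\<omega>. Z \<omega> * (u \<bullet> I \<omega>) \<partial>M) = (\<integral>\<omega>. Z \<omega> * (u \<bullet> J \<omega>) \<partial>M)"
    using 1 2 by (auto intro: LIMSEQ_unique)
  then show ?thesis
    using iZ[OF s(5)] iZ[OF s'(5)] by (simp add: inner_diff_right right_diff_distrib)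
qed

text \<open>Plays the part of the integral up to time 0 in \<open>ito_orthogonal\<close>, which
  makes every Ito integral orthogonal to the initial state.\<close>

lemma has_ito_integral_0: "has_ito_integral M F W 0 Y (\<lambda>_. 0)"
proof -
  have [simp]: "{0..0::real} = {0}" by auto
  have "(\<integral>\<^sup>+s\<in>{0..0}. f s \<partial>lborel) = 0" for f :: "real \<Rightarrow> ennreal"
    by (rule nn_integral_null_set) (auto intro: finite_imp_null_set_lborel)
  then show ?thesis
    unfolding has_ito_integral_def
    by (intro conjI exI[of _ "\<lambda>_. 0"] exI[of _ "\<lambda>_ _. 0"] exI[of _ "\<lambda>_ _ _. 0"])
      (auto simp: simple_integrand_def simple_ito_integral_def simple_process_def)
qed

end

section \<open>Second moments of solutions of linear equations\<close>

lemma inner_matrix_vector: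
  fixes A :: "real^'n^'m"
  shows "u \<bullet> (A *v x) = (transpose A *v u) \<bullet> x"
  using dot_lmul_matrix[of u A x] by simp

text \<open>By continuity in time the process is the pointwise limit of processes frozen on cells of
  length \<open>1 / Suc n\<close>; each of those is pieced together from countably many measurable
  functions and hence jointly measurable.\<close>

lemma cut_process_measurable:
  fixes X :: "real \<Rightarrow> 'a \<Rightarrow> 'v::euclidean_space"
  assumes X: "\<And>t. 0 \<le> t \<Longrightarrow> X t \<in> borel_measurable M"
    and cont: "\<And>\<omega>. \<omega> \<in> space M \<Longrightarrow> continuous_on {0..} (\<lambda>t. X t \<omega>)"
  shows "cut_process T X \<in> borel_measurable (M \<Otimes>\<^sub>M lborel)"
proof -
  define k where "k n s = nat \<lfloor>s * real (Suc n)\<rfloor>" for n and s :: real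
  define G where "G n x = indicator {0..T} (snd x) *\<^sub>R X (real (k n (snd x)) / real (Suc n)) (fst x)" for n and x :: "'a \<times> real"
  have [measurable]: "X (real j / real (Suc n)) \<in> borel_measurable M" for j n by (rule X) simp
  have "(\<lambda>x. X (real (k n (snd x)) / real (Suc n)) (fst x)) \<in> borel_measurable (M \<Otimes>\<^sub>M lborel)" for n
    by (rule measurable_compose_countable[where f="\<lambda>j x. X (real j / real (Suc n)) (fst x)" and g="\<lambda>x. k n (snd x)"])
      (measurable, simp add: k_def)
  then have G: "G n \<in> borel_measurable (M \<Otimes>\<^sub>M lborel)" for n
    unfolding G_def by measurable
  show ?thesis
  proof (rule borel_measurable_LIMSEQ_metric[OF G])
    fix x :: "'a \<times> real" assume x: "x \<in> space (M \<Otimes>\<^sub>M lborel)"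
    obtain \<omega> s where xs: "x = (\<omega>, s)" and \<omega>: "\<omega> \<in> space M" using x by (auto simp: space_pair_measure)
    show "(\<lambda>n. G n x) \<longlonglongrightarrow> cut_process T X x"
    proof (cases "s \<in> {0..T}")
      case True
      have a: "\<bar>real (k n s) / real (Suc n) - s\<bar> \<le> 1 / real (Suc n)" for n
      proof -
        have "real (k n s) = of_int \<lfloor>s * real (Suc n)\<rfloor>" using True by (simp add: k_def)
        then have "\<bar>real (k n s) - s * real (Suc n)\<bar> \<le> 1" by linarith
        then have "\<bar>real (k n s) - s * real (Suc n)\<bar> / real (Suc n) \<le> 1 / real (Suc n)"
          by (rule divide_right_mono) simp
        moreover have "real (k n s) / real (Suc n) - s = (real (k n s) - s * real (Suc n)) / real (Suc n)"
          by (simp add: field_simps)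
        ultimately show ?thesis by simp
      qed
      have "(\<lambda>n. real (k n s) / real (Suc n)) \<longlonglongrightarrow> s"
        by (rule LIM_zero_cancel, rule Lim_null_comparison[OF _ LIMSEQ_inverse_real_of_nat])
          (use a in \<open>auto simp: inverse_eq_divide\<close>)
      then have "(\<lambda>n. X (real (k n s) / real (Suc n)) \<omega>) \<longlonglongrightarrow> X s \<omega>"
        using cont[OF \<omega>] True
        by (intro continuous_on_tendsto_compose[of "{0..}" "\<lambda>t. X t \<omega>"]) (auto intro!: always_eventually)
      then show ?thesis using True by (simp add: G_def cut_process_def xs)
    qed (simp add: G_def cut_process_def xs)
  qed
qed

lemma norm_integral_sq_le:
  fixes f :: "real \<Rightarrow> 'v::euclidean_space"
  assumes t: "0 \<le> t" and f: "continuous_on {0..t} f"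
  shows "(norm (integral {0..t} f))\<^sup>2 \<le> t * integral {0..t} (\<lambda>s. (norm (f s))\<^sup>2)"
proof -
  have cn: "continuous_on {0..t} (\<lambda>s. norm (f s))" and cn2: "continuous_on {0..t} (\<lambda>s. (norm (f s))\<^sup>2)"
    by (intro continuous_intros f)+
  have i: "f integrable_on {0..t}" "(\<lambda>s. norm (f s)) integrable_on {0..t}" "(\<lambda>s. (norm (f s))\<^sup>2) integrable_on {0..t}"
    by (intro integrable_continuous_interval f cn cn2)+
  define q where "q = integral {0..t} (\<lambda>s. norm (f s))"
  have q: "norm (integral {0..t} f) \<le> q"
    unfolding q_def by (intro integral_norm_bound_integral i) auto
  have "2 * q * q \<le> t * integral {0..t} (\<lambda>s. (norm (f s))\<^sup>2) + q * q"
  proof (cases "t = 0")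
    case False
    \<comment> \<open>\<open>m\<close> is the mean of \<open>norm (f s)\<close> over the interval.
      Integrating the inequality between \<open>2 * m * norm (f s)\<close> and the sum of the
      squares gives the Cauchy-Schwarz inequality.\<close>
    define m where "m = q / t"
    have "integral {0..t} (\<lambda>s. 2 * m * norm (f s)) \<le> integral {0..t} (\<lambda>s. (norm (f s))\<^sup>2 + m\<^sup>2)"
    proof (rule integral_le)
      show "2 * m * norm (f s) \<le> (norm (f s))\<^sup>2 + m\<^sup>2" for s
        using sum_squares_bound[of m "norm (f s)"] by simp
    qed (intro integrable_continuous_interval continuous_intros f)+
    moreover have "integral {0..t} (\<lambda>s. (norm (f s))\<^sup>2 + m\<^sup>2) = integral {0..t} (\<lambda>s. (norm (f s))\<^sup>2) + t * m\<^sup>2"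
      by (subst Henstock_Kurzweil_Integration.integral_add) (use t i in auto)
    ultimately have "2 * m * q \<le> integral {0..t} (\<lambda>s. (norm (f s))\<^sup>2) + t * m\<^sup>2"
      by (simp add: q_def)
    then have "t * (2 * m * q) \<le> t * (integral {0..t} (\<lambda>s. (norm (f s))\<^sup>2) + t * m\<^sup>2)"
      using t by (intro mult_left_mono)
    moreover have "t * m = q" using False by (simp add: m_def)
    then have "t * (2 * m * q) = 2 * q * q" "t * (t * m\<^sup>2) = q * q"
      by (auto simp: power2_eq_square algebra_simps)
    ultimately show ?thesis by (simp add: distrib_left)
  qed (simp add: q_def)
  moreover have "(norm (integral {0..t} f))\<^sup>2 \<le> q * q"
    using power_mono[OF q, of 2] by (simp add: power2_eq_square)
  ultimately show ?thesis by linarith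
qed

lemma at_within_atLeast:
  fixes s :: real
  assumes "0 \<le> s"
  shows "at s within {0..} = at s within {0..s + 1}"
  by (rule at_within_nhd[of s "{..<s + 1}"]) auto

lemma continuous_on_atLeastI:
  fixes f :: "real \<Rightarrow> 'b::topological_space"
  assumes "\<And>t. continuous_on {0..t} f"
  shows "continuous_on {0..} f"
  unfolding continuous_on_eq_continuous_within
proof
  fix s :: real assume "s \<in> {0..}"
  then show "continuous (at s within {0..}) f"
    using assms[of "s + 1"] by (simp add: at_within_atLeast continuous_on_eq_continuous_within)
qed

lemma integral_cut:
  fixes f :: "real \<Rightarrow> 'v::euclidean_space"
  assumes "continuous_on {0..t} f"
  shows "integrable lborel (\<lambda>s. indicator {0..t} s *\<^sub>R f s)"
    "(\<integral>s. indicator {0..t} s *\<^sub>R f s \<partial>lborel) = integral {0..t} f"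
  using borel_integrable_atLeastAtMost'[OF assms] set_borel_integral_eq_integral(2)[of "{0..t}" f]
  by (auto simp: set_integrable_def set_lebesgue_integral_def)

text \<open>A solution with every path continuous, not just almost every path, so that the cut
  process is jointly measurable. \<open>I t\<close> is a version of the Ito integral chosen
  separately for each \<open>t\<close>; no regularity in \<open>t\<close> is assumed for it.\<close>

locale regular_sde_solution = brownian_basis M F W
  for M :: "'a measure" and F :: "real \<Rightarrow> 'a measure" and W :: "real \<Rightarrow> 'a \<Rightarrow> real" +
  fixes A C :: "real^'n^'n" and \<xi> :: "'a \<Rightarrow> real^'n" and X I :: "real \<Rightarrow> 'a \<Rightarrow> real^'n"
  assumes init: "initial_state M F \<xi>"
    and X_adapted: "0 \<le> t \<Longrightarrow> X t \<in> borel_measurable (F t)"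
    and X_cont: "\<omega> \<in> space M \<Longrightarrow> continuous_on {0..} (\<lambda>t. X t \<omega>)"
    and X_L2: "0 \<le> T \<Longrightarrow> (\<integral>\<^sup>+\<omega>. (\<integral>\<^sup>+s\<in>{0..T}. ennreal ((norm (X s \<omega>))\<^sup>2) \<partial>lborel) \<partial>M) < \<infinity>"
    and X_ito: "0 \<le> t \<Longrightarrow> has_ito_integral M F W t (\<lambda>s \<omega>. C *v X s \<omega>) (I t)"
    and X_eq: "0 \<le> t \<Longrightarrow> AE \<omega> in M. X t \<omega> = \<xi> \<omega> + integral {0..t} (\<lambda>s. A *v X s \<omega>) + I t \<omega>"
begin

lemma X_measurable: "0 \<le> t \<Longrightarrow> X t \<in> borel_measurable M"
  using X_adapted measurable_F_M by blast

lemma X_cont': "\<omega> \<in> space M \<Longrightarrow> continuous_on {0..t} (\<lambda>t. X t \<omega>)"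
  by (rule continuous_on_subset[OF X_cont]) auto

lemma cut_X: "0 \<le> t \<Longrightarrow> square_integrable path_measure (cut_process t X)"
  using cut_process_measurable[OF X_measurable X_cont, where T=t] X_L2[of t]
  by (simp add: square_integrable_nn nn_integral_cut_process)

lemma cut_linear: "cut_process t (\<lambda>s \<omega>. G *v X s \<omega>) = (\<lambda>x. G *v cut_process t X x)"
  for G :: "real^'n^'k"
  by (auto simp: cut_process_def fun_eq_iff matrix_vector_mult_scaleR)

lemma cut_GX: "0 \<le> t \<Longrightarrow> square_integrable path_measure (cut_process t (\<lambda>s \<omega>. G *v X s \<omega>))"
  for G :: "real^'n^'k"
  unfolding cut_linear by (intro square_integrable_linear[OF matrix_vector_mul_bounded_linear] cut_X)

definition drift :: "real \<Rightarrow> 'a \<Rightarrow> real^'n" where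
  "drift t \<omega> = integral {0..t} (\<lambda>s. A *v X s \<omega>)"

lemma AX_cont: "\<omega> \<in> space M \<Longrightarrow> continuous_on {0..t} (\<lambda>s. A *v X s \<omega>)"
  using linear_continuous_on_compose[OF X_cont' matrix_vector_mul_linear[of A]] .

lemma drift_eq:
  assumes "\<omega> \<in> space M"
  shows "integrable lborel (\<lambda>s. cut_process t (\<lambda>s \<omega>. A *v X s \<omega>) (\<omega>, s))"
    "(\<integral>s. cut_process t (\<lambda>s \<omega>. A *v X s \<omega>) (\<omega>, s) \<partial>lborel) = drift t \<omega>"
  using integral_cut[OF AX_cont[OF assms, of t]] by (auto simp: cut_process_def drift_def)

lemma drift_measurable: assumes "0 \<le> t" shows "drift t \<in> borel_measurable M"
proof -
  note [measurable] = square_integrable_measurable[OF cut_GX[OF assms, of A]]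
  have "(\<lambda>\<omega>. \<integral>s. cut_process t (\<lambda>s \<omega>. A *v X s \<omega>) (\<omega>, s) \<partial>lborel) \<in> borel_measurable M"
    by measurable
  then show ?thesis by (subst measurable_cong[OF drift_eq(2)[symmetric]])
qed

lemma drift_derivative:
  assumes "\<omega> \<in> space M" "s \<in> {0..t}"
  shows "((\<lambda>s. drift s \<omega>) has_vector_derivative A *v X s \<omega>) (at s within {0..t})"
  unfolding drift_def by (rule integral_has_vector_derivative[OF AX_cont[OF assms(1)] assms(2)])

lemma drift_cont: "\<omega> \<in> space M \<Longrightarrow> continuous_on {0..} (\<lambda>t. drift t \<omega>)"
  by (rule continuous_on_atLeastI)
    (use continuous_on_vector_derivative[OF drift_derivative] in blast)

lemma drift_bound:
  assumes \<omega>: "\<omega> \<in> space M" and s: "0 \<le> s" "s \<le> t"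
  shows "(norm (drift s \<omega>))\<^sup>2 \<le> t * (\<integral>r. (norm (cut_process t (\<lambda>s \<omega>. A *v X s \<omega>) (\<omega>, r)))\<^sup>2 \<partial>lborel)"
proof -
  have c: "continuous_on {0..r} (\<lambda>s. (norm (A *v X s \<omega>))\<^sup>2)" for r
    by (intro continuous_on_power continuous_on_norm AX_cont \<omega>)
  have "(norm (drift s \<omega>))\<^sup>2 \<le> s * integral {0..s} (\<lambda>s. (norm (A *v X s \<omega>))\<^sup>2)"
    unfolding drift_def by (rule norm_integral_sq_le[OF s(1) AX_cont[OF \<omega>]])
  also have "\<dots> \<le> t * integral {0..t} (\<lambda>s. (norm (A *v X s \<omega>))\<^sup>2)"
  proof (rule mult_mono[OF s(2) _ _ integral_nonneg])
    show "integral {0..s} (\<lambda>s. (norm (A *v X s \<omega>))\<^sup>2) \<le> integral {0..t} (\<lambda>s. (norm (A *v X s \<omega>))\<^sup>2)"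
      by (rule integral_subset_le) (use s in \<open>auto intro: integrable_continuous_interval c\<close>)
  qed (use s in \<open>auto intro: integrable_continuous_interval c\<close>)
  also have "integral {0..t} (\<lambda>s. (norm (A *v X s \<omega>))\<^sup>2)
      = (\<integral>r. indicator {0..t} r *\<^sub>R (norm (A *v X r \<omega>))\<^sup>2 \<partial>lborel)"
    using integral_cut(2)[OF c] ..
  also have "\<dots> = (\<integral>r. (norm (cut_process t (\<lambda>s \<omega>. A *v X s \<omega>) (\<omega>, r)))\<^sup>2 \<partial>lborel)"
    by (rule Bochner_Integration.integral_cong) (auto simp: cut_process_def indicator_def)
  finally show ?thesis .
qed

text \<open>By Cauchy-Schwarz in time, a square integrable majorant of
  \<open>norm (drift s \<omega>)\<close> simultaneously for all \<open>s \<le> t\<close>. It makes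
  the drift square integrable on the product space.\<close>

definition drift_envelope :: "real \<Rightarrow> 'a \<Rightarrow> real" where
  "drift_envelope t \<omega> = sqrt (t * (\<integral>r. (norm (cut_process t (\<lambda>s \<omega>. A *v X s \<omega>) (\<omega>, r)))\<^sup>2 \<partial>lborel))"

lemma drift_envelope:
  assumes "0 \<le> t"
  shows "square_integrable M (drift_envelope t)"
    and "\<omega> \<in> space M \<Longrightarrow> 0 \<le> s \<Longrightarrow> s \<le> t \<Longrightarrow> norm (drift s \<omega>) \<le> drift_envelope t \<omega>"
proof -
  interpret P: pair_sigma_finite M lborel by (rule pair_sigma_finite_path)
  note c = cut_GX[OF assms, of A]
  note [measurable] = square_integrable_measurable[OF c]
  have i: "integrable M (\<lambda>\<omega>. t * (\<integral>r. (norm (cut_process t (\<lambda>s \<omega>. A *v X s \<omega>) (\<omega>, r)))\<^sup>2 \<partial>lborel))"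
    using P.integrable_fst'[OF square_integrable_integrable[OF c]] by simp
  have "drift_envelope t \<in> borel_measurable M"
    unfolding drift_envelope_def by measurable
  then show "square_integrable M (drift_envelope t)"
    by (rule square_integrable_bound[OF i]) (auto simp: drift_envelope_def assms)
  assume "\<omega> \<in> space M" "0 \<le> s" "s \<le> t"
  from drift_bound[OF this] show "norm (drift s \<omega>) \<le> drift_envelope t \<omega>"
    unfolding drift_envelope_def by (rule real_le_rsqrt)
qed

lemma drift_square_integrable:
  assumes t: "0 \<le> t"
  shows "square_integrable M (drift t)"
proof (rule square_integrable_bound[OF square_integrable_integrable[OF drift_envelope(1)[OF t]] drift_measurable[OF t]])
  show "AE \<omega> in M. (norm (drift t \<omega>))\<^sup>2 \<le> (norm (drift_envelope t \<omega>))\<^sup>2"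
  proof (rule AE_I2)
    fix \<omega> assume "\<omega> \<in> space M"
    from drift_envelope(2)[OF t this t order_refl]
    have "norm (drift t \<omega>) \<le> norm (drift_envelope t \<omega>)" by simp
    then show "(norm (drift t \<omega>))\<^sup>2 \<le> (norm (drift_envelope t \<omega>))\<^sup>2" by (intro power_mono) auto
  qed
qed

lemma square_integrable_path_bound:
  fixes f :: "'a \<times> real \<Rightarrow> 'v::euclidean_space" and h :: "'a \<Rightarrow> real"
  assumes t: "0 \<le> t" and h: "square_integrable M h" and f: "f \<in> borel_measurable path_measure"
    and b: "\<And>\<omega> s. \<omega> \<in> space M \<Longrightarrow> norm (f (\<omega>, s)) \<le> indicator {0..t} s * h \<omega>"
  shows "square_integrable path_measure f"
proof (rule square_integrable_bound[OF square_integrable_integrable[OF square_integrable_path_indicator[OF h, of "-1" t]] f])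
  \<comment> \<open>The half-open interval starts at \<open>-1\<close> in order to contain time
    0.\<close>
  show "AE x in path_measure. (norm (f x))\<^sup>2 \<le> (norm (case x of (\<omega>, s) \<Rightarrow> indicator {-1<..t} s *\<^sub>R h \<omega>))\<^sup>2"
  proof (rule AE_I2, safe)
    fix \<omega> s assume "(\<omega>, s) \<in> space path_measure"
    then have "norm (f (\<omega>, s)) \<le> indicator {0..t} s * h \<omega>" using b by (auto simp: space_pair_measure)
    also have "\<dots> \<le> norm (indicator {-1<..t} s *\<^sub>R h \<omega>)" by (auto simp: indicator_def)
    finally show "(norm (f (\<omega>, s)))\<^sup>2 \<le> (norm (indicator {-1<..t} s *\<^sub>R h \<omega>))\<^sup>2"
      by (intro power_mono) auto
  qed
qed (use t in auto)

lemma cut_drift: "0 \<le> t \<Longrightarrow> square_integrable path_measure (cut_process t drift)"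
  using drift_envelope
  by (intro square_integrable_path_bound[where h="drift_envelope t"] cut_process_measurable drift_measurable drift_cont)
    (auto simp: cut_process_def indicator_def)

lemma cut_const:
  fixes h :: "'a \<Rightarrow> 'v::euclidean_space"
  assumes "0 \<le> t" and h: "square_integrable M h"
  shows "square_integrable path_measure (cut_process t (\<lambda>s. h))"
proof (rule square_integrable_path_bound[where h="\<lambda>\<omega>. norm (h \<omega>)"])
  show "square_integrable M (\<lambda>\<omega>. norm (h \<omega>))"
    using h by (auto simp: square_integrable_def)
  show "cut_process t (\<lambda>s. h) \<in> borel_measurable path_measure"
    using h by (intro cut_process_measurable) (auto simp: square_integrable_def)
qed (use assms in \<open>auto simp: cut_process_def\<close>)

lemma I_square_integrable: "0 \<le> t \<Longrightarrow> square_integrable M (I t)"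
  by (rule has_ito_integralE[OF X_ito square_integrable_measurable[OF cut_GX]])

lemma \<xi>_adapted: "adapted_L2 0 \<xi>"
  using init by (simp add: adapted_L2_iff initial_state_def)

lemma X_AE: "0 \<le> t \<Longrightarrow> AE \<omega> in M. X t \<omega> - drift t \<omega> = \<xi> \<omega> + I t \<omega>"
  by (drule X_eq, erule eventually_mono) (simp add: drift_def)

lemma X_drift_square_integrable:
  assumes "0 \<le> t"
  shows "square_integrable M (\<lambda>\<omega>. X t \<omega> - drift t \<omega>)"
proof -
  have 1: "square_integrable M (\<lambda>\<omega>. \<xi> \<omega> + I t \<omega>)"
    using adapted_L2_square_integrable[OF \<xi>_adapted] I_square_integrable[OF assms]
    by (rule square_integrable_add)
  show ?thesis
    by (rule square_integrable_bound[OF square_integrable_integrable[OF 1]])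
      (use X_AE[OF assms] X_measurable[OF assms] drift_measurable[OF assms] in auto)
qed

lemma X_square_integrable: "0 \<le> t \<Longrightarrow> square_integrable M (X t)"
  using square_integrable_add[OF X_drift_square_integrable drift_square_integrable, of t t] by simp

lemma X_adapted_L2: "0 \<le> t \<Longrightarrow> adapted_L2 t (X t)"
  by (simp add: adapted_L2_def X_adapted X_square_integrable)

text \<open>\<open>X - drift\<close> equals \<open>\<xi> + I\<close> almost surely, and the
  increment of \<open>I\<close> from \<open>r\<close> to \<open>t\<close> is orthogonal to whatever
  is known at \<open>r\<close>. So \<open>X - drift\<close> is a martingale, tested here against
  \<open>Z\<close>.\<close>

lemma martingale_part:
  assumes r: "0 \<le> r" "r \<le> t" and Z: "adapted_L2 r Z"
  shows "(\<integral>\<omega>. Z \<omega> * (w \<bullet> (X t \<omega> - drift t \<omega>)) \<partial>M) = (\<integral>\<omega>. Z \<omega> * (w \<bullet> (X r \<omega> - drift r \<omega>)) \<partial>M)"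
proof -
  have t: "0 \<le> t" using r by simp
  note Z2 = adapted_L2_square_integrable[OF Z]
  note [measurable] = square_integrable_measurable[OF Z2]
    square_integrable_measurable[OF X_drift_square_integrable[OF t]] square_integrable_measurable[OF X_drift_square_integrable[OF r(1)]]
    square_integrable_measurable[OF I_square_integrable[OF t]] square_integrable_measurable[OF I_square_integrable[OF r(1)]]
    square_integrable_measurable[OF adapted_L2_square_integrable[OF \<xi>_adapted]]
  have e: "(\<integral>\<omega>. Z \<omega> * (w \<bullet> (X q \<omega> - drift q \<omega>)) \<partial>M) = (\<integral>\<omega>. Z \<omega> * (w \<bullet> \<xi> \<omega>) \<partial>M) + (\<integral>\<omega>. Z \<omega> * (w \<bullet> I q \<omega>) \<partial>M)"
    if q: "0 \<le> q" for q
  proof -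
    have "(\<integral>\<omega>. Z \<omega> * (w \<bullet> (X q \<omega> - drift q \<omega>)) \<partial>M) = (\<integral>\<omega>. Z \<omega> * (w \<bullet> \<xi> \<omega>) + Z \<omega> * (w \<bullet> I q \<omega>) \<partial>M)"
      using square_integrable_measurable[OF X_drift_square_integrable[OF q]] square_integrable_measurable[OF I_square_integrable[OF q]]
      by (intro integral_cong_AE; measurable?) (use X_AE[OF q] in \<open>auto simp: inner_add_right distrib_left\<close>)
    also have "\<dots> = (\<integral>\<omega>. Z \<omega> * (w \<bullet> \<xi> \<omega>) \<partial>M) + (\<integral>\<omega>. Z \<omega> * (w \<bullet> I q \<omega>) \<partial>M)"
      by (intro Bochner_Integration.integral_add integrable_mult_sq Z2 square_integrable_inner_left
        I_square_integrable q adapted_L2_square_integrable[OF \<xi>_adapted])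
    finally show ?thesis .
  qed
  have "(\<integral>\<omega>. Z \<omega> * (w \<bullet> (I t \<omega> - I r \<omega>)) \<partial>M) = 0"
    by (rule ito_orthogonal[OF X_ito[OF t] square_integrable_measurable[OF cut_GX[OF t]]
        X_ito[OF r(1)] square_integrable_measurable[OF cut_GX[OF r(1)]] r Z])
  moreover have "(\<integral>\<omega>. Z \<omega> * (w \<bullet> (I t \<omega> - I r \<omega>)) \<partial>M) = (\<integral>\<omega>. Z \<omega> * (w \<bullet> I t \<omega>) \<partial>M) - (\<integral>\<omega>. Z \<omega> * (w \<bullet> I r \<omega>) \<partial>M)"
    using integrable_mult_sq[OF Z2 square_integrable_inner_left[OF I_square_integrable[OF t]], of w]
      integrable_mult_sq[OF Z2 square_integrable_inner_left[OF I_square_integrable[OF r(1)]], of w]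
    by (simp add: inner_diff_right right_diff_distrib)
  ultimately show ?thesis using e[OF t] e[OF r(1)] by simp
qed

lemma initial_orthogonal:
  assumes t: "0 \<le> t"
  shows "(\<integral>\<omega>. (u \<bullet> \<xi> \<omega>) * (v \<bullet> I t \<omega>) \<partial>M) = 0"
proof -
  have "cut_process 0 (\<lambda>s \<omega>. C *v X s \<omega>) \<in> borel_measurable path_measure"
    using square_integrable_measurable[OF cut_GX[of 0]] by simp
  from ito_orthogonal[OF X_ito[OF t] square_integrable_measurable[OF cut_GX[OF t]]
        has_ito_integral_0 this order_refl t adapted_L2_inner[OF \<xi>_adapted]]
  show ?thesis by simp
qed

lemma martingale_covariance:
  assumes t: "0 \<le> t"
  shows "(\<integral>\<omega>. (u \<bullet> (X t \<omega> - drift t \<omega>)) * (v \<bullet> (X t \<omega> - drift t \<omega>)) \<partial>M)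
    = (\<integral>\<omega>. (u \<bullet> \<xi> \<omega>) * (v \<bullet> \<xi> \<omega>) \<partial>M)
      + (\<integral>x. (u \<bullet> (C *v cut_process t X x)) * (v \<bullet> (C *v cut_process t X x)) \<partial>path_measure)"
proof -
  note \<xi>2 = adapted_L2_square_integrable[OF \<xi>_adapted]
  note I2 = I_square_integrable[OF t]
  note [measurable] = square_integrable_measurable[OF \<xi>2] square_integrable_measurable[OF I2]
    square_integrable_measurable[OF X_drift_square_integrable[OF t]]
  note ii = integrable_mult_sq[OF square_integrable_inner_left[OF \<xi>2] square_integrable_inner_left[OF \<xi>2]]
    integrable_mult_sq[OF square_integrable_inner_left[OF \<xi>2] square_integrable_inner_left[OF I2]]
    integrable_mult_sq[OF square_integrable_inner_left[OF I2] square_integrable_inner_left[OF I2]]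
  have "(\<integral>\<omega>. (u \<bullet> (X t \<omega> - drift t \<omega>)) * (v \<bullet> (X t \<omega> - drift t \<omega>)) \<partial>M)
    = (\<integral>\<omega>. (u \<bullet> \<xi> \<omega>) * (v \<bullet> \<xi> \<omega>) + (u \<bullet> \<xi> \<omega>) * (v \<bullet> I t \<omega>) + (v \<bullet> \<xi> \<omega>) * (u \<bullet> I t \<omega>) + (u \<bullet> I t \<omega>) * (v \<bullet> I t \<omega>) \<partial>M)"
    by (intro integral_cong_AE; measurable?) (use X_AE[OF t] in \<open>auto simp: inner_add_right algebra_simps\<close>)
  also have "\<dots> = (\<integral>\<omega>. (u \<bullet> \<xi> \<omega>) * (v \<bullet> \<xi> \<omega>) \<partial>M) + (\<integral>\<omega>. (u \<bullet> I t \<omega>) * (v \<bullet> I t \<omega>) \<partial>M)"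
    using ii by (simp add: initial_orthogonal[OF t])
  also have "(\<integral>\<omega>. (u \<bullet> I t \<omega>) * (v \<bullet> I t \<omega>) \<partial>M)
     = (\<integral>x. (u \<bullet> (C *v cut_process t X x)) * (v \<bullet> (C *v cut_process t X x)) \<partial>path_measure)"
    using ito_covariance[OF X_ito[OF t] square_integrable_measurable[OF cut_GX[OF t]]] by (simp add: cut_linear)
  finally show ?thesis .
qed

text \<open>The drift is written as a time integral and the expectation is moved inside. At time
  \<open>s\<close> the factor \<open>A *v X s\<close> is known, so the martingale at time
  \<open>t\<close> may be replaced by its value at \<open>s\<close>.\<close>

lemma martingale_drift:
  assumes t: "0 \<le> t"
  shows "(\<integral>\<omega>. (u \<bullet> (X t \<omega> - drift t \<omega>)) * (v \<bullet> drift t \<omega>) \<partial>M)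
    = (\<integral>x. (u \<bullet> (cut_process t X x - cut_process t drift x)) * (v \<bullet> (A *v cut_process t X x)) \<partial>path_measure)"
proof -
  interpret P: pair_sigma_finite M lborel by (rule pair_sigma_finite_path)
  let ?N = "\<lambda>\<omega>. X t \<omega> - drift t \<omega>"
  let ?a = "\<lambda>x. v \<bullet> (A *v cut_process t X x)"
  have a: "square_integrable path_measure ?a"
    using square_integrable_inner_left[OF cut_GX[OF t, of A], of v] by (simp add: cut_linear)
  have i1: "integrable path_measure (\<lambda>(\<omega>, s). (u \<bullet> cut_process t (\<lambda>s. ?N) (\<omega>, s)) * ?a (\<omega>, s))"
    using integrable_mult_sq[OF square_integrable_inner_left[OF cut_const[OF t X_drift_square_integrable[OF t]], of u] a]
    by (simp add: split_beta')
  have i2: "integrable path_measure (\<lambda>(\<omega>, s). (u \<bullet> (cut_process t X (\<omega>, s) - cut_process t drift (\<omega>, s))) * ?a (\<omega>, s))"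
    using integrable_mult_sq[OF square_integrable_inner_left[OF square_integrable_diff[OF cut_X[OF t] cut_drift[OF t]], of u] a]
    by (simp add: split_beta')
  have "(\<integral>\<omega>. (u \<bullet> ?N \<omega>) * (v \<bullet> drift t \<omega>) \<partial>M) = (\<integral>\<omega>. (\<integral>s. (u \<bullet> cut_process t (\<lambda>s. ?N) (\<omega>, s)) * ?a (\<omega>, s) \<partial>lborel) \<partial>M)"
  proof (rule Bochner_Integration.integral_cong[OF refl])
    fix \<omega> assume \<omega>: "\<omega> \<in> space M"
    have "(u \<bullet> ?N \<omega>) * (v \<bullet> drift t \<omega>) = (\<integral>s. (u \<bullet> ?N \<omega>) * (v \<bullet> cut_process t (\<lambda>s \<omega>. A *v X s \<omega>) (\<omega>, s)) \<partial>lborel)"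
      using drift_eq[OF \<omega>, of t] by simp
    also have "\<dots> = (\<integral>s. (u \<bullet> cut_process t (\<lambda>s. ?N) (\<omega>, s)) * ?a (\<omega>, s) \<partial>lborel)"
      by (rule Bochner_Integration.integral_cong) (auto simp: cut_process_def indicator_def)
    finally show "(u \<bullet> ?N \<omega>) * (v \<bullet> drift t \<omega>) = (\<integral>s. (u \<bullet> cut_process t (\<lambda>s. ?N) (\<omega>, s)) * ?a (\<omega>, s) \<partial>lborel)" .
  qed
  also have "\<dots> = (\<integral>s. (\<integral>\<omega>. (u \<bullet> cut_process t (\<lambda>s. ?N) (\<omega>, s)) * ?a (\<omega>, s) \<partial>M) \<partial>lborel)"
    using P.integral_fst[OF i1] P.integral_snd[OF i1] by simp
  also have "\<dots> = (\<integral>s. (\<integral>\<omega>. (u \<bullet> (cut_process t X (\<omega>, s) - cut_process t drift (\<omega>, s))) * ?a (\<omega>, s) \<partial>M) \<partial>lborel)"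
  proof (rule Bochner_Integration.integral_cong[OF refl])
    fix s :: real
    show "(\<integral>\<omega>. (u \<bullet> cut_process t (\<lambda>s. ?N) (\<omega>, s)) * ?a (\<omega>, s) \<partial>M)
      = (\<integral>\<omega>. (u \<bullet> (cut_process t X (\<omega>, s) - cut_process t drift (\<omega>, s))) * ?a (\<omega>, s) \<partial>M)"
    proof (cases "s \<in> {0..t}")
      case True
      have "adapted_L2 s (\<lambda>\<omega>. (transpose A *v v) \<bullet> X s \<omega>)"
        using True by (intro adapted_L2_inner X_adapted_L2) auto
      from martingale_part[OF _ _ this, of t u] True show ?thesis
        by (simp add: cut_process_def inner_matrix_vector mult.commute)
    qed (simp add: cut_process_def)
  qed
  also have "\<dots> = (\<integral>x. (u \<bullet> (cut_process t X x - cut_process t drift x)) * ?a x \<partial>path_measure)"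
    using P.integral_snd[OF i2] by (simp add: split_beta')
  finally show ?thesis .
qed

text \<open>Along each path the drift is differentiable in time, so the ordinary product rule
  applies to the two linear functionals of it.\<close>

lemma drift_covariance:
  assumes t: "0 \<le> t"
  shows "(\<integral>\<omega>. (u \<bullet> drift t \<omega>) * (v \<bullet> drift t \<omega>) \<partial>M)
    = (\<integral>x. (u \<bullet> cut_process t drift x) * (v \<bullet> (A *v cut_process t X x)) \<partial>path_measure)
      + (\<integral>x. (v \<bullet> cut_process t drift x) * (u \<bullet> (A *v cut_process t X x)) \<partial>path_measure)"
proof -
  interpret P: pair_sigma_finite M lborel by (rule pair_sigma_finite_path)
  have i: "integrable path_measure (\<lambda>x. (u \<bullet> cut_process t drift x) * (v \<bullet> (A *v cut_process t X x)))" for u v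
    using integrable_mult_sq[OF square_integrable_inner_left[OF cut_drift[OF t]] square_integrable_inner_left[OF cut_GX[OF t, of A], of v], of u]
    by (simp add: cut_linear)
  let ?f = "\<lambda>x. (u \<bullet> cut_process t drift x) * (v \<bullet> (A *v cut_process t X x)) + (v \<bullet> cut_process t drift x) * (u \<bullet> (A *v cut_process t X x))"
  have "(u \<bullet> drift t \<omega>) * (v \<bullet> drift t \<omega>) = (\<integral>s. ?f (\<omega>, s) \<partial>lborel)" if \<omega>: "\<omega> \<in> space M" for \<omega>
  proof -
    let ?g = "\<lambda>s. (u \<bullet> drift s \<omega>) * (v \<bullet> (A *v X s \<omega>)) + (u \<bullet> (A *v X s \<omega>)) * (v \<bullet> drift s \<omega>)"
    have cd: "continuous_on {0..t} (\<lambda>t. drift t \<omega>)"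
      by (rule continuous_on_subset[OF drift_cont[OF \<omega>]]) auto
    have "(\<integral>s. indicator {0..t} s *\<^sub>R ?g s \<partial>lborel) = (u \<bullet> drift t \<omega>) * (v \<bullet> drift t \<omega>) - (u \<bullet> drift 0 \<omega>) * (v \<bullet> drift 0 \<omega>)"
    proof (rule integral_FTC_Icc[OF t])
      fix s assume s: "0 \<le> s" "s \<le> t"
      have d: "((\<lambda>s. w \<bullet> drift s \<omega>) has_vector_derivative w \<bullet> (A *v X s \<omega>)) (at s within {0..t})" for w
        using drift_derivative[OF \<omega>, of s t] s
        by (intro bounded_linear.has_vector_derivative[OF bounded_linear_inner_right]) auto
      show "((\<lambda>s. (u \<bullet> drift s \<omega>) * (v \<bullet> drift s \<omega>)) has_vector_derivative ?g s) (at s within {0..t})"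
        by (rule has_vector_derivative_mult[OF d d])
    qed (intro continuous_on_add continuous_on_mult continuous_on_inner continuous_on_const cd AX_cont[OF \<omega>])
    moreover have "drift 0 \<omega> = 0" by (simp add: drift_def)
    moreover have "(\<integral>s. ?f (\<omega>, s) \<partial>lborel) = (\<integral>s. indicator {0..t} s *\<^sub>R ?g s \<partial>lborel)"
      by (rule Bochner_Integration.integral_cong) (auto simp: cut_process_def indicator_def)
    ultimately show ?thesis by simp
  qed
  then have "(\<integral>\<omega>. (u \<bullet> drift t \<omega>) * (v \<bullet> drift t \<omega>) \<partial>M) = (\<integral>\<omega>. (\<integral>s. ?f (\<omega>, s) \<partial>lborel) \<partial>M)"
    by (intro Bochner_Integration.integral_cong) auto
  also have "\<dots> = (\<integral>x. ?f x \<partial>path_measure)"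
    by (rule P.integral_fst') (intro Bochner_Integration.integrable_add i)
  finally show ?thesis using i by simp
qed

definition mom :: "real^'n \<Rightarrow> real^'n \<Rightarrow> real \<Rightarrow> real" where
  "mom u v t = (\<integral>\<omega>. (u \<bullet> X t \<omega>) * (v \<bullet> X t \<omega>) \<partial>M)"

lemma path_mom:
  assumes t: "0 \<le> t"
  shows "integrable path_measure (\<lambda>x. (u \<bullet> cut_process t X x) * (v \<bullet> cut_process t X x))"
    "integrable lborel (\<lambda>s. indicator {0..t} s *\<^sub>R mom u v s)"
    "(\<integral>x. (u \<bullet> cut_process t X x) * (v \<bullet> cut_process t X x) \<partial>path_measure)
      = (\<integral>s. indicator {0..t} s *\<^sub>R mom u v s \<partial>lborel)"
proof -
  interpret P: pair_sigma_finite M lborel by (rule pair_sigma_finite_path)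
  show i: "integrable path_measure (\<lambda>x. (u \<bullet> cut_process t X x) * (v \<bullet> cut_process t X x))"
    by (intro integrable_mult_sq square_integrable_inner_left cut_X t)
  then have i': "integrable path_measure (\<lambda>(\<omega>, s). (u \<bullet> cut_process t X (\<omega>, s)) * (v \<bullet> cut_process t X (\<omega>, s)))"
    by (simp add: split_beta')
  have e: "(\<integral>\<omega>. (u \<bullet> cut_process t X (\<omega>, s)) * (v \<bullet> cut_process t X (\<omega>, s)) \<partial>M) = indicator {0..t} s *\<^sub>R mom u v s" for s
    by (cases "s \<in> {0..t}") (auto simp: cut_process_def mom_def)
  show "integrable lborel (\<lambda>s. indicator {0..t} s *\<^sub>R mom u v s)"
    "(\<integral>x. (u \<bullet> cut_process t X x) * (v \<bullet> cut_process t X x) \<partial>path_measure)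
      = (\<integral>s. indicator {0..t} s *\<^sub>R mom u v s \<partial>lborel)"
    using P.integrable_snd[OF i'] P.integral_snd[OF i'] by (simp_all add: e split_beta')
qed

definition mom_rate :: "real^'n \<Rightarrow> real^'n \<Rightarrow> real \<Rightarrow> real" where
  "mom_rate u v s = mom u (transpose A *v v) s + mom (transpose A *v u) v s
     + mom (transpose C *v u) (transpose C *v v) s"

text \<open>The Lyapunov equation in integrated form, obtained without Ito's formula by expanding
  the state as martingale plus drift. The terms containing the drift process in the two mixed
  covariances cancel against the drift covariance, which leaves products of the state with
  \<open>A *v X\<close>.\<close>

lemma mom_equation:
  assumes t: "0 \<le> t"
  shows "mom u v t = (\<integral>\<omega>. (u \<bullet> \<xi> \<omega>) * (v \<bullet> \<xi> \<omega>) \<partial>M) + (\<integral>s. indicator {0..t} s *\<^sub>R mom_rate u v s \<partial>lborel)"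
proof -
  let ?N = "\<lambda>\<omega>. X t \<omega> - drift t \<omega>"
  let ?X = "cut_process t X" and ?V = "cut_process t drift"
  note N2 = X_drift_square_integrable[OF t] and D2 = drift_square_integrable[OF t]
  note ii = integrable_mult_sq[OF square_integrable_inner_left[OF N2] square_integrable_inner_left[OF N2]]
    integrable_mult_sq[OF square_integrable_inner_left[OF N2] square_integrable_inner_left[OF D2]]
    integrable_mult_sq[OF square_integrable_inner_left[OF D2] square_integrable_inner_left[OF D2]]
  have "mom u v t = (\<integral>\<omega>. (u \<bullet> ?N \<omega>) * (v \<bullet> ?N \<omega>) + (u \<bullet> ?N \<omega>) * (v \<bullet> drift t \<omega>)
       + (v \<bullet> ?N \<omega>) * (u \<bullet> drift t \<omega>) + (u \<bullet> drift t \<omega>) * (v \<bullet> drift t \<omega>) \<partial>M)"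
    unfolding mom_def by (rule Bochner_Integration.integral_cong) (auto simp: inner_diff_right algebra_simps)
  also have "\<dots> = (\<integral>\<omega>. (u \<bullet> ?N \<omega>) * (v \<bullet> ?N \<omega>) \<partial>M) + (\<integral>\<omega>. (u \<bullet> ?N \<omega>) * (v \<bullet> drift t \<omega>) \<partial>M)
       + (\<integral>\<omega>. (v \<bullet> ?N \<omega>) * (u \<bullet> drift t \<omega>) \<partial>M) + (\<integral>\<omega>. (u \<bullet> drift t \<omega>) * (v \<bullet> drift t \<omega>) \<partial>M)"
    using ii by simp
  also have "\<dots> = (\<integral>\<omega>. (u \<bullet> \<xi> \<omega>) * (v \<bullet> \<xi> \<omega>) \<partial>M)
      + (\<integral>x. (u \<bullet> (C *v ?X x)) * (v \<bullet> (C *v ?X x)) \<partial>path_measure)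
      + (\<integral>x. (u \<bullet> (?X x - ?V x)) * (v \<bullet> (A *v ?X x)) \<partial>path_measure)
      + (\<integral>x. (v \<bullet> (?X x - ?V x)) * (u \<bullet> (A *v ?X x)) \<partial>path_measure)
      + (\<integral>x. (u \<bullet> ?V x) * (v \<bullet> (A *v ?X x)) \<partial>path_measure)
      + (\<integral>x. (v \<bullet> ?V x) * (u \<bullet> (A *v ?X x)) \<partial>path_measure)"
    unfolding martingale_covariance[OF t] martingale_drift[OF t] drift_covariance[OF t] by simp
  also have "\<dots> = (\<integral>\<omega>. (u \<bullet> \<xi> \<omega>) * (v \<bullet> \<xi> \<omega>) \<partial>M)
      + (\<integral>x. (u \<bullet> (C *v ?X x)) * (v \<bullet> (C *v ?X x)) \<partial>path_measure)
      + (\<integral>x. (u \<bullet> ?X x) * (v \<bullet> (A *v ?X x)) \<partial>path_measure)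
      + (\<integral>x. (v \<bullet> ?X x) * (u \<bullet> (A *v ?X x)) \<partial>path_measure)"
  proof -
    have "(\<integral>x. (u \<bullet> (?X x - ?V x)) * (v \<bullet> (A *v ?X x)) \<partial>path_measure)
      = (\<integral>x. (u \<bullet> ?X x) * (v \<bullet> (A *v ?X x)) \<partial>path_measure) - (\<integral>x. (u \<bullet> ?V x) * (v \<bullet> (A *v ?X x)) \<partial>path_measure)" for u v
      using integrable_mult_sq[OF square_integrable_inner_left[OF cut_X[OF t]] square_integrable_inner_left[OF cut_GX[OF t, of A]], of u v]
        integrable_mult_sq[OF square_integrable_inner_left[OF cut_drift[OF t]] square_integrable_inner_left[OF cut_GX[OF t, of A]], of u v]
      by (simp add: inner_diff_right left_diff_distrib cut_linear)
    then show ?thesis by simp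
  qed
  also have "\<dots> = (\<integral>\<omega>. (u \<bullet> \<xi> \<omega>) * (v \<bullet> \<xi> \<omega>) \<partial>M)
      + ((\<integral>x. (u \<bullet> ?X x) * ((transpose A *v v) \<bullet> ?X x) \<partial>path_measure)
      + (\<integral>x. ((transpose A *v u) \<bullet> ?X x) * (v \<bullet> ?X x) \<partial>path_measure)
      + (\<integral>x. ((transpose C *v u) \<bullet> ?X x) * ((transpose C *v v) \<bullet> ?X x) \<partial>path_measure))"
    by (simp add: inner_matrix_vector mult.commute)
  also have "\<dots> = (\<integral>\<omega>. (u \<bullet> \<xi> \<omega>) * (v \<bullet> \<xi> \<omega>) \<partial>M) + (\<integral>s. indicator {0..t} s *\<^sub>R mom_rate u v s \<partial>lborel)"
    unfolding path_mom(3)[OF t] mom_rate_def scaleR_add_right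
    using path_mom(2)[OF t] by simp
  finally show ?thesis .
qed

end

section \<open>The differential equation of the second moments\<close>

context regular_sde_solution
begin

lemma mom_cong_integral:
  assumes t: "0 \<le> t"
  shows "mom_rate u v integrable_on {0..t}"
    "mom u v t = (\<integral>\<omega>. (u \<bullet> \<xi> \<omega>) * (v \<bullet> \<xi> \<omega>) \<partial>M) + integral {0..t} (mom_rate u v)"
proof -
  have i: "set_integrable lborel {0..t} (mom_rate u v)"
    unfolding set_integrable_def mom_rate_def scaleR_add_right
    by (intro Bochner_Integration.integrable_add path_mom(2) t)
  show "mom_rate u v integrable_on {0..t}"
    "mom u v t = (\<integral>\<omega>. (u \<bullet> \<xi> \<omega>) * (v \<bullet> \<xi> \<omega>) \<partial>M) + integral {0..t} (mom_rate u v)"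
    using set_borel_integral_eq_integral[OF i] mom_equation[OF t, of u v]
    by (auto simp: set_lebesgue_integral_def)
qed

lemma mom_continuous: "continuous_on {0..} (mom u v)"
proof (rule continuous_on_atLeastI)
  fix t :: real
  show "continuous_on {0..t} (mom u v)"
  proof (cases "0 \<le> t")
    case True
    have "continuous_on {0..t} (\<lambda>s. (\<integral>\<omega>. (u \<bullet> \<xi> \<omega>) * (v \<bullet> \<xi> \<omega>) \<partial>M) + integral {0..s} (mom_rate u v))"
      by (intro continuous_intros indefinite_integral_continuous_1 mom_cong_integral True)
    then show ?thesis
      by (rule continuous_on_eq) (use mom_cong_integral(2) in auto)
  qed simp
qed

lemma mom_rate_continuous: "continuous_on {0..} (mom_rate u v)"
  unfolding mom_rate_def by (intro continuous_on_add mom_continuous)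

text \<open>A bootstrap: the integral equation makes the moments continuous, hence their rate, which
  is a combination of moments, is continuous, hence the integral is differentiable with that rate.
  At time 0 the derivative is one-sided.\<close>

lemma mom_derivative:
  assumes t: "0 \<le> t"
  shows "(mom u v has_vector_derivative mom_rate u v t) (at t within {0..})"
proof -
  have c: "continuous_on {0..t + 1} (mom_rate u v)"
    by (rule continuous_on_subset[OF mom_rate_continuous]) auto
  have "((\<lambda>s. integral {0..s} (mom_rate u v)) has_vector_derivative mom_rate u v t) (at t within {0..t + 1})"
    by (rule integral_has_vector_derivative[OF c]) (use t in auto)
  then have "((\<lambda>s. (\<integral>\<omega>. (u \<bullet> \<xi> \<omega>) * (v \<bullet> \<xi> \<omega>) \<partial>M) + integral {0..s} (mom_rate u v)) has_vector_derivative 0 + mom_rate u v t) (at t within {0..t + 1})"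
    by (intro has_vector_derivative_add has_vector_derivative_const)
  then have "(mom u v has_vector_derivative mom_rate u v t) (at t within {0..t + 1})"
    unfolding add_0 by (rule has_vector_derivative_transform[rotated 2]) (use t mom_cong_integral(2) in auto)
  then show ?thesis by (simp add: at_within_atLeast[OF t])
qed

lemma inner_matrix_vector_sum:
  fixes S :: "real^'k^'k"
  shows "u \<bullet> (S *v v) = (\<Sum>i\<in>UNIV. \<Sum>j\<in>UNIV. u $ i * v $ j * S $ i $ j)"
  by (simp add: inner_vec_def matrix_vector_mult_def sum_distrib_left mult_ac)

lemma mom_eq_second_moment:
  assumes t: "0 \<le> t"
  shows "mom u v t = u \<bullet> (second_moment M (X t) *v v)"
proof -
  have i: "integrable M (\<lambda>\<omega>. X t \<omega> $ i * X t \<omega> $ j)" for i j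
    using integrable_mult_sq[OF square_integrable_inner_left[OF X_square_integrable[OF t], of "axis i 1"]
       square_integrable_inner_left[OF X_square_integrable[OF t], of "axis j 1"]]
    by (simp add: inner_axis')
  have "mom u v t = (\<integral>\<omega>. (\<Sum>i\<in>UNIV. \<Sum>j\<in>UNIV. u $ i * v $ j * (X t \<omega> $ i * X t \<omega> $ j)) \<partial>M)"
    unfolding mom_def by (rule Bochner_Integration.integral_cong)
      (auto simp: inner_vec_def sum_product mult_ac)
  also have "\<dots> = (\<Sum>i\<in>UNIV. \<Sum>j\<in>UNIV. u $ i * v $ j * (\<integral>\<omega>. X t \<omega> $ i * X t \<omega> $ j \<partial>M))"
    using i by (simp add: Bochner_Integration.integral_sum)
  finally show ?thesis by (simp add: inner_matrix_vector_sum second_moment_def)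
qed

lemma second_moment_derivative:
  assumes t: "0 \<le> t"
  defines "S \<equiv> second_moment M (X t)"
  shows "((\<lambda>t. second_moment M (X t) $ i $ j) has_vector_derivative
      (A ** S + S ** transpose A + C ** S ** transpose C) $ i $ j) (at t within {0..})"
proof -
  let ?u = "axis i 1 :: real^'n" and ?v = "axis j 1 :: real^'n"
  have e: "G $ i $ j = ?u \<bullet> (G *v ?v)" for G :: "real^'n^'n"
    by (simp add: inner_axis' matrix_vector_mul_component inner_axis row_def)
  have r: "mom_rate ?u ?v t = ?u \<bullet> ((A ** S + S ** transpose A + C ** S ** transpose C) *v ?v)"
    unfolding mom_rate_def mom_eq_second_moment[OF t]
    by (simp add: S_def matrix_vector_mult_add_rdistrib inner_add_right
      inner_matrix_vector[of ?u A] inner_matrix_vector[of ?u C] matrix_vector_mul_assoc[symmetric])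
  have "(mom ?u ?v has_vector_derivative (A ** S + S ** transpose A + C ** S ** transpose C) $ i $ j) (at t within {0..})"
    using mom_derivative[OF t, of ?u ?v] unfolding r e .
  then show ?thesis
    by (rule has_vector_derivative_transform[rotated 2])
      (use t mom_eq_second_moment in \<open>auto simp: e[of "second_moment M (X _)"]\<close>)
qed

lemma second_moment_0: "second_moment M (X 0) = second_moment M \<xi>"
proof -
  have "mom (axis i 1) (axis j 1) 0 = (\<integral>\<omega>. (axis i 1 \<bullet> \<xi> \<omega>) * (axis j 1 \<bullet> \<xi> \<omega>) \<partial>M)" for i j
    using mom_cong_integral(2)[of 0] by simp
  then show ?thesis
    by (simp add: mom_def second_moment_def inner_axis' vec_eq_iff)
qed

lemma X_joint_measurable:
  "(\<lambda>(\<omega>, s). indicator {0..} s *\<^sub>R X s \<omega>) \<in> borel_measurable path_measure"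
proof (rule borel_measurable_LIMSEQ_metric)
  show "cut_process (real n) X \<in> borel_measurable path_measure" for n
    by (rule square_integrable_measurable[OF cut_X]) simp
  fix x :: "'a \<times> real"
  obtain \<omega> s where x: "x = (\<omega>, s)" by force
  have "\<forall>\<^sub>F n in sequentially. cut_process (real n) X x = indicator {0..} s *\<^sub>R X s \<omega>"
    using eventually_ge_at_top[of "nat \<lceil>s\<rceil>"]
    by eventually_elim (auto simp: x cut_process_def indicator_def nat_le_iff ceiling_le_iff)
  then show "(\<lambda>n. cut_process (real n) X x) \<longlonglongrightarrow> (case x of (\<omega>, s) \<Rightarrow> indicator {0..} s *\<^sub>R X s \<omega>)"
    unfolding x by (simp add: tendsto_eventually)
qed

lemma expectation_quadratic:
  assumes t: "0 \<le> t"
  shows "integrable M (\<lambda>\<omega>. X t \<omega> \<bullet> (G *v X t \<omega>))"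
    "(\<integral>\<omega>. X t \<omega> \<bullet> (G *v X t \<omega>) \<partial>M) = G \<bullet> second_moment M (X t)"
proof -
  have i: "integrable M (\<lambda>\<omega>. X t \<omega> $ i * X t \<omega> $ j)" for i j
    using integrable_mult_sq[OF square_integrable_inner_left[OF X_square_integrable[OF t], of "axis i 1"]
       square_integrable_inner_left[OF X_square_integrable[OF t], of "axis j 1"]]
    by (simp add: inner_axis')
  show "integrable M (\<lambda>\<omega>. X t \<omega> \<bullet> (G *v X t \<omega>))"
    using i by (simp add: inner_matrix_vector_sum)
  show "(\<integral>\<omega>. X t \<omega> \<bullet> (G *v X t \<omega>) \<partial>M) = G \<bullet> second_moment M (X t)"
    using i by (simp add: inner_matrix_vector_sum Bochner_Integration.integral_sum)
      (simp add: inner_vec_def second_moment_def mult_ac)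
qed

lemma nn_expectation_quadratic:
  assumes t: "0 \<le> t" and G: "\<And>v. 0 \<le> v \<bullet> (G *v v)"
  shows "(\<integral>\<^sup>+\<omega>. ennreal (X t \<omega> \<bullet> (G *v X t \<omega>)) \<partial>M) = ennreal (G \<bullet> second_moment M (X t))"
  using expectation_quadratic[OF t, of G] G by (simp add: nn_integral_eq_integral)

text \<open>Tonelli's theorem asks for one jointly measurable integrand, so the state is extended by
  zero to negative times.\<close>

lemma nn_expectation_cost:
  assumes G: "\<And>v. 0 \<le> v \<bullet> (G *v v)"
  shows "(\<integral>\<^sup>+\<omega>. (\<integral>\<^sup>+t\<in>{0..}. ennreal (X t \<omega> \<bullet> (G *v X t \<omega>)) \<partial>lborel) \<partial>M)
    = (\<integral>\<^sup>+t\<in>{0..}. ennreal (G \<bullet> second_moment M (X t)) \<partial>lborel)"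
proof -
  interpret P: pair_sigma_finite M lborel by (rule pair_sigma_finite_path)
  let ?X = "\<lambda>x. (case x of (\<omega>, s) \<Rightarrow> indicator {0..} s *\<^sub>R X s \<omega>)"
  have m: "?X \<in> borel_measurable path_measure"
    using X_joint_measurable by (simp add: split_beta')
  have "(*v) G \<in> borel_measurable borel"
    by (intro borel_measurable_continuous_onI linear_continuous_on matrix_vector_mul_bounded_linear)
  then have "(\<lambda>x. G *v ?X x) \<in> borel_measurable path_measure"
    using m by (rule measurable_compose[rotated])
  with m have meas: "(\<lambda>x. ennreal (?X x \<bullet> (G *v ?X x))) \<in> borel_measurable path_measure"
    by measurable
  have eq: "ennreal (X s \<omega> \<bullet> (G *v X s \<omega>)) * indicator {0..} s = ennreal (?X (\<omega>, s) \<bullet> (G *v ?X (\<omega>, s)))" for \<omega> s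
    by (auto simp: indicator_def)
  have "(\<integral>\<^sup>+\<omega>. (\<integral>\<^sup>+t\<in>{0..}. ennreal (X t \<omega> \<bullet> (G *v X t \<omega>)) \<partial>lborel) \<partial>M)
     = (\<integral>\<^sup>+s. (\<integral>\<^sup>+\<omega>. ennreal (?X (\<omega>, s) \<bullet> (G *v ?X (\<omega>, s))) \<partial>M) \<partial>lborel)"
    unfolding eq using P.Fubini[of "\<lambda>x. ennreal (?X x \<bullet> (G *v ?X x))"] meas by simp
  also have "\<dots> = (\<integral>\<^sup>+s\<in>{0..}. ennreal (G \<bullet> second_moment M (X s)) \<partial>lborel)"
  proof (rule nn_integral_cong)
    fix s :: real
    show "(\<integral>\<^sup>+\<omega>. ennreal (?X (\<omega>, s) \<bullet> (G *v ?X (\<omega>, s))) \<partial>M) = ennreal (G \<bullet> second_moment M (X s)) * indicator {0..} s"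
      using nn_expectation_quadratic[OF _ G, of s] by (cases "0 \<le> s") auto
  qed
  finally show ?thesis .
qed

lemma second_moment_psd:
  assumes t: "0 \<le> t"
  shows "transpose (second_moment M (X t)) = second_moment M (X t)"
    "0 \<le> v \<bullet> (second_moment M (X t) *v v)"
proof -
  show "transpose (second_moment M (X t)) = second_moment M (X t)"
    by (simp add: second_moment_def transpose_def vec_eq_iff mult.commute)
  have "0 \<le> mom v v t" by (simp add: mom_def)
  then show "0 \<le> v \<bullet> (second_moment M (X t) *v v)" by (simp add: mom_eq_second_moment[OF t])
qed

end

section \<open>From arbitrary closed-loop solutions to second moments\<close>

context brownian_basis
begin

text \<open>The paths are set to 0 on a null set outside which they are continuous. Since
  \<open>F 0\<close> contains all null sets of \<open>M\<close>, this keeps the process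
  adapted.\<close>

lemma regular_version:
  assumes init: "initial_state M F \<xi>" and sol: "closed_loop_solution M F W A B C D K \<xi> X"
  obtains X' I where "regular_sde_solution M F W (A + B ** K) (C + D ** K) \<xi> X' I"
    "AE \<omega> in M. \<forall>t. X t \<omega> = X' t \<omega>"
proof -
  have ad: "\<And>t. 0 \<le> t \<Longrightarrow> X t \<in> borel_measurable (F t)"
    using sol unfolding closed_loop_solution_def by (elim conjE) simp
  have cont: "AE \<omega> in M. continuous_on {0..} (\<lambda>t. X t \<omega>)"
    using sol unfolding closed_loop_solution_def by (elim conjE)
  have L2: "\<And>T. 0 \<le> T \<Longrightarrow> (\<integral>\<^sup>+\<omega>. (\<integral>\<^sup>+s\<in>{0..T}. ennreal ((norm (X s \<omega>))\<^sup>2) \<partial>lborel) \<partial>M) < \<infinity>"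
    using sol unfolding closed_loop_solution_def by (elim conjE) simp
  have ex: "\<forall>t\<in>{0..}. \<exists>I. has_ito_integral M F W t (\<lambda>s \<omega>. (C + D ** K) *v X s \<omega>) I \<and>
        (AE \<omega> in M. X t \<omega> = \<xi> \<omega> + integral {0..t} (\<lambda>s. (A + B ** K) *v X s \<omega>) + I \<omega>)"
    using sol unfolding closed_loop_solution_def by (elim conjE) simp
  obtain N where N: "N \<in> null_sets M" "\<And>\<omega>. \<omega> \<in> space M - N \<Longrightarrow> continuous_on {0..} (\<lambda>t. X t \<omega>)"
    using AE_E3[OF cont] by blast
  obtain I where I: "\<And>t. 0 \<le> t \<Longrightarrow> has_ito_integral M F W t (\<lambda>s \<omega>. (C + D ** K) *v X s \<omega>) (I t)"
    "\<And>t. 0 \<le> t \<Longrightarrow> AE \<omega> in M. X t \<omega> = \<xi> \<omega> + integral {0..t} (\<lambda>s. (A + B ** K) *v X s \<omega>) + I t \<omega>"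
    using bchoice[OF ex] by auto
  define X' where "X' t \<omega> = (if \<omega> \<in> N then 0 else X t \<omega>)" for t \<omega>
  have ae: "AE \<omega> in M. \<forall>t. X t \<omega> = X' t \<omega>"
    by (rule AE_I'[OF N(1)]) (auto simp: X'_def)
  have "regular_sde_solution M F W (A + B ** K) (C + D ** K) \<xi> X' I"
  proof
    show "initial_state M F \<xi>" by fact
    show "X' t \<in> borel_measurable (F t)" if t: "0 \<le> t" for t
    proof -
      have "N \<in> sets (F t)" using N(1) null_sets_F sets_F_mono[OF t] by blast
      then have "N \<inter> space (F t) \<in> sets (F t)" by auto
      then show ?thesis unfolding X'_def
        by (intro measurable_If_set ad t) auto
    qed
    show "continuous_on {0..} (\<lambda>t. X' t \<omega>)" if "\<omega> \<in> space M" for \<omega>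
      using N(2) that by (cases "\<omega> \<in> N") (auto simp: X'_def)
    show "(\<integral>\<^sup>+\<omega>. (\<integral>\<^sup>+s\<in>{0..T}. ennreal ((norm (X' s \<omega>))\<^sup>2) \<partial>lborel) \<partial>M) < \<infinity>" if "0 \<le> T" for T
    proof -
      have "(\<integral>\<^sup>+\<omega>. (\<integral>\<^sup>+s\<in>{0..T}. ennreal ((norm (X' s \<omega>))\<^sup>2) \<partial>lborel) \<partial>M)
        = (\<integral>\<^sup>+\<omega>. (\<integral>\<^sup>+s\<in>{0..T}. ennreal ((norm (X s \<omega>))\<^sup>2) \<partial>lborel) \<partial>M)"
        by (rule nn_integral_cong_AE) (use ae in \<open>eventually_elim, simp\<close>)
      then show ?thesis using L2[OF that] by simp
    qed
    show "has_ito_integral M F W t (\<lambda>s \<omega>. (C + D ** K) *v X' s \<omega>) (I t)" if "0 \<le> t" for t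
    proof -
      have e: "(\<integral>\<^sup>+\<omega>. (\<integral>\<^sup>+s\<in>{0..t}. ennreal ((norm (H s \<omega> - (C + D ** K) *v X' s \<omega>))\<^sup>2) \<partial>lborel) \<partial>M)
        = (\<integral>\<^sup>+\<omega>. (\<integral>\<^sup>+s\<in>{0..t}. ennreal ((norm (H s \<omega> - (C + D ** K) *v X s \<omega>))\<^sup>2) \<partial>lborel) \<partial>M)" for H
        by (rule nn_integral_cong_AE) (use ae in \<open>eventually_elim, simp\<close>)
      show ?thesis using I(1)[OF that] unfolding has_ito_integral_def e .
    qed
    show "AE \<omega> in M. X' t \<omega> = \<xi> \<omega> + integral {0..t} (\<lambda>s. (A + B ** K) *v X' s \<omega>) + I t \<omega>" if "0 \<le> t" for t
      using I(2)[OF that] ae by eventually_elim simp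
  qed
  then show ?thesis using ae by (rule that)
qed

text \<open>The interface between the stochastic and the deterministic half: the stability condition
  and the cost are expressed through a matrix curve solving a linear equation, and the process
  itself disappears.\<close>

lemma closed_loop_second_moment:
  fixes A C :: "real^'n^'n" and B D :: "real^'m^'n" and K :: "real^'n^'m"
  assumes init: "initial_state M F \<xi>" and sol: "closed_loop_solution M F W A B C D K \<xi> X"
  obtains S :: "real \<Rightarrow> real^'n^'n" where
    "S 0 = second_moment M \<xi>"
    "\<And>t. 0 \<le> t \<Longrightarrow> transpose (S t) = S t"
    "\<And>t v. 0 \<le> t \<Longrightarrow> 0 \<le> v \<bullet> (S t *v v)"
    "\<And>t i j. 0 \<le> t \<Longrightarrow> ((\<lambda>t. S t $ i $ j) has_vector_derivative
      ((A + B ** K) ** S t + S t ** transpose (A + B ** K)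
        + (C + D ** K) ** S t ** transpose (C + D ** K)) $ i $ j) (at t within {0..})"
    "\<And>t. 0 \<le> t \<Longrightarrow> (\<integral>\<^sup>+\<omega>. ennreal (X t \<omega> \<bullet> X t \<omega>) \<partial>M) = ennreal (mat 1 \<bullet> S t)"
    "\<And>G. (\<And>v. 0 \<le> v \<bullet> (G *v v)) \<Longrightarrow>
      (\<integral>\<^sup>+\<omega>. (\<integral>\<^sup>+t\<in>{0..}. ennreal (X t \<omega> \<bullet> (G *v X t \<omega>)) \<partial>lborel) \<partial>M)
       = (\<integral>\<^sup>+t\<in>{0..}. ennreal (G \<bullet> S t) \<partial>lborel)"
proof -
  obtain X' I where r: "regular_sde_solution M F W (A + B ** K) (C + D ** K) \<xi> X' I"
    and ae: "AE \<omega> in M. \<forall>t. X t \<omega> = X' t \<omega>"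
    using regular_version[OF init sol] .
  interpret r: regular_sde_solution M F W "A + B ** K" "C + D ** K" \<xi> X' I by (rule r)
  show ?thesis
  proof (rule that[of "\<lambda>t. second_moment M (X' t)"])
    show "second_moment M (X' 0) = second_moment M \<xi>" by (rule r.second_moment_0)
    fix t :: real assume t: "0 \<le> t"
    show "transpose (second_moment M (X' t)) = second_moment M (X' t)"
      "0 \<le> v \<bullet> (second_moment M (X' t) *v v)" for v
      by (rule r.second_moment_psd[OF t])+
    show "((\<lambda>t. second_moment M (X' t) $ i $ j) has_vector_derivative
      ((A + B ** K) ** second_moment M (X' t) + second_moment M (X' t) ** transpose (A + B ** K)
        + (C + D ** K) ** second_moment M (X' t) ** transpose (C + D ** K)) $ i $ j) (at t within {0..})" for i j
      by (rule r.second_moment_derivative[OF t])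
    have "(\<integral>\<^sup>+\<omega>. ennreal (X t \<omega> \<bullet> X t \<omega>) \<partial>M) = (\<integral>\<^sup>+\<omega>. ennreal (X' t \<omega> \<bullet> (mat 1 *v X' t \<omega>)) \<partial>M)"
      by (rule nn_integral_cong_AE) (use ae in \<open>eventually_elim, simp\<close>)
    also have "\<dots> = ennreal (mat 1 \<bullet> second_moment M (X' t))"
      by (rule r.nn_expectation_quadratic[OF t]) simp
    finally show "(\<integral>\<^sup>+\<omega>. ennreal (X t \<omega> \<bullet> X t \<omega>) \<partial>M) = ennreal (mat 1 \<bullet> second_moment M (X' t))" .
  next
    fix G :: "real^'n^'n" assume G: "\<And>v. 0 \<le> v \<bullet> (G *v v)"
    have "(\<integral>\<^sup>+\<omega>. (\<integral>\<^sup>+t\<in>{0..}. ennreal (X t \<omega> \<bullet> (G *v X t \<omega>)) \<partial>lborel) \<partial>M)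
       = (\<integral>\<^sup>+\<omega>. (\<integral>\<^sup>+t\<in>{0..}. ennreal (X' t \<omega> \<bullet> (G *v X' t \<omega>)) \<partial>lborel) \<partial>M)"
      by (rule nn_integral_cong_AE) (use ae in \<open>eventually_elim, simp\<close>)
    then show "(\<integral>\<^sup>+\<omega>. (\<integral>\<^sup>+t\<in>{0..}. ennreal (X t \<omega> \<bullet> (G *v X t \<omega>)) \<partial>lborel) \<partial>M)
       = (\<integral>\<^sup>+t\<in>{0..}. ennreal (G \<bullet> second_moment M (X' t)) \<partial>lborel)"
      using r.nn_expectation_cost[OF G] by simp
  qed
qed

end

section \<open>Existence of solutions: the Euler scheme\<close>

lemma norm_add_scaleR_sq:
  fixes z h :: "'v::real_inner"
  shows "(norm (z + c *\<^sub>R h))\<^sup>2 = (norm z)\<^sup>2 + 2 * c * (z \<bullet> h) + c\<^sup>2 * (norm h)\<^sup>2"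
  unfolding power2_norm_eq_inner
  by (simp add: inner_add_left inner_add_right inner_commute algebra_simps) (simp add: power2_eq_square)

context brownian_basis
begin

abbreviation msq :: "('a \<Rightarrow> 'v::real_normed_vector) \<Rightarrow> real" where
  "msq f \<equiv> (\<integral>\<omega>. (norm (f \<omega>))\<^sup>2 \<partial>M)"

text \<open>Pythagoras: the increment is centred and independent of everything known at
  \<open>s\<close>, so the mixed term has mean zero and the squared increment contributes its
  length.\<close>

lemma msq_increment:
  fixes Z H :: "'a \<Rightarrow> 'v::euclidean_space"
  assumes s: "0 \<le> s" "s \<le> t" and Z: "adapted_L2 s Z" and H: "adapted_L2 s H"
  shows "msq (\<lambda>\<omega>. Z \<omega> + (W t \<omega> - W s \<omega>) *\<^sub>R H \<omega>) = msq Z + (t - s) * msq H"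
proof -
  have m: "(\<lambda>\<omega>. Z \<omega> \<bullet> H \<omega>) \<in> borel_measurable (F s)" "(\<lambda>\<omega>. (norm (H \<omega>))\<^sup>2) \<in> borel_measurable (F s)"
    using Z H by (auto simp: adapted_L2_def)
  have i: "integrable M (\<lambda>\<omega>. (norm (Z \<omega>))\<^sup>2)" "integrable M (\<lambda>\<omega>. Z \<omega> \<bullet> H \<omega>)" "integrable M (\<lambda>\<omega>. (norm (H \<omega>))\<^sup>2)"
    using Z H by (auto simp: adapted_L2_def square_integrable_def intro!: integrable_inner)
  note a = increment_mult[OF s m(1) i(2)] and b = increment_mult[OF s m(2) i(3)]
  have "msq (\<lambda>\<omega>. Z \<omega> + (W t \<omega> - W s \<omega>) *\<^sub>R H \<omega>)
    = (\<integral>\<omega>. (norm (Z \<omega>))\<^sup>2 + 2 * ((Z \<omega> \<bullet> H \<omega>) * (W t \<omega> - W s \<omega>)) + (norm (H \<omega>))\<^sup>2 * (W t \<omega> - W s \<omega>)\<^sup>2 \<partial>M)"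
    by (rule Bochner_Integration.integral_cong) (auto simp: norm_add_scaleR_sq)
  also have "\<dots> = msq Z + (t - s) * msq H"
    using a b i by simp
  finally show ?thesis .
qed

lemma msq_nonneg: "0 \<le> msq f" by simp

lemma msq_add_le:
  assumes "square_integrable M f" "square_integrable M g"
  shows "msq (\<lambda>\<omega>. f \<omega> + g \<omega>) \<le> 2 * msq f + 2 * msq g"
proof -
  have "msq (\<lambda>\<omega>. f \<omega> + g \<omega>) \<le> (\<integral>\<omega>. 2 * (norm (f \<omega>))\<^sup>2 + 2 * (norm (g \<omega>))\<^sup>2 \<partial>M)"
    using square_integrable_integrable[OF square_integrable_add[OF assms]] assms
    by (intro integral_mono norm_add_sq_le) (auto simp: square_integrable_def)
  then show ?thesis using assms by (simp add: square_integrable_def)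
qed

lemma adapted_L2_add: "adapted_L2 s f \<Longrightarrow> adapted_L2 s g \<Longrightarrow> adapted_L2 s (\<lambda>\<omega>. f \<omega> + g \<omega>)"
  by (auto simp: adapted_L2_def intro: square_integrable_add)

lemma adapted_L2_diff: "adapted_L2 s f \<Longrightarrow> adapted_L2 s g \<Longrightarrow> adapted_L2 s (\<lambda>\<omega>. f \<omega> - g \<omega>)"
  by (auto simp: adapted_L2_def intro: square_integrable_diff)

lemma adapted_L2_scaleR: "adapted_L2 s f \<Longrightarrow> adapted_L2 s (\<lambda>\<omega>. c *\<^sub>R f \<omega>)"
  by (auto simp: adapted_L2_def intro: square_integrable_scaleR)

lemma adapted_L2_zero: "adapted_L2 s (\<lambda>_. 0)"
  by (simp add: adapted_L2_def)

lemma adapted_L2_matrix: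
  fixes G :: "real^'n^'k"
  assumes "adapted_L2 s f" shows "adapted_L2 s (\<lambda>\<omega>. G *v f \<omega>)"
proof -
  have "(*v) G \<in> borel_measurable borel"
    by (intro borel_measurable_continuous_onI linear_continuous_on matrix_vector_mul_bounded_linear)
  then show ?thesis using assms
    by (auto simp: adapted_L2_def intro!: square_integrable_linear[OF matrix_vector_mul_bounded_linear]
        intro: measurable_compose)
qed

lemma msq_matrix_le:
  fixes G :: "real^'n^'k"
  assumes "square_integrable M f"
  shows "msq (\<lambda>\<omega>. G *v f \<omega>) \<le> (onorm ((*v) G))\<^sup>2 * msq f"
proof -
  have "msq (\<lambda>\<omega>. G *v f \<omega>) \<le> (\<integral>\<omega>. (onorm ((*v) G))\<^sup>2 * (norm (f \<omega>))\<^sup>2 \<partial>M)"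
  proof (rule integral_mono)
    show "integrable M (\<lambda>\<omega>. (norm (G *v f \<omega>))\<^sup>2)"
      by (intro square_integrable_integrable square_integrable_linear[OF matrix_vector_mul_bounded_linear] assms)
    show "integrable M (\<lambda>\<omega>. (onorm ((*v) G))\<^sup>2 * (norm (f \<omega>))\<^sup>2)"
      using square_integrable_integrable[OF assms] by simp
    show "(norm (G *v f \<omega>))\<^sup>2 \<le> (onorm ((*v) G))\<^sup>2 * (norm (f \<omega>))\<^sup>2" for \<omega>
      using power_mono[OF onorm[OF matrix_vector_mul_bounded_linear, of G "f \<omega>"], of 2]
      by (simp add: power_mult_distrib)
  qed
  then show ?thesis by simp
qed

end

section \<open>Dyadic time grids and a discrete Gronwall inequality\<close>

definition dyad :: "nat \<Rightarrow> nat \<Rightarrow> real" where "dyad n j = real j / 2 ^ n"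
definition dyad_index :: "nat \<Rightarrow> real \<Rightarrow> nat" where "dyad_index n t = nat \<lfloor>t * 2 ^ n\<rfloor>"

lemma dyad_0 [simp]: "dyad n 0 = 0" and dyad_nonneg [simp]: "0 \<le> dyad n j"
  and dyad_Suc: "dyad n (Suc j) = dyad n j + 1 / 2 ^ n"
  by (auto simp: dyad_def add_divide_distrib)

lemma index_dyad [simp]: "dyad_index n (dyad n j) = j"
  by (simp add: dyad_index_def dyad_def)

lemma dyad_index_le: "0 \<le> t \<Longrightarrow> dyad n (dyad_index n t) \<le> t"
  by (simp add: dyad_index_def dyad_def field_simps)

lemma less_dyad_index: "0 \<le> t \<Longrightarrow> t < dyad n (Suc (dyad_index n t))"
proof -
  assume "0 \<le> t"
  then have "real (Suc (dyad_index n t)) = of_int \<lfloor>t * 2 ^ n\<rfloor> + 1" by (simp add: dyad_index_def)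
  then have "t * 2 ^ n < real (Suc (dyad_index n t))" by linarith
  then show ?thesis by (simp add: dyad_def field_simps del: of_nat_Suc)
qed

lemma index_eqI: "dyad n j \<le> t \<Longrightarrow> t < dyad n (Suc j) \<Longrightarrow> dyad_index n t = j"
proof -
  assume a: "dyad n j \<le> t" "t < dyad n (Suc j)"
  then have "real j \<le> t * 2 ^ n" "t * 2 ^ n < real j + 1"
    by (auto simp: dyad_def field_simps)
  then have "\<lfloor>t * 2 ^ n\<rfloor> = int j" by (intro floor_unique) auto
  then show ?thesis by (simp add: dyad_index_def)
qed

text \<open>Dyadic grids are nested, so the fine cell around \<open>s\<close> lies in the coarse
  one. On a fine cell both Euler schemes therefore have frozen coefficients and can be advanced
  together.\<close>

lemma cell_coarser:
  assumes s: "0 \<le> s" and nm: "n \<le> m" and t: "t \<le> dyad m (Suc (dyad_index m s))"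
  shows "t \<le> dyad n (Suc (dyad_index n s))"
proof -
  have p: "(2::real) ^ m = 2 ^ n * 2 ^ (m - n)" using nm by (simp flip: power_add)
  have "s < dyad n (Suc (dyad_index n s))" by (rule less_dyad_index[OF s])
  then have "s * 2 ^ n < real (Suc (dyad_index n s))"
    by (simp add: dyad_def field_simps del: of_nat_Suc)
  then have "s * 2 ^ n * 2 ^ (m - n) < real (Suc (dyad_index n s)) * 2 ^ (m - n)"
    by (intro mult_strict_right_mono) auto
  then have "s * 2 ^ m < real (Suc (dyad_index n s) * 2 ^ (m - n))"
    by (simp only: p of_nat_mult of_nat_power mult.assoc of_nat_numeral)
  then have "\<lfloor>s * 2 ^ m\<rfloor> < int (Suc (dyad_index n s) * 2 ^ (m - n))"
    by (simp add: floor_less_iff del: of_nat_Suc)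
  moreover have "0 \<le> \<lfloor>s * 2 ^ m\<rfloor>" using s by simp
  ultimately have "Suc (dyad_index m s) \<le> Suc (dyad_index n s) * 2 ^ (m - n)"
    unfolding dyad_index_def[of m] Suc_le_eq by (simp only: nat_less_iff)
  then have "real (Suc (dyad_index m s)) \<le> real (Suc (dyad_index n s) * 2 ^ (m - n))"
    by (rule of_nat_mono)
  then have "real (Suc (dyad_index m s)) \<le> real (Suc (dyad_index n s)) * 2 ^ (m - n)"
    by (simp only: of_nat_mult of_nat_power of_nat_numeral)
  then have "real (Suc (dyad_index m s)) / 2 ^ m \<le> real (Suc (dyad_index n s)) * 2 ^ (m - n) / 2 ^ m"
    by (rule divide_right_mono) simp
  then have "dyad m (Suc (dyad_index m s)) \<le> dyad n (Suc (dyad_index n s))"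
    unfolding dyad_def by (simp add: p del: of_nat_Suc)
  then show ?thesis using t by simp
qed

text \<open>Each factor \<open>1 + h * \<alpha>\<close> is at most
  \<open>exp (h * \<alpha>)\<close>; every source \<open>h * \<beta>\<close> is inflated by the full
  exponential, so the sources add up linearly in \<open>h * i\<close>.\<close>

lemma gronwall_discrete:
  fixes d :: "nat \<Rightarrow> real"
  assumes d0: "d 0 \<le> c" and step: "\<And>i. i < N \<Longrightarrow> d (Suc i) \<le> (1 + h * \<alpha>) * d i + h * \<beta>"
    and pos: "0 \<le> h" "0 \<le> \<alpha>" "0 \<le> \<beta>" "0 \<le> c" and i: "i \<le> N"
  shows "d i \<le> exp (\<alpha> * (h * i)) * (c + \<beta> * (h * i))"
  using i
proof (induction i)
  case 0 then show ?case using d0 by simp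
next
  case (Suc i)
  have "d (Suc i) \<le> (1 + h * \<alpha>) * d i + h * \<beta>" using step Suc.prems by simp
  also have "\<dots> \<le> exp (h * \<alpha>) * (exp (\<alpha> * (h * i)) * (c + \<beta> * (h * i))) + exp (\<alpha> * (h * Suc i)) * (h * \<beta>)"
  proof (rule add_mono)
    have "(1 + h * \<alpha>) * d i \<le> (1 + h * \<alpha>) * (exp (\<alpha> * (h * i)) * (c + \<beta> * (h * i)))"
      using Suc pos by (intro mult_left_mono) auto
    also have "\<dots> \<le> exp (h * \<alpha>) * (exp (\<alpha> * (h * i)) * (c + \<beta> * (h * i)))"
      using pos exp_ge_add_one_self[of "h * \<alpha>"] by (intro mult_right_mono) auto
    finally show "(1 + h * \<alpha>) * d i \<le> exp (h * \<alpha>) * (exp (\<alpha> * (h * i)) * (c + \<beta> * (h * i)))" .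
    have "1 * (h * \<beta>) \<le> exp (\<alpha> * (h * Suc i)) * (h * \<beta>)"
      using pos by (intro mult_right_mono) auto
    then show "h * \<beta> \<le> exp (\<alpha> * (h * Suc i)) * (h * \<beta>)" by simp
  qed
  also have "exp (h * \<alpha>) * (exp (\<alpha> * (h * i)) * (c + \<beta> * (h * i))) = exp (\<alpha> * (h * Suc i)) * (c + \<beta> * (h * i))"
  proof -
    have "exp (h * \<alpha>) * exp (\<alpha> * (h * i)) = exp (\<alpha> * (h * Suc i))"
      unfolding mult_exp_exp by (rule arg_cong[where f=exp]) (simp add: algebra_simps)
    then show ?thesis by (simp only: mult.assoc[symmetric])
  qed
  also have "exp (\<alpha> * (h * Suc i)) * (c + \<beta> * (h * i)) + exp (\<alpha> * (h * Suc i)) * (h * \<beta>)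
      = exp (\<alpha> * (h * Suc i)) * (c + \<beta> * (h * Suc i))"
    unfolding distrib_left[symmetric] by (simp add: distrib_left distrib_right)
  finally show ?case .
qed

section \<open>Mean square convergence of the Euler scheme\<close>

locale linear_sde = brownian_basis M F W
  for M :: "'a measure" and F :: "real \<Rightarrow> 'a measure" and W :: "real \<Rightarrow> 'a \<Rightarrow> real" +
  fixes A C :: "real^'n^'n" and \<xi> :: "'a \<Rightarrow> real^'n"
  assumes init: "initial_state M F \<xi>"
begin

fun x :: "nat \<Rightarrow> nat \<Rightarrow> 'a \<Rightarrow> real^'n" where
  "x n 0 \<omega> = \<xi> \<omega>"
| "x n (Suc j) \<omega> = x n j \<omega> + (1 / 2 ^ n) *\<^sub>R (A *v x n j \<omega>)
     + (W (dyad n (Suc j)) \<omega> - W (dyad n j) \<omega>) *\<^sub>R (C *v x n j \<omega>)"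

text \<open>\<open>x n j\<close> is the Euler approximation at time \<open>j / 2 ^ n\<close>; \<open>Y n\<close> extends it continuously to all
  times, without linear interpolation of the Brownian path.\<close>

definition left_value :: "nat \<Rightarrow> real \<Rightarrow> 'a \<Rightarrow> real^'n" where
  "left_value n t \<omega> = x n (dyad_index n t) \<omega>"

definition Y :: "nat \<Rightarrow> real \<Rightarrow> 'a \<Rightarrow> real^'n" where
  "Y n t \<omega> = left_value n t \<omega> + (t - dyad n (dyad_index n t)) *\<^sub>R (A *v left_value n t \<omega>)
     + (W t \<omega> - W (dyad n (dyad_index n t)) \<omega>) *\<^sub>R (C *v left_value n t \<omega>)"

text \<open>The constant of the one-step estimate \<open>euler_step_msq\<close>. The drift enters
  twice, once from Young's inequality for the mixed term and once from its square because
  \<open>h\<^sup>2 \<le> h\<close>; the diffusion enters once, by the isometry.\<close>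

definition growth :: real where
  "growth = 2 * (onorm ((*v) A))\<^sup>2 + (onorm ((*v) C))\<^sup>2"

lemma growth_nonneg: "0 \<le> growth" by (simp add: growth_def)

lemma euler_step_adapted:
  assumes s: "0 \<le> s" "s \<le> t" and Z: "adapted_L2 s Z" and G: "adapted_L2 s G"
  shows "adapted_L2 t (\<lambda>\<omega>. Z \<omega> + c *\<^sub>R (A *v G \<omega>) + (W t \<omega> - W s \<omega>) *\<^sub>R (C *v G \<omega>))"
  using adapted_L2_mono[OF Z s(2)] adapted_L2_mono[OF adapted_L2_scaleR[OF adapted_L2_matrix[OF G]] s(2)]
    adapted_L2_increment_mult[OF s order_refl adapted_L2_matrix[OF G]]
  by (intro adapted_L2_add) auto

text \<open>The current state \<open>Z\<close> and the value \<open>G\<close> at which the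
  coefficients are frozen are kept apart. This covers a step of the scheme, the difference of two
  schemes with different frozen values, and the move away from a frozen value, where
  \<open>Z\<close> is 0.\<close>

lemma euler_step_msq:
  assumes s: "0 \<le> s" "s \<le> t" "t \<le> s + 1" and Z: "adapted_L2 s Z" and G: "adapted_L2 s G"
  shows "msq (\<lambda>\<omega>. Z \<omega> + (t - s) *\<^sub>R (A *v G \<omega>) + (W t \<omega> - W s \<omega>) *\<^sub>R (C *v G \<omega>))
    \<le> (1 + (t - s)) * msq Z + (t - s) * growth * msq G"
proof -
  define h where "h = t - s"
  have h: "0 \<le> h" "h \<le> 1" using s by (auto simp: h_def)
  define a where "a = (onorm ((*v) A))\<^sup>2"
  have Z2: "square_integrable M Z" and G2: "square_integrable M G"
    using Z G by (auto intro: adapted_L2_square_integrable)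
  note AG2 = square_integrable_linear[OF matrix_vector_mul_bounded_linear G2, of A]
  have i: "integrable M (\<lambda>\<omega>. (norm (Z \<omega>))\<^sup>2)" "integrable M (\<lambda>\<omega>. (norm (A *v G \<omega>))\<^sup>2)"
    by (intro square_integrable_integrable Z2 AG2)+
  have "msq (\<lambda>\<omega>. Z \<omega> + h *\<^sub>R (A *v G \<omega>)) \<le> (\<integral>\<omega>. (1 + h) * (norm (Z \<omega>))\<^sup>2 + 2 * h * (norm (A *v G \<omega>))\<^sup>2 \<partial>M)"
  proof (rule integral_mono)
    show "integrable M (\<lambda>\<omega>. (norm (Z \<omega> + h *\<^sub>R (A *v G \<omega>)))\<^sup>2)"
      by (intro square_integrable_integrable square_integrable_add square_integrable_scaleR Z2 AG2)
    show "integrable M (\<lambda>\<omega>. (1 + h) * (norm (Z \<omega>))\<^sup>2 + 2 * h * (norm (A *v G \<omega>))\<^sup>2)"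
      using i by simp
    fix \<omega>
    let ?z = "Z \<omega>" and ?g = "A *v G \<omega>"
    have "2 * (?z \<bullet> ?g) \<le> (norm ?z)\<^sup>2 + (norm ?g)\<^sup>2"
      using norm_ge_zero[of "?z - ?g"] zero_le_power2[of "norm (?z - ?g)"]
      by (simp add: power2_norm_eq_inner inner_diff_left inner_diff_right inner_commute del: zero_le_power2)
    then have "h * (2 * (?z \<bullet> ?g)) \<le> h * ((norm ?z)\<^sup>2 + (norm ?g)\<^sup>2)"
      using h by (intro mult_left_mono)
    moreover have "h\<^sup>2 * (norm ?g)\<^sup>2 \<le> h * (norm ?g)\<^sup>2"
      using h by (intro mult_right_mono) (auto simp: power2_eq_square mult_left_le)
    moreover have "(norm (?z + h *\<^sub>R ?g))\<^sup>2 = (norm ?z)\<^sup>2 + h * (2 * (?z \<bullet> ?g)) + h\<^sup>2 * (norm ?g)\<^sup>2"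
      by (simp add: norm_add_scaleR_sq)
    ultimately show "(norm (?z + h *\<^sub>R ?g))\<^sup>2 \<le> (1 + h) * (norm ?z)\<^sup>2 + 2 * h * (norm ?g)\<^sup>2"
      by (simp add: algebra_simps)
  qed
  also have "\<dots> = (1 + h) * msq Z + 2 * h * msq (\<lambda>\<omega>. A *v G \<omega>)"
    using i by simp
  also have "\<dots> \<le> (1 + h) * msq Z + 2 * h * (a * msq G)"
    using h msq_matrix_le[OF G2, of A] by (intro add_left_mono mult_left_mono) (auto simp: a_def)
  finally have 1: "msq (\<lambda>\<omega>. Z \<omega> + h *\<^sub>R (A *v G \<omega>)) \<le> (1 + h) * msq Z + 2 * h * (a * msq G)" .
  have "msq (\<lambda>\<omega>. (Z \<omega> + h *\<^sub>R (A *v G \<omega>)) + (W t \<omega> - W s \<omega>) *\<^sub>R (C *v G \<omega>))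
     = msq (\<lambda>\<omega>. Z \<omega> + h *\<^sub>R (A *v G \<omega>)) + (t - s) * msq (\<lambda>\<omega>. C *v G \<omega>)"
    by (rule msq_increment[OF s(1,2)]) (intro adapted_L2_add adapted_L2_scaleR adapted_L2_matrix Z G)+
  also have "\<dots> \<le> (1 + h) * msq Z + 2 * h * (a * msq G) + h * ((onorm ((*v) C))\<^sup>2 * msq G)"
    using 1 h msq_matrix_le[OF G2, of C] unfolding h_def by (intro add_mono mult_left_mono) auto
  also have "\<dots> = (1 + h) * msq Z + h * growth * msq G"
    by (simp add: growth_def a_def algebra_simps)
  finally show ?thesis by (simp add: h_def)
qed

lemma \<xi>_adapted: "adapted_L2 0 \<xi>"
  using init by (simp add: adapted_L2_iff initial_state_def)

lemma x_adapted: "adapted_L2 (dyad n j) (x n j)"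
proof (induction j)
  case 0 then show ?case using \<xi>_adapted by simp
next
  case (Suc j)
  have "adapted_L2 (dyad n (Suc j)) (\<lambda>\<omega>. x n j \<omega> + (1 / 2 ^ n) *\<^sub>R (A *v x n j \<omega>)
     + (W (dyad n (Suc j)) \<omega> - W (dyad n j) \<omega>) *\<^sub>R (C *v x n j \<omega>))"
    by (rule euler_step_adapted[OF _ _ Suc Suc]) (auto simp: dyad_Suc)
  then show ?case by simp
qed

lemma left_value_adapted: "0 \<le> t \<Longrightarrow> adapted_L2 t (left_value n t)"
  unfolding left_value_def by (rule adapted_L2_mono[OF x_adapted dyad_index_le])

lemma Y_adapted: "0 \<le> t \<Longrightarrow> adapted_L2 t (Y n t)"
  unfolding Y_def left_value_def by (rule euler_step_adapted[OF _ _ x_adapted x_adapted]) (auto simp: dyad_index_le)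

lemma Y_dyad: "Y n (dyad n j) \<omega> = x n j \<omega>"
  by (simp add: Y_def left_value_def)

text \<open>Inside a cell the scheme can be restarted from any intermediate time with the same
  frozen value. The right end of the cell is included although \<open>Y\<close> uses the next frozen
  value there, because both expressions agree at the grid point.\<close>

lemma Y_increment:
  assumes s: "0 \<le> s" "s \<le> t" "t \<le> dyad n (Suc (dyad_index n s))"
  shows "Y n t \<omega> = Y n s \<omega> + (t - s) *\<^sub>R (A *v left_value n s \<omega>) + (W t \<omega> - W s \<omega>) *\<^sub>R (C *v left_value n s \<omega>)"
proof -
  define j where "j = dyad_index n s"
  have j: "dyad n j \<le> s" using dyad_index_le[OF s(1)] by (simp add: j_def)
  show ?thesis
  proof (cases "t < dyad n (Suc j)")
    case True
    then have "dyad_index n t = j" using j s by (intro index_eqI) auto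
    then show ?thesis
      by (simp add: Y_def left_value_def j_def[symmetric] algebra_simps)
  next
    case False
    then have t: "t = dyad n (Suc j)" using s by (simp add: j_def)
    have "1 / 2 ^ n = (dyad n (Suc j) - s) + (s - dyad n j)" by (simp add: dyad_Suc)
    then show ?thesis
      unfolding t Y_dyad x.simps by (simp only: Y_def left_value_def j_def[symmetric]) (simp add: algebra_simps)
  qed
qed

definition msq_bound :: "real \<Rightarrow> real" where
  "msq_bound T = exp ((1 + growth) * T) * msq \<xi>"

lemma msq_bound_nonneg: "0 \<le> msq_bound T" by (simp add: msq_bound_def)

lemma x_msq:
  assumes "dyad n j \<le> T" shows "msq (x n j) \<le> msq_bound T"
proof -
  have "msq (x n j) \<le> exp ((1 + growth) * (1 / 2 ^ n * j)) * (msq \<xi> + 0 * (1 / 2 ^ n * j))"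
  proof (rule gronwall_discrete[where N=j])
    fix i
    have "msq (x n (Suc i)) = msq (\<lambda>\<omega>. x n i \<omega> + (dyad n (Suc i) - dyad n i) *\<^sub>R (A *v x n i \<omega>) + (W (dyad n (Suc i)) \<omega> - W (dyad n i) \<omega>) *\<^sub>R (C *v x n i \<omega>))"
      by (simp add: dyad_Suc)
    also have "\<dots> \<le> (1 + (dyad n (Suc i) - dyad n i)) * msq (x n i) + (dyad n (Suc i) - dyad n i) * growth * msq (x n i)"
      by (rule euler_step_msq[OF _ _ _ x_adapted x_adapted]) (auto simp: dyad_Suc)
    finally show "msq (x n (Suc i)) \<le> (1 + 1 / 2 ^ n * (1 + growth)) * msq (x n i) + 1 / 2 ^ n * 0"
      by (simp add: dyad_Suc algebra_simps add_divide_distrib)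
  qed (auto simp: growth_nonneg)
  also have "\<dots> \<le> msq_bound T"
  proof -
    have "(1 + growth) * (1 / 2 ^ n * real j) \<le> (1 + growth) * T"
      using assms growth_nonneg by (intro mult_left_mono) (auto simp: dyad_def)
    then have "exp ((1 + growth) * (1 / 2 ^ n * real j)) * msq \<xi> \<le> exp ((1 + growth) * T) * msq \<xi>"
      by (intro mult_right_mono msq_nonneg) simp
    then show ?thesis by (simp add: msq_bound_def)
  qed
  finally show ?thesis .
qed

lemma left_value_msq: "0 \<le> t \<Longrightarrow> t \<le> T \<Longrightarrow> msq (left_value n t) \<le> msq_bound T"
  unfolding left_value_def using dyad_index_le[of t n] by (intro x_msq) auto

lemma left_value_dyad: "left_value n (dyad n j) = x n j"
  by (simp add: left_value_def fun_eq_iff)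

lemma Y_left_value_msq:
  assumes t: "0 \<le> t" "t \<le> T"
  shows "msq (\<lambda>\<omega>. Y n t \<omega> - left_value n t \<omega>) \<le> growth * msq_bound T / 2 ^ n"
proof -
  let ?s = "dyad n (dyad_index n t)"
  have s: "0 \<le> ?s" "?s \<le> t" "t \<le> ?s + 1 / 2 ^ n"
    using dyad_index_le[OF t(1), of n] less_dyad_index[OF t(1), of n] by (auto simp: dyad_Suc)
  have "(1::real) / 2 ^ n \<le> 1" by simp
  have "msq (\<lambda>\<omega>. Y n t \<omega> - left_value n t \<omega>) = msq (\<lambda>\<omega>. 0 + (t - ?s) *\<^sub>R (A *v left_value n t \<omega>) + (W t \<omega> - W ?s \<omega>) *\<^sub>R (C *v left_value n t \<omega>))"
    by (simp add: Y_def)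
  also have "\<dots> \<le> (1 + (t - ?s)) * msq (\<lambda>\<omega>. 0 :: real^'n) + (t - ?s) * growth * msq (left_value n t)"
  proof (rule euler_step_msq[OF s(1,2) _ adapted_L2_zero])
    show "t \<le> ?s + 1" using s(3) \<open>1 / 2 ^ n \<le> 1\<close> by linarith
    show "adapted_L2 ?s (left_value n t)" unfolding left_value_def by (rule x_adapted)
  qed
  also have "(t - ?s) * growth * msq (left_value n t) \<le> 1 / 2 ^ n * growth * msq_bound T"
    by (intro mult_mono left_value_msq t growth_nonneg mult_nonneg_nonneg msq_nonneg) (use s in auto)
  finally show ?thesis by simp
qed

lemma dyad_le_one: "t \<le> dyad n (Suc (dyad_index n s)) \<Longrightarrow> 0 \<le> s \<Longrightarrow> t \<le> s + 1"
proof -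
  assume "t \<le> dyad n (Suc (dyad_index n s))" "0 \<le> s"
  moreover have "(1::real) / 2 ^ n \<le> 1" by simp
  ultimately show ?thesis using dyad_index_le[of s n] unfolding dyad_Suc by linarith
qed

lemma compare_step:
  assumes nm: "n \<le> m" and s: "0 \<le> s" "s \<le> t" "t \<le> dyad m (Suc (dyad_index m s))" and T: "s \<le> T"
    and sm: "s = dyad m i"
  shows "msq (\<lambda>\<omega>. Y m t \<omega> - Y n t \<omega>)
    \<le> (1 + (t - s) * (1 + 2 * growth)) * msq (\<lambda>\<omega>. Y m s \<omega> - Y n s \<omega>) + (t - s) * (2 * growth * (growth * msq_bound T / 2 ^ n))"
proof -
  let ?D = "\<lambda>\<omega>. Y m s \<omega> - Y n s \<omega>" and ?G = "\<lambda>\<omega>. left_value m s \<omega> - left_value n s \<omega>"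
  have D: "adapted_L2 s ?D" and G: "adapted_L2 s ?G" and YX: "adapted_L2 s (\<lambda>\<omega>. Y n s \<omega> - left_value n s \<omega>)"
    by (intro adapted_L2_diff Y_adapted left_value_adapted s)+
  have "Y m t \<omega> - Y n t \<omega> = ?D \<omega> + (t - s) *\<^sub>R (A *v ?G \<omega>) + (W t \<omega> - W s \<omega>) *\<^sub>R (C *v ?G \<omega>)" for \<omega>
    unfolding Y_increment[OF s, of \<omega>] Y_increment[OF s(1,2) cell_coarser[OF s(1) nm s(3)], of \<omega>]
    by (simp add: algebra_simps matrix_vector_mult_diff_distrib)
  then have "msq (\<lambda>\<omega>. Y m t \<omega> - Y n t \<omega>) \<le> (1 + (t - s)) * msq ?D + (t - s) * growth * msq ?G"
    using euler_step_msq[OF s(1,2) dyad_le_one[OF s(3,1)] D G] by simp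
  moreover have "msq ?G \<le> 2 * msq ?D + 2 * (growth * msq_bound T / 2 ^ n)"
  proof -
    have "msq ?G = msq (\<lambda>\<omega>. ?D \<omega> + (Y n s \<omega> - left_value n s \<omega>))"
      unfolding sm left_value_dyad Y_dyad by simp
    also have "\<dots> \<le> 2 * msq ?D + 2 * msq (\<lambda>\<omega>. Y n s \<omega> - left_value n s \<omega>)"
      by (intro msq_add_le adapted_L2_square_integrable[OF D] adapted_L2_square_integrable[OF YX])
    finally show ?thesis using Y_left_value_msq[OF s(1) T, of n] by simp
  qed
  moreover have "0 \<le> (t - s) * growth" using s growth_nonneg by simp
  ultimately have "msq (\<lambda>\<omega>. Y m t \<omega> - Y n t \<omega>)
     \<le> (1 + (t - s)) * msq ?D + (t - s) * growth * (2 * msq ?D + 2 * (growth * msq_bound T / 2 ^ n))"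
    by (meson add_left_mono mult_left_mono order_trans)
  then show ?thesis by (simp add: algebra_simps)
qed

lemma compare_grid:
  assumes nm: "n \<le> m" and i: "dyad m i \<le> T"
  shows "msq (\<lambda>\<omega>. Y m (dyad m i) \<omega> - Y n (dyad m i) \<omega>)
     \<le> exp ((1 + 2 * growth) * T) * (2 * growth * (growth * msq_bound T / 2 ^ n) * T)"
proof -
  have "msq (\<lambda>\<omega>. Y m (dyad m i) \<omega> - Y n (dyad m i) \<omega>)
     \<le> exp ((1 + 2 * growth) * (1 / 2 ^ m * i)) * (0 + 2 * growth * (growth * msq_bound T / 2 ^ n) * (1 / 2 ^ m * i))"
  proof (rule gronwall_discrete[where N=i])
    show "msq (\<lambda>\<omega>. Y m (dyad m 0) \<omega> - Y n (dyad m 0) \<omega>) \<le> 0"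
      using Y_dyad[of m 0] Y_dyad[of n 0] by simp
    fix j assume j: "j < i"
    then have "dyad m j \<le> T" using i by (auto simp: dyad_def field_simps intro: order_trans[rotated])
    from compare_step[OF nm _ _ _ this refl, of "dyad m (Suc j)"]
    show "msq (\<lambda>\<omega>. Y m (dyad m (Suc j)) \<omega> - Y n (dyad m (Suc j)) \<omega>)
      \<le> (1 + 1 / 2 ^ m * (1 + 2 * growth)) * msq (\<lambda>\<omega>. Y m (dyad m j) \<omega> - Y n (dyad m j) \<omega>) + 1 / 2 ^ m * (2 * growth * (growth * msq_bound T / 2 ^ n))"
      by (simp add: dyad_Suc)
  qed (auto simp: growth_nonneg msq_bound_nonneg)
  also have "\<dots> \<le> exp ((1 + 2 * growth) * T) * (2 * growth * (growth * msq_bound T / 2 ^ n) * T)"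
  proof -
    have iT: "1 / 2 ^ m * real i \<le> T" using i by (simp add: dyad_def)
    have nn: "0 \<le> 2 * growth * (growth * msq_bound T / 2 ^ n)" using growth_nonneg msq_bound_nonneg[of T] by simp
    have "(1 + 2 * growth) * (1 / 2 ^ m * real i) \<le> (1 + 2 * growth) * T"
      using growth_nonneg by (intro mult_left_mono iT) auto
    then show ?thesis unfolding add_0
      by (intro mult_mono mult_left_mono[OF iT nn] mult_nonneg_nonneg[OF nn]) auto
  qed
  finally show ?thesis .
qed

definition grid_const :: "real \<Rightarrow> real" where
  "grid_const T = exp ((1 + 2 * growth) * T) * (2 * growth * (growth * msq_bound T) * T)"

text \<open>The grid estimate is followed by one incomplete step from the last fine grid point
  before \<open>t\<close>; that step has length at most 1.\<close>

lemma compare_any: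
  assumes nm: "n \<le> m" and t: "0 \<le> t" "t \<le> T"
  shows "msq (\<lambda>\<omega>. Y m t \<omega> - Y n t \<omega>) \<le> ((2 + 2 * growth) * grid_const T + 2 * growth * (growth * msq_bound T)) / 2 ^ n"
proof -
  let ?s = "dyad m (dyad_index m t)"
  have s: "0 \<le> ?s" "?s \<le> t" "t \<le> dyad m (Suc (dyad_index m ?s))" "?s \<le> T"
    using dyad_index_le[OF t(1), of m] less_dyad_index[OF t(1), of m] t by auto
  have h: "0 \<le> t - ?s" "t - ?s \<le> 1" using s dyad_le_one[OF s(3,1)] by auto
  have "msq (\<lambda>\<omega>. Y m t \<omega> - Y n t \<omega>)
    \<le> (1 + (t - ?s) * (1 + 2 * growth)) * msq (\<lambda>\<omega>. Y m ?s \<omega> - Y n ?s \<omega>) + (t - ?s) * (2 * growth * (growth * msq_bound T / 2 ^ n))"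
    by (rule compare_step[OF nm s refl])
  also have "\<dots> \<le> (1 + 1 * (1 + 2 * growth)) * (grid_const T / 2 ^ n) + 1 * (2 * growth * (growth * msq_bound T / 2 ^ n))"
    using h compare_grid[OF nm s(4)] growth_nonneg msq_bound_nonneg[of T]
    by (intro add_mono mult_mono) (auto simp: grid_const_def)
  finally show ?thesis by (simp add: add_divide_distrib algebra_simps)
qed

end

section \<open>A maximal inequality for discrete stochastic integrals\<close>

context brownian_basis
begin

definition ito_sums :: "(nat \<Rightarrow> real) \<Rightarrow> (nat \<Rightarrow> 'a \<Rightarrow> 'v::euclidean_space) \<Rightarrow> nat \<Rightarrow> 'a \<Rightarrow> 'v" where
  "ito_sums s H i \<omega> = (\<Sum>j<i. (W (s (Suc j)) \<omega> - W (s j) \<omega>) *\<^sub>R H j \<omega>)"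

lemma ito_sums_Suc: "ito_sums s H (Suc i) \<omega> = ito_sums s H i \<omega> + (W (s (Suc i)) \<omega> - W (s i) \<omega>) *\<^sub>R H i \<omega>"
  by (simp add: ito_sums_def)

lemma ito_sums_props:
  assumes s: "\<And>j. 0 \<le> s j" "\<And>j. s j \<le> s (Suc j)" and H: "\<And>j. adapted_L2 (s j) (H j)"
  shows "adapted_L2 (s i) (ito_sums s H i)"
    and "msq (ito_sums s H i) = (\<Sum>j<i. (s (Suc j) - s j) * msq (H j))"
proof (induction i)
  case 0
  show "adapted_L2 (s 0) (ito_sums s H 0)" by (simp add: ito_sums_def[abs_def] adapted_L2_zero)
  show "msq (ito_sums s H 0) = (\<Sum>j<0. (s (Suc j) - s j) * msq (H j))" by (simp add: ito_sums_def)
next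
  case (Suc i)
  have e: "ito_sums s H (Suc i) = (\<lambda>\<omega>. ito_sums s H i \<omega> + (W (s (Suc i)) \<omega> - W (s i) \<omega>) *\<^sub>R H i \<omega>)"
    by (simp add: fun_eq_iff ito_sums_Suc)
  show "adapted_L2 (s (Suc i)) (ito_sums s H (Suc i))"
    unfolding e by (intro adapted_L2_add adapted_L2_mono[OF Suc(1) s(2)]
      adapted_L2_increment_mult[OF s order_refl H])
  show "msq (ito_sums s H (Suc i)) = (\<Sum>j<Suc i. (s (Suc j) - s j) * msq (H j))"
    unfolding e msq_increment[OF s Suc(1) H] using Suc(2) by simp
qed

lemma chebyshev_norm:
  fixes f :: "'a \<Rightarrow> 'v::euclidean_space"
  assumes f: "square_integrable M f" and c: "0 < c"
  shows "prob {\<omega> \<in> space M. c < norm (f \<omega>)} \<le> msq f / c\<^sup>2"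
proof -
  have [measurable]: "f \<in> borel_measurable M" by (rule square_integrable_measurable[OF f])
  have "prob {\<omega> \<in> space M. c < norm (f \<omega>)} \<le> prob {\<omega> \<in> space M. c\<^sup>2 \<le> (norm (f \<omega>))\<^sup>2}"
    using c by (intro finite_measure_mono) (auto intro!: power_mono)
  also have "\<dots> \<le> msq f / c\<^sup>2"
    by (rule integral_Markov_inequality_measure[where A="{}"])
      (use square_integrable_integrable[OF f] c in auto)
  finally show ?thesis .
qed

text \<open>The martingale is stopped once its norm exceeds \<open>c\<close>; Chebyshev's inequality for the stopped
  martingale then controls the running maximum.\<close>

lemma maximal_inequality:
  fixes H :: "nat \<Rightarrow> 'a \<Rightarrow> 'v::euclidean_space"
  assumes s: "\<And>j. 0 \<le> s j" "\<And>j. s j \<le> s (Suc j)" and H: "\<And>j. adapted_L2 (s j) (H j)" and c: "0 < c"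
  shows "{\<omega> \<in> space M. \<exists>i\<le>N. c < norm (ito_sums s H i \<omega>)} \<in> sets M"
    and "prob {\<omega> \<in> space M. \<exists>i\<le>N. c < norm (ito_sums s H i \<omega>)} \<le> (\<Sum>j<N. (s (Suc j) - s j) * msq (H j)) / c\<^sup>2"
proof -
  define B where "B j = {\<omega> \<in> space M. \<forall>i\<le>j. norm (ito_sums s H i \<omega>) \<le> c}" for j
  define H' where "H' j = (\<lambda>\<omega>. indicator (B j) \<omega> *\<^sub>R H j \<omega>)" for j
  have smono: "s i \<le> s j" if "i \<le> j" for i j using s(2) that by (rule lift_Suc_mono_le)
  have m: "ito_sums s H i \<in> borel_measurable (F (s j))" if "i \<le> j" for i j
    using ito_sums_props(1)[where s=s and H=H, OF s H, of i] measurable_F_mono[OF _ smono[OF that]] by (auto simp: adapted_L2_def)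
  have mM: "ito_sums s H i \<in> borel_measurable M" for i
    using m[OF order_refl] measurable_F_M s(1) by blast
  have BF: "B j \<in> sets (F (s j))" for j
  proof -
    have "(\<Inter>i\<le>j. {\<omega> \<in> space (F (s j)). norm (ito_sums s H i \<omega>) \<le> c}) \<in> sets (F (s j))"
    proof (rule sets.finite_INT)
      fix i assume "i \<in> {..j}"
      then have [measurable]: "ito_sums s H i \<in> borel_measurable (F (s j))" using m by simp
      show "{\<omega> \<in> space (F (s j)). norm (ito_sums s H i \<omega>) \<le> c} \<in> sets (F (s j))" by measurable
    qed auto
    moreover have "B j = (\<Inter>i\<le>j. {\<omega> \<in> space (F (s j)). norm (ito_sums s H i \<omega>) \<le> c})"
      by (auto simp: B_def space_F)
    ultimately show ?thesis by simp
  qed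
  have BM: "B j \<in> sets M" for j using BF[of j] subalgebra_F[OF s(1), of j] by (auto simp: subalgebra_def)
  have H': "adapted_L2 (s j) (H' j)" for j
    using H[of j] BF[of j] BM[of j] unfolding H'_def adapted_L2_def
    by (auto intro: square_integrable_indicator_mult)
  have le: "msq (H' j) \<le> msq (H j)" for j
    using adapted_L2_square_integrable[OF H] adapted_L2_square_integrable[OF H']
    by (intro integral_mono) (auto simp: square_integrable_def H'_def indicator_def)
  have stop: "(\<omega> \<in> B i \<and> ito_sums s H' i \<omega> = ito_sums s H i \<omega>) \<or> (\<omega> \<notin> B i \<and> c < norm (ito_sums s H' i \<omega>))"
    if \<omega>: "\<omega> \<in> space M" for i \<omega>
  proof (induction i)
    case 0 then show ?case using \<omega> c by (simp add: B_def ito_sums_def)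
  next
    case (Suc i)
    have BS: "\<omega> \<in> B (Suc i) \<longleftrightarrow> \<omega> \<in> B i \<and> norm (ito_sums s H (Suc i) \<omega>) \<le> c"
      using \<omega> by (auto simp: B_def le_Suc_eq)
    have "H' i \<omega> = (if \<omega> \<in> B i then H i \<omega> else 0)" by (simp add: H'_def)
    then show ?case using Suc unfolding BS ito_sums_Suc by auto
  qed
  have eq: "{\<omega> \<in> space M. \<exists>i\<le>N. c < norm (ito_sums s H i \<omega>)} = space M - B N"
    by (auto simp: B_def not_le[symmetric])
  then show "{\<omega> \<in> space M. \<exists>i\<le>N. c < norm (ito_sums s H i \<omega>)} \<in> sets M" using BM by simp
  have SI: "square_integrable M (ito_sums s H' N)"
    by (rule adapted_L2_square_integrable[OF ito_sums_props(1)[where s=s and H=H', OF s H']])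
  have [measurable]: "ito_sums s H' N \<in> borel_measurable M"
    by (rule square_integrable_measurable[OF SI])
  have "prob (space M - B N) \<le> prob {\<omega> \<in> space M. c < norm (ito_sums s H' N \<omega>)}"
    using stop[of _ N] by (intro finite_measure_mono) auto
  also have "\<dots> \<le> msq (ito_sums s H' N) / c\<^sup>2" by (rule chebyshev_norm[OF SI c])
  also have "msq (ito_sums s H' N) = (\<Sum>j<N. (s (Suc j) - s j) * msq (H' j))"
    by (rule ito_sums_props(2)[where s=s and H=H', OF s H'])
  also have "\<dots> / c\<^sup>2 \<le> (\<Sum>j<N. (s (Suc j) - s j) * msq (H j)) / c\<^sup>2"
    using s le by (intro divide_right_mono sum_mono mult_left_mono) auto
  finally show "prob {\<omega> \<in> space M. \<exists>i\<le>N. c < norm (ito_sums s H i \<omega>)} \<le> (\<Sum>j<N. (s (Suc j) - s j) * msq (H j)) / c\<^sup>2"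
    unfolding eq .
qed

end

section \<open>Almost sure uniform convergence of the Euler scheme\<close>

context linear_sde
begin

definition compare_const :: "real \<Rightarrow> real" where
  "compare_const T = (2 + 2 * growth) * grid_const T + 2 * growth * (growth * msq_bound T)"

text \<open>Going from one frozen value to its scheme, to the other scheme and to the other frozen
  value uses the two-term square inequality twice; the weights are 2, 4 and 4, and the two outer
  contributions add up to 6.\<close>

definition diff_const :: "real \<Rightarrow> real" where
  "diff_const T = 6 * (growth * msq_bound T) + 4 * compare_const T"

lemma Y_compare: "n \<le> m \<Longrightarrow> 0 \<le> t \<Longrightarrow> t \<le> T \<Longrightarrow> msq (\<lambda>\<omega>. Y m t \<omega> - Y n t \<omega>) \<le> compare_const T / 2 ^ n"
  unfolding compare_const_def by (rule compare_any)

lemma left_value_compare: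
  assumes nm: "n \<le> m" and t: "0 \<le> t" "t \<le> T"
  shows "msq (\<lambda>\<omega>. left_value m t \<omega> - left_value n t \<omega>) \<le> diff_const T / 2 ^ n"
proof -
  have SI: "square_integrable M (left_value k t)" "square_integrable M (Y k t)" for k
    using adapted_L2_square_integrable[OF left_value_adapted[OF t(1)]] adapted_L2_square_integrable[OF Y_adapted[OF t(1)]] by auto
  have neg: "msq (\<lambda>\<omega>. left_value m t \<omega> - Y m t \<omega>) = msq (\<lambda>\<omega>. Y m t \<omega> - left_value m t \<omega>)"
    by (simp add: norm_minus_commute)
  have "msq (\<lambda>\<omega>. left_value m t \<omega> - left_value n t \<omega>) = msq (\<lambda>\<omega>. (left_value m t \<omega> - Y m t \<omega>) + ((Y m t \<omega> - Y n t \<omega>) + (Y n t \<omega> - left_value n t \<omega>)))"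
    by simp
  also have "\<dots> \<le> 2 * msq (\<lambda>\<omega>. left_value m t \<omega> - Y m t \<omega>) + 2 * msq (\<lambda>\<omega>. (Y m t \<omega> - Y n t \<omega>) + (Y n t \<omega> - left_value n t \<omega>))"
    by (intro msq_add_le square_integrable_add square_integrable_diff SI)
  finally have f1: "msq (\<lambda>\<omega>. left_value m t \<omega> - left_value n t \<omega>) \<le> 2 * msq (\<lambda>\<omega>. left_value m t \<omega> - Y m t \<omega>) + 2 * msq (\<lambda>\<omega>. (Y m t \<omega> - Y n t \<omega>) + (Y n t \<omega> - left_value n t \<omega>))" .
  have f2: "msq (\<lambda>\<omega>. (Y m t \<omega> - Y n t \<omega>) + (Y n t \<omega> - left_value n t \<omega>)) \<le> 2 * msq (\<lambda>\<omega>. Y m t \<omega> - Y n t \<omega>) + 2 * msq (\<lambda>\<omega>. Y n t \<omega> - left_value n t \<omega>)"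
    by (intro msq_add_le square_integrable_add square_integrable_diff SI)
  have a: "msq (\<lambda>\<omega>. left_value m t \<omega> - left_value n t \<omega>) \<le> 2 * (growth * msq_bound T / 2 ^ m) + 4 * (compare_const T / 2 ^ n) + 4 * (growth * msq_bound T / 2 ^ n)"
    using f1[unfolded neg] f2 Y_left_value_msq[OF t, of m] Y_left_value_msq[OF t, of n] Y_compare[OF nm t] by linarith
  have "growth * msq_bound T / 2 ^ m \<le> growth * msq_bound T / 2 ^ n"
    using nm growth_nonneg msq_bound_nonneg[of T] by (intro divide_left_mono) (auto intro: power_increasing)
  then have "msq (\<lambda>\<omega>. left_value m t \<omega> - left_value n t \<omega>) \<le> 2 * (growth * msq_bound T / 2 ^ n) + 4 * (compare_const T / 2 ^ n) + 4 * (growth * msq_bound T / 2 ^ n)"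
    using a by linarith
  also have "\<dots> = diff_const T / 2 ^ n" by (simp add: diff_const_def add_divide_distrib)
  finally show ?thesis .
qed

definition deviation_const :: "real \<Rightarrow> real" where
  "deviation_const T = ((onorm ((*v) A))\<^sup>2 * T + (onorm ((*v) C))\<^sup>2) * T * diff_const T"

lemma diff_const_nonneg: "0 \<le> T \<Longrightarrow> 0 \<le> diff_const T"
  using growth_nonneg msq_bound_nonneg[of T] by (simp add: diff_const_def compare_const_def grid_const_def)

text \<open>On a grid refining both schemes their difference is a drift sum plus a discrete
  stochastic integral. To exceed \<open>2 * c\<close>, one of the two must exceed \<open>c\<close>:
  Chebyshev's inequality controls the drift through \<open>R\<close>, the maximal inequality
  controls the rest. The bound is independent of \<open>l\<close>, so the grid may be refined
  without limit.\<close>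

lemma grid_deviation:
  assumes l: "Suc n \<le> l" and N: "dyad l N = T" and c: "0 < c"
  shows "{\<omega> \<in> space M. \<exists>i\<le>N. 2 * c < norm (Y (Suc n) (dyad l i) \<omega> - Y n (dyad l i) \<omega>)} \<in> sets M"
    and "prob {\<omega> \<in> space M. \<exists>i\<le>N. 2 * c < norm (Y (Suc n) (dyad l i) \<omega> - Y n (dyad l i) \<omega>)} \<le> deviation_const T / 2 ^ n / c\<^sup>2"
proof -
  have T: "0 \<le> T" using N dyad_nonneg by metis
  define s where "s = dyad l"
  define d where "d = (1::real) / 2 ^ l"
  have d0: "0 \<le> d" by (simp add: d_def)
  have s: "\<And>j. 0 \<le> s j" "\<And>j. s j \<le> s (Suc j)" and ds: "\<And>j. s (Suc j) - s j = d"
    by (auto simp: s_def dyad_Suc d_def)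
  have dN: "d * N = T" using N by (simp add: d_def dyad_def)
  define G where "G j = (\<lambda>\<omega>. left_value (Suc n) (s j) \<omega> - left_value n (s j) \<omega>)" for j
  have G: "adapted_L2 (s j) (G j)" for j unfolding G_def by (intro adapted_L2_diff left_value_adapted s)
  have G2: "square_integrable M (G j)" for j by (rule adapted_L2_square_integrable[OF G])
  define H where "H j = (\<lambda>\<omega>. C *v G j \<omega>)" for j
  have H: "adapted_L2 (s j) (H j)" for j unfolding H_def by (intro adapted_L2_matrix G)
  let ?E = "\<lambda>i \<omega>. Y (Suc n) (s i) \<omega> - Y n (s i) \<omega>"
  have E: "?E i \<omega> = (\<Sum>j<i. d *\<^sub>R (A *v G j \<omega>)) + ito_sums s H i \<omega>" for i \<omega>
  proof (induction i)
    case 0 show ?case using Y_dyad[of "Suc n" 0 \<omega>] Y_dyad[of n 0 \<omega>] by (simp add: s_def ito_sums_def)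
  next
    case (Suc i)
    have c: "s (Suc i) \<le> dyad k (Suc (dyad_index k (s i)))" if "k \<le> l" for k
      by (rule cell_coarser[OF s(1) that]) (simp add: s_def)
    have k: "Suc n \<le> l" "n \<le> l" using l by auto
    have HG: "H i \<omega> = C *v left_value (Suc n) (s i) \<omega> - C *v left_value n (s i) \<omega>"
      and AG: "A *v G i \<omega> = A *v left_value (Suc n) (s i) \<omega> - A *v left_value n (s i) \<omega>"
      by (simp_all add: H_def G_def matrix_vector_mult_diff_distrib)
    show ?case
      unfolding Y_increment[OF s(1) s(2) c[OF k(1)]] Y_increment[OF s(1) s(2) c[OF k(2)]] ds ito_sums_Suc
      using Suc by (simp add: HG AG algebra_simps)
  qed
  \<comment> \<open>The sum of the norms of all drift steps; it dominates every partial drift sum at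
    once.\<close>
  define R where "R = (\<lambda>\<omega>. \<Sum>j<N. d * norm (A *v G j \<omega>))"
  have AG2: "square_integrable M (\<lambda>\<omega>. A *v G j \<omega>)" for j
    by (rule square_integrable_linear[OF matrix_vector_mul_bounded_linear G2])
  have "square_integrable M (\<lambda>\<omega>. norm (A *v G j \<omega>))" for j
    using AG2[of j] by (auto simp: square_integrable_def)
  then have R2: "square_integrable M R"
    unfolding R_def real_scaleR_def[symmetric] by (intro square_integrable_sum square_integrable_scaleR)
  have [measurable]: "R \<in> borel_measurable M" by (rule square_integrable_measurable[OF R2])
  have [measurable]: "Y k (s i) \<in> borel_measurable M" for k i
    using adapted_L2_square_integrable[OF Y_adapted[OF s(1)]] by (rule square_integrable_measurable)
  have Gm: "msq (G j) \<le> diff_const T / 2 ^ n" if "j < N" for j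
  proof -
    have "s j \<le> T" using that N by (auto simp: s_def dyad_def divide_right_mono)
    then show ?thesis unfolding G_def by (intro left_value_compare s) auto
  qed
  define e where "e = diff_const T / 2 ^ n"
  have sumG: "(\<Sum>j<N. d * msq (G j)) \<le> T * e"
  proof -
    have "(\<Sum>j<N. d * msq (G j)) \<le> (\<Sum>j<N. d * e)"
      using Gm d0 by (intro sum_mono mult_left_mono) (auto simp: e_def)
    also have "\<dots> = T * e" using dN by (simp add: mult.commute mult.left_commute)
    finally show ?thesis .
  qed
  have mR: "msq R \<le> T * ((onorm ((*v) A))\<^sup>2 * (T * e))"
  proof -
    have "msq R \<le> (\<integral>\<omega>. T * (\<Sum>j<N. d * (norm (A *v G j \<omega>))\<^sup>2) \<partial>M)"
    proof (rule integral_mono)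
      show "integrable M (\<lambda>\<omega>. (norm (R \<omega>))\<^sup>2)" by (rule square_integrable_integrable[OF R2])
      show "integrable M (\<lambda>\<omega>. T * (\<Sum>j<N. d * (norm (A *v G j \<omega>))\<^sup>2))"
        using square_integrable_integrable[OF AG2] by simp
      fix \<omega>
      \<comment> \<open>Cauchy-Schwarz for \<open>N\<close> summands. One factor \<open>d\<close> is
        absorbed by \<open>N\<close>, since \<open>d * N = T\<close>, so the bound is uniform in the
        grid.\<close>
      have "(R \<omega>)\<^sup>2 \<le> (\<Sum>j<N. (d * norm (A *v G j \<omega>))\<^sup>2) * card {..<N}"
        unfolding R_def by (rule sum_squared_le_sum_of_squares)
      also have "\<dots> = (d * N) * (\<Sum>j<N. d * (norm (A *v G j \<omega>))\<^sup>2)"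
        by (simp add: sum_distrib_left sum_distrib_right power2_eq_square mult_ac)
      finally show "(norm (R \<omega>))\<^sup>2 \<le> T * (\<Sum>j<N. d * (norm (A *v G j \<omega>))\<^sup>2)"
        unfolding dN by simp
    qed
    also have "\<dots> = T * (\<Sum>j<N. d * msq (\<lambda>\<omega>. A *v G j \<omega>))"
      using square_integrable_integrable[OF AG2] by simp
    also have "\<dots> \<le> T * (\<Sum>j<N. d * ((onorm ((*v) A))\<^sup>2 * msq (G j)))"
      using d0 T by (intro mult_left_mono sum_mono msq_matrix_le G2)
    also have "(\<Sum>j<N. d * ((onorm ((*v) A))\<^sup>2 * msq (G j))) = (onorm ((*v) A))\<^sup>2 * (\<Sum>j<N. d * msq (G j))"
      by (simp add: sum_distrib_left mult_ac)
    also have "T * \<dots> \<le> T * ((onorm ((*v) A))\<^sup>2 * (T * e))"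
      using T by (intro mult_left_mono sumG) auto
    finally show ?thesis .
  qed
  have mH: "(\<Sum>j<N. (s (Suc j) - s j) * msq (H j)) \<le> (onorm ((*v) C))\<^sup>2 * (T * e)"
  proof -
    have "(\<Sum>j<N. (s (Suc j) - s j) * msq (H j)) \<le> (\<Sum>j<N. d * ((onorm ((*v) C))\<^sup>2 * msq (G j)))"
      unfolding ds H_def using d0 by (intro sum_mono mult_left_mono msq_matrix_le G2)
    also have "\<dots> = (onorm ((*v) C))\<^sup>2 * (\<Sum>j<N. d * msq (G j))"
      by (simp add: sum_distrib_left mult_ac)
    also have "\<dots> \<le> (onorm ((*v) C))\<^sup>2 * (T * e)"
      by (intro mult_left_mono sumG) auto
    finally show ?thesis .
  qed
  let ?S = "{\<omega> \<in> space M. \<exists>i\<le>N. 2 * c < norm (?E i \<omega>)}"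
  let ?S1 = "{\<omega> \<in> space M. c < norm (R \<omega>)}"
  let ?S2 = "{\<omega> \<in> space M. \<exists>i\<le>N. c < norm (ito_sums s H i \<omega>)}"
  have split: "?S \<subseteq> ?S1 \<union> ?S2"
  proof (safe, rule ccontr)
    fix \<omega> i assume \<omega>: "\<omega> \<in> space M" "i \<le> N" "2 * c < norm (?E i \<omega>)"
      "\<not> (\<exists>i\<le>N. c < norm (ito_sums s H i \<omega>))" "\<not> c < norm (R \<omega>)"
    have "norm (\<Sum>j<i. d *\<^sub>R (A *v G j \<omega>)) \<le> (\<Sum>j<i. norm (d *\<^sub>R (A *v G j \<omega>)))" by (rule norm_sum)
    also have "\<dots> \<le> (\<Sum>j<N. norm (d *\<^sub>R (A *v G j \<omega>)))"
      using \<omega>(2) by (intro sum_mono2) auto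
    also have "\<dots> = R \<omega>" using d0 by (simp add: R_def)
    also have "\<dots> \<le> c" using \<omega>(5) by simp
    finally have "norm (?E i \<omega>) \<le> c + norm (ito_sums s H i \<omega>)"
      unfolding E using norm_triangle_ineq[of "\<Sum>j<i. d *\<^sub>R (A *v G j \<omega>)" "ito_sums s H i \<omega>"] by linarith
    moreover have "norm (ito_sums s H i \<omega>) \<le> c" using \<omega> by (meson not_le)
    ultimately show False using \<omega>(3) by linarith
  qed
  show meas: "{\<omega> \<in> space M. \<exists>i\<le>N. 2 * c < norm (Y (Suc n) (dyad l i) \<omega> - Y n (dyad l i) \<omega>)} \<in> sets M"
    unfolding s_def[symmetric] by measurable
  have m1: "?S1 \<in> sets M" by measurable
  have "prob ?S \<le> prob (?S1 \<union> ?S2)"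
    by (rule finite_measure_mono[OF split]) (intro sets.Un m1 maximal_inequality(1)[where s=s and H=H, OF s H c])
  also have "\<dots> \<le> prob ?S1 + prob ?S2"
    by (rule measure_Un_le[OF m1 maximal_inequality(1)[where s=s and H=H, OF s H c]])
  also have "\<dots> \<le> T * ((onorm ((*v) A))\<^sup>2 * (T * e)) / c\<^sup>2 + (onorm ((*v) C))\<^sup>2 * (T * e) / c\<^sup>2"
    using chebyshev_norm[OF R2 c] maximal_inequality(2)[where s=s and H=H, OF s H c, of N] mR mH
    by (intro add_mono) (auto elim!: order_trans intro!: divide_right_mono)
  also have "\<dots> = deviation_const T / 2 ^ n / c\<^sup>2"
    by (simp add: deviation_const_def e_def add_divide_distrib algebra_simps)
  finally show "prob {\<omega> \<in> space M. \<exists>i\<le>N. 2 * c < norm (Y (Suc n) (dyad l i) \<omega> - Y n (dyad l i) \<omega>)} \<le> deviation_const T / 2 ^ n / c\<^sup>2"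
    unfolding s_def .
qed

text \<open>The events grow with \<open>l\<close>, because every grid point belongs to all finer
  grids; continuity from below passes the uniform bound to their union, the event over all dyadic
  times.\<close>

lemma dyadic_deviation:
  fixes T n :: nat
  assumes c: "0 < c"
  defines "B \<equiv> \<lambda>l. {\<omega> \<in> space M. \<exists>i\<le>T * 2 ^ l. 2 * c < norm (Y (Suc n) (dyad l i) \<omega> - Y n (dyad l i) \<omega>)}"
  shows "(\<Union>l. B l) \<in> sets M" "prob (\<Union>l. B l) \<le> deviation_const T / 2 ^ n / c\<^sup>2"
proof -
  have gN: "dyad l (T * 2 ^ l) = real T" for l by (simp add: dyad_def)
  have inc1: "B l \<subseteq> B (Suc l)" for l
  proof
    fix \<omega> assume "\<omega> \<in> B l"
    then obtain i where i: "\<omega> \<in> space M" "i \<le> T * 2 ^ l" "2 * c < norm (Y (Suc n) (dyad l i) \<omega> - Y n (dyad l i) \<omega>)"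
      by (auto simp: B_def)
    have "dyad (Suc l) (2 * i) = dyad l i" by (simp add: dyad_def)
    then show "\<omega> \<in> B (Suc l)" using i by (auto simp: B_def intro!: exI[of _ "2 * i"])
  qed
  then have inc: "incseq B" by (rule incseq_SucI)
  have Bs: "B l \<in> sets M" for l
  proof -
    have [measurable]: "Y k (dyad l i) \<in> borel_measurable M" for k i
      using adapted_L2_square_integrable[OF Y_adapted[OF dyad_nonneg]] by (rule square_integrable_measurable)
    show ?thesis unfolding B_def by measurable
  qed
  then show "(\<Union>l. B l) \<in> sets M" by auto
  have "prob (B l) \<le> deviation_const T / 2 ^ n / c\<^sup>2" for l
  proof -
    have "prob (B l) \<le> prob (B (max l (Suc n)))"
      using inc by (intro finite_measure_mono Bs) (auto simp: incseq_def)
    also have "\<dots> \<le> deviation_const T / 2 ^ n / c\<^sup>2"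
      unfolding B_def by (rule grid_deviation(2)[OF _ gN c]) simp
    finally show ?thesis .
  qed
  moreover have "(\<lambda>l. prob (B l)) \<longlonglongrightarrow> prob (\<Union>l. B l)"
    using Bs inc by (intro finite_Lim_measure_incseq) auto
  ultimately show "prob (\<Union>l. B l) \<le> deviation_const T / 2 ^ n / c\<^sup>2"
    by (intro LIMSEQ_le_const2) auto
qed

text \<open>The scheme stopped at \<open>t\<close>: cells beyond \<open>t\<close> contribute
  nothing. This form gives continuity in \<open>t\<close> and exposes the stochastic sum contained
  in the scheme.\<close>

lemma Y_sum:
  assumes "0 \<le> t"
  shows "Y n (min (dyad n J) t) \<omega> = \<xi> \<omega> + (\<Sum>j<J. (min (dyad n (Suc j)) t - min (dyad n j) t) *\<^sub>R (A *v x n j \<omega>)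
     + (W (min (dyad n (Suc j)) t) \<omega> - W (min (dyad n j) t) \<omega>) *\<^sub>R (C *v x n j \<omega>))"
proof (induction J)
  case 0 then show ?case using assms Y_dyad[of n 0 \<omega>] by (simp add: min_def)
next
  case (Suc J)
  show ?case
  proof (cases "t \<le> dyad n J")
    case True
    moreover have "dyad n J \<le> dyad n (Suc J)" by (simp add: dyad_Suc)
    ultimately have "min (dyad n (Suc J)) t = t" "min (dyad n J) t = t" by auto
    then show ?thesis using Suc by simp
  next
    case False
    then have J: "min (dyad n J) t = dyad n J" by simp
    have "Y n (min (dyad n (Suc J)) t) \<omega> = Y n (dyad n J) \<omega> + (min (dyad n (Suc J)) t - dyad n J) *\<^sub>R (A *v left_value n (dyad n J) \<omega>)
      + (W (min (dyad n (Suc J)) t) \<omega> - W (dyad n J) \<omega>) *\<^sub>R (C *v left_value n (dyad n J) \<omega>)"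
      using False by (intro Y_increment) (auto simp: dyad_Suc)
    then show ?thesis using Suc J by (simp add: left_value_dyad)
  qed
qed

lemma Y_continuous:
  assumes "continuous_on {0..} (\<lambda>t. W t \<omega>)"
  shows "continuous_on {0..real T} (\<lambda>t. Y n t \<omega>)"
proof -
  let ?f = "\<lambda>t. \<xi> \<omega> + (\<Sum>j<T * 2 ^ n. (min (dyad n (Suc j)) t - min (dyad n j) t) *\<^sub>R (A *v x n j \<omega>)
     + (W (min (dyad n (Suc j)) t) \<omega> - W (min (dyad n j) t) \<omega>) *\<^sub>R (C *v x n j \<omega>))"
  have w: "continuous_on {0..real T} (\<lambda>t. W (min a t) \<omega>)" if "0 \<le> a" for a
    by (rule continuous_on_compose2[OF assms]) (use that in \<open>auto intro!: continuous_intros\<close>)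
  have "continuous_on {0..real T} ?f"
    by (intro continuous_on_add continuous_on_const continuous_on_sum continuous_on_scaleR
      continuous_on_diff w continuous_on_min continuous_on_id) auto
  moreover have "?f t = Y n t \<omega>" if "t \<in> {0..real T}" for t
    using Y_sum[of t n "T * 2 ^ n" \<omega>] that by (simp add: dyad_def min_absorb2)
  ultimately show ?thesis by (rule continuous_on_eq)
qed

text \<open>Borel-Cantelli bounds consecutive differences at all dyadic times for all but finitely
  many \<open>n\<close>; continuity of the paths extends the bound from dyadic times to the whole
  interval.\<close>

lemma Y_deviation:
  fixes T :: nat
  shows "AE \<omega> in M. \<forall>\<^sub>F n in sequentially. \<forall>t\<in>{0..real T}. norm (Y (Suc n) t \<omega> - Y n t \<omega>) \<le> 2 * (4/5) ^ n"
proof -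
  \<comment> \<open>The ratio \<open>4/5\<close> serves two series: the thresholds
    \<open>(4/5) ^ n\<close> are summable, and the probabilities, of order \<open>1 / 2 ^ n\<close>
    divided by the squared threshold, are bounded by a multiple of \<open>(25/32) ^ n\<close>. Any
    ratio below 1 whose square exceeds 1/2 would do.\<close>
  define B where "B n l = {\<omega> \<in> space M. \<exists>i\<le>T * 2 ^ l. 2 * (4/5) ^ n < norm (Y (Suc n) (dyad l i) \<omega> - Y n (dyad l i) \<omega>)}" for n l
  have d: "(\<Union>l. B n l) \<in> sets M" "prob (\<Union>l. B n l) \<le> deviation_const T / 2 ^ n / ((4/5) ^ n)\<^sup>2" for n
    unfolding B_def by (rule dyadic_deviation; simp)+
  have e: "deviation_const T / 2 ^ n / ((4/5) ^ n)\<^sup>2 = deviation_const T * (25/32) ^ n" for n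
  proof -
    have "(2::real) ^ n * ((4/5) ^ n)\<^sup>2 = (32/25) ^ n"
      by (simp add: power2_eq_square flip: power_mult_distrib)
    then have "deviation_const T / 2 ^ n / ((4/5) ^ n)\<^sup>2 = deviation_const T / (32/25) ^ n" by (simp add: divide_divide_eq_left)
    then show ?thesis by (simp add: power_divide)
  qed
  have "summable (\<lambda>n. prob (\<Union>l. B n l))"
  proof (rule summable_comparison_test')
    show "summable (\<lambda>n. deviation_const T * (25/32) ^ n)" by (intro summable_mult summable_geometric) simp
    show "norm (prob (\<Union>l. B n l)) \<le> deviation_const T * (25/32) ^ n" for n
      using d(2)[of n] unfolding e by simp
  qed
  then have "AE \<omega> in M. \<forall>\<^sub>F n in sequentially. \<omega> \<in> space M - (\<Union>l. B n l)"
    using d(1) by (intro borel_cantelli_AE1) (auto simp: emeasure_eq_measure)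
  with W_continuous show ?thesis
  proof eventually_elim
    case (elim \<omega>)
    show ?case using elim(2)
    proof eventually_elim
      case (elim n)
      have dy: "norm (Y (Suc n) (dyad l i) \<omega> - Y n (dyad l i) \<omega>) \<le> 2 * (4/5) ^ n" if "i \<le> T * 2 ^ l" for l i
        using elim that by (auto simp: B_def not_less)
      show ?case
      proof
        fix t assume t: "t \<in> {0..real T}"
        have c: "continuous_on {0..real T} (\<lambda>t. norm (Y (Suc n) t \<omega> - Y n t \<omega>))"
          by (intro continuous_on_norm continuous_on_diff Y_continuous \<open>continuous_on {0..} (\<lambda>t. W t \<omega>)\<close>)
        have b: "dyad l (dyad_index l t) \<le> t" "t \<le> dyad l (dyad_index l t) + 1 / 2 ^ l" for l
          using dyad_index_le[of t l] less_dyad_index[of t l] t by (auto simp: dyad_Suc)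
        have i: "dyad_index l t \<le> T * 2 ^ l" for l
        proof -
          have "t * 2 ^ l \<le> real T * 2 ^ l" using t by (intro mult_right_mono) auto
          then have "t * 2 ^ l \<le> real (T * 2 ^ l)" by simp
          from floor_mono[OF this] have "\<lfloor>t * 2 ^ l\<rfloor> \<le> int (T * 2 ^ l)" by (simp only: floor_of_nat)
          then show ?thesis by (simp add: dyad_index_def nat_le_iff)
        qed
        have "(\<lambda>l. dyad l (dyad_index l t)) \<longlonglongrightarrow> t"
        proof (rule tendsto_sandwich[OF _ _ _ tendsto_const])
          have "(\<lambda>l. t - (1/2) ^ l) \<longlonglongrightarrow> t - 0" by (intro tendsto_intros LIMSEQ_power_zero) simp
          then show "(\<lambda>l. t - (1/2) ^ l) \<longlonglongrightarrow> t" by simp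
          show "\<forall>\<^sub>F l in sequentially. t - (1/2) ^ l \<le> dyad l (dyad_index l t)"
          proof (rule always_eventually, rule allI)
            fix l show "t - (1/2) ^ l \<le> dyad l (dyad_index l t)" using b(2)[of l] unfolding power_one_over by linarith
          qed
        qed (use b(1) in auto)
        then have "(\<lambda>l. norm (Y (Suc n) (dyad l (dyad_index l t)) \<omega> - Y n (dyad l (dyad_index l t)) \<omega>)) \<longlonglongrightarrow> norm (Y (Suc n) t \<omega> - Y n t \<omega>)"
          using b(1) t by (intro continuous_on_tendsto_compose[OF c _ t]) (auto intro!: always_eventually intro: order_trans)
        then show "norm (Y (Suc n) t \<omega> - Y n t \<omega>) \<le> 2 * (4/5) ^ n"
          by (rule LIMSEQ_le_const2) (use dy i in auto)
      qed
    qed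
  qed
qed

text \<open>The pointwise \<open>lim\<close>, with an unspecified value where the scheme diverges;
  taken this way \<open>X t\<close> is measurable for \<open>F t\<close> without any correction on a
  null set.\<close>

definition X :: "real \<Rightarrow> 'a \<Rightarrow> real^'n" where
  "X t \<omega> = lim (\<lambda>n. Y n t \<omega>)"

text \<open>The scheme is telescoped from \<open>Y 0\<close>; the geometric bounds hold for all
  large \<open>n\<close>, so Weierstrass's test applies along almost every path.\<close>

lemma Y_uniform_limit:
  "AE \<omega> in M. \<forall>T::nat. uniform_limit {0..real T} (\<lambda>n t. Y n t \<omega>) (\<lambda>t. X t \<omega>) sequentially"
proof (subst AE_all_countable, rule allI)
  fix T :: nat
  show "AE \<omega> in M. uniform_limit {0..real T} (\<lambda>n t. Y n t \<omega>) (\<lambda>t. X t \<omega>) sequentially"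
    using Y_deviation[of T]
  proof eventually_elim
    case (elim \<omega>)
    have "summable (\<lambda>n. 2 * (4/5 :: real) ^ n)" by (intro summable_mult summable_geometric) simp
    from Weierstrass_m_test_ev[OF elim this]
    have "uniform_limit {0..real T} (\<lambda>n t. \<Sum>i<n. Y (Suc i) t \<omega> - Y i t \<omega>) (\<lambda>t. \<Sum>i. Y (Suc i) t \<omega> - Y i t \<omega>) sequentially"
      by simp
    then have *: "uniform_limit {0..real T} (\<lambda>n t. (\<Sum>i<n. Y (Suc i) t \<omega> - Y i t \<omega>) + Y 0 t \<omega>) (\<lambda>t. (\<Sum>i. Y (Suc i) t \<omega> - Y i t \<omega>) + Y 0 t \<omega>) sequentially"
      by (intro uniform_limit_intros)
    have u: "uniform_limit {0..real T} (\<lambda>n t. Y n t \<omega>) (\<lambda>t. (\<Sum>i. Y (Suc i) t \<omega> - Y i t \<omega>) + Y 0 t \<omega>) sequentially"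
    proof -
      have "(\<Sum>i<n. Y (Suc i) t \<omega> - Y i t \<omega>) + Y 0 t \<omega> = Y n t \<omega>" for n t
        by (induction n) (simp_all add: add_diff_eq)
      then show ?thesis using * by (simp only:)
    qed
    moreover have "(\<Sum>i. Y (Suc i) t \<omega> - Y i t \<omega>) + Y 0 t \<omega> = X t \<omega>" if "t \<in> {0..real T}" for t
      using tendsto_uniform_limitI[OF u that] unfolding X_def by (simp add: limI)
    ultimately show ?case by (subst uniform_limit_cong'[where g="\<lambda>n t. Y n t \<omega>"]) auto
  qed
qed

end

lemma dyad_le_Suc: "dyad n j \<le> dyad n (Suc j)"
  by (simp add: dyad_Suc)

section \<open>The limit of the Euler scheme solves the equation\<close>

context linear_sde
begin

definition good_path :: "'a \<Rightarrow> bool" where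
  "good_path \<omega> \<longleftrightarrow> (\<forall>T::nat. uniform_limit {0..real T} (\<lambda>n t. Y n t \<omega>) (\<lambda>t. X t \<omega>) sequentially)
     \<and> continuous_on {0..} (\<lambda>t. W t \<omega>)"

lemma AE_good_path: "AE \<omega> in M. good_path \<omega>"
  using Y_uniform_limit W_continuous by eventually_elim (simp add: good_path_def)

lemma good_path_lim:
  assumes "good_path \<omega>" "0 \<le> t" shows "(\<lambda>n. Y n t \<omega>) \<longlonglongrightarrow> X t \<omega>"
proof -
  have "uniform_limit {0..real (nat \<lceil>t\<rceil>)} (\<lambda>n t. Y n t \<omega>) (\<lambda>t. X t \<omega>) sequentially"
    using assms(1) by (simp add: good_path_def)
  moreover have "t \<in> {0..real (nat \<lceil>t\<rceil>)}" using assms(2) by simp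
  ultimately show ?thesis by (rule tendsto_uniform_limitI)
qed

lemma good_path_continuous_nat:
  assumes "good_path \<omega>" shows "continuous_on {0..real T} (\<lambda>t. X t \<omega>)"
  by (rule uniform_limit_theorem[where f="\<lambda>n t. Y n t \<omega>" and F=sequentially])
    (use assms Y_continuous in \<open>auto simp: good_path_def\<close>)

lemma good_path_continuous:
  assumes "good_path \<omega>" shows "continuous_on {0..} (\<lambda>t. X t \<omega>)"
proof (rule continuous_on_atLeastI)
  fix t :: real
  have "t \<le> real (nat \<lceil>t\<rceil>)" by linarith
  then show "continuous_on {0..t} (\<lambda>t. X t \<omega>)"
    by (intro continuous_on_subset[OF good_path_continuous_nat[OF assms, of "nat \<lceil>t\<rceil>"]]) auto
qed

text \<open>A frozen value is the scheme at the left end of the cell, a point within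
  \<open>1 / 2 ^ n\<close>; uniform continuity of the limit path absorbs this shift of time.\<close>

lemma good_path_left_value_uniform:
  assumes g: "good_path \<omega>"
  shows "uniform_limit {0..real T} (\<lambda>n t. left_value n t \<omega>) (\<lambda>t. X t \<omega>) sequentially"
proof (rule uniform_limitI)
  fix e :: real assume e: "e > 0"
  have "uniformly_continuous_on {0..real T} (\<lambda>t. X t \<omega>)"
    by (intro compact_uniformly_continuous good_path_continuous_nat g) simp
  then obtain d where d: "d > 0" "\<And>s t. s \<in> {0..real T} \<Longrightarrow> t \<in> {0..real T} \<Longrightarrow> dist s t < d \<Longrightarrow> dist (X s \<omega>) (X t \<omega>) < e / 2"
    unfolding uniformly_continuous_on_def using e by (metis half_gt_zero)
  have "\<forall>\<^sub>F n in sequentially. (1/2::real) ^ n < d"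
    using LIMSEQ_power_zero[of "1/2::real"] d(1) by (intro order_tendstoD(2)[of _ 0]) auto
  moreover have "\<forall>\<^sub>F n in sequentially. \<forall>t\<in>{0..real T}. dist (Y n t \<omega>) (X t \<omega>) < e / 2"
    using g e unfolding good_path_def by (intro uniform_limitD) auto
  ultimately show "\<forall>\<^sub>F n in sequentially. \<forall>t\<in>{0..real T}. dist (left_value n t \<omega>) (X t \<omega>) < e"
  proof eventually_elim
    case (elim n)
    show ?case
    proof
      fix t assume t: "t \<in> {0..real T}"
      let ?s = "dyad n (dyad_index n t)"
      have "?s \<le> t" "t < ?s + 1 / 2 ^ n"
        using t dyad_index_le[of t n] less_dyad_index[of t n] by (auto simp: dyad_Suc)
      then have s: "?s \<in> {0..real T}" "dist ?s t < d"
        using t elim(1) by (auto simp: dist_real_def power_one_over intro: order_trans)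
      have "left_value n t \<omega> = Y n ?s \<omega>" by (simp add: Y_dyad left_value_def)
      then have "dist (left_value n t \<omega>) (X ?s \<omega>) < e / 2" using elim(2) s(1) by simp
      moreover have "dist (X ?s \<omega>) (X t \<omega>) < e / 2" by (rule d(2)[OF s(1) t s(2)])
      ultimately show "dist (left_value n t \<omega>) (X t \<omega>) < e"
        using dist_triangle[of "left_value n t \<omega>" "X t \<omega>" "X ?s \<omega>"] by linarith
    qed
  qed
qed

lemma good_path_left_value_lim:
  assumes "good_path \<omega>" "0 \<le> t" shows "(\<lambda>n. left_value n t \<omega>) \<longlonglongrightarrow> X t \<omega>"
  using tendsto_uniform_limitI[OF good_path_left_value_uniform[OF assms(1), of "nat \<lceil>t\<rceil>"], of t] assms(2) by simp

lemma X_adapted: "0 \<le> t \<Longrightarrow> X t \<in> borel_measurable (F t)"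
  unfolding X_def[abs_def] using Y_adapted
  by (intro borel_measurable_lim_metric) (auto simp: adapted_L2_def)

definition mesh_size :: "nat \<Rightarrow> real \<Rightarrow> nat" where "mesh_size n t = nat \<lceil>t\<rceil> * 2 ^ n"
definition mesh :: "nat \<Rightarrow> real \<Rightarrow> nat \<Rightarrow> real" where "mesh n t j = min (dyad n j) t"
definition mesh_coeff :: "real^'n^'n \<Rightarrow> nat \<Rightarrow> real \<Rightarrow> nat \<Rightarrow> 'a \<Rightarrow> real^'n" where
  "mesh_coeff G n t j = (if dyad n j \<le> t then (\<lambda>\<omega>. G *v x n j \<omega>) else (\<lambda>_. 0))"

lemma dyad_mesh_size: "t \<le> dyad n (mesh_size n t)"
proof -
  have "dyad n (mesh_size n t) = real (nat \<lceil>t\<rceil>)" by (simp add: dyad_def mesh_size_def)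
  then show ?thesis by linarith
qed

lemma mesh_simple_integrand:
  assumes t: "0 \<le> t"
  shows "simple_integrand M F t (mesh_size n t) (mesh n t) (mesh_coeff G n t)"
  unfolding simple_integrand_def
proof (intro conjI allI impI)
  show "mesh n t 0 = 0" using t by (simp add: mesh_def)
  show "mesh n t (mesh_size n t) = t" using dyad_mesh_size[of t n] by (simp add: mesh_def)
  fix i
  show "mesh n t i \<le> mesh n t (Suc i)" by (simp add: mesh_def dyad_Suc min_le_iff_disj)
  have "adapted_L2 (mesh n t i) (mesh_coeff G n t i)"
    unfolding mesh_coeff_def mesh_def by (auto intro: adapted_L2_matrix x_adapted adapted_L2_zero simp: min_absorb1)
  moreover have "0 \<le> mesh n t i" using t by (simp add: mesh_def)
  ultimately show "mesh_coeff G n t i \<in> borel_measurable (F (mesh n t i))" "integrable M (\<lambda>\<omega>. (norm (mesh_coeff G n t i \<omega>))\<^sup>2)"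
    by (auto simp: adapted_L2_iff)
qed

text \<open>Simple processes are constant on left-open cells, frozen values on right-open ones. The
  two differ only at grid points, a null set of times.\<close>

lemma mesh_process_eq:
  assumes s: "0 < s" "s \<le> t" and nd: "\<And>j. s \<noteq> dyad n j"
  shows "simple_process (mesh_size n t) (mesh n t) (mesh_coeff G n t) s \<omega> = G *v left_value n s \<omega>"
proof -
  have b: "dyad n (dyad_index n s) < s" "s < dyad n (Suc (dyad_index n s))"
    using dyad_index_le[of s n] less_dyad_index[of s n] s nd[of "dyad_index n s"] by auto
  have "dyad_index n s < mesh_size n t"
  proof -
    have "dyad n (dyad_index n s) < dyad n (mesh_size n t)" using b(1) s dyad_mesh_size[of t n] by linarith
    then show ?thesis by (simp add: dyad_def divide_less_cancel)
  qed
  moreover have "indicator {mesh n t i<..mesh n t (Suc i)} s *\<^sub>R mesh_coeff G n t i \<omega>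
      = (if i = dyad_index n s then G *v left_value n s \<omega> else 0)" for i
  proof (cases "i = dyad_index n s")
    case True
    then show ?thesis using b s by (auto simp: mesh_def mesh_coeff_def left_value_def indicator_def)
  next
    case False
    have "\<not> (dyad n i < s \<and> s \<le> dyad n (Suc i))"
    proof
      assume "dyad n i < s \<and> s \<le> dyad n (Suc i)"
      moreover have "s \<noteq> dyad n (Suc i)" by (rule nd)
      ultimately have "dyad_index n s = i" by (intro index_eqI) auto
      then show False using False by simp
    qed
    then show ?thesis using False s by (auto simp: mesh_def indicator_def)
  qed
  ultimately show ?thesis by (simp add: simple_process_def)
qed

lemma mesh_process_outside: "0 \<le> t \<Longrightarrow> \<not> (0 < s \<and> s \<le> t) \<Longrightarrow> simple_process (mesh_size n t) (mesh n t) (mesh_coeff G n t) s \<omega> = 0"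
  unfolding simple_process_def
proof (rule sum.neutral, rule ballI)
  fix i assume t: "0 \<le> t" and n: "\<not> (0 < s \<and> s \<le> t)"
  have "0 \<le> mesh n t i" "mesh n t (Suc i) \<le> t" using t by (auto simp: mesh_def)
  then show "indicator {mesh n t i<..mesh n t (Suc i)} s *\<^sub>R mesh_coeff G n t i \<omega> = 0"
    using n by (auto simp: indicator_def)
qed

lemma AE_nondyadic: "AE s in lborel. \<forall>n j. s \<noteq> dyad n j"
proof -
  have "AE s in lborel. s \<notin> range (\<lambda>(n, j). dyad n j)"
    by (intro AE_not_in countable_imp_null_set_lborel) auto
  then show ?thesis by eventually_elim auto
qed

lemma path_bound:
  fixes U :: "real \<Rightarrow> 'a \<Rightarrow> 'v::euclidean_space"
  assumes m: "(\<lambda>(\<omega>, s). U s \<omega>) \<in> borel_measurable path_measure" and t: "0 \<le> t" and K: "0 \<le> K"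
    and out: "\<And>s \<omega>. s \<notin> {0..t} \<Longrightarrow> U s \<omega> = 0"
    and b: "AE s in lborel. s \<in> {0..t} \<longrightarrow> (\<integral>\<^sup>+\<omega>. ennreal ((norm (U s \<omega>))\<^sup>2) \<partial>M) \<le> ennreal K"
  shows "(\<integral>\<^sup>+(\<omega>, s). ennreal ((norm (U s \<omega>))\<^sup>2) \<partial>path_measure) \<le> ennreal (K * t)"
proof -
  interpret P: pair_sigma_finite M lborel by (rule pair_sigma_finite_path)
  have m': "(\<lambda>x. ennreal ((norm (case x of (\<omega>, s) \<Rightarrow> U s \<omega>))\<^sup>2)) \<in> borel_measurable path_measure"
    using m by measurable
  have "(\<integral>\<^sup>+(\<omega>, s). ennreal ((norm (U s \<omega>))\<^sup>2) \<partial>path_measure) = (\<integral>\<^sup>+s. (\<integral>\<^sup>+\<omega>. ennreal ((norm (U s \<omega>))\<^sup>2) \<partial>M) \<partial>lborel)"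
    using P.nn_integral_snd[OF m'] by (simp add: split_beta')
  also have "\<dots> \<le> (\<integral>\<^sup>+s. ennreal K * indicator {0..t} s \<partial>lborel)"
    by (rule nn_integral_mono_AE, use b in eventually_elim) (auto simp: out indicator_def)
  also have "\<dots> = ennreal (K * t)"
    using t K by (simp add: nn_integral_cmult_indicator ennreal_mult)
  finally show ?thesis .
qed

text \<open>Fatou's lemma is applied first in time along almost every path and then over the paths.
  The limit process is identified only almost everywhere, so its integral is kept in iterated
  form.\<close>

lemma path_Fatou:
  fixes U :: "real \<Rightarrow> 'a \<Rightarrow> 'v::euclidean_space"
  assumes m: "\<And>k. (\<lambda>(\<omega>, s). V k s \<omega>) \<in> borel_measurable path_measure"
    and l: "AE \<omega> in M. AE s in lborel. (\<lambda>k. V k s \<omega>) \<longlonglongrightarrow> U s \<omega>"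
    and b: "\<forall>\<^sub>F k in sequentially. (\<integral>\<^sup>+(\<omega>, s). ennreal ((norm (V k s \<omega>))\<^sup>2) \<partial>path_measure) \<le> K"
  shows "(\<integral>\<^sup>+\<omega>. (\<integral>\<^sup>+s. ennreal ((norm (U s \<omega>))\<^sup>2) \<partial>lborel) \<partial>M) \<le> K"
proof -
  have m': "(\<lambda>x. ennreal ((norm (case x of (\<omega>, s) \<Rightarrow> V k s \<omega>))\<^sup>2)) \<in> borel_measurable path_measure" for k
    using m[of k] by measurable
  have ms: "(\<lambda>s. ennreal ((norm (V k s \<omega>))\<^sup>2)) \<in> borel_measurable lborel" if "\<omega> \<in> space M" for k \<omega>
    using measurable_Pair2[OF m'[of k] that] by simp
  have mo: "(\<lambda>\<omega>. \<integral>\<^sup>+s. ennreal ((norm (V k s \<omega>))\<^sup>2) \<partial>lborel) \<in> borel_measurable M" for k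
    using lborel.borel_measurable_nn_integral_fst[OF m'[of k]] by simp
  have "(\<integral>\<^sup>+\<omega>. (\<integral>\<^sup>+s. ennreal ((norm (U s \<omega>))\<^sup>2) \<partial>lborel) \<partial>M)
     \<le> (\<integral>\<^sup>+\<omega>. liminf (\<lambda>k. \<integral>\<^sup>+s. ennreal ((norm (V k s \<omega>))\<^sup>2) \<partial>lborel) \<partial>M)"
  proof (rule nn_integral_mono_AE)
    show "AE \<omega> in M. (\<integral>\<^sup>+s. ennreal ((norm (U s \<omega>))\<^sup>2) \<partial>lborel) \<le> liminf (\<lambda>k. \<integral>\<^sup>+s. ennreal ((norm (V k s \<omega>))\<^sup>2) \<partial>lborel)"
      using l AE_space
    proof eventually_elim
      case (elim \<omega>)
      have "(\<integral>\<^sup>+s. ennreal ((norm (U s \<omega>))\<^sup>2) \<partial>lborel) = (\<integral>\<^sup>+s. liminf (\<lambda>k. ennreal ((norm (V k s \<omega>))\<^sup>2)) \<partial>lborel)"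
      proof (rule nn_integral_cong_AE, use elim(1) in eventually_elim)
        case (elim s)
        have "(\<lambda>k. ennreal ((norm (V k s \<omega>))\<^sup>2)) \<longlonglongrightarrow> ennreal ((norm (U s \<omega>))\<^sup>2)"
          by (intro tendsto_ennrealI tendsto_intros elim)
        then show ?case by (rule lim_imp_Liminf[symmetric, rotated]) simp
      qed
      also have "\<dots> \<le> liminf (\<lambda>k. \<integral>\<^sup>+s. ennreal ((norm (V k s \<omega>))\<^sup>2) \<partial>lborel)"
        by (rule nn_integral_liminf) (rule ms[OF elim(2)])
      finally show ?case .
    qed
  qed
  also have "\<dots> \<le> liminf (\<lambda>k. \<integral>\<^sup>+\<omega>. \<integral>\<^sup>+s. ennreal ((norm (V k s \<omega>))\<^sup>2) \<partial>lborel \<partial>M)"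
    by (rule nn_integral_liminf) (rule mo)
  also have "\<dots> \<le> K"
  proof (rule Liminf_le)
    show "\<forall>\<^sub>F k in sequentially. (\<integral>\<^sup>+\<omega>. \<integral>\<^sup>+s. ennreal ((norm (V k s \<omega>))\<^sup>2) \<partial>lborel \<partial>M) \<le> K"
      using b lborel.nn_integral_fst[OF m'] by (simp add: split_beta')
  qed simp
  finally show ?thesis .
qed

abbreviation mesh_process :: "real^'n^'n \<Rightarrow> nat \<Rightarrow> real \<Rightarrow> real \<Rightarrow> 'a \<Rightarrow> real^'n" where
  "mesh_process G n t \<equiv> simple_process (mesh_size n t) (mesh n t) (mesh_coeff G n t)"

lemma mesh_process_measurable: "0 \<le> t \<Longrightarrow> (\<lambda>(\<omega>, s). mesh_process G n t s \<omega>) \<in> borel_measurable path_measure"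
  by (rule square_integrable_measurable[OF simple_process_square_integrable[OF mesh_simple_integrand]])

lemma nn_msq: "square_integrable M f \<Longrightarrow> (\<integral>\<^sup>+\<omega>. ennreal ((norm (f \<omega>))\<^sup>2) \<partial>M) = ennreal (msq f)"
  by (simp add: nn_integral_eq_integral square_integrable_integrable)

lemma mesh_process_bound:
  assumes t: "0 \<le> t"
  shows "(\<integral>\<^sup>+(\<omega>, s). ennreal ((norm (mesh_process G n t s \<omega>))\<^sup>2) \<partial>path_measure) \<le> ennreal ((onorm ((*v) G))\<^sup>2 * msq_bound t * t)"
proof (rule path_bound[OF mesh_process_measurable[OF t] t])
  show "AE s in lborel. s \<in> {0..t} \<longrightarrow> (\<integral>\<^sup>+\<omega>. ennreal ((norm (mesh_process G n t s \<omega>))\<^sup>2) \<partial>M) \<le> ennreal ((onorm ((*v) G))\<^sup>2 * msq_bound t)"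
    using AE_nondyadic
  proof eventually_elim
    case (elim s)
    show ?case
    proof
      assume s: "s \<in> {0..t}"
      then have s0: "0 < s" using elim[rule_format, of 0 0] by auto
      note SI = adapted_L2_square_integrable[OF left_value_adapted[of s n]]
      have "msq (\<lambda>\<omega>. G *v left_value n s \<omega>) \<le> (onorm ((*v) G))\<^sup>2 * msq (left_value n s)"
        using s by (intro msq_matrix_le SI) auto
      also have "\<dots> \<le> (onorm ((*v) G))\<^sup>2 * msq_bound t"
        using s by (intro mult_left_mono left_value_msq) auto
      finally have "msq (\<lambda>\<omega>. G *v left_value n s \<omega>) \<le> (onorm ((*v) G))\<^sup>2 * msq_bound t" .
      moreover have "mesh_process G n t s = (\<lambda>\<omega>. G *v left_value n s \<omega>)"
        using mesh_process_eq[OF s0, of t n G] s elim by auto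
      ultimately show "(\<integral>\<^sup>+\<omega>. ennreal ((norm (mesh_process G n t s \<omega>))\<^sup>2) \<partial>M) \<le> ennreal ((onorm ((*v) G))\<^sup>2 * msq_bound t)"
        using s by (simp add: nn_msq square_integrable_linear[OF matrix_vector_mul_bounded_linear SI] ennreal_leI)
    qed
  qed
qed (use t mesh_process_outside msq_bound_nonneg in auto)

lemma mesh_process_diff_bound:
  assumes t: "0 \<le> t" and nm: "n \<le> m"
  shows "(\<integral>\<^sup>+(\<omega>, s). ennreal ((norm (mesh_process G m t s \<omega> - mesh_process G n t s \<omega>))\<^sup>2) \<partial>path_measure)
    \<le> ennreal ((onorm ((*v) G))\<^sup>2 * (diff_const t / 2 ^ n) * t)"
proof (rule path_bound)
  show "(\<lambda>(\<omega>, s). mesh_process G m t s \<omega> - mesh_process G n t s \<omega>) \<in> borel_measurable path_measure"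
    using borel_measurable_diff[OF mesh_process_measurable[OF t, where G=G and n=m] mesh_process_measurable[OF t, where G=G and n=n]] by (simp add: split_beta')
  show "AE s in lborel. s \<in> {0..t} \<longrightarrow> (\<integral>\<^sup>+\<omega>. ennreal ((norm (mesh_process G m t s \<omega> - mesh_process G n t s \<omega>))\<^sup>2) \<partial>M) \<le> ennreal ((onorm ((*v) G))\<^sup>2 * (diff_const t / 2 ^ n))"
    using AE_nondyadic
  proof eventually_elim
    case (elim s)
    show ?case
    proof
      assume s: "s \<in> {0..t}"
      then have s0: "0 < s" using elim[rule_format, of 0 0] by auto
      let ?d = "\<lambda>\<omega>. left_value m s \<omega> - left_value n s \<omega>"
      have SI: "square_integrable M ?d"
        using s by (intro square_integrable_diff adapted_L2_square_integrable[OF left_value_adapted]) auto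
      have "msq (\<lambda>\<omega>. G *v ?d \<omega>) \<le> (onorm ((*v) G))\<^sup>2 * msq ?d"
        by (intro msq_matrix_le SI)
      also have "\<dots> \<le> (onorm ((*v) G))\<^sup>2 * (diff_const t / 2 ^ n)"
        using s by (intro mult_left_mono left_value_compare nm) auto
      finally have "msq (\<lambda>\<omega>. G *v ?d \<omega>) \<le> (onorm ((*v) G))\<^sup>2 * (diff_const t / 2 ^ n)" .
      moreover have "mesh_process G m t s \<omega> - mesh_process G n t s \<omega> = G *v ?d \<omega>" for \<omega>
        using mesh_process_eq[OF s0, of t m G] mesh_process_eq[OF s0, of t n G] s elim by (simp add: matrix_vector_mult_diff_distrib)
      ultimately show "(\<integral>\<^sup>+\<omega>. ennreal ((norm (mesh_process G m t s \<omega> - mesh_process G n t s \<omega>))\<^sup>2) \<partial>M) \<le> ennreal ((onorm ((*v) G))\<^sup>2 * (diff_const t / 2 ^ n))"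
        by (simp add: nn_msq square_integrable_linear[OF matrix_vector_mul_bounded_linear SI] ennreal_leI)
    qed
  qed
qed (use t mesh_process_outside diff_const_nonneg in auto)

lemma mesh_process_lim:
  assumes "good_path \<omega>" and t: "0 \<le> t"
  shows "AE s in lborel. (\<lambda>n. mesh_process G n t s \<omega>) \<longlonglongrightarrow> indicator {0..t} s *\<^sub>R (G *v X s \<omega>)"
  using AE_nondyadic
proof eventually_elim
  case (elim s)
  show ?case
  proof (cases "0 < s \<and> s \<le> t")
    case True
    have "(\<lambda>n. G *v left_value n s \<omega>) \<longlonglongrightarrow> G *v X s \<omega>"
      using good_path_left_value_lim[OF assms(1), of s] True
      by (intro bounded_linear.tendsto[OF matrix_vector_mul_bounded_linear]) auto
    then show ?thesis using mesh_process_eq[of s t _ G \<omega>] True elim by simp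
  next
    case False
    moreover have "s \<noteq> 0" using elim[rule_format, of 0 0] by simp
    ultimately show ?thesis using mesh_process_outside[OF t False] by (auto simp: indicator_def)
  qed
qed

lemma X_path_L2:
  assumes t: "0 \<le> t"
  shows "(\<integral>\<^sup>+\<omega>. (\<integral>\<^sup>+s\<in>{0..t}. ennreal ((norm (X s \<omega>))\<^sup>2) \<partial>lborel) \<partial>M) < \<infinity>"
proof -
  have "(\<integral>\<^sup>+\<omega>. (\<integral>\<^sup>+s. ennreal ((norm (indicator {0..t} s *\<^sub>R (mat 1 *v X s \<omega>)))\<^sup>2) \<partial>lborel) \<partial>M)
     \<le> ennreal ((onorm ((*v) (mat 1 :: real^'n^'n)))\<^sup>2 * msq_bound t * t)"
  proof (rule path_Fatou[OF mesh_process_measurable[OF t, where G="mat 1"]])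
    show "AE \<omega> in M. AE s in lborel. (\<lambda>k. mesh_process (mat 1) k t s \<omega>) \<longlonglongrightarrow> indicator {0..t} s *\<^sub>R (mat 1 *v X s \<omega>)"
      using AE_good_path by eventually_elim (rule mesh_process_lim[OF _ t])
  qed (use mesh_process_bound[OF t] in \<open>auto simp: split_beta'\<close>)
  also have "\<dots> < \<infinity>" by simp
  also have "(\<integral>\<^sup>+\<omega>. (\<integral>\<^sup>+s. ennreal ((norm (indicator {0..t} s *\<^sub>R (mat 1 *v X s \<omega>)))\<^sup>2) \<partial>lborel) \<partial>M)
     = (\<integral>\<^sup>+\<omega>. (\<integral>\<^sup>+s\<in>{0..t}. ennreal ((norm (X s \<omega>))\<^sup>2) \<partial>lborel) \<partial>M)"
    by (intro nn_integral_cong) (auto simp: indicator_def)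
  finally show ?thesis .
qed

text \<open>The distance between levels \<open>k\<close> and \<open>n\<close> is bounded uniformly
  in \<open>k\<close>; letting \<open>k\<close> tend to infinity with \<open>n\<close> fixed turns
  it into the distance to the limit.\<close>

lemma mesh_process_X_bound:
  assumes t: "0 \<le> t"
  shows "(\<integral>\<^sup>+\<omega>. (\<integral>\<^sup>+s\<in>{0..t}. ennreal ((norm (mesh_process G n t s \<omega> - G *v X s \<omega>))\<^sup>2) \<partial>lborel) \<partial>M)
    \<le> ennreal ((onorm ((*v) G))\<^sup>2 * (diff_const t / 2 ^ n) * t)"
proof -
  have "(\<integral>\<^sup>+\<omega>. (\<integral>\<^sup>+s. ennreal ((norm (indicator {0..t} s *\<^sub>R (G *v X s \<omega>) - mesh_process G n t s \<omega>))\<^sup>2) \<partial>lborel) \<partial>M)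
     \<le> ennreal ((onorm ((*v) G))\<^sup>2 * (diff_const t / 2 ^ n) * t)"
  proof (rule path_Fatou[where V="\<lambda>k s \<omega>. mesh_process G k t s \<omega> - mesh_process G n t s \<omega>"])
    show "(\<lambda>(\<omega>, s). mesh_process G k t s \<omega> - mesh_process G n t s \<omega>) \<in> borel_measurable path_measure" for k
      using borel_measurable_diff[OF mesh_process_measurable[OF t, where G=G and n=k] mesh_process_measurable[OF t, where G=G and n=n]] by (simp add: split_beta')
    show "AE \<omega> in M. AE s in lborel. (\<lambda>k. mesh_process G k t s \<omega> - mesh_process G n t s \<omega>) \<longlonglongrightarrow> indicator {0..t} s *\<^sub>R (G *v X s \<omega>) - mesh_process G n t s \<omega>"
      using AE_good_path
    proof eventually_elim
      case (elim \<omega>)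
      show ?case using mesh_process_lim[OF elim t, of G] by eventually_elim (intro tendsto_intros)
    qed
    show "\<forall>\<^sub>F k in sequentially. (\<integral>\<^sup>+(\<omega>, s). ennreal ((norm (mesh_process G k t s \<omega> - mesh_process G n t s \<omega>))\<^sup>2) \<partial>path_measure) \<le> ennreal ((onorm ((*v) G))\<^sup>2 * (diff_const t / 2 ^ n) * t)"
      using eventually_ge_at_top[of n] by eventually_elim (rule mesh_process_diff_bound[OF t])
  qed
  also have "(\<integral>\<^sup>+\<omega>. (\<integral>\<^sup>+s. ennreal ((norm (indicator {0..t} s *\<^sub>R (G *v X s \<omega>) - mesh_process G n t s \<omega>))\<^sup>2) \<partial>lborel) \<partial>M)
    = (\<integral>\<^sup>+\<omega>. (\<integral>\<^sup>+s\<in>{0..t}. ennreal ((norm (mesh_process G n t s \<omega> - G *v X s \<omega>))\<^sup>2) \<partial>lborel) \<partial>M)"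
    using mesh_process_outside[OF t] by (intro nn_integral_cong) (auto simp: indicator_def norm_minus_commute)
  finally show ?thesis .
qed

abbreviation mesh_ito :: "nat \<Rightarrow> real \<Rightarrow> 'a \<Rightarrow> real^'n" where
  "mesh_ito n t \<equiv> simple_ito_integral W (mesh_size n t) (mesh n t) (mesh_coeff C n t)"

lemma drift_integral:
  assumes t: "0 \<le> t"
  shows "((\<lambda>s. A *v left_value n s \<omega>) has_integral
     (\<Sum>j<J. (min (dyad n (Suc j)) t - min (dyad n j) t) *\<^sub>R (A *v x n j \<omega>))) {0..min (dyad n J) t}"
proof (induction J)
  case 0
  have "{0..min (dyad n 0) t} = {0}" using t by auto
  then show ?case by (simp add: has_integral_refl)
next
  case (Suc J)
  let ?a = "min (dyad n J) t" and ?b = "min (dyad n (Suc J)) t"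
  have ab: "0 \<le> ?a" "?a \<le> ?b" using t dyad_le_Suc[of n J] by (auto simp: min_def)
  have "((\<lambda>s. A *v x n J \<omega>) has_integral (measure lborel {?a..?b} *\<^sub>R (A *v x n J \<omega>))) {?a..?b}"
    by (rule has_integral_const_real)
  then have "((\<lambda>s. A *v left_value n s \<omega>) has_integral (?b - ?a) *\<^sub>R (A *v x n J \<omega>)) {?a..?b}"
    unfolding content_real[OF ab(2)]
  proof (rule has_integral_spike_finite[of "{?b}", rotated 2])
    fix s assume s: "s \<in> {?a..?b} - {?b}"
    show "A *v left_value n s \<omega> = A *v x n J \<omega>"
    proof (cases "t \<le> dyad n J")
      case True
      then have "?a = ?b" using dyad_le_Suc[of n J] by (simp add: min_def)
      then show ?thesis using s by auto
    next
      case False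
      then have "dyad_index n s = J" using s by (intro index_eqI) auto
      then show ?thesis by (simp add: left_value_def)
    qed
  qed simp
  from has_integral_combine[OF ab Suc this] show ?case by simp
qed

text \<open>The stochastic sum is what remains of the scheme after removal of the initial value and
  the drift integral. Its pathwise convergence therefore follows from uniform convergence of the
  scheme.\<close>

lemma mesh_ito_eq:
  assumes t: "0 \<le> t"
  shows "mesh_ito n t \<omega> = Y n t \<omega> - \<xi> \<omega> - integral {0..t} (\<lambda>s. A *v left_value n s \<omega>)"
    "(\<lambda>s. A *v left_value n s \<omega>) integrable_on {0..t}"
proof -
  have N: "min (dyad n (mesh_size n t)) t = t" using dyad_mesh_size[of t n] by simp
  have I: "((\<lambda>s. A *v left_value n s \<omega>) has_integral
     (\<Sum>j<mesh_size n t. (min (dyad n (Suc j)) t - min (dyad n j) t) *\<^sub>R (A *v x n j \<omega>))) {0..t}"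
    using drift_integral[OF t, of n \<omega> "mesh_size n t"] unfolding N .
  then show "(\<lambda>s. A *v left_value n s \<omega>) integrable_on {0..t}" by blast
  have "mesh_ito n t \<omega> = (\<Sum>j<mesh_size n t. (W (min (dyad n (Suc j)) t) \<omega> - W (min (dyad n j) t) \<omega>) *\<^sub>R (C *v x n j \<omega>))"
    unfolding simple_ito_integral_def
  proof (rule sum.cong[OF refl])
    fix j
    show "(W (mesh n t (Suc j)) \<omega> - W (mesh n t j) \<omega>) *\<^sub>R mesh_coeff C n t j \<omega>
      = (W (min (dyad n (Suc j)) t) \<omega> - W (min (dyad n j) t) \<omega>) *\<^sub>R (C *v x n j \<omega>)"
    proof (cases "dyad n j \<le> t")
      case False
      then have "min (dyad n (Suc j)) t = t" "min (dyad n j) t = t" using dyad_le_Suc[of n j] by auto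
      then show ?thesis using False by (simp add: mesh_def mesh_coeff_def)
    qed (simp add: mesh_def mesh_coeff_def)
  qed
  then show "mesh_ito n t \<omega> = Y n t \<omega> - \<xi> \<omega> - integral {0..t} (\<lambda>s. A *v left_value n s \<omega>)"
    using Y_sum[OF t, of n "mesh_size n t" \<omega>] integral_unique[OF I] unfolding N by (simp add: sum.distrib)
qed

lemma mesh_ito_lim:
  assumes g: "good_path \<omega>" and t: "0 \<le> t"
  shows "(\<lambda>n. mesh_ito n t \<omega>) \<longlonglongrightarrow> X t \<omega> - \<xi> \<omega> - integral {0..t} (\<lambda>s. A *v X s \<omega>)"
proof -
  have c: "continuous_on {0..t} (\<lambda>s. X s \<omega>)"
    by (rule continuous_on_subset[OF good_path_continuous[OF g]]) auto
  have cA: "continuous_on {0..t} (\<lambda>s. A *v X s \<omega>)"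
    using linear_continuous_on_compose[OF c matrix_vector_mul_linear[of A]] .
  have "(\<lambda>n. integral {0..t} (\<lambda>s. A *v left_value n s \<omega>)) \<longlonglongrightarrow> integral {0..t} (\<lambda>s. A *v X s \<omega>)"
  proof (rule LIMSEQ_I)
    fix e :: real assume e: "e > 0"
    define d where "d = e / (2 * (onorm ((*v) A) + 1) * (t + 1))"
    have o: "0 \<le> onorm ((*v) A)" by (rule onorm_pos_le[OF matrix_vector_mul_bounded_linear])
    have d: "d > 0" using e t o by (auto simp: d_def intro!: divide_pos_pos mult_pos_pos)
    have "\<forall>\<^sub>F n in sequentially. \<forall>s\<in>{0..real (nat \<lceil>t\<rceil>)}. dist (left_value n s \<omega>) (X s \<omega>) < d"
      by (rule uniform_limitD[OF good_path_left_value_uniform[OF g] d])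
    then obtain no where no: "\<And>n s. n \<ge> no \<Longrightarrow> s \<in> {0..real (nat \<lceil>t\<rceil>)} \<Longrightarrow> dist (left_value n s \<omega>) (X s \<omega>) < d"
      unfolding eventually_sequentially by blast
    have "norm (integral {0..t} (\<lambda>s. A *v left_value n s \<omega>) - integral {0..t} (\<lambda>s. A *v X s \<omega>)) < e" if n: "n \<ge> no" for n
    proof -
      have i: "(\<lambda>s. A *v left_value n s \<omega> - A *v X s \<omega>) integrable_on {0..t}"
        by (intro integrable_diff mesh_ito_eq(2) t integrable_continuous_interval cA)
      have "integral {0..t} (\<lambda>s. A *v left_value n s \<omega>) - integral {0..t} (\<lambda>s. A *v X s \<omega>) = integral {0..t} (\<lambda>s. A *v left_value n s \<omega> - A *v X s \<omega>)"
        by (rule Henstock_Kurzweil_Integration.integral_diff[symmetric]) (intro mesh_ito_eq(2) t integrable_continuous_interval cA)+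
      also have "norm \<dots> \<le> integral {0..t} (\<lambda>s. onorm ((*v) A) * d)"
      proof (rule integral_norm_bound_integral[OF i])
        fix s assume s: "s \<in> {0..t}"
        then have "s \<le> real (nat \<lceil>t\<rceil>)" by (simp) linarith
        then have "dist (left_value n s \<omega>) (X s \<omega>) < d" using no[OF n, of s] s by simp
        then have "onorm ((*v) A) * norm (left_value n s \<omega> - X s \<omega>) \<le> onorm ((*v) A) * d"
          using o by (intro mult_left_mono) (auto simp: dist_norm)
        moreover have "norm (A *v (left_value n s \<omega> - X s \<omega>)) \<le> onorm ((*v) A) * norm (left_value n s \<omega> - X s \<omega>)"
          by (rule onorm[OF matrix_vector_mul_bounded_linear])
        ultimately show "norm (A *v left_value n s \<omega> - A *v X s \<omega>) \<le> onorm ((*v) A) * d"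
          by (simp add: matrix_vector_mult_diff_distrib)
      qed auto
      also have "\<dots> = t * (onorm ((*v) A) * d)" using t by simp
      also have "\<dots> \<le> (t + 1) * ((onorm ((*v) A) + 1) * d)"
        using t o d by (intro mult_mono) auto
      also have "\<dots> = e / 2"
      proof -
        have "onorm ((*v) A) + 1 \<noteq> 0" "t + 1 \<noteq> 0" using t o by linarith+
        moreover have "q * (p * (e / (2 * p * q))) = e / 2" if "p \<noteq> 0" "q \<noteq> 0" for p q :: real
          using that by (simp add: field_simps)
        ultimately show ?thesis unfolding d_def by blast
      qed
      also have "\<dots> < e" using e by simp
      finally show ?thesis .
    qed
    then show "\<exists>no. \<forall>n\<ge>no. norm (integral {0..t} (\<lambda>s. A *v left_value n s \<omega>) - integral {0..t} (\<lambda>s. A *v X s \<omega>)) < e" by blast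
  qed
  then show ?thesis unfolding mesh_ito_eq(1)[OF t] by (intro tendsto_diff tendsto_const good_path_lim g t)
qed

text \<open>The integral is defined as the pathwise limit of the mesh sums, hence measurable, and
  almost surely equals what the equation demands. That it is also the mean square limit follows from
  Fatou's lemma together with the isometry for pairs of mesh levels.\<close>

lemma solution_ito:
  assumes t: "0 \<le> t"
  shows "\<exists>I. has_ito_integral M F W t (\<lambda>s \<omega>. C *v X s \<omega>) I \<and>
        (AE \<omega> in M. X t \<omega> = \<xi> \<omega> + integral {0..t} (\<lambda>s. A *v X s \<omega>) + I \<omega>)"
proof -
  define I where "I \<omega> = lim (\<lambda>n. mesh_ito n t \<omega>)" for \<omega>
  note SI = simple_ito_square_integrable[OF mesh_simple_integrand[OF t]]
  have [measurable]: "mesh_ito n t \<in> borel_measurable M" for n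
    by (rule square_integrable_measurable[OF SI])
  have Im: "I \<in> borel_measurable M" unfolding I_def[abs_def] by measurable
  note [measurable] = Im
  have Il: "AE \<omega> in M. (\<lambda>n. mesh_ito n t \<omega>) \<longlonglongrightarrow> I \<omega> \<and> I \<omega> = X t \<omega> - \<xi> \<omega> - integral {0..t} (\<lambda>s. A *v X s \<omega>)"
    using AE_good_path
  proof eventually_elim
    case (elim \<omega>)
    have "I \<omega> = X t \<omega> - \<xi> \<omega> - integral {0..t} (\<lambda>s. A *v X s \<omega>)"
      unfolding I_def by (rule limI[OF mesh_ito_lim[OF elim t]])
    then show ?case using mesh_ito_lim[OF elim t] by simp
  qed
  define q where "q = (\<lambda>n. (onorm ((*v) C))\<^sup>2 * (diff_const t / 2 ^ n) * t)"
  have "(\<lambda>n. (onorm ((*v) C))\<^sup>2 * diff_const t * t * (1/2) ^ n) \<longlonglongrightarrow> (onorm ((*v) C))\<^sup>2 * diff_const t * t * 0"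
    by (rule tendsto_mult_left[OF LIMSEQ_power_zero]) simp
  moreover have "(onorm ((*v) C))\<^sup>2 * diff_const t * t * (1/2) ^ n = q n" for n
    by (simp add: q_def power_one_over)
  ultimately have "q \<longlonglongrightarrow> 0" by simp
  from tendsto_ennrealI[OF this] have q0: "(\<lambda>n. ennreal (q n)) \<longlonglongrightarrow> 0" by simp
  have IL2: "(\<integral>\<^sup>+\<omega>. ennreal ((norm (mesh_ito n t \<omega> - I \<omega>))\<^sup>2) \<partial>M) \<le> ennreal (q n)" for n
  proof -
    have "(\<integral>\<^sup>+\<omega>. ennreal ((norm (mesh_ito n t \<omega> - I \<omega>))\<^sup>2) \<partial>M) = (\<integral>\<^sup>+\<omega>. liminf (\<lambda>m. ennreal ((norm (mesh_ito m t \<omega> - mesh_ito n t \<omega>))\<^sup>2)) \<partial>M)"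
    proof (rule nn_integral_cong_AE, use Il in eventually_elim)
      case (elim \<omega>)
      have "(\<lambda>m. ennreal ((norm (mesh_ito m t \<omega> - mesh_ito n t \<omega>))\<^sup>2)) \<longlonglongrightarrow> ennreal ((norm (I \<omega> - mesh_ito n t \<omega>))\<^sup>2)"
        using elim by (intro tendsto_ennrealI tendsto_intros) auto
      from lim_imp_Liminf[OF _ this] show ?case by (simp add: norm_minus_commute)
    qed
    also have "\<dots> \<le> liminf (\<lambda>m. \<integral>\<^sup>+\<omega>. ennreal ((norm (mesh_ito m t \<omega> - mesh_ito n t \<omega>))\<^sup>2) \<partial>M)"
      by (rule nn_integral_liminf) measurable
    also have "\<dots> \<le> ennreal (q n)"
    proof (rule Liminf_le)
      show "\<forall>\<^sub>F m in sequentially. (\<integral>\<^sup>+\<omega>. ennreal ((norm (mesh_ito m t \<omega> - mesh_ito n t \<omega>))\<^sup>2) \<partial>M) \<le> ennreal (q n)"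
        using eventually_ge_at_top[of n]
      proof eventually_elim
        case (elim m)
        show ?case
          unfolding simple_ito_isometry_diff[OF mesh_simple_integrand[OF t] mesh_simple_integrand[OF t]] q_def
          by (rule mesh_process_diff_bound[OF t elim])
      qed
    qed simp
    finally show ?thesis .
  qed
  have "has_ito_integral M F W t (\<lambda>s \<omega>. C *v X s \<omega>) I"
    unfolding has_ito_integral_def
  proof (intro conjI Im exI allI)
    show "simple_integrand M F t (mesh_size k t) (mesh k t) (mesh_coeff C k t)" for k by (rule mesh_simple_integrand[OF t])
    show "(\<lambda>k. \<integral>\<^sup>+\<omega>. (\<integral>\<^sup>+s\<in>{0..t}. ennreal ((norm (mesh_process C k t s \<omega> - C *v X s \<omega>))\<^sup>2) \<partial>lborel) \<partial>M) \<longlonglongrightarrow> 0"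
      by (rule ennreal_tendsto_0_le[OF _ q0]) (unfold q_def, rule mesh_process_X_bound[OF t])
    show "(\<lambda>k. \<integral>\<^sup>+\<omega>. ennreal ((norm (mesh_ito k t \<omega> - I \<omega>))\<^sup>2) \<partial>M) \<longlonglongrightarrow> 0"
      by (rule ennreal_tendsto_0_le[OF IL2 q0])
  qed
  moreover have "AE \<omega> in M. X t \<omega> = \<xi> \<omega> + integral {0..t} (\<lambda>s. A *v X s \<omega>) + I \<omega>"
    using Il by eventually_elim simp
  ultimately show ?thesis by blast
qed

end

section \<open>Existence of the closed-loop state\<close>

context brownian_basis
begin

lemma closed_loop_solution_exists:
  fixes A C :: "real^'n^'n" and B D :: "real^'m^'n" and K :: "real^'n^'m"
  assumes init: "initial_state M F \<xi>"
  shows "\<exists>X. closed_loop_solution M F W A B C D K \<xi> X"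
proof -
  interpret l: linear_sde M F W "A + B ** K" "C + D ** K" \<xi>
    by standard (rule init)
  have "closed_loop_solution M F W A B C D K \<xi> l.X"
    unfolding closed_loop_solution_def
  proof (intro conjI allI impI)
    show "AE \<omega> in M. continuous_on {0..} (\<lambda>t. l.X t \<omega>)"
      using l.AE_good_path by eventually_elim (rule l.good_path_continuous)
  qed (use l.X_adapted l.X_path_L2 l.solution_ito in auto)
  then show ?thesis by blast
qed

text \<open>Existence makes the choice in \<open>closed_loop_state\<close> a genuine solution, to
  which the moment equation for arbitrary solutions applies.\<close>

lemma closed_loop_state_solution:
  "initial_state M F \<xi> \<Longrightarrow> closed_loop_solution M F W A B C D K \<xi> (closed_loop_state M F W A B C D K \<xi>)"
  unfolding closed_loop_state_def by (rule someI_ex[OF closed_loop_solution_exists])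

end

section \<open>Positive semidefinite matrices\<close>

definition psd :: "real^'n^'n \<Rightarrow> bool" where
  "psd S \<longleftrightarrow> transpose S = S \<and> (\<forall>v. 0 \<le> v \<bullet> (S *v v))"

definition outer :: "real^'n \<Rightarrow> real^'m \<Rightarrow> real^'m^'n" where
  "outer w z = (\<chi> i j. w $ i * z $ j)"

lemma inner_outer: "U \<bullet> outer w z = w \<bullet> (U *v z)"
  by (simp add: outer_def inner_vec_def matrix_vector_mult_def sum_distrib_left mult_ac)

lemma outer_mult: "outer w z *v v = (z \<bullet> v) *\<^sub>R w"
  by (simp add: outer_def vec_eq_iff inner_vec_def matrix_vector_mult_def sum_distrib_left mult_ac)

lemma transpose_outer: "transpose (outer w z) = outer z w"
  by (simp add: outer_def transpose_def vec_eq_iff mult.commute)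

lemma inner_transpose: "transpose X \<bullet> transpose Y = X \<bullet> Y"
  for X Y :: "real^'a^'b"
  unfolding inner_vec_def transpose_def by (simp add: sum.swap[of _ "UNIV :: 'a set"])

lemma inner_mult_left: "(A ** X) \<bullet> Y = X \<bullet> (transpose A ** Y)"
  for A :: "real^'a^'b" and X :: "real^'c^'a" and Y :: "real^'c^'b"
proof -
  have "(A ** X) \<bullet> Y = (\<Sum>i\<in>UNIV. \<Sum>j\<in>UNIV. \<Sum>k\<in>UNIV. A $ i $ k * X $ k $ j * Y $ i $ j)"
    by (simp add: inner_vec_def matrix_matrix_mult_def sum_distrib_right)
  also have "\<dots> = (\<Sum>i\<in>UNIV. \<Sum>k\<in>UNIV. \<Sum>j\<in>UNIV. A $ i $ k * X $ k $ j * Y $ i $ j)"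
    by (intro sum.cong refl sum.swap)
  also have "\<dots> = (\<Sum>k\<in>UNIV. \<Sum>i\<in>UNIV. \<Sum>j\<in>UNIV. A $ i $ k * X $ k $ j * Y $ i $ j)"
    by (rule sum.swap)
  also have "\<dots> = (\<Sum>k\<in>UNIV. \<Sum>j\<in>UNIV. \<Sum>i\<in>UNIV. A $ i $ k * X $ k $ j * Y $ i $ j)"
    by (intro sum.cong refl sum.swap)
  also have "\<dots> = X \<bullet> (transpose A ** Y)"
    by (simp add: inner_vec_def matrix_matrix_mult_def transpose_def sum_distrib_left mult_ac)
  finally show ?thesis .
qed

lemma inner_mult_right: "(X ** A) \<bullet> Y = X \<bullet> (Y ** transpose A)"
  for A :: "real^'a^'b" and X :: "real^'b^'c" and Y :: "real^'a^'c"
proof -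
  have "(X ** A) \<bullet> Y = (transpose A ** transpose X) \<bullet> transpose Y"
    unfolding matrix_transpose_mul[symmetric] by (rule inner_transpose[symmetric])
  also have "\<dots> = transpose X \<bullet> transpose (Y ** transpose A)"
    unfolding inner_mult_left by (simp add: matrix_transpose_mul)
  finally show ?thesis by (simp add: inner_transpose)
qed

lemma transpose_add: "transpose (A + B) = transpose A + transpose B"
  and transpose_diff: "transpose (A - B) = transpose A - transpose B"
  and transpose_uminus: "transpose (- A) = - transpose A"
  and transpose_zero: "transpose 0 = 0"
  for A B :: "real^'a^'b"
  by (simp_all add: transpose_def vec_eq_iff)

lemma transpose_scaleR: "transpose (c *\<^sub>R A) = c *\<^sub>R transpose A"
  for A :: "real^'a^'b"
  by (simp add: transpose_def vec_eq_iff)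

lemma matrix_add_mult: "(A + B) ** C = A ** C + B ** C"
  and matrix_diff_mult: "(A - B) ** C = A ** C - B ** C"
  and matrix_uminus_mult: "(- A) ** C = - (A ** C)"
  for A B :: "real^'a^'b" and C :: "real^'c^'a"
  by (simp_all add: matrix_matrix_mult_def vec_eq_iff sum.distrib sum_subtractf sum_negf left_diff_distrib distrib_right)

lemma matrix_mult_add: "C ** (A + B) = C ** A + C ** B"
  and matrix_mult_diff: "C ** (A - B) = C ** A - C ** B"
  and matrix_mult_uminus: "C ** (- A) = - (C ** A)"
  for A B :: "real^'a^'b" and C :: "real^'b^'c"
  by (simp_all add: matrix_matrix_mult_def vec_eq_iff sum.distrib sum_subtractf sum_negf right_diff_distrib distrib_left)

lemma matrix_scaleR_mult: "(c *\<^sub>R A) ** B = c *\<^sub>R (A ** B)"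
  and matrix_mult_scaleR: "A ** (c *\<^sub>R B) = c *\<^sub>R (A ** B)"
  for A :: "real^'a^'b" and B :: "real^'c^'a"
  by (simp_all add: matrix_matrix_mult_def vec_eq_iff sum_distrib_left mult_ac)

lemmas matrix_distribs = matrix_add_mult matrix_diff_mult matrix_mult_add matrix_mult_diff
  matrix_uminus_mult matrix_mult_uminus matrix_scaleR_mult matrix_mult_scaleR
  transpose_add transpose_diff transpose_uminus transpose_scaleR transpose_zero

lemma sym_inner: "transpose S = S \<Longrightarrow> u \<bullet> (S *v v) = v \<bullet> (S *v u)"
  for S :: "real^'n^'n"
  by (metis inner_matrix_vector inner_commute)

lemma quad_add: "v \<bullet> ((A + B) *v v) = v \<bullet> (A *v v) + v \<bullet> (B *v v)"
  and quad_diff: "v \<bullet> ((A - B) *v v) = v \<bullet> (A *v v) - v \<bullet> (B *v v)"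
  and quad_uminus: "v \<bullet> ((- A) *v v) = - (v \<bullet> (A *v v))"
  and quad_scaleR: "v \<bullet> ((c *\<^sub>R A) *v v) = c * (v \<bullet> (A *v v))"
  and quad_zero: "v \<bullet> (0 *v v) = 0"
  and quad_mat1: "v \<bullet> (mat 1 *v v) = v \<bullet> v"
  for A B :: "real^'n^'n"
  by (simp_all add: matrix_vector_mult_add_rdistrib matrix_vector_mult_diff_rdistrib inner_add_right
    inner_diff_right scaleR_matrix_vector_assoc[symmetric])
    (simp add: matrix_vector_mult_def inner_vec_def sum_negf)

lemmas quad_simps = quad_add quad_diff quad_uminus quad_scaleR quad_zero quad_mat1

text \<open>The form is nonnegative on the line \<open>u + t *\<^sub>R v\<close>; \<open>?t\<close>
  minimizes it there.\<close>

lemma psd_cauchy_schwarz: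
  assumes S: "psd S" and v: "0 < v \<bullet> (S *v v)"
  shows "(u \<bullet> (S *v v))\<^sup>2 / (v \<bullet> (S *v v)) \<le> u \<bullet> (S *v u)"
proof -
  let ?a = "v \<bullet> (S *v v)" and ?b = "u \<bullet> (S *v v)"
  let ?t = "- ?b / ?a"
  have e: "(u + t *\<^sub>R v) \<bullet> (S *v (u + t *\<^sub>R v)) = u \<bullet> (S *v u) + 2 * t * ?b + t\<^sup>2 * ?a" for t
    using sym_inner[of S u v] S
    by (simp add: psd_def matrix_vector_right_distrib matrix_vector_mult_scaleR inner_add_left inner_add_right
       power2_eq_square distrib_left)
  have "0 \<le> (u + ?t *\<^sub>R v) \<bullet> (S *v (u + ?t *\<^sub>R v))" using S by (simp add: psd_def)
  also have "\<dots> = u \<bullet> (S *v u) + 2 * ?t * ?b + ?t\<^sup>2 * ?a" by (rule e)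
  also have "\<dots> = u \<bullet> (S *v u) - ?b\<^sup>2 / ?a"
    using v by (simp add: field_simps power2_eq_square)
  finally show ?thesis by simp
qed

text \<open>If \<open>S *v v\<close> were nonzero, the form on the line through
  \<open>S *v v\<close> in direction \<open>v\<close> would be affine with nonzero slope in
  \<open>t\<close>, and so negative somewhere.\<close>

lemma psd_null:
  assumes S: "psd S" and v: "v \<bullet> (S *v v) = 0"
  shows "S *v v = 0"
proof (rule ccontr)
  assume n: "S *v v \<noteq> 0"
  let ?z = "S *v v"
  have zz: "0 < ?z \<bullet> ?z" using n by simp
  have e: "(?z + t *\<^sub>R v) \<bullet> (S *v (?z + t *\<^sub>R v)) = ?z \<bullet> (S *v ?z) + 2 * t * (?z \<bullet> ?z)" for t
    using v sym_inner[of S v ?z] S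
    by (simp add: psd_def matrix_vector_right_distrib matrix_vector_mult_scaleR inner_add_left inner_add_right algebra_simps)
  have "0 \<le> ?z \<bullet> (S *v ?z) + 2 * t * (?z \<bullet> ?z)" for t
    using S unfolding psd_def e[symmetric] by blast
  from this[of "- (?z \<bullet> (S *v ?z) + 1) / (2 * (?z \<bullet> ?z))"] zz show False by (simp add: field_simps)
qed

lemma sym_eq_0I:
  fixes S :: "real^'n^'n"
  assumes S: "transpose S = S" and z: "\<And>v. v \<bullet> (S *v v) = 0"
  shows "S = 0"
proof -
  have "psd S" using assms by (simp add: psd_def)
  then have "S *v v = 0" for v using psd_null z by blast
  then show ?thesis by (simp add: matrix_eq)
qed

text \<open>Peeling off a rank-one summand \<open>S v (S v)\<^sup>T / (v\<^sup>T S v)\<close> keeps \<open>S\<close> positive semidefinite and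
  enlarges its kernel.\<close>

lemma psd_inner_nonneg:
  fixes S U :: "real^'n^'n"
  assumes "psd S" and U: "\<And>v. 0 \<le> v \<bullet> (U *v v)"
  shows "0 \<le> U \<bullet> S"
  using assms(1)
proof (induction "CARD('n) - dim {v. S *v v = 0}" arbitrary: S rule: less_induct)
  case less
  show ?case
  proof (cases "\<forall>v. v \<bullet> (S *v v) = 0")
    case True
    then have "S = 0" using less.prems by (intro sym_eq_0I) (auto simp: psd_def)
    then show ?thesis by simp
  next
    case False
    then obtain v where v0: "v \<bullet> (S *v v) \<noteq> 0" by blast
    have "0 \<le> v \<bullet> (S *v v)" using less.prems by (simp add: psd_def)
    with v0 have v: "0 < v \<bullet> (S *v v)" by linarith
    let ?a = "v \<bullet> (S *v v)" and ?z = "S *v v"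
    define S' where "S' = S - (1 / ?a) *\<^sub>R outer ?z ?z"
    have sym: "transpose S = S" using less.prems by (simp add: psd_def)
    have S'v: "S' *v u = S *v u - ((?z \<bullet> u) / ?a) *\<^sub>R ?z" for u
      by (simp add: S'_def matrix_vector_mult_diff_rdistrib scaleR_matrix_vector_assoc[symmetric] outer_mult)
    have zu: "?z \<bullet> u = u \<bullet> (S *v v)" for u by (rule inner_commute)
    have S': "psd S'"
      unfolding psd_def
    proof (intro conjI allI)
      show "transpose S' = S'" by (simp add: S'_def matrix_distribs transpose_outer sym)
      fix u
      have "u \<bullet> (S' *v u) = u \<bullet> (S *v u) - (u \<bullet> (S *v v))\<^sup>2 / ?a"
        unfolding S'v zu by (simp add: inner_diff_right power2_eq_square)
      then show "0 \<le> u \<bullet> (S' *v u)" using psd_cauchy_schwarz[OF less.prems v, of u] by simp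
    qed
    have sublevel: "subspace {v. T *v v = 0}" for T :: "real^'n^'n"
      by (auto simp: subspace_def matrix_vector_right_distrib matrix_vector_mult_scaleR)
    have "{u. S *v u = 0} \<subset> {u. S' *v u = 0}"
    proof
      show "{u. S *v u = 0} \<subseteq> {u. S' *v u = 0}"
      proof safe
        fix u assume u: "S *v u = 0"
        have "?z \<bullet> u = v \<bullet> (S *v u)" using sym_inner[OF sym, of u v] by (simp add: inner_commute)
        then show "S' *v u = 0" using u by (simp add: S'v)
      qed
      have "S' *v v = 0" using v by (simp add: S'v zu)
      moreover have "S *v v \<noteq> 0" using v by auto
      ultimately show "{u. S *v u = 0} \<noteq> {u. S' *v u = 0}" by blast
    qed
    then have "dim {u. S *v u = 0} < dim {u. S' *v u = 0}"
      by (intro dim_psubset) (simp add: span_eq_iff[THEN iffD2, OF sublevel])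
    moreover have "dim {u. S' *v u = 0} \<le> CARD('n)"
      using dim_subset_UNIV[of "{u. S' *v u = 0}"] by simp
    ultimately have "0 \<le> U \<bullet> S'" using S' by (intro less.hyps) auto
    moreover have "U \<bullet> S = U \<bullet> S' + (?z \<bullet> (U *v ?z)) / ?a"
      by (simp add: S'_def inner_diff_right inner_outer)
    moreover have "0 \<le> (?z \<bullet> (U *v ?z)) / ?a" using U v by simp
    ultimately show ?thesis by linarith
  qed
qed

lemma psd_inner_mono:
  fixes S U V :: "real^'n^'n"
  assumes "psd S" and "\<And>v. v \<bullet> (U *v v) \<le> v \<bullet> (V *v v)"
  shows "U \<bullet> S \<le> V \<bullet> S"
  using psd_inner_nonneg[OF assms(1), of "V - U"] assms(2) by (simp add: quad_simps inner_diff_left)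

lemma psd_trace_nonneg: "psd S \<Longrightarrow> 0 \<le> mat 1 \<bullet> S"
  by (rule psd_inner_nonneg) (simp_all add: quad_simps)

lemma psd_quad_le_trace:
  assumes "psd S" shows "v \<bullet> (S *v v) \<le> (mat 1 \<bullet> S) * (v \<bullet> v)"
proof -
  have "outer v v \<bullet> S \<le> ((v \<bullet> v) *\<^sub>R mat 1) \<bullet> S"
  proof (rule psd_inner_mono[OF assms])
    fix u :: "real^'a"
    have "(v \<bullet> u)\<^sup>2 \<le> (v \<bullet> v) * (u \<bullet> u)" by (rule Cauchy_Schwarz_ineq)
    then show "u \<bullet> (outer v v *v u) \<le> u \<bullet> (((v \<bullet> v) *\<^sub>R mat 1) *v u)"
      by (simp add: outer_mult quad_simps power2_eq_square inner_commute)
  qed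
  then show ?thesis by (simp add: inner_commute[of "outer v v"] inner_outer mult.commute)
qed

text \<open>\<open>S\<close> lies below its trace times the identity; pairing this with
  \<open>S\<close> itself compares the squares.\<close>

lemma psd_norm_le_trace:
  assumes "psd S" shows "norm S \<le> mat 1 \<bullet> S"
proof -
  have "S \<bullet> S \<le> ((mat 1 \<bullet> S) *\<^sub>R mat 1) \<bullet> S"
    by (rule psd_inner_mono[OF assms]) (simp add: quad_simps psd_quad_le_trace[OF assms])
  then have "(norm S)\<^sup>2 \<le> (mat 1 \<bullet> S)\<^sup>2"
    unfolding power2_norm_eq_inner by (simp add: power2_eq_square)
  then show ?thesis using psd_trace_nonneg[OF assms] by (rule power2_le_imp_le)
qed

text \<open>Twice \<open>X\<close> is the difference of two positive semidefinite matrices whose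
  traces sum to twice that of \<open>H\<close>. Two-sided order bounds thus become norm
  bounds.\<close>

lemma norm_le_trace_of_bounds:
  assumes "psd (H + X)" "psd (H - X)" shows "norm X \<le> mat 1 \<bullet> H"
proof -
  have "norm (2 *\<^sub>R X) = norm ((H + X) - (H - X))" by (simp add: scaleR_2)
  also have "\<dots> \<le> norm (H + X) + norm (H - X)" by (rule norm_triangle_ineq4)
  also have "\<dots> \<le> mat 1 \<bullet> (H + X) + mat 1 \<bullet> (H - X)"
    by (intro add_mono psd_norm_le_trace assms)
  also have "\<dots> = 2 * (mat 1 \<bullet> H)" by (simp add: inner_add_right inner_diff_right)
  finally show ?thesis by simp
qed

section \<open>Norms and eigenvalues\<close>

lemma norm_matvec_le: "norm (A *v v) \<le> norm A * norm v"
  for A :: "real^'n^'m"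
proof -
  have "(norm (A *v v))\<^sup>2 = (\<Sum>i\<in>UNIV. (A $ i \<bullet> v)\<^sup>2)"
    unfolding power2_norm_eq_inner inner_vec_def[of "A *v v"]
    by (simp add: matrix_vector_mul_component power2_eq_square)
  also have "\<dots> \<le> (\<Sum>i\<in>UNIV. (A $ i \<bullet> A $ i) * (v \<bullet> v))"
    by (intro sum_mono Cauchy_Schwarz_ineq)
  also have "\<dots> = (norm A * norm v)\<^sup>2"
    by (simp add: power_mult_distrib power2_norm_eq_inner inner_vec_def[of A] sum_distrib_right)
  finally show ?thesis by (rule power2_le_imp_le) simp
qed

lemma norm_transpose: "norm (transpose A) = norm A"
  for A :: "real^'n^'m"
  by (simp add: norm_eq_sqrt_inner inner_transpose)

lemma norm_matmul_le: "norm (A ** B) \<le> norm A * norm B"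
  for A :: "real^'n^'m" and B :: "real^'k^'n"
proof -
  have r: "(A ** B) $ i = transpose B *v (A $ i)" for i
    by (simp add: vec_eq_iff matrix_matrix_mult_def matrix_vector_mult_def transpose_def mult.commute)
  have "(norm (A ** B))\<^sup>2 = (\<Sum>i\<in>UNIV. (norm (transpose B *v (A $ i)))\<^sup>2)"
    by (simp add: power2_norm_eq_inner inner_vec_def[of "A ** B"] r)
  also have "\<dots> \<le> (\<Sum>i\<in>UNIV. (norm B * norm (A $ i))\<^sup>2)"
    using norm_matvec_le[of "transpose B"] by (intro sum_mono power_mono) (auto simp: norm_transpose)
  also have "\<dots> = (norm A * norm B)\<^sup>2"
    by (simp add: power_mult_distrib power2_norm_eq_inner inner_vec_def[of A] sum_distrib_right sum_distrib_left mult.commute)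
  finally show ?thesis by (rule power2_le_imp_le) simp
qed

lemma quad_le_norm: "\<bar>v \<bullet> (A *v v)\<bar> \<le> norm A * (v \<bullet> v)"
  for A :: "real^'n^'n"
proof -
  have "\<bar>v \<bullet> (A *v v)\<bar> \<le> norm v * norm (A *v v)" by (rule Cauchy_Schwarz_ineq2)
  also have "\<dots> \<le> norm v * (norm A * norm v)" by (intro mult_left_mono norm_matvec_le) auto
  finally show ?thesis by (simp add: power2_norm_eq_inner[symmetric] power2_eq_square mult_ac)
qed

lemma spectral_norm_bound: "norm (A *v v) \<le> spectral_norm A * norm v"
  unfolding spectral_norm_def by (rule onorm[OF matrix_vector_mul_bounded_linear])

lemma spectral_norm_nonneg: "0 \<le> spectral_norm A"
  unfolding spectral_norm_def by (rule onorm_pos_le[OF matrix_vector_mul_bounded_linear])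

lemma spectral_norm_pos: "A \<noteq> 0 \<Longrightarrow> 0 < spectral_norm A"
proof -
  assume "A \<noteq> 0"
  then obtain v where "A *v v \<noteq> 0" by (metis matrix_eq matrix_vector_mult_0)
  then show ?thesis unfolding spectral_norm_def
    using onorm_pos_lt[OF matrix_vector_mul_bounded_linear, of A] by blast
qed

text \<open>Eigenvectors of a symmetric matrix for distinct eigenvalues are orthogonal, hence
  independent. Finiteness gives \<open>Min\<close> and \<open>Max\<close> in the eigenvalue
  definitions their meaning.\<close>

lemma finite_eigenvalues:
  fixes S :: "real^'n^'n"
  assumes S: "transpose S = S" shows "finite (eigenvalues S)"
proof -
  define w where "w c = (SOME v. v \<noteq> 0 \<and> S *v v = c *\<^sub>R v)" for c
  have w: "w c \<noteq> 0" "S *v w c = c *\<^sub>R w c" if "c \<in> eigenvalues S" for c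
    using someI_ex[of "\<lambda>v. v \<noteq> 0 \<and> S *v v = c *\<^sub>R v"] that by (auto simp: eigenvalues_def w_def)
  have orth: "w c \<bullet> w d = 0" if "c \<in> eigenvalues S" "d \<in> eigenvalues S" "c \<noteq> d" for c d
  proof -
    have "d * (w c \<bullet> w d) = w c \<bullet> (S *v w d)" using w[OF that(2)] by simp
    also have "\<dots> = w d \<bullet> (S *v w c)" by (rule sym_inner[OF S])
    also have "\<dots> = c * (w c \<bullet> w d)" using w[OF that(1)] by (simp add: inner_commute)
    finally show ?thesis using that(3) by simp
  qed
  have inj: "inj_on w (eigenvalues S)"
  proof (rule inj_onI, rule ccontr)
    fix c d assume a: "c \<in> eigenvalues S" "d \<in> eigenvalues S" "w c = w d" "c \<noteq> d"
    have "w c \<bullet> w c = 0" using orth[OF a(1,2,4)] a(3) by simp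
    then show False using w(1)[OF a(1)] by simp
  qed
  have "pairwise orthogonal (w ` eigenvalues S)"
    using orth by (auto simp: pairwise_def orthogonal_def)
  moreover have "0 \<notin> w ` eigenvalues S" using w(1) by force
  ultimately have "independent (w ` eigenvalues S)" by (rule pairwise_orthogonal_independent)
  then have "finite (w ` eigenvalues S)" by (rule independent_imp_finite)
  then show ?thesis using finite_imageD[OF _ inj] by blast
qed

text \<open>The quadratic form attains its minimum \<open>m\<close> on the unit sphere. Then
  \<open>S\<close> minus \<open>m\<close> times the identity is positive semidefinite with vanishing
  form at the minimizer, so \<open>psd_null\<close> makes the minimizer an eigenvector.\<close>

lemma eigenvalue_rayleigh:
  fixes S :: "real^'n^'n"
  assumes S: "transpose S = S"
  obtains v where "v \<bullet> v = 1" "S *v v = min_eigenvalue S *\<^sub>R v" "min_eigenvalue S \<in> eigenvalues S"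
    "\<And>u. min_eigenvalue S * (u \<bullet> u) \<le> u \<bullet> (S *v u)"
proof -
  have "continuous_on (sphere 0 1) (\<lambda>v::real^'n. v \<bullet> (S *v v))"
    by (intro continuous_on_inner continuous_on_id linear_continuous_on matrix_vector_mul_bounded_linear)
  moreover have "sphere 0 1 \<noteq> ({} :: (real^'n) set)" by simp
  ultimately obtain v :: "real^'n" where v: "v \<in> sphere 0 1" "\<And>u. u \<in> sphere 0 1 \<Longrightarrow> v \<bullet> (S *v v) \<le> u \<bullet> (S *v u)"
    using continuous_attains_inf[OF compact_sphere, of "0 :: real^'n" 1 "\<lambda>v. v \<bullet> (S *v v)"] by blast
  define m where "m = v \<bullet> (S *v v)"
  have vv: "v \<bullet> v = 1" using v(1) by (simp add: norm_eq_1)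
  have low: "m * (u \<bullet> u) \<le> u \<bullet> (S *v u)" for u
  proof (cases "u = 0")
    case False
    let ?u = "(1 / norm u) *\<^sub>R u"
    have "m \<le> ?u \<bullet> (S *v ?u)" unfolding m_def using False by (intro v(2)) simp
    also have "\<dots> = (u \<bullet> (S *v u)) / (norm u)\<^sup>2"
      by (simp add: matrix_vector_mult_scaleR power2_eq_square)
    finally show ?thesis using False by (simp add: field_simps power2_norm_eq_inner)
  qed simp
  have "psd (S - m *\<^sub>R mat 1)"
    using low S by (auto simp: psd_def quad_simps matrix_distribs transpose_mat)
  moreover have "v \<bullet> ((S - m *\<^sub>R mat 1) *v v) = 0" by (simp add: quad_simps m_def vv)
  ultimately have "(S - m *\<^sub>R mat 1) *v v = 0" by (rule psd_null)
  then have Sv: "S *v v = m *\<^sub>R v"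
    by (simp add: matrix_vector_mult_diff_rdistrib scaleR_matrix_vector_assoc[symmetric])
  moreover have "v \<noteq> 0" using vv by auto
  ultimately have m: "m \<in> eigenvalues S" by (auto simp: eigenvalues_def)
  have "m \<le> c" if "c \<in> eigenvalues S" for c
  proof -
    obtain u where u: "u \<noteq> 0" "S *v u = c *\<^sub>R u" using \<open>c \<in> eigenvalues S\<close> by (auto simp: eigenvalues_def)
    then have "m * (u \<bullet> u) \<le> c * (u \<bullet> u)" using low[of u] by simp
    then show ?thesis using u(1) by simp
  qed
  then have "min_eigenvalue S = m"
    unfolding min_eigenvalue_def by (intro Min_eqI finite_eigenvalues[OF S] m)
  then show ?thesis using that[OF vv] Sv m low by simp
qed

lemma min_eigenvalue_le: "transpose S = S \<Longrightarrow> min_eigenvalue S * (u \<bullet> u) \<le> u \<bullet> (S *v u)"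
  using eigenvalue_rayleigh[of S] by metis

lemma min_eigenvalue_pos:
  assumes "sym_pos_def S" shows "0 < min_eigenvalue S"
proof -
  obtain v where v: "v \<bullet> v = 1" "S *v v = min_eigenvalue S *\<^sub>R v"
    using assms unfolding sym_pos_def_def by (metis eigenvalue_rayleigh)
  then have "v \<noteq> 0" by auto
  then have "0 < v \<bullet> (S *v v)" using assms by (simp add: sym_pos_def_def)
  then show ?thesis using v by simp
qed

lemma min_le_max_eigenvalue:
  assumes "transpose S = S" shows "min_eigenvalue S \<le> max_eigenvalue S"
proof -
  have "min_eigenvalue S \<in> eigenvalues S" by (rule eigenvalue_rayleigh[OF assms])
  then show ?thesis unfolding max_eigenvalue_def by (intro Max_ge finite_eigenvalues assms)
qed

lemma sym_pos_def_psd: "sym_pos_def S \<Longrightarrow> psd S"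
  unfolding sym_pos_def_def psd_def by (metis inner_zero_left less_eq_real_def)

section \<open>Generalized Lyapunov operators\<close>

definition lyap :: "real^'n^'n \<Rightarrow> real^'n^'n \<Rightarrow> real^'n^'n \<Rightarrow> real^'n^'n" where
  "lyap a c S = a ** S + S ** transpose a + c ** S ** transpose c"

text \<open>The adjoint of \<open>lyap a c\<close> for the trace inner product. Since it is the
  operator \<open>lyap\<close> of the transposed pair, the general facts apply to it as
  well.\<close>

definition lyap_adj :: "real^'n^'n \<Rightarrow> real^'n^'n \<Rightarrow> real^'n^'n \<Rightarrow> real^'n^'n" where
  "lyap_adj a c P = transpose a ** P + P ** a + transpose c ** P ** c"

lemma lyap_inner: "lyap a c S \<bullet> P = S \<bullet> lyap_adj a c P"
proof -
  have "(c ** S ** transpose c) \<bullet> P = S \<bullet> (transpose c ** P ** c)"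
  proof -
    have "(c ** S ** transpose c) \<bullet> P = (c ** S) \<bullet> (P ** c)"
      unfolding inner_mult_right[of "c ** S"] by simp
    also have "\<dots> = S \<bullet> (transpose c ** (P ** c))" by (rule inner_mult_left)
    finally show ?thesis by (simp add: matrix_mul_assoc)
  qed
  then show ?thesis
    using inner_mult_left[of a S P] inner_mult_right[of S "transpose a" P]
    by (simp add: lyap_def lyap_adj_def inner_add_left inner_add_right)
qed

lemma lyap_adj_eq: "lyap_adj a c = lyap (transpose a) (transpose c)"
  by (simp add: fun_eq_iff lyap_def lyap_adj_def)

lemma lyap_linear: "linear (lyap a c)"
  by (rule linearI) (simp_all add: lyap_def matrix_distribs algebra_simps)

lemma transpose_lyap: "transpose (lyap a c S) = lyap a c (transpose S)"
  by (simp add: lyap_def matrix_distribs matrix_transpose_mul matrix_mul_assoc algebra_simps)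

lemma lyap_add: "lyap a c (S + T) = lyap a c S + lyap a c T"
  and lyap_diff: "lyap a c (S - T) = lyap a c S - lyap a c T"
  and lyap_scaleR: "lyap a c (k *\<^sub>R S) = k *\<^sub>R lyap a c S"
  and lyap_uminus: "lyap a c (- S) = - lyap a c S"
  using lyap_linear[of a c] by (simp_all add: linear_add linear_diff linear_scale linear_neg)

text \<open>On a kernel vector of \<open>S\<close> both terms with \<open>a\<close> vanish and only
  the nonnegative term with \<open>c\<close> remains. This cross-positivity is the matrix analogue
  of nonnegative off-diagonal entries.\<close>

lemma lyap_quad_kernel:
  assumes S: "psd S" and v: "S *v v = 0"
  shows "0 \<le> v \<bullet> (lyap a c S *v v)"
proof -
  have "v \<bullet> ((a ** S) *v v) = 0" by (simp add: matrix_vector_mul_assoc[symmetric] v)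
  moreover have "v \<bullet> ((S ** transpose a) *v v) = 0"
    using sym_inner[of S v "transpose a *v v"] S v by (simp add: matrix_vector_mul_assoc[symmetric] psd_def)
  moreover have "0 \<le> v \<bullet> ((c ** S ** transpose c) *v v)"
  proof -
    have "v \<bullet> ((c ** S ** transpose c) *v v) = (transpose c *v v) \<bullet> (S *v (transpose c *v v))"
      by (simp add: matrix_vector_mul_assoc[symmetric] inner_matrix_vector[of v c])
    then show ?thesis using S by (simp add: psd_def)
  qed
  ultimately show ?thesis by (simp add: lyap_def quad_simps)
qed

text \<open>Stability as existence of a certificate instead of a spectral condition: some positive
  semidefinite \<open>G\<close> that the moment equation strictly decreases in every
  direction.\<close>

definition lyap_stable :: "real^'n^'n \<Rightarrow> real^'n^'n \<Rightarrow> bool" where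
  "lyap_stable a c \<longleftrightarrow> (\<exists>G. psd G \<and> (\<forall>v. v \<noteq> 0 \<longrightarrow> v \<bullet> (lyap a c G *v v) < 0))"

lemma lyap_neg_pd:
  assumes "psd G" "\<And>v. v \<noteq> 0 \<Longrightarrow> v \<bullet> (lyap a c G *v v) < 0" "v \<noteq> 0"
  shows "0 < v \<bullet> (G *v v)"
proof (rule ccontr)
  assume "\<not> 0 < v \<bullet> (G *v v)"
  moreover have "0 \<le> v \<bullet> (G *v v)" using assms(1) by (simp add: psd_def)
  ultimately have "v \<bullet> (G *v v) = 0" by linarith
  from lyap_quad_kernel[OF assms(1) psd_null[OF assms(1) this], of a c] assms(2)[OF assms(3)]
  show False by linarith
qed

text \<open>An M-matrix argument: shift \<open>X\<close> by the least multiple of \<open>G\<close> that makes it positive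
  semidefinite; on the kernel of the shifted matrix the Lyapunov operator cannot be negative.\<close>

lemma lyap_stable_monotone:
  fixes X :: "real^'n^'n"
  assumes st: "lyap_stable a c" and X: "transpose X = X" and neg: "\<And>v. v \<bullet> (lyap a c X *v v) \<le> 0"
  shows "psd X"
proof -
  obtain G where G: "psd G" "\<And>v. v \<noteq> 0 \<Longrightarrow> v \<bullet> (lyap a c G *v v) < 0"
    using st by (auto simp: lyap_stable_def)
  have pd: "0 < v \<bullet> (G *v v)" if "v \<noteq> 0" for v
    using lyap_neg_pd[OF G(1), of a c] G(2) that by blast
  have nz: "v \<in> sphere 0 1 \<Longrightarrow> v \<noteq> 0" for v :: "real^'n" by auto
  let ?f = "\<lambda>v. - (v \<bullet> (X *v v)) / (v \<bullet> (G *v v))"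
  have "continuous_on (sphere 0 1) ?f"
    by (intro continuous_on_divide continuous_on_minus continuous_on_inner continuous_on_id linear_continuous_on matrix_vector_mul_bounded_linear)
      (use pd nz in force)
  moreover have "sphere 0 1 \<noteq> ({} :: (real^'n) set)" by simp
  ultimately obtain v :: "real^'n" where v: "v \<in> sphere 0 1" "\<And>u. u \<in> sphere 0 1 \<Longrightarrow> ?f u \<le> ?f v"
    using continuous_attains_sup[OF compact_sphere, of "0 :: real^'n" 1 ?f] by blast
  define \<theta> where "\<theta> = ?f v"
  have v0: "v \<noteq> 0" by (rule nz[OF v(1)])
  have Y: "0 \<le> u \<bullet> ((X + \<theta> *\<^sub>R G) *v u)" for u
  proof (cases "u = 0")
    case False
    let ?u = "(1 / norm u) *\<^sub>R u"
    have un: "?u \<noteq> 0" using False by simp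
    have "?f ?u \<le> \<theta>" unfolding \<theta>_def using False by (intro v(2)) simp
    then have "- (?u \<bullet> (X *v ?u)) \<le> \<theta> * (?u \<bullet> (G *v ?u))"
      using pd[OF un] by (simp only: pos_divide_le_eq)
    then have "0 \<le> (1 / norm u)\<^sup>2 * (u \<bullet> (X *v u) + \<theta> * (u \<bullet> (G *v u)))"
      by (simp add: matrix_vector_mult_scaleR power2_eq_square algebra_simps)
    then have "0 \<le> u \<bullet> (X *v u) + \<theta> * (u \<bullet> (G *v u))"
      using False by (simp add: zero_le_mult_iff)
    then show ?thesis by (simp add: quad_simps)
  qed simp
  have "transpose G = G" using G by (simp add: psd_def)
  then have Yp: "psd (X + \<theta> *\<^sub>R G)" using Y X by (simp add: psd_def matrix_distribs)
  have "v \<bullet> ((X + \<theta> *\<^sub>R G) *v v) = 0"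
    using pd[OF v0] by (simp add: quad_simps \<theta>_def)
  from lyap_quad_kernel[OF Yp psd_null[OF Yp this], of a c]
  have "0 \<le> v \<bullet> (lyap a c X *v v) + \<theta> * (v \<bullet> (lyap a c G *v v))"
    by (simp add: lyap_add lyap_scaleR quad_simps)
  then have "\<theta> * (v \<bullet> (lyap a c G *v v)) \<ge> 0" using neg[of v] by linarith
  then have \<theta>: "\<theta> \<le> 0" using G(2)[OF v0] by (simp add: zero_le_mult_iff)
  have "0 \<le> u \<bullet> (X *v u)" for u
  proof -
    have "\<theta> * (u \<bullet> (G *v u)) \<le> 0" using \<theta> G(1) by (simp add: psd_def mult_nonpos_nonneg)
    then show ?thesis using Y[of u] by (simp add: quad_simps)
  qed
  then show ?thesis using X by (simp add: psd_def)
qed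

text \<open>Monotonicity applies to both \<open>X\<close> and \<open>- X\<close>, so the form of
  \<open>X\<close> vanishes.\<close>

lemma lyap_stable_injective:
  assumes st: "lyap_stable a c" and X: "transpose X = X" and z: "lyap a c X = 0"
  shows "X = 0"
proof (rule sym_eq_0I[OF X])
  fix v
  have "psd X" by (rule lyap_stable_monotone[OF st X]) (simp add: z)
  moreover have "psd (- X)" by (rule lyap_stable_monotone[OF st]) (simp_all add: z X matrix_distribs lyap_uminus)
  ultimately show "v \<bullet> (X *v v) = 0" by (auto simp: psd_def quad_simps intro: antisym)
qed

text \<open>The symmetric matrices form a proper subspace; subtracting the antisymmetric part extends the
  operator injectively to all matrices.\<close>

lemma lyap_solve:
  fixes Z :: "real^'n^'n"
  assumes inj: "\<And>X. transpose X = X \<Longrightarrow> lyap a c X = 0 \<Longrightarrow> X = 0" and Z: "transpose Z = Z"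
  obtains X where "transpose X = X" "lyap a c X = Z"
proof -
  define T where "T X = lyap a c ((1/2) *\<^sub>R (X + transpose X)) - (1/2) *\<^sub>R (X - transpose X)" for X
  have lin: "linear T"
    unfolding T_def
    by (rule linearI) (simp_all add: lyap_add lyap_scaleR lyap_diff matrix_distribs algebra_simps)
  have tT: "transpose (T X) = lyap a c ((1/2) *\<^sub>R (X + transpose X)) + (1/2) *\<^sub>R (X - transpose X)" for X
    by (simp add: T_def matrix_distribs transpose_lyap algebra_simps)
  have parts: "lyap a c ((1/2) *\<^sub>R (X + transpose X)) = (1/2) *\<^sub>R (T X + transpose (T X))"
    "X - transpose X = transpose (T X) - T X" for X
  proof -
    let ?L = "lyap a c ((1/2) *\<^sub>R (X + transpose X))" and ?D = "X - transpose X"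
    have e: "T X = ?L - (1/2) *\<^sub>R ?D" by (simp add: T_def)
    have "T X + transpose (T X) = 2 *\<^sub>R ?L" unfolding tT scaleR_2 by (simp add: e)
    then show "?L = (1/2) *\<^sub>R (T X + transpose (T X))" by simp
    have "transpose (T X) - T X = 2 *\<^sub>R ((1/2) *\<^sub>R ?D)" unfolding tT scaleR_2 by (simp add: e)
    then show "?D = transpose (T X) - T X" by simp
  qed
  have "inj T"
  proof (subst linear_injective_0[OF lin], intro allI impI)
    fix X assume "T X = 0"
    then have 1: "lyap a c ((1/2) *\<^sub>R (X + transpose X)) = 0" and 2: "X = transpose X"
      using parts[of X] by (simp_all add: transpose_zero)
    have "(1/2) *\<^sub>R (X + transpose X) = 0"
      by (rule inj[OF _ 1]) (simp add: matrix_distribs add.commute)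
    then show "X = 0" using 2 by (simp flip: scaleR_2)
  qed
  then have "surj T" by (rule linear_injective_imp_surjective[OF lin]) simp
  then obtain X where X: "T X = Z" by (metis surjD)
  have "X = transpose X" using parts(2)[of X] Z by (simp add: X)
  then have "lyap a c X = Z" using parts(1)[of X] Z by (simp add: X flip: scaleR_2)
  then show ?thesis using \<open>X = transpose X\<close> by (intro that[of X]) auto
qed

lemma lyap_stable_solve:
  assumes "lyap_stable a c" "transpose Z = Z"
  obtains X where "transpose X = X" "lyap a c X = Z"
  using lyap_solve[OF lyap_stable_injective[OF assms(1)] assms(2)] by blast

text \<open>Duality: a kernel element of the adjoint is orthogonal to the range of
  \<open>lyap a c\<close>, and here it belongs to that range.\<close>

lemma lyap_adj_injective:
  assumes surj: "\<And>Z. transpose Z = Z \<Longrightarrow> \<exists>X. transpose X = X \<and> lyap a c X = Z"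
    and P: "transpose P = P" "lyap_adj a c P = 0"
  shows "P = 0"
proof -
  obtain X where X: "lyap a c X = P" using surj[OF P(1)] by blast
  have "P \<bullet> P = X \<bullet> lyap_adj a c P" using lyap_inner[of a c X P] by (simp add: X)
  then show ?thesis by (simp add: P(2))
qed

text \<open>The certificate is for the original pair, not the transposed one. Injectivity of the
  adjoint is therefore obtained by duality from solvability of the original equation, and
  solvability of the adjoint equation follows from it.\<close>

lemma lyap_adj_stable_solve:
  assumes st: "lyap_stable a c" and Z: "transpose Z = Z"
  obtains P where "transpose P = P" "lyap_adj a c P = Z"
proof (rule lyap_solve[of "transpose a" "transpose c" Z])
  show "X = 0" if "transpose X = X" "lyap (transpose a) (transpose c) X = 0" for X
    using lyap_adj_injective[of a c X] lyap_stable_solve[OF st] that by (metis lyap_adj_eq)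
qed (use Z that in \<open>auto simp: lyap_adj_eq\<close>)

text \<open>The source \<open>Y\<close> lies between \<open>- ?k\<close> and \<open>?k\<close> times
  \<open>S\<close>; monotonicity transfers this to the solutions, so \<open>X\<close> lies between
  \<open>- ?k\<close> and \<open>?k\<close> times \<open>G\<close>.\<close>

lemma lyap_inverse_bound:
  assumes st: "lyap_stable a c" and G: "lyap a c G = - S" "transpose G = G"
    and S: "0 < l" "\<And>v. l * (v \<bullet> v) \<le> v \<bullet> (S *v v)"
    and X: "transpose X = X" "lyap a c X = - Y"
  shows "norm X \<le> norm Y / l * (mat 1 \<bullet> G)"
proof -
  let ?k = "norm Y / l"
  have Yb: "\<bar>v \<bullet> (Y *v v)\<bar> \<le> ?k * (v \<bullet> (S *v v))" for v
  proof -
    have "\<bar>v \<bullet> (Y *v v)\<bar> \<le> norm Y * (v \<bullet> v)" by (rule quad_le_norm)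
    also have "\<dots> = ?k * (l * (v \<bullet> v))" using S(1) by simp
    also have "\<dots> \<le> ?k * (v \<bullet> (S *v v))" using S by (intro mult_left_mono) auto
    finally show ?thesis .
  qed
  have "psd (?k *\<^sub>R G + X)" "psd (?k *\<^sub>R G - X)"
  proof -
    show "psd (?k *\<^sub>R G + X)"
    proof (rule lyap_stable_monotone[OF st])
      show "v \<bullet> (lyap a c (?k *\<^sub>R G + X) *v v) \<le> 0" for v
        using Yb[of v] by (simp only: lyap_add lyap_scaleR quad_simps G X abs_le_iff) linarith
    qed (simp add: G X matrix_distribs)
    show "psd (?k *\<^sub>R G - X)"
    proof (rule lyap_stable_monotone[OF st])
      show "v \<bullet> (lyap a c (?k *\<^sub>R G - X) *v v) \<le> 0" for v
        using Yb[of v] by (simp only: lyap_diff lyap_scaleR quad_simps G X abs_le_iff) linarith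
    qed (simp add: G X matrix_distribs)
  qed
  from norm_le_trace_of_bounds[OF this] show ?thesis by simp
qed

text \<open>An operator and its adjoint have inverses of equal norm: pairing \<open>X\<close> with
  the solution \<open>T\<close> of the direct equation with source \<open>- X\<close> turns the
  squared norm of \<open>X\<close> into the inner product of \<open>T\<close> and
  \<open>Y\<close>.\<close>

lemma lyap_adj_inverse_bound:
  assumes st: "lyap_stable a c" and G: "lyap a c G = - S" "transpose G = G"
    and S: "0 < l" "\<And>v. l * (v \<bullet> v) \<le> v \<bullet> (S *v v)"
    and X: "transpose X = X" "lyap_adj a c X = - Y"
  shows "norm X \<le> norm Y / l * (mat 1 \<bullet> G)"
proof (cases "X = 0")
  case False
  let ?C = "(mat 1 \<bullet> G) / l"
  obtain T where T: "transpose T = T" "lyap a c T = - X"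
    using lyap_stable_solve[OF st, of "- X"] X(1) by (auto simp: matrix_distribs)
  have nT: "norm T \<le> norm X * ?C" using lyap_inverse_bound[OF st G S T] by (simp add: mult.commute)
  have "norm X * norm X = X \<bullet> X" by (simp add: power2_norm_eq_inner[symmetric] power2_eq_square)
  also have "\<dots> = - (lyap a c T \<bullet> X)" by (simp add: T(2))
  also have "\<dots> = T \<bullet> Y" by (simp add: lyap_inner X(2))
  also have "\<dots> \<le> norm T * norm Y" by (rule norm_cauchy_schwarz)
  also have "\<dots> \<le> norm X * ?C * norm Y" by (intro mult_right_mono nT) auto
  finally have "norm X * norm X \<le> norm X * (?C * norm Y)" by (simp add: mult_ac)
  then have "norm X \<le> ?C * norm Y" by (rule mult_left_le_imp_le) (use False in simp)
  then show ?thesis by (simp add: mult.commute)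
next
  case True
  have "psd G"
  proof (rule lyap_stable_monotone[OF st G(2)])
    fix v :: "real^'a"
    have "0 \<le> l * (v \<bullet> v)" using S(1) by simp
    then show "v \<bullet> (lyap a c G *v v) \<le> 0" using S(2)[of v] by (simp add: G(1) quad_simps)
  qed
  then show ?thesis using psd_trace_nonneg[of G] S(1) True by simp
qed

section \<open>The cost as a function of the feedback matrix\<close>

locale lq_problem =
  fixes A C Q \<Sigma>0 :: "real^'n^'n" and B D :: "real^'m^'n" and R :: "real^'m^'m"
  assumes B_nonzero: "B \<noteq> 0" and Q: "sym_pos_def Q" and R: "sym_pos_def R" and \<Sigma>0: "sym_pos_def \<Sigma>0"
begin

text \<open>\<open>stable\<close> is an algebraic form of mean-square stability, and \<open>GK K\<close> is the integral of the second
  moments of the closed-loop state. \<open>GK\<close>, \<open>PK\<close> and \<open>cost\<close> are junk values outside of \<open>stable\<close>.\<close>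

definition Ak :: "real^'n^'m \<Rightarrow> real^'n^'n" where "Ak K = A + B ** K"
definition Ck :: "real^'n^'m \<Rightarrow> real^'n^'n" where "Ck K = C + D ** K"
definition Qk :: "real^'n^'m \<Rightarrow> real^'n^'n" where "Qk K = Q + transpose K ** R ** K"

abbreviation "lQ \<equiv> min_eigenvalue Q"
abbreviation "lR \<equiv> min_eigenvalue R"
abbreviation "lS \<equiv> min_eigenvalue \<Sigma>0"

definition stable :: "real^'n^'m \<Rightarrow> bool" where
  "stable K \<longleftrightarrow> (\<exists>G. psd G \<and> lyap (Ak K) (Ck K) G = - \<Sigma>0)"

definition GK :: "real^'n^'m \<Rightarrow> real^'n^'n" where
  "GK K = (SOME G. psd G \<and> lyap (Ak K) (Ck K) G = - \<Sigma>0)"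

definition PK :: "real^'n^'m \<Rightarrow> real^'n^'n" where
  "PK K = (SOME P. transpose P = P \<and> lyap_adj (Ak K) (Ck K) P = - Qk K)"

definition cost :: "real^'n^'m \<Rightarrow> real" where
  "cost K = Qk K \<bullet> GK K"

lemma min_eigenvalues_pos: "0 < lQ" "0 < lR" "0 < lS"
  using Q R \<Sigma>0 by (auto intro: min_eigenvalue_pos)

lemma min_eigenvalues_le: "lQ * (v \<bullet> v) \<le> v \<bullet> (Q *v v)" "lR * (w \<bullet> w) \<le> w \<bullet> (R *v w)" "lS * (v \<bullet> v) \<le> v \<bullet> (\<Sigma>0 *v v)"
  using Q R \<Sigma>0 by (auto intro!: min_eigenvalue_le simp: sym_pos_def_def)

lemma symmetric_data: "transpose Q = Q" "transpose R = R" "transpose \<Sigma>0 = \<Sigma>0"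
  using Q R \<Sigma>0 by (auto simp: sym_pos_def_def)

lemma \<Sigma>0_psd: "psd \<Sigma>0" by (rule sym_pos_def_psd[OF \<Sigma>0])

lemma \<Sigma>0_pos: "v \<noteq> 0 \<Longrightarrow> 0 < v \<bullet> (\<Sigma>0 *v v)" using \<Sigma>0 by (auto simp: sym_pos_def_def)

lemma GK_spec:
  assumes "stable K"
  shows "psd (GK K)" "lyap (Ak K) (Ck K) (GK K) = - \<Sigma>0"
  using someI_ex[OF assms[unfolded stable_def]] unfolding GK_def by auto

lemma stable_lyap: "stable K \<Longrightarrow> lyap_stable (Ak K) (Ck K)"
  using GK_spec[of K] \<Sigma>0_pos unfolding lyap_stable_def
  by (intro exI[of _ "GK K"]) (simp add: quad_simps)

text \<open>Any certificate will do: the equation with source \<open>- \<Sigma>0\<close> is then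
  solvable, and monotonicity makes its solution positive semidefinite.\<close>

lemma stableI: "lyap_stable (Ak K) (Ck K) \<Longrightarrow> stable K"
proof -
  assume st: "lyap_stable (Ak K) (Ck K)"
  obtain X where X: "transpose X = X" "lyap (Ak K) (Ck K) X = - \<Sigma>0"
    using lyap_stable_solve[OF st, of "- \<Sigma>0"] symmetric_data by (auto simp: matrix_distribs)
  have "psd X"
  proof (rule lyap_stable_monotone[OF st X(1)])
    show "v \<bullet> (lyap (Ak K) (Ck K) X *v v) \<le> 0" for v
      using \<Sigma>0_psd by (simp add: X quad_simps psd_def)
  qed
  then show ?thesis using X by (auto simp: stable_def)
qed

lemma GK_sym: "stable K \<Longrightarrow> transpose (GK K) = GK K"
  using GK_spec(1) by (auto simp: psd_def)

lemma GK_unique: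
  assumes X: "transpose X = X" "lyap (Ak K) (Ck K) X = - \<Sigma>0" and st: "stable K"
  shows "X = GK K"
proof -
  have "X - GK K = 0"
    by (rule lyap_stable_injective[OF stable_lyap[OF st]])
      (simp_all add: matrix_distribs X GK_sym[OF st] lyap_diff GK_spec(2)[OF st])
  then show ?thesis by simp
qed

lemma GK_pos: "stable K \<Longrightarrow> v \<noteq> 0 \<Longrightarrow> 0 < v \<bullet> (GK K *v v)"
proof (rule lyap_neg_pd)
  assume st: "stable K"
  show "psd (GK K)" by (rule GK_spec(1)[OF st])
  show "u \<noteq> 0 \<Longrightarrow> u \<bullet> (lyap (Ak K) (Ck K) (GK K) *v u) < 0" for u
    using \<Sigma>0_pos by (simp add: GK_spec(2)[OF st] quad_simps)
qed

lemma GK_spd: "stable K \<Longrightarrow> sym_pos_def (GK K)"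
  using GK_pos GK_sym by (auto simp: sym_pos_def_def)

lemma Qk_sym: "transpose (Qk K) = Qk K"
  by (simp add: Qk_def matrix_distribs matrix_transpose_mul symmetric_data matrix_mul_assoc)

lemma quad_sandwich: "v \<bullet> ((transpose U ** S ** V) *v v) = (U *v v) \<bullet> (S *v (V *v v))"
  for S :: "real^'k^'k" and U V :: "real^'n^'k"
  using inner_matrix_vector[of v "transpose U" "S *v (V *v v)"]
  by (simp add: matrix_vector_mul_assoc[symmetric])

lemma quad_gram: "v \<bullet> ((transpose U ** V) *v v) = (U *v v) \<bullet> (V *v v)"
  for U V :: "real^'n^'k"
  using inner_matrix_vector[of v "transpose U" "V *v v"] by (simp add: matrix_vector_mul_assoc[symmetric])

lemma Qk_quad: "v \<bullet> (Qk K *v v) = v \<bullet> (Q *v v) + (K *v v) \<bullet> (R *v (K *v v))"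
  by (simp add: Qk_def quad_simps quad_sandwich)

lemma Qk_nonneg: "0 \<le> v \<bullet> (Qk K *v v)"
  using sym_pos_def_psd[OF Q] sym_pos_def_psd[OF R] by (simp add: Qk_quad psd_def)

lemma PK_spec:
  assumes st: "stable K"
  shows "transpose (PK K) = PK K" "lyap_adj (Ak K) (Ck K) (PK K) = - Qk K"
proof -
  have "\<exists>P. transpose P = P \<and> lyap_adj (Ak K) (Ck K) P = - Qk K"
    using lyap_adj_stable_solve[OF stable_lyap[OF st], of "- Qk K"] Qk_sym by (auto simp: matrix_distribs)
  from someI_ex[OF this] show "transpose (PK K) = PK K" "lyap_adj (Ak K) (Ck K) (PK K) = - Qk K"
    unfolding PK_def by auto
qed

text \<open>The form of \<open>PK K\<close> at \<open>v\<close> is the cost of starting from the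
  rank-one moment \<open>outer v v\<close>: it equals \<open>Qk K\<close> paired with the solution
  \<open>X\<close> of the direct equation with that source.\<close>

lemma PK_psd:
  assumes st: "stable K" shows "psd (PK K)"
  unfolding psd_def
proof (intro conjI allI PK_spec(1)[OF st])
  fix v
  have ov: "v \<bullet> (outer w w *v v) = (w \<bullet> v)\<^sup>2" for w v :: "real^'n"
    by (simp add: outer_mult power2_eq_square inner_commute)
  obtain X where X: "transpose X = X" "lyap (Ak K) (Ck K) X = - outer v v"
    using lyap_stable_solve[OF stable_lyap[OF st], of "- outer v v"] by (auto simp: matrix_distribs transpose_outer)
  have "psd X"
    by (rule lyap_stable_monotone[OF stable_lyap[OF st] X(1)]) (simp add: X(2) quad_simps ov)
  then have "0 \<le> Qk K \<bullet> X" by (rule psd_inner_nonneg[OF _ Qk_nonneg])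
  also have "\<dots> = - (X \<bullet> lyap_adj (Ak K) (Ck K) (PK K))"
    by (simp add: PK_spec(2)[OF st] inner_commute)
  also have "\<dots> = - (lyap (Ak K) (Ck K) X \<bullet> PK K)" by (simp add: lyap_inner)
  also have "\<dots> = v \<bullet> (PK K *v v)" by (simp add: X(2) inner_commute[of "outer v v"] inner_outer)
  finally show "0 \<le> v \<bullet> (PK K *v v)" .
qed

lemma cost_PK: assumes st: "stable K" shows "cost K = PK K \<bullet> \<Sigma>0"
proof -
  have "PK K \<bullet> \<Sigma>0 = - (lyap (Ak K) (Ck K) (GK K) \<bullet> PK K)"
    by (simp add: GK_spec(2)[OF st] inner_commute)
  also have "\<dots> = - (GK K \<bullet> lyap_adj (Ak K) (Ck K) (PK K))" by (simp add: lyap_inner)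
  also have "\<dots> = cost K" by (simp add: PK_spec(2)[OF st] cost_def inner_commute)
  finally show ?thesis by simp
qed

lemma Qk_lower: "v \<bullet> ((lQ *\<^sub>R mat 1) *v v) \<le> v \<bullet> (Qk K *v v)"
proof -
  have "0 \<le> (K *v v) \<bullet> (R *v (K *v v))" using sym_pos_def_psd[OF R] by (simp add: psd_def)
  then show ?thesis using min_eigenvalues_le(1)[of v] by (simp add: quad_simps Qk_quad)
qed

lemma trace_GK_le: assumes st: "stable K" shows "lQ * (mat 1 \<bullet> GK K) \<le> cost K"
proof -
  have "(lQ *\<^sub>R mat 1) \<bullet> GK K \<le> Qk K \<bullet> GK K"
    by (rule psd_inner_mono[OF GK_spec(1)[OF st] Qk_lower])
  then show ?thesis by (simp add: cost_def)
qed

text \<open>The residual of the optimality equation: with \<open>PK K\<close> frozen, it is the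
  first-order coefficient in the feedback of the left-hand side of the equation defining
  \<open>PK\<close>. The second-order coefficient is \<open>Rk\<close>.\<close>

definition EK :: "real^'n^'m \<Rightarrow> real^'n^'m" where
  "EK K = R ** K + transpose B ** PK K + transpose D ** PK K ** Ck K"

definition Rk :: "real^'n^'m \<Rightarrow> real^'m^'m" where
  "Rk K = R + transpose D ** PK K ** D"

lemma Rk_quad: "stable K \<Longrightarrow> lR * (w \<bullet> w) \<le> w \<bullet> (Rk K *v w)"
proof -
  assume st: "stable K"
  have "w \<bullet> ((transpose D ** PK K ** D) *v w) = (D *v w) \<bullet> (PK K *v (D *v w))"
    using inner_matrix_vector[of w "transpose D" "PK K *v (D *v w)"] by (simp add: matrix_vector_mul_assoc[symmetric])
  moreover have "0 \<le> (D *v w) \<bullet> (PK K *v (D *v w))" using PK_psd[OF st] by (simp add: psd_def)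
  ultimately show ?thesis using min_eigenvalues_le(2)[of w] by (simp add: Rk_def quad_simps)
qed

text \<open>For a frozen \<open>P\<close> the expression is quadratic in the feedback and vanishes
  at \<open>K\<close> by the equation of \<open>PK K\<close>, so its second-order expansion is
  exact.\<close>

lemma cost_shift:
  fixes K K' :: "real^'n^'m"
  assumes st: "stable K"
  defines "\<Delta> \<equiv> K' - K"
  shows "Qk K' + lyap_adj (Ak K') (Ck K') (PK K)
    = transpose \<Delta> ** EK K + transpose (EK K) ** \<Delta> + transpose \<Delta> ** Rk K ** \<Delta>"
proof -
  have K': "K' = K + \<Delta>" by (simp add: \<Delta>_def)
  have z: "Qk K + lyap_adj (Ak K) (Ck K) (PK K) = 0" using PK_spec(2)[OF st] by simp
  have "Qk K' + lyap_adj (Ak K') (Ck K') (PK K) = (Qk K + lyap_adj (Ak K) (Ck K) (PK K))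
     + (transpose \<Delta> ** EK K + transpose (EK K) ** \<Delta> + transpose \<Delta> ** Rk K ** \<Delta>)"
    unfolding K' Qk_def lyap_adj_def Ak_def Ck_def EK_def Rk_def
    by (simp add: matrix_distribs matrix_transpose_mul matrix_mul_assoc symmetric_data PK_spec(1)[OF st])
  then show ?thesis unfolding z by simp
qed

text \<open>The equation for \<open>PK K\<close> is paired with the Lyapunov equation of the other
  feedback \<open>K'\<close>. Mixing the two leaves no remainder, however far apart the feedbacks
  are.\<close>

lemma cost_diff:
  assumes st: "stable K" and st': "stable K'"
  shows "cost K' - cost K = (transpose (K' - K) ** EK K + transpose (EK K) ** (K' - K)
     + transpose (K' - K) ** Rk K ** (K' - K)) \<bullet> GK K'"
proof -
  have "cost K = - (lyap (Ak K') (Ck K') (GK K') \<bullet> PK K)"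
    by (simp add: cost_PK[OF st] GK_spec(2)[OF st'] inner_commute)
  also have "\<dots> = - (lyap_adj (Ak K') (Ck K') (PK K) \<bullet> GK K')"
    unfolding lyap_inner inner_commute[of "GK K'"] ..
  finally show ?thesis
    unfolding cost_shift[OF st, symmetric] by (simp add: cost_def inner_add_left)
qed

lemma gram_inner:
  fixes U V :: "real^'n^'m" and G :: "real^'n^'n"
  assumes "transpose G = G"
  shows "(transpose U ** V) \<bullet> G = (V ** G) \<bullet> U"
proof -
  have "(transpose U ** V) \<bullet> G = V \<bullet> (U ** G)" using inner_mult_left[of "transpose U" V G] by simp
  also have "\<dots> = (V ** G) \<bullet> U" using inner_mult_right[of V G U] assms by simp
  finally show ?thesis .
qed

lemma cross_inner:
  fixes U V :: "real^'n^'m" and G :: "real^'n^'n"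
  assumes "transpose G = G"
  shows "(transpose U ** V + transpose V ** U) \<bullet> G = 2 * ((V ** G) \<bullet> U)"
proof -
  have "(transpose V ** U) \<bullet> G = transpose (transpose V ** U) \<bullet> transpose G" by (simp add: inner_transpose)
  also have "\<dots> = (transpose U ** V) \<bullet> G" by (simp add: matrix_transpose_mul assms)
  finally show ?thesis using gram_inner[OF assms, of U V] by (simp add: inner_add_left)
qed

lemma cost_diff':
  assumes st: "stable K" and st': "stable K'"
  shows "cost K' - cost K = 2 * ((EK K ** GK K') \<bullet> (K' - K))
     + (transpose (K' - K) ** Rk K ** (K' - K)) \<bullet> GK K'"
  unfolding cost_diff[OF assms] using cross_inner[OF GK_sym[OF st'], of "K' - K" "EK K"]
  by (simp add: inner_add_left)

section \<open>Bounds through the least eigenvalue of the integrated moments\<close>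

abbreviation lam :: "real^'n^'m \<Rightarrow> real" where "lam K \<equiv> min_eigenvalue (GK K)"

lemma lam_pos: "stable K \<Longrightarrow> 0 < lam K"
  by (intro min_eigenvalue_pos GK_spd)

lemma lam_le: "stable K \<Longrightarrow> lam K * (v \<bullet> v) \<le> v \<bullet> (GK K *v v)"
  by (intro min_eigenvalue_le GK_sym)

lemma gram_GK:
  fixes U :: "real^'n^'m"
  assumes st: "stable K"
  shows "lam K * (norm U)\<^sup>2 \<le> (transpose U ** U) \<bullet> GK K"
proof -
  have "psd (transpose U ** U)" by (simp add: psd_def quad_gram matrix_transpose_mul)
  then have "(lam K *\<^sub>R mat 1) \<bullet> (transpose U ** U) \<le> GK K \<bullet> (transpose U ** U)"
    by (rule psd_inner_mono) (simp add: quad_simps lam_le[OF st])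
  moreover have "mat 1 \<bullet> (transpose U ** U) = (norm U)\<^sup>2"
    using inner_mult_left[of "transpose U" U "mat 1"] by (simp add: power2_norm_eq_inner inner_commute)
  ultimately show ?thesis by (simp add: inner_commute)
qed

lemma lam_lower:
  assumes st: "stable K" shows "lS \<le> 2 * lam K * spectral_norm (Ak K)"
proof -
  obtain v where v: "v \<bullet> v = 1" "GK K *v v = lam K *\<^sub>R v"
    using eigenvalue_rayleigh[OF GK_sym[OF st]] by metis
  let ?a = "Ak K" and ?c = "Ck K" and ?G = "GK K"
  have 1: "v \<bullet> ((?a ** ?G) *v v) = lam K * (v \<bullet> (?a *v v))"
    by (simp add: matrix_vector_mul_assoc[symmetric] v(2) matrix_vector_mult_scaleR)
  have 2: "v \<bullet> ((?G ** transpose ?a) *v v) = lam K * (v \<bullet> (?a *v v))"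
  proof -
    have "v \<bullet> (?G *v (transpose ?a *v v)) = (transpose ?a *v v) \<bullet> (?G *v v)" by (rule sym_inner[OF GK_sym[OF st]])
    also have "\<dots> = lam K * (v \<bullet> (?a *v v))" by (simp add: v(2) inner_matrix_vector[of v ?a v])
    finally show ?thesis by (simp add: matrix_vector_mul_assoc[symmetric])
  qed
  have 3: "0 \<le> v \<bullet> ((?c ** ?G ** transpose ?c) *v v)"
  proof -
    have "v \<bullet> ((?c ** ?G ** transpose ?c) *v v) = (transpose ?c *v v) \<bullet> (?G *v (transpose ?c *v v))"
      by (simp add: matrix_vector_mul_assoc[symmetric] inner_matrix_vector[of v ?c])
    then show ?thesis using GK_spec(1)[OF st] by (simp add: psd_def)
  qed
  have "- (v \<bullet> (\<Sigma>0 *v v)) = v \<bullet> (lyap ?a ?c ?G *v v)" by (simp add: GK_spec(2)[OF st] quad_simps)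
  also have "\<dots> \<ge> 2 * lam K * (v \<bullet> (?a *v v))" using 1 2 3 by (simp add: lyap_def quad_simps)
  finally have "lS \<le> 2 * lam K * (- (v \<bullet> (?a *v v)))" using min_eigenvalues_le(3)[of v] v(1) by simp
  also have "\<dots> \<le> 2 * lam K * spectral_norm ?a"
  proof (rule mult_left_mono)
    have "norm v = 1" using v(1) by (simp add: norm_eq_1)
    then show "- (v \<bullet> (?a *v v)) \<le> spectral_norm ?a"
      using Cauchy_Schwarz_ineq2[of v "?a *v v"] spectral_norm_bound[of ?a v] by simp
  qed (use lam_pos[OF st] in simp)
  finally show ?thesis .
qed

lemma cost_ge_norm:
  assumes st: "stable K" shows "lR * lam K * (norm K)\<^sup>2 \<le> cost K"
proof -
  have "lR * (lam K * (norm K)\<^sup>2) \<le> lR * ((transpose K ** K) \<bullet> GK K)"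
    using min_eigenvalues_pos by (intro mult_left_mono gram_GK st) auto
  also have "\<dots> = (lR *\<^sub>R (transpose K ** K)) \<bullet> GK K" by simp
  also have "\<dots> \<le> cost K"
    unfolding cost_def
  proof (rule psd_inner_mono[OF GK_spec(1)[OF st]])
    fix v
    have "0 \<le> v \<bullet> (Q *v v)" using sym_pos_def_psd[OF Q] by (simp add: psd_def)
    then show "v \<bullet> ((lR *\<^sub>R (transpose K ** K)) *v v) \<le> v \<bullet> (Qk K *v v)"
      using min_eigenvalues_le(2)[of "K *v v"] by (simp add: quad_simps Qk_quad quad_gram)
  qed
  finally show ?thesis by (simp add: mult.assoc)
qed

text \<open>Half of the bound for \<open>spectral_norm (Ak K)\<close> on the sublevel set of
  \<open>c\<close>; at \<open>c = J0\<close> it is the bracket squared in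
  \<open>\<mu>\<close>.\<close>

definition \<kappa> :: "real \<Rightarrow> real" where
  "\<kappa> c = spectral_norm A + (spectral_norm B)\<^sup>2 * c / (lR * lS)"

lemma Ak_spectral: "spectral_norm (Ak K) \<le> spectral_norm A + spectral_norm B * norm K"
  unfolding spectral_norm_def[of "Ak K"]
proof (rule onorm_le)
  fix v :: "real^'n"
  have "norm (Ak K *v v) \<le> norm (A *v v) + norm (B *v (K *v v))"
    by (simp add: Ak_def matrix_vector_mult_add_rdistrib matrix_vector_mul_assoc[symmetric] norm_triangle_ineq)
  also have "\<dots> \<le> spectral_norm A * norm v + spectral_norm B * (norm K * norm v)"
    by (intro add_mono spectral_norm_bound order_trans[OF spectral_norm_bound] mult_left_mono norm_matvec_le spectral_norm_nonneg)
  finally show "norm (Ak K *v v) \<le> (spectral_norm A + spectral_norm B * norm K) * norm v"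
    by (simp add: algebra_simps)
qed

text \<open>If \<open>y\<close> exceeded \<open>a + 2 * p\<close>, then \<open>y * y\<close> would
  exceed \<open>y * a + 2 * p * y\<close>, which is at least \<open>2 * p * (a + y)\<close>.\<close>

lemma quadratic_bound:
  fixes y a p :: real
  assumes "y * y \<le> 2 * p * (a + y)" "0 \<le> a" "0 \<le> p" "0 \<le> y"
  shows "y \<le> a + 2 * p"
proof (rule ccontr)
  assume "\<not> y \<le> a + 2 * p"
  then have y: "a + 2 * p < y" by simp
  then have "0 < y" using assms by linarith
  then have "y * (a + 2 * p) < y * y" using y by (rule mult_strict_left_mono[rotated])
  moreover have "2 * p * a \<le> y * a" using y assms by (intro mult_right_mono) auto
  ultimately show False using assms(1) by (simp add: algebra_simps)
qed

text \<open>Three estimates close a circle: the cost bounds \<open>lam K\<close> times the squared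
  norm of \<open>K\<close>, \<open>lam K\<close> is bounded below through the norm of
  \<open>Ak K\<close>, and that norm grows at most linearly in \<open>K\<close>. Together they form
  a quadratic inequality for \<open>spectral_norm B * norm K\<close>.\<close>

lemma norm_K_bound:
  assumes st: "stable K" and c: "cost K \<le> c"
  shows "spectral_norm B * norm K \<le> spectral_norm A + 2 * ((spectral_norm B)\<^sup>2 * c / (lR * lS))"
proof (rule quadratic_bound)
  let ?a = "spectral_norm A" and ?b = "spectral_norm B" and ?k = "norm K"
  have c0: "0 \<le> c" using trace_GK_le[OF st] psd_trace_nonneg[OF GK_spec(1)[OF st]] min_eigenvalues_pos c
    by (meson mult_nonneg_nonneg less_imp_le order_trans)
  have "lS * (lR * ?k\<^sup>2) \<le> (2 * lam K * spectral_norm (Ak K)) * (lR * ?k\<^sup>2)"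
    using min_eigenvalues_pos by (intro mult_right_mono lam_lower st) auto
  also have "\<dots> = 2 * spectral_norm (Ak K) * (lR * lam K * ?k\<^sup>2)" by simp
  also have "\<dots> \<le> 2 * spectral_norm (Ak K) * c"
    using cost_ge_norm[OF st] c by (intro mult_left_mono) (auto simp: spectral_norm_nonneg)
  also have "\<dots> \<le> 2 * (?a + ?b * ?k) * c"
    using Ak_spectral[of K] c0 by (intro mult_right_mono) auto
  finally have "(lR * lS) * ?k\<^sup>2 \<le> 2 * (?a + ?b * ?k) * c" by (simp add: mult_ac)
  then have "?k\<^sup>2 \<le> 2 * (?a + ?b * ?k) * c / (lR * lS)"
    using min_eigenvalues_pos by (simp add: pos_le_divide_eq mult.commute)
  then have "?b\<^sup>2 * ?k\<^sup>2 \<le> ?b\<^sup>2 * (2 * (?a + ?b * ?k) * c / (lR * lS))"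
    by (rule mult_left_mono) simp
  then show "?b * ?k * (?b * ?k) \<le> 2 * (?b\<^sup>2 * c / (lR * lS)) * (?a + ?b * ?k)"
    by (simp add: power2_eq_square mult_ac)
  show "0 \<le> ?b\<^sup>2 * c / (lR * lS)" using c0 min_eigenvalues_pos by simp
qed (simp_all add: spectral_norm_nonneg)

lemma Ak_kappa:
  assumes "stable K" "cost K \<le> c" shows "spectral_norm (Ak K) \<le> 2 * \<kappa> c"
  using Ak_spectral[of K] norm_K_bound[OF assms] by (simp add: \<kappa>_def)

lemma lam_kappa:
  assumes "stable K" "cost K \<le> c" shows "lS \<le> 4 * lam K * \<kappa> c"
proof -
  have "lS \<le> 2 * lam K * spectral_norm (Ak K)" by (rule lam_lower[OF assms(1)])
  also have "\<dots> \<le> 2 * lam K * (2 * \<kappa> c)"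
    using lam_pos[OF assms(1)] by (intro mult_left_mono Ak_kappa assms) auto
  finally show ?thesis by simp
qed

lemma kappa_pos:
  assumes "stable K" "cost K \<le> c" shows "0 < \<kappa> c"
proof (rule ccontr)
  assume "\<not> 0 < \<kappa> c"
  then have "4 * lam K * \<kappa> c \<le> 0" using lam_pos[OF assms(1)] by (intro mult_nonneg_nonpos) auto
  then show False using lam_kappa[OF assms] min_eigenvalues_pos(3) by linarith
qed

text \<open>The least eigenvalue of \<open>GK K\<close> is at most its trace, which the cost bounds
  from above, while \<open>\<kappa> c\<close> bounds that eigenvalue from below. The outcome is used
  to compare constants in \<open>flow_distance_decay\<close>.\<close>

lemma cost_lower:
  assumes "stable K" "cost K \<le> c" shows "lQ * lS \<le> 4 * c * \<kappa> c"
proof -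
  obtain v where v: "v \<bullet> v = 1" "GK K *v v = lam K *\<^sub>R v"
    using eigenvalue_rayleigh[OF GK_sym[OF assms(1)]] by metis
  have "lam K \<le> mat 1 \<bullet> GK K"
    using psd_quad_le_trace[OF GK_spec(1)[OF assms(1)], of v] v by simp
  then have "lQ * lam K \<le> lQ * (mat 1 \<bullet> GK K)" using min_eigenvalues_pos by (intro mult_left_mono) auto
  then have lc: "lQ * lam K \<le> c" using trace_GK_le[OF assms(1)] assms(2) by linarith
  have "lQ * lS \<le> lQ * (4 * lam K * \<kappa> c)" using min_eigenvalues_pos by (intro mult_left_mono lam_kappa assms) auto
  also have "\<dots> = 4 * (lQ * lam K) * \<kappa> c" by simp
  also have "\<dots> \<le> 4 * c * \<kappa> c" using lc kappa_pos[OF assms] by (intro mult_right_mono) auto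
  finally show ?thesis .
qed

lemma cost_pos: "stable K \<Longrightarrow> 0 < cost K"
proof -
  assume st: "stable K"
  have "0 < 4 * cost K * \<kappa> (cost K)"
    using cost_lower[OF st order_refl] min_eigenvalues_pos by (meson mult_pos_pos less_le_trans)
  then show ?thesis using kappa_pos[OF st order_refl] by (simp add: zero_less_mult_iff)
qed

section \<open>Gradient dominance and quadratic growth\<close>

definition grad :: "real^'n^'m \<Rightarrow> real^'n^'m" where
  "grad K = 2 *\<^sub>R (EK K ** GK K)"

definition \<mu> :: "real \<Rightarrow> real" where
  "\<mu> c = 4 * c / (lR * lQ * lS\<^sup>2) * (\<kappa> c)\<^sup>2"

text \<open>The exact cost difference is minimized over all displacements at once, which bounds it
  by the squared residual times the trace of \<open>GK K'\<close>. The norm of the residual is then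
  recovered from the gradient by means of the lower bound on \<open>lam K\<close>; the factors of
  these two steps multiply to \<open>\<mu> c\<close>.\<close>

lemma gradient_dominance:
  assumes st: "stable K" "cost K \<le> c" and st': "stable K'" "cost K' \<le> c"
  shows "cost K - cost K' \<le> \<mu> c * (norm (grad K))\<^sup>2"
proof -
  let ?\<Delta> = "K' - K" and ?E = "EK K" and ?G = "GK K" and ?G' = "GK K'"
  have c0: "0 \<le> c" using cost_pos[OF st(1)] st(2) by linarith
  have "(- (1/lR) *\<^sub>R (transpose ?E ** ?E)) \<bullet> ?G' \<le> (transpose ?\<Delta> ** ?E + transpose ?E ** ?\<Delta> + transpose ?\<Delta> ** Rk K ** ?\<Delta>) \<bullet> ?G'"
  proof (rule psd_inner_mono[OF GK_spec(1)[OF st'(1)]])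
    fix v
    let ?e = "?E *v v" and ?d = "?\<Delta> *v v"
    \<comment> \<open>Completing the square, with \<open>Rk K\<close> already replaced by its lower
      bound \<open>lR\<close>: the least favourable displacement is \<open>- ?e\<close> divided by
      \<open>lR\<close>, and the resulting bound no longer contains it.\<close>
    have "0 \<le> (norm (?e + lR *\<^sub>R ?d))\<^sup>2" by simp
    then have "0 \<le> ?e \<bullet> ?e + 2 * lR * (?d \<bullet> ?e) + lR * lR * (?d \<bullet> ?d)"
      unfolding power2_norm_eq_inner by (simp add: inner_add_left inner_add_right inner_commute algebra_simps)
    then have "0 \<le> (1 / lR) * (?e \<bullet> ?e + 2 * lR * (?d \<bullet> ?e) + lR * lR * (?d \<bullet> ?d))"
      using min_eigenvalues_pos by simp
    also have "\<dots> = (1/lR) * (?e \<bullet> ?e) + 2 * (?d \<bullet> ?e) + lR * (?d \<bullet> ?d)"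
      using min_eigenvalues_pos by (simp add: field_simps)
    also have "\<dots> \<le> (1/lR) * (?e \<bullet> ?e) + 2 * (?d \<bullet> ?e) + ?d \<bullet> (Rk K *v ?d)"
      using Rk_quad[OF st(1), of ?d] by simp
    finally show "v \<bullet> ((- (1/lR) *\<^sub>R (transpose ?E ** ?E)) *v v)
      \<le> v \<bullet> ((transpose ?\<Delta> ** ?E + transpose ?E ** ?\<Delta> + transpose ?\<Delta> ** Rk K ** ?\<Delta>) *v v)"
      by (simp add: quad_simps quad_gram quad_sandwich inner_commute[of ?e ?d])
  qed
  then have 1: "cost K - cost K' \<le> (1/lR) * ((transpose ?E ** ?E) \<bullet> ?G')"
    using cost_diff[OF st(1) st'(1)] by simp
  have "(transpose ?E ** ?E) \<bullet> ?G' \<le> ((norm ?E)\<^sup>2 *\<^sub>R mat 1) \<bullet> ?G'"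
  proof (rule psd_inner_mono[OF GK_spec(1)[OF st'(1)]])
    fix v
    have "(norm (?E *v v))\<^sup>2 \<le> (norm ?E * norm v)\<^sup>2" by (intro power_mono norm_matvec_le) auto
    then show "v \<bullet> ((transpose ?E ** ?E) *v v) \<le> v \<bullet> (((norm ?E)\<^sup>2 *\<^sub>R mat 1) *v v)"
      by (simp add: quad_simps quad_gram power_mult_distrib power2_norm_eq_inner)
  qed
  also have "\<dots> = (norm ?E)\<^sup>2 * (mat 1 \<bullet> ?G')" by simp
  also have "\<dots> \<le> (norm ?E)\<^sup>2 * (c / lQ)"
  proof (rule mult_left_mono)
    show "mat 1 \<bullet> ?G' \<le> c / lQ" using trace_GK_le[OF st'(1)] st'(2) min_eigenvalues_pos by (simp add: pos_le_divide_eq mult.commute)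
  qed simp
  finally have "(1/lR) * ((transpose ?E ** ?E) \<bullet> ?G') \<le> (1/lR) * ((norm ?E)\<^sup>2 * (c / lQ))"
    using min_eigenvalues_pos by (intro mult_left_mono) auto
  with 1 have 2: "cost K - cost K' \<le> (1/lR) * ((norm ?E)\<^sup>2 * (c / lQ))" by linarith
  \<comment> \<open>Multiplication by \<open>GK K\<close> shrinks no matrix by more than the factor
    \<open>lam K\<close>; this is read off from the inner product of \<open>?E ** ?G\<close> with
    \<open>?E\<close>.\<close>
  have lamE: "lam K * norm ?E \<le> norm (?E ** ?G)"
  proof (cases "?E = 0")
    case False
    have "lam K * (norm ?E)\<^sup>2 \<le> (transpose ?E ** ?E) \<bullet> ?G" by (rule gram_GK[OF st(1)])
    also have "\<dots> = (?E ** ?G) \<bullet> ?E"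
      by (rule gram_inner[OF GK_sym[OF st(1)]])
    also have "\<dots> \<le> norm (?E ** ?G) * norm ?E" by (rule norm_cauchy_schwarz)
    finally have "norm ?E * (lam K * norm ?E) \<le> norm ?E * norm (?E ** ?G)" by (simp add: power2_eq_square mult_ac)
    then show ?thesis by (rule mult_left_le_imp_le) (use False in simp)
  qed simp
  have "lS * norm ?E \<le> 4 * lam K * \<kappa> c * norm ?E" by (intro mult_right_mono lam_kappa st) auto
  also have "\<dots> = 4 * \<kappa> c * (lam K * norm ?E)" by simp
  also have "\<dots> \<le> 4 * \<kappa> c * norm (?E ** ?G)"
    using kappa_pos[OF st] by (intro mult_left_mono lamE) auto
  also have "\<dots> = 2 * \<kappa> c * norm (grad K)" by (simp add: grad_def)
  finally have "norm ?E \<le> 2 * \<kappa> c * norm (grad K) / lS" using min_eigenvalues_pos by (simp add: pos_le_divide_eq mult.commute)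
  then have "(norm ?E)\<^sup>2 \<le> (2 * \<kappa> c * norm (grad K) / lS)\<^sup>2" by (rule power_mono) simp
  then have "(1/lR) * ((norm ?E)\<^sup>2 * (c / lQ)) \<le> (1/lR) * ((2 * \<kappa> c * norm (grad K) / lS)\<^sup>2 * (c / lQ))"
    using min_eigenvalues_pos c0 by (intro mult_left_mono mult_right_mono) auto
  also have "\<dots> = \<mu> c * (norm (grad K))\<^sup>2"
    by (simp add: \<mu>_def power_divide power_mult_distrib mult_ac)
  finally show ?thesis using 2 by linarith
qed

text \<open>The exact cost difference is expanded around the critical point \<open>K'\<close>, where
  the linear term is absent, and its quadratic term is integrated against \<open>GK K\<close>, whose
  least eigenvalue is bounded below.\<close>

lemma quadratic_growth:
  assumes st: "stable K" "cost K \<le> c" and st': "stable K'" and E: "EK K' = 0"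
  shows "lR * lS * (norm (K - K'))\<^sup>2 \<le> 4 * \<kappa> c * (cost K - cost K')"
proof -
  let ?\<Delta> = "K - K'"
  have "lR * (lam K * (norm ?\<Delta>)\<^sup>2) \<le> lR * ((transpose ?\<Delta> ** ?\<Delta>) \<bullet> GK K)"
    using min_eigenvalues_pos by (intro mult_left_mono gram_GK st) auto
  also have "\<dots> = (lR *\<^sub>R (transpose ?\<Delta> ** ?\<Delta>)) \<bullet> GK K" by simp
  also have "\<dots> \<le> (transpose ?\<Delta> ** Rk K' ** ?\<Delta>) \<bullet> GK K"
    by (rule psd_inner_mono[OF GK_spec(1)[OF st(1)]]) (simp add: quad_simps quad_gram quad_sandwich Rk_quad[OF st'])
  also have "\<dots> = cost K - cost K'"
    using cost_diff'[OF st' st(1)] by (simp add: E)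
  finally have 1: "lR * (lam K * (norm ?\<Delta>)\<^sup>2) \<le> cost K - cost K'" .
  have "lR * lS * (norm ?\<Delta>)\<^sup>2 \<le> lR * (4 * lam K * \<kappa> c) * (norm ?\<Delta>)\<^sup>2"
    using min_eigenvalues_pos by (intro mult_right_mono mult_left_mono lam_kappa st) auto
  also have "\<dots> = 4 * \<kappa> c * (lR * (lam K * (norm ?\<Delta>)\<^sup>2))" by simp
  also have "\<dots> \<le> 4 * \<kappa> c * (cost K - cost K')"
    using kappa_pos[OF st] 1 by (intro mult_left_mono) auto
  finally show ?thesis .
qed

end

section \<open>Sublevel sets and the gradient\<close>

lemma bounded_bilinear_matmul: "bounded_bilinear ((**) :: real^'n^'m \<Rightarrow> real^'k^'n \<Rightarrow> real^'k^'m)"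
proof (rule bounded_bilinear.intro)
  show "\<exists>K. \<forall>(a :: real^'n^'m) (b :: real^'k^'n). norm (a ** b) \<le> norm a * norm b * K"
    by (rule exI[of _ 1]) (simp add: norm_matmul_le)
qed (simp_all add: matrix_distribs)

lemmas tendsto_matmul = bounded_bilinear.tendsto[OF bounded_bilinear_matmul]

lemma tendsto_transpose: "(f \<longlongrightarrow> X) F \<Longrightarrow> ((\<lambda>x. transpose (f x)) \<longlongrightarrow> transpose X) F"
  for f :: "'a \<Rightarrow> real^'n^'m"
  by (rule bounded_linear.tendsto[of transpose], rule bounded_linear_intro[where K=1])
    (simp_all add: matrix_distribs norm_transpose)

lemma tendsto_lyap:
  assumes "(a \<longlongrightarrow> a') F" "(c \<longlongrightarrow> c') F" "(g \<longlongrightarrow> G) F"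
  shows "((\<lambda>x. lyap (a x) (c x) (g x)) \<longlongrightarrow> lyap a' c' G) F"
  unfolding lyap_def by (intro tendsto_add tendsto_matmul tendsto_transpose assms)

lemma lyap_diff_bound:
  "norm (lyap a' c' G - lyap a c G) \<le> (2 * norm (a' - a) + (norm c' + norm c) * norm (c' - c)) * norm G"
proof -
  have "lyap a' c' G - lyap a c G = ((a' - a) ** G + G ** transpose (a' - a))
     + ((c' - c) ** G ** transpose c' + c ** G ** transpose (c' - c))"
    by (simp add: lyap_def matrix_distribs)
  also have "norm \<dots> \<le> (norm ((a' - a) ** G) + norm (G ** transpose (a' - a)))
     + (norm ((c' - c) ** G ** transpose c') + norm (c ** G ** transpose (c' - c)))"
    by (intro order_trans[OF norm_triangle_ineq] add_mono norm_triangle_ineq)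
  also have "\<dots> \<le> (norm (a' - a) * norm G + norm G * norm (a' - a))
     + (norm (c' - c) * norm G * norm c' + norm c * norm G * norm (c' - c))"
  proof (intro add_mono)
    show "norm ((a' - a) ** G) \<le> norm (a' - a) * norm G" by (rule norm_matmul_le)
    show "norm (G ** transpose (a' - a)) \<le> norm G * norm (a' - a)"
      using norm_matmul_le[of G "transpose (a' - a)"] by (simp only: norm_transpose)
    have "norm ((c' - c) ** G ** transpose c') \<le> norm ((c' - c) ** G) * norm c'"
      using norm_matmul_le[of "(c' - c) ** G" "transpose c'"] by (simp only: norm_transpose)
    then show "norm ((c' - c) ** G ** transpose c') \<le> norm (c' - c) * norm G * norm c'"
      using mult_right_mono[OF norm_matmul_le[of "c' - c" G] norm_ge_zero[of c']] by linarith
    have "norm (c ** G ** transpose (c' - c)) \<le> norm (c ** G) * norm (c' - c)"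
      using norm_matmul_le[of "c ** G" "transpose (c' - c)"] by (simp only: norm_transpose)
    then show "norm (c ** G ** transpose (c' - c)) \<le> norm c * norm G * norm (c' - c)"
      using mult_right_mono[OF norm_matmul_le[of c G] norm_ge_zero[of "c' - c"]] by linarith
  qed
  finally show ?thesis by (simp add: algebra_simps)
qed

text \<open>The two properties are kept together because a product of Lipschitz maps is Lipschitz
  only with bounds on the factors; in this form the class is closed under matrix products.\<close>

definition bounded_lipschitz :: "'a::real_normed_vector set \<Rightarrow> ('a \<Rightarrow> 'b::real_normed_vector) \<Rightarrow> bool" where
  "bounded_lipschitz S h \<longleftrightarrow> (\<exists>b\<ge>0. \<forall>x\<in>S. norm (h x) \<le> b) \<and> (\<exists>l\<ge>0. \<forall>x\<in>S. \<forall>y\<in>S. norm (h x - h y) \<le> l * norm (x - y))"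

lemma bounded_lipschitzE:
  assumes "bounded_lipschitz S h"
  obtains b l where "0 \<le> b" "0 \<le> l" "\<And>x. x \<in> S \<Longrightarrow> norm (h x) \<le> b"
    "\<And>x y. x \<in> S \<Longrightarrow> y \<in> S \<Longrightarrow> norm (h x - h y) \<le> l * norm (x - y)"
  using assms unfolding bounded_lipschitz_def by blast

lemma bounded_lipschitzI:
  assumes "0 \<le> b" "0 \<le> l" "\<And>x. x \<in> S \<Longrightarrow> norm (h x) \<le> b"
    "\<And>x y. x \<in> S \<Longrightarrow> y \<in> S \<Longrightarrow> norm (h x - h y) \<le> l * norm (x - y)"
  shows "bounded_lipschitz S h"
  using assms unfolding bounded_lipschitz_def by blast

lemma bounded_lipschitz_const: "bounded_lipschitz S (\<lambda>_. c)"
  by (rule bounded_lipschitzI[of "norm c" 0]) auto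

lemma bounded_lipschitz_id: "bounded S \<Longrightarrow> bounded_lipschitz S (\<lambda>x. x)"
proof -
  assume "bounded S"
  then obtain b where "b > 0" "\<And>x. x \<in> S \<Longrightarrow> norm x \<le> b" using bounded_pos by blast
  then show ?thesis by (intro bounded_lipschitzI[of b 1]) auto
qed

lemma bounded_lipschitz_add:
  assumes "bounded_lipschitz S f" "bounded_lipschitz S g" shows "bounded_lipschitz S (\<lambda>x. f x + g x)"
proof -
  obtain b l where f: "0 \<le> b" "0 \<le> l" "\<And>x. x \<in> S \<Longrightarrow> norm (f x) \<le> b"
    "\<And>x y. x \<in> S \<Longrightarrow> y \<in> S \<Longrightarrow> norm (f x - f y) \<le> l * norm (x - y)" using bounded_lipschitzE[OF assms(1)] by blast
  obtain b' l' where g: "0 \<le> b'" "0 \<le> l'" "\<And>x. x \<in> S \<Longrightarrow> norm (g x) \<le> b'"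
    "\<And>x y. x \<in> S \<Longrightarrow> y \<in> S \<Longrightarrow> norm (g x - g y) \<le> l' * norm (x - y)" using bounded_lipschitzE[OF assms(2)] by blast
  show ?thesis
  proof (rule bounded_lipschitzI[of "b + b'" "l + l'"])
    show "norm (f x + g x) \<le> b + b'" if "x \<in> S" for x
      using norm_triangle_ineq[of "f x" "g x"] f(3)[OF that] g(3)[OF that] by linarith
    show "norm (f x + g x - (f y + g y)) \<le> (l + l') * norm (x - y)" if "x \<in> S" "y \<in> S" for x y
      using norm_triangle_ineq[of "f x - f y" "g x - g y"] f(4)[OF that] g(4)[OF that]
      by (simp add: algebra_simps)
  qed (use f g in auto)
qed

lemma bounded_lipschitz_matmul:
  fixes f :: "'a::real_normed_vector \<Rightarrow> real^'n^'m" and g :: "'a \<Rightarrow> real^'k^'n"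
  assumes "bounded_lipschitz S f" "bounded_lipschitz S g" shows "bounded_lipschitz S (\<lambda>x. f x ** g x)"
proof -
  obtain b l where f: "0 \<le> b" "0 \<le> l" "\<And>x. x \<in> S \<Longrightarrow> norm (f x) \<le> b"
    "\<And>x y. x \<in> S \<Longrightarrow> y \<in> S \<Longrightarrow> norm (f x - f y) \<le> l * norm (x - y)" using bounded_lipschitzE[OF assms(1)] by blast
  obtain b' l' where g: "0 \<le> b'" "0 \<le> l'" "\<And>x. x \<in> S \<Longrightarrow> norm (g x) \<le> b'"
    "\<And>x y. x \<in> S \<Longrightarrow> y \<in> S \<Longrightarrow> norm (g x - g y) \<le> l' * norm (x - y)" using bounded_lipschitzE[OF assms(2)] by blast
  show ?thesis
  proof (rule bounded_lipschitzI[of "b * b'" "l * b' + b * l'"])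
    show "norm (f x ** g x) \<le> b * b'" if "x \<in> S" for x
      by (rule order_trans[OF norm_matmul_le]) (intro mult_mono f g that norm_ge_zero)
    show "norm (f x ** g x - f y ** g y) \<le> (l * b' + b * l') * norm (x - y)" if s: "x \<in> S" "y \<in> S" for x y
    proof -
      have "f x ** g x - f y ** g y = (f x - f y) ** g x + f y ** (g x - g y)"
        by (simp add: matrix_distribs)
      also have "norm \<dots> \<le> norm ((f x - f y) ** g x) + norm (f y ** (g x - g y))" by (rule norm_triangle_ineq)
      also have "\<dots> \<le> norm (f x - f y) * norm (g x) + norm (f y) * norm (g x - g y)"
        by (intro add_mono norm_matmul_le)
      also have "\<dots> \<le> (l * norm (x - y)) * b' + b * (l' * norm (x - y))"
        using s f g by (intro add_mono mult_mono) auto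
      finally show ?thesis by (simp add: algebra_simps)
    qed
  qed (use f g in auto)
qed

lemma bounded_lipschitz_isometry:
  assumes "bounded_lipschitz S f" "\<And>x y. x \<in> S \<Longrightarrow> y \<in> S \<Longrightarrow> norm (T (f x) - T (f y)) = norm (f x - f y)" "\<And>x. norm (T (f x)) = norm (f x)"
  shows "bounded_lipschitz S (\<lambda>x. T (f x))"
  using assms unfolding bounded_lipschitz_def by simp

lemma bounded_lipschitz_transpose: "bounded_lipschitz S f \<Longrightarrow> bounded_lipschitz S (\<lambda>x. transpose (f x))"
  for f :: "'a::real_normed_vector \<Rightarrow> real^'n^'m"
  by (rule bounded_lipschitz_isometry) (simp_all add: norm_transpose flip: transpose_diff)

lemma bounded_lipschitz_scaleR:
  assumes "bounded_lipschitz S f" shows "bounded_lipschitz S (\<lambda>x. c *\<^sub>R f x)"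
proof -
  obtain b l where f: "0 \<le> b" "0 \<le> l" "\<And>x. x \<in> S \<Longrightarrow> norm (f x) \<le> b"
    "\<And>x y. x \<in> S \<Longrightarrow> y \<in> S \<Longrightarrow> norm (f x - f y) \<le> l * norm (x - y)" using bounded_lipschitzE[OF assms(1)] by blast
  show ?thesis
  proof (rule bounded_lipschitzI[of "\<bar>c\<bar> * b" "\<bar>c\<bar> * l"])
    show "norm (c *\<^sub>R f x) \<le> \<bar>c\<bar> * b" if "x \<in> S" for x using f(3)[OF that] by (simp add: mult_left_mono)
    show "norm (c *\<^sub>R f x - c *\<^sub>R f y) \<le> \<bar>c\<bar> * l * norm (x - y)" if "x \<in> S" "y \<in> S" for x y
      using mult_left_mono[OF f(4)[OF that], of "\<bar>c\<bar>"] by (simp flip: scaleR_diff_right add: mult.assoc)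
  qed (use f in auto)
qed

lemma bounded_lipschitz_continuous: "bounded_lipschitz S h \<Longrightarrow> continuous_on S h"
proof -
  assume "bounded_lipschitz S h"
  then obtain b l where "0 \<le> b" "0 \<le> l" "\<And>x. x \<in> S \<Longrightarrow> norm (h x) \<le> b"
    "\<And>x y. x \<in> S \<Longrightarrow> y \<in> S \<Longrightarrow> norm (h x - h y) \<le> l * norm (x - y)"
    using bounded_lipschitzE by blast
  then have "l-lipschitz_on S h" by (intro lipschitz_onI) (auto simp: dist_norm)
  then show ?thesis by (rule lipschitz_on_continuous_on)
qed

section \<open>Openness, compactness and Lipschitz estimates\<close>

context lq_problem
begin

definition sublevel :: "real \<Rightarrow> (real^'n^'m) set" where
  "sublevel c = {K. stable K \<and> cost K \<le> c}"

lemma tendsto_Ak: "(f \<longlongrightarrow> K) F \<Longrightarrow> ((\<lambda>x. Ak (f x)) \<longlongrightarrow> Ak K) F"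
  unfolding Ak_def by (intro tendsto_add tendsto_const tendsto_matmul)

lemma tendsto_Ck: "(f \<longlongrightarrow> K) F \<Longrightarrow> ((\<lambda>x. Ck (f x)) \<longlongrightarrow> Ck K) F"
  unfolding Ck_def by (intro tendsto_add tendsto_const tendsto_matmul)

lemma tendsto_Qk: "(f \<longlongrightarrow> K) F \<Longrightarrow> ((\<lambda>x. Qk (f x)) \<longlongrightarrow> Qk K) F"
  unfolding Qk_def by (intro tendsto_add tendsto_const tendsto_matmul tendsto_transpose)

text \<open>For nearby \<open>K'\<close> the matrix \<open>GK K\<close> is still a certificate, with
  at least half of the decrease, so \<open>K'\<close> is stable and \<open>GK K'\<close> lies below
  twice \<open>GK K\<close>. The constant is twice the bound \<open>cost K + 1\<close> on
  \<open>Qk K' \<bullet> GK K\<close>.\<close>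

lemma stable_neighborhood:
  assumes st: "stable K"
  obtains \<delta> where "0 < \<delta>" "\<And>K'. dist K' K < \<delta> \<Longrightarrow> K' \<in> sublevel (2 * cost K + 2)"
proof -
  let ?G = "GK K"
  have "((\<lambda>K'. lyap (Ak K') (Ck K') ?G) \<longlongrightarrow> lyap (Ak K) (Ck K) ?G) (nhds K)"
    by (intro tendsto_lyap tendsto_Ak tendsto_Ck tendsto_const tendsto_ident_at filterlim_ident)
  then have "\<forall>\<^sub>F K' in nhds K. dist (lyap (Ak K') (Ck K') ?G) (lyap (Ak K) (Ck K) ?G) < lS / 2"
    using min_eigenvalues_pos by (intro tendstoD) auto
  moreover have "((\<lambda>K'. Qk K' \<bullet> ?G) \<longlongrightarrow> Qk K \<bullet> ?G) (nhds K)"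
    by (intro tendsto_inner tendsto_Qk tendsto_const filterlim_ident)
  then have "\<forall>\<^sub>F K' in nhds K. Qk K' \<bullet> ?G < cost K + 1"
    by (rule order_tendstoD(2)) (simp add: cost_def)
  ultimately have "\<forall>\<^sub>F K' in nhds K. K' \<in> sublevel (2 * cost K + 2)"
  proof eventually_elim
    case (elim K')
    let ?L = "lyap (Ak K') (Ck K') ?G"
    have n: "norm (?L + \<Sigma>0) \<le> lS / 2" using elim(1) by (simp add: dist_norm GK_spec(2)[OF st])
    have q: "v \<bullet> (?L *v v) \<le> - (1/2) * (v \<bullet> (\<Sigma>0 *v v))" for v
    proof -
      have "v \<bullet> ((?L + \<Sigma>0) *v v) \<le> norm (?L + \<Sigma>0) * (v \<bullet> v)" using quad_le_norm[of v "?L + \<Sigma>0"] by linarith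
      also have "\<dots> \<le> lS / 2 * (v \<bullet> v)" using n by (intro mult_right_mono) auto
      also have "\<dots> \<le> (1/2) * (v \<bullet> (\<Sigma>0 *v v))" using min_eigenvalues_le(3)[of v] by simp
      finally show ?thesis by (simp add: quad_simps)
    qed
    have "lyap_stable (Ak K') (Ck K')"
      unfolding lyap_stable_def
    proof (intro exI[of _ ?G] conjI allI impI GK_spec(1)[OF st])
      show "v \<bullet> (?L *v v) < 0" if "v \<noteq> 0" for v using q[of v] \<Sigma>0_pos[OF that] by linarith
    qed
    then have st': "stable K'" by (rule stableI)
    have "psd (2 *\<^sub>R ?G - GK K')"
    proof (rule lyap_stable_monotone[OF stable_lyap[OF st']])
      show "v \<bullet> (lyap (Ak K') (Ck K') (2 *\<^sub>R ?G - GK K') *v v) \<le> 0" for v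
        using q[of v] by (simp add: lyap_diff lyap_scaleR quad_simps GK_spec(2)[OF st'])
    qed (simp add: matrix_distribs GK_sym st st')
    from psd_inner_nonneg[OF this Qk_nonneg, of K']
    have "cost K' \<le> 2 * (Qk K' \<bullet> ?G)" by (simp add: cost_def inner_diff_right)
    then show ?case using st' elim(2) by (simp add: sublevel_def)
  qed
  then show ?thesis unfolding eventually_nhds_metric using that by blast
qed

lemma sublevel_trace: "K \<in> sublevel c \<Longrightarrow> mat 1 \<bullet> GK K \<le> c / lQ"
  using trace_GK_le[of K] min_eigenvalues_pos by (simp add: sublevel_def pos_le_divide_eq mult.commute)

lemma sublevel_GK_norm: "K \<in> sublevel c \<Longrightarrow> norm (GK K) \<le> c / lQ"
  using psd_norm_le_trace[OF GK_spec(1)] sublevel_trace by (force simp: sublevel_def)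

lemma sublevel_PK_norm: "K \<in> sublevel c \<Longrightarrow> norm (PK K) \<le> c / lS"
proof -
  assume K: "K \<in> sublevel c"
  then have st: "stable K" by (simp add: sublevel_def)
  have "(lS *\<^sub>R mat 1) \<bullet> PK K \<le> \<Sigma>0 \<bullet> PK K"
    by (rule psd_inner_mono[OF PK_psd[OF st]]) (simp add: quad_simps min_eigenvalues_le)
  then have "lS * (mat 1 \<bullet> PK K) \<le> c" using K cost_PK[OF st] by (simp add: sublevel_def inner_commute)
  then have "mat 1 \<bullet> PK K \<le> c / lS" using min_eigenvalues_pos by (simp add: pos_le_divide_eq mult.commute)
  then show ?thesis using psd_norm_le_trace[OF PK_psd[OF st]] by linarith
qed

lemma bounded_sublevel: "bounded (sublevel c)"
proof (rule boundedI)
  fix K assume K: "K \<in> sublevel c"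
  then show "norm K \<le> (spectral_norm A + 2 * ((spectral_norm B)\<^sup>2 * c / (lR * lS))) / spectral_norm B"
    using norm_K_bound[of K c] spectral_norm_pos[OF B_nonzero]
    by (simp add: sublevel_def pos_le_divide_eq mult.commute)
qed

text \<open>The cost bounds the integrated moments, so along a subsequence they converge, and the
  limit solves the Lyapunov equation of the limit feedback. Hence a limit of stable feedbacks of
  bounded cost is stable.\<close>

lemma closed_sublevel: "closed (sublevel c)"
  unfolding closed_sequential_limits
proof (intro allI impI, elim conjE)
  fix f K assume f: "\<forall>n. f n \<in> sublevel c" and l: "f \<longlonglongrightarrow> K"
  have "\<forall>n. GK (f n) \<in> cball 0 (c / lQ)" using f sublevel_GK_norm by auto
  then obtain G r where r: "strict_mono (r :: nat \<Rightarrow> nat)" "((\<lambda>n. GK (f n)) \<circ> r) \<longlonglongrightarrow> G"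
    using compact_cball[of "0 :: real^'n^'n" "c / lQ"] unfolding compact_def by metis
  have G: "(\<lambda>n. GK (f (r n))) \<longlonglongrightarrow> G" using r(2) by (simp add: o_def)
  have fr: "(\<lambda>n. f (r n)) \<longlonglongrightarrow> K" using LIMSEQ_subseq_LIMSEQ[OF l r(1)] by (simp add: o_def)
  have st: "stable (f (r n))" "cost (f (r n)) \<le> c" for n using f by (auto simp: sublevel_def)
  have "(\<lambda>n. transpose (GK (f (r n)))) \<longlonglongrightarrow> transpose G" by (rule tendsto_transpose[OF G])
  then have "(\<lambda>n. GK (f (r n))) \<longlonglongrightarrow> transpose G" using GK_sym[OF st(1)] by simp
  then have Gs: "transpose G = G" using G LIMSEQ_unique by blast
  have "0 \<le> v \<bullet> (G *v v)" for v
  proof (rule LIMSEQ_le_const)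
    have "bounded_linear (\<lambda>X :: real^'n^'n. X *v v)"
      by (rule bounded_linear_intro[where K="norm v"])
        (simp_all add: matrix_vector_mult_add_rdistrib scaleR_matrix_vector_assoc norm_matvec_le)
    then show "(\<lambda>n. v \<bullet> (GK (f (r n)) *v v)) \<longlonglongrightarrow> v \<bullet> (G *v v)"
      by (intro tendsto_inner tendsto_const bounded_linear.tendsto[of "\<lambda>X. X *v v"] G)
    show "\<exists>N. \<forall>n\<ge>N. 0 \<le> v \<bullet> (GK (f (r n)) *v v)"
      using GK_spec(1)[OF st(1)] by (auto simp: psd_def)
  qed
  then have Gp: "psd G" using Gs by (simp add: psd_def)
  have "(\<lambda>n. lyap (Ak (f (r n))) (Ck (f (r n))) (GK (f (r n)))) \<longlonglongrightarrow> lyap (Ak K) (Ck K) G"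
    by (intro tendsto_lyap tendsto_Ak tendsto_Ck fr G)
  then have GL: "lyap (Ak K) (Ck K) G = - \<Sigma>0"
    using LIMSEQ_unique[OF _ tendsto_const] by (simp add: GK_spec(2)[OF st(1)])
  have stK: "stable K" using Gp GL by (auto simp: stable_def)
  have GK: "G = GK K" by (rule GK_unique[OF Gs GL stK])
  have "(\<lambda>n. Qk (f (r n)) \<bullet> GK (f (r n))) \<longlonglongrightarrow> Qk K \<bullet> G"
    by (intro tendsto_inner tendsto_Qk fr G)
  then have "cost K \<le> c"
    using st(2) unfolding cost_def GK by (intro LIMSEQ_le_const2) auto
  then show "K \<in> sublevel c" using stK by (simp add: sublevel_def)
qed

lemma compact_sublevel: "compact (sublevel c)"
  using bounded_sublevel closed_sublevel compact_eq_bounded_closed by blast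

lemma bounded_lipschitz_Ak: "bounded_lipschitz (sublevel c) Ak" and bounded_lipschitz_Ck: "bounded_lipschitz (sublevel c) Ck" and bounded_lipschitz_Qk: "bounded_lipschitz (sublevel c) Qk"
  unfolding Ak_def[abs_def] Ck_def[abs_def] Qk_def[abs_def]
  by (intro bounded_lipschitz_add bounded_lipschitz_const bounded_lipschitz_matmul bounded_lipschitz_transpose bounded_lipschitz_id bounded_sublevel)+

lemma sublevel_nonneg: "K \<in> sublevel c \<Longrightarrow> 0 \<le> c"
  using cost_pos[of K] by (auto simp: sublevel_def)

text \<open>The difference of two integrated moments solves the Lyapunov equation of
  \<open>K'\<close>, with the change of the operator as source. The inverse of that operator is
  bounded by the trace of \<open>GK K'\<close>, hence uniformly on the sublevel set.\<close>

lemma bounded_lipschitz_GK: "bounded_lipschitz (sublevel c) GK"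
proof (cases "sublevel c = {}")
  case False
  then have c: "0 \<le> c" using sublevel_nonneg by blast
  obtain ba la where a: "0 \<le> ba" "0 \<le> la" "\<And>x. x \<in> sublevel c \<Longrightarrow> norm (Ak x) \<le> ba"
    "\<And>x y. x \<in> sublevel c \<Longrightarrow> y \<in> sublevel c \<Longrightarrow> norm (Ak x - Ak y) \<le> la * norm (x - y)" using bounded_lipschitzE[OF bounded_lipschitz_Ak] by blast
  obtain bc lc where cc: "0 \<le> bc" "0 \<le> lc" "\<And>x. x \<in> sublevel c \<Longrightarrow> norm (Ck x) \<le> bc"
    "\<And>x y. x \<in> sublevel c \<Longrightarrow> y \<in> sublevel c \<Longrightarrow> norm (Ck x - Ck y) \<le> lc * norm (x - y)" using bounded_lipschitzE[OF bounded_lipschitz_Ck] by blast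
  define N where "N = (2 * la + (bc + bc) * lc) * (c / lQ)"
  show ?thesis
  proof (rule bounded_lipschitzI[of "c / lQ" "N / lS * (c / lQ)"])
    show "norm (GK K) \<le> c / lQ" if "K \<in> sublevel c" for K by (rule sublevel_GK_norm[OF that])
    show "norm (GK K' - GK K) \<le> N / lS * (c / lQ) * norm (K' - K)" if K': "K' \<in> sublevel c" and K: "K \<in> sublevel c" for K' K
    proof -
      let ?Y = "lyap (Ak K') (Ck K') (GK K) - lyap (Ak K) (Ck K) (GK K)"
      have st: "stable K" and st': "stable K'" using K K' by (auto simp: sublevel_def)
      have "norm ?Y \<le> (2 * norm (Ak K' - Ak K) + (norm (Ck K') + norm (Ck K)) * norm (Ck K' - Ck K)) * norm (GK K)"
        by (rule lyap_diff_bound)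
      also have "\<dots> \<le> (2 * (la * norm (K' - K)) + (bc + bc) * (lc * norm (K' - K))) * (c / lQ)"
        using a(4)[OF K' K] cc(3)[OF K'] cc(3)[OF K] cc(4)[OF K' K] sublevel_GK_norm[OF K] a cc
        by (intro mult_mono add_mono mult_left_mono) auto
      also have "\<dots> = N * norm (K' - K)" by (simp add: N_def algebra_simps)
      finally have Y: "norm ?Y \<le> N * norm (K' - K)" .
      have "norm (GK K' - GK K) \<le> norm ?Y / lS * (mat 1 \<bullet> GK K')"
        by (rule lyap_inverse_bound[OF stable_lyap[OF st'] GK_spec(2)[OF st'] GK_sym[OF st'] min_eigenvalues_pos(3) min_eigenvalues_le(3)])
          (simp_all add: matrix_distribs GK_sym st st' lyap_diff GK_spec(2))
      also have "\<dots> \<le> (N * norm (K' - K)) / lS * (c / lQ)"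
        using Y sublevel_trace[OF K'] min_eigenvalues_pos psd_trace_nonneg[OF GK_spec(1)[OF st']] order_trans[OF norm_ge_zero Y]
        by (intro mult_mono divide_right_mono) auto
      finally show ?thesis by (simp add: mult_ac)
    qed
  qed (use a cc c min_eigenvalues_pos in \<open>auto simp: N_def\<close>)
qed (simp add: bounded_lipschitz_def, blast)

text \<open>As for \<open>GK\<close>, with the adjoint inverse bound; the change of
  \<open>Qk\<close> enters the source as well.\<close>

lemma bounded_lipschitz_PK: "bounded_lipschitz (sublevel c) PK"
proof (cases "sublevel c = {}")
  case False
  then have c: "0 \<le> c" using sublevel_nonneg by blast
  obtain ba la where a: "0 \<le> ba" "0 \<le> la" "\<And>x. x \<in> sublevel c \<Longrightarrow> norm (Ak x) \<le> ba"
    "\<And>x y. x \<in> sublevel c \<Longrightarrow> y \<in> sublevel c \<Longrightarrow> norm (Ak x - Ak y) \<le> la * norm (x - y)" using bounded_lipschitzE[OF bounded_lipschitz_Ak] by blast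
  obtain bc lc where cc: "0 \<le> bc" "0 \<le> lc" "\<And>x. x \<in> sublevel c \<Longrightarrow> norm (Ck x) \<le> bc"
    "\<And>x y. x \<in> sublevel c \<Longrightarrow> y \<in> sublevel c \<Longrightarrow> norm (Ck x - Ck y) \<le> lc * norm (x - y)" using bounded_lipschitzE[OF bounded_lipschitz_Ck] by blast
  obtain bq lq where q: "0 \<le> bq" "0 \<le> lq" "\<And>x. x \<in> sublevel c \<Longrightarrow> norm (Qk x) \<le> bq"
    "\<And>x y. x \<in> sublevel c \<Longrightarrow> y \<in> sublevel c \<Longrightarrow> norm (Qk x - Qk y) \<le> lq * norm (x - y)" using bounded_lipschitzE[OF bounded_lipschitz_Qk] by blast
  define N where "N = lq + (2 * la + (bc + bc) * lc) * (c / lS)"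
  show ?thesis
  proof (rule bounded_lipschitzI[of "c / lS" "N / lS * (c / lQ)"])
    show "norm (PK K) \<le> c / lS" if "K \<in> sublevel c" for K by (rule sublevel_PK_norm[OF that])
    show "norm (PK K' - PK K) \<le> N / lS * (c / lQ) * norm (K' - K)" if K': "K' \<in> sublevel c" and K: "K \<in> sublevel c" for K' K
    proof -
      let ?L = "lyap_adj (Ak K') (Ck K') (PK K) - lyap_adj (Ak K) (Ck K) (PK K)"
      let ?Y = "(Qk K' - Qk K) + ?L"
      have st: "stable K" and st': "stable K'" using K K' by (auto simp: sublevel_def)
      have "norm ?L \<le> (2 * norm (Ak K' - Ak K) + (norm (Ck K') + norm (Ck K)) * norm (Ck K' - Ck K)) * norm (PK K)"
        using lyap_diff_bound[of "transpose (Ak K')" "transpose (Ck K')" "PK K" "transpose (Ak K)" "transpose (Ck K)"]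
        by (simp add: lyap_adj_eq norm_transpose flip: transpose_diff)
      also have "\<dots> \<le> (2 * (la * norm (K' - K)) + (bc + bc) * (lc * norm (K' - K))) * (c / lS)"
        using a(4)[OF K' K] cc(3)[OF K'] cc(3)[OF K] cc(4)[OF K' K] sublevel_PK_norm[OF K] a cc
        by (intro mult_mono add_mono mult_left_mono) auto
      finally have "norm ?Y \<le> lq * norm (K' - K) + (2 * (la * norm (K' - K)) + (bc + bc) * (lc * norm (K' - K))) * (c / lS)"
        using q(4)[OF K' K] norm_triangle_ineq[of "Qk K' - Qk K" ?L] by linarith
      also have "\<dots> = N * norm (K' - K)" by (simp add: N_def algebra_simps)
      finally have Y: "norm ?Y \<le> N * norm (K' - K)" .
      have "norm (PK K' - PK K) \<le> norm ?Y / lS * (mat 1 \<bullet> GK K')"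
        by (rule lyap_adj_inverse_bound[OF stable_lyap[OF st'] GK_spec(2)[OF st'] GK_sym[OF st'] min_eigenvalues_pos(3) min_eigenvalues_le(3)])
          (simp_all add: matrix_distribs PK_spec st st' lyap_diff lyap_adj_eq[of "Ak K'"] PK_spec(2)[OF st', unfolded lyap_adj_eq])
      also have "\<dots> \<le> (N * norm (K' - K)) / lS * (c / lQ)"
        using Y sublevel_trace[OF K'] min_eigenvalues_pos psd_trace_nonneg[OF GK_spec(1)[OF st']] order_trans[OF norm_ge_zero Y]
        by (intro mult_mono divide_right_mono) auto
      finally show ?thesis by (simp add: mult_ac)
    qed
  qed (use a cc q c min_eigenvalues_pos in \<open>auto simp: N_def\<close>)
qed (simp add: bounded_lipschitz_def, blast)

lemma bounded_lipschitz_EK: "bounded_lipschitz (sublevel c) EK"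
  unfolding EK_def[abs_def]
  by (intro bounded_lipschitz_add bounded_lipschitz_matmul bounded_lipschitz_const bounded_lipschitz_id bounded_sublevel bounded_lipschitz_PK bounded_lipschitz_Ck)

lemma bounded_lipschitz_grad: "bounded_lipschitz (sublevel c) grad"
  unfolding grad_def[abs_def] by (intro bounded_lipschitz_scaleR bounded_lipschitz_matmul bounded_lipschitz_EK bounded_lipschitz_GK)

text \<open>In the exact difference formula the linear term carries \<open>GK K'\<close> where the
  gradient has \<open>GK K\<close>; Lipschitz continuity of \<open>GK\<close> makes this discrepancy
  quadratic in the displacement, as the remaining term already is.\<close>

lemma cost_gderiv:
  assumes st: "stable K"
  shows "GDERIV cost K :> grad K"
proof -
  obtain \<delta> where \<delta>: "0 < \<delta>" "\<And>K'. dist K' K < \<delta> \<Longrightarrow> K' \<in> sublevel (2 * cost K + 2)"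
    using stable_neighborhood[OF st] by blast
  define c where "c = 2 * cost K + 2"
  have K: "K \<in> sublevel c" using \<delta>(2)[of K] \<delta>(1) by (simp add: c_def)
  obtain bg lg where g: "0 \<le> bg" "0 \<le> lg" "\<And>x. x \<in> sublevel c \<Longrightarrow> norm (GK x) \<le> bg"
    "\<And>x y. x \<in> sublevel c \<Longrightarrow> y \<in> sublevel c \<Longrightarrow> norm (GK x - GK y) \<le> lg * norm (x - y)" using bounded_lipschitzE[OF bounded_lipschitz_GK] by blast
  define N where "N = 2 * (norm (EK K) * lg) + norm (Rk K) * bg"
  have bound: "\<bar>cost K' - cost K - (K' - K) \<bullet> grad K\<bar> \<le> N * norm (K' - K) * norm (K' - K)" if d: "dist K' K < \<delta>" for K'
  proof -
    let ?D = "K' - K"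
    have K': "K' \<in> sublevel c" using \<delta>(2)[OF d] by (simp add: c_def)
    then have st': "stable K'" by (simp add: sublevel_def)
    have "cost K' - cost K - ?D \<bullet> grad K = 2 * ((EK K ** (GK K' - GK K)) \<bullet> ?D) + (transpose ?D ** Rk K ** ?D) \<bullet> GK K'"
    proof -
      have "?D \<bullet> grad K = 2 * ((EK K ** GK K) \<bullet> ?D)" unfolding grad_def inner_commute[of ?D] by simp
      moreover have "(EK K ** (GK K' - GK K)) \<bullet> ?D = (EK K ** GK K') \<bullet> ?D - (EK K ** GK K) \<bullet> ?D"
        unfolding matrix_mult_diff inner_diff_left ..
      ultimately show ?thesis using cost_diff'[OF st st'] by linarith
    qed
    also have "\<bar>\<dots>\<bar> \<le> 2 * \<bar>(EK K ** (GK K' - GK K)) \<bullet> ?D\<bar> + \<bar>(transpose ?D ** Rk K ** ?D) \<bullet> GK K'\<bar>"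
      by linarith
    also have "\<dots> \<le> 2 * (norm (EK K) * (lg * norm ?D) * norm ?D) + (norm ?D * norm (Rk K) * norm ?D) * bg"
    proof (intro add_mono mult_left_mono)
      have "\<bar>(EK K ** (GK K' - GK K)) \<bullet> ?D\<bar> \<le> norm (EK K ** (GK K' - GK K)) * norm ?D" by (rule Cauchy_Schwarz_ineq2)
      also have "\<dots> \<le> norm (EK K) * norm (GK K' - GK K) * norm ?D" by (intro mult_right_mono norm_matmul_le) auto
      also have "\<dots> \<le> norm (EK K) * (lg * norm ?D) * norm ?D"
        by (intro mult_right_mono mult_left_mono g K K') auto
      finally show "\<bar>(EK K ** (GK K' - GK K)) \<bullet> ?D\<bar> \<le> norm (EK K) * (lg * norm ?D) * norm ?D" .
      have "norm (transpose ?D ** Rk K ** ?D) \<le> norm (transpose ?D) * norm (Rk K) * norm ?D"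
        by (rule order_trans[OF norm_matmul_le]) (intro mult_right_mono norm_matmul_le norm_ge_zero)
      then have "norm (transpose ?D ** Rk K ** ?D) * norm (GK K') \<le> (norm ?D * norm (Rk K) * norm ?D) * bg"
        unfolding norm_transpose using g K' by (intro mult_mono) auto
      then show "\<bar>(transpose ?D ** Rk K ** ?D) \<bullet> GK K'\<bar> \<le> (norm ?D * norm (Rk K) * norm ?D) * bg"
        using Cauchy_Schwarz_ineq2[of "transpose ?D ** Rk K ** ?D" "GK K'"] by linarith
    qed auto
    also have "\<dots> = N * norm ?D * norm ?D" by (simp add: N_def algebra_simps)
    finally show ?thesis .
  qed
  show ?thesis
    unfolding gderiv_def
  proof (rule has_derivativeI_sandwich[OF \<delta>(1) bounded_linear_inner_left])
    show "((\<lambda>K'. N * norm (K' - K)) \<longlongrightarrow> 0) (at K)"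
    proof -
      have "((\<lambda>K'. N * norm (K' - K)) \<longlongrightarrow> N * norm (K - K)) (at K)" by (intro tendsto_intros)
      then show ?thesis by simp
    qed
    fix K' assume "K' \<noteq> K" "dist K' K < \<delta>"
    then show "norm (cost K' - cost K - (K' - K) \<bullet> grad K) / norm (K' - K) \<le> N * norm (K' - K)"
      using bound[of K'] by (simp add: pos_divide_le_eq)
  qed
qed

lemma EK_zero: "stable K \<Longrightarrow> grad K = 0 \<Longrightarrow> EK K = 0"
proof -
  assume st: "stable K" and g: "grad K = 0"
  have "EK K ** GK K = 0" using g by (simp add: grad_def)
  then have "(transpose (EK K) ** EK K) \<bullet> GK K = 0"
    using gram_inner[OF GK_sym[OF st], of "EK K" "EK K"] by simp
  then have "lam K * (norm (EK K))\<^sup>2 \<le> 0" using gram_GK[OF st, of "EK K"] by simp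
  then show "EK K = 0" using lam_pos[OF st] by (simp add: mult_le_0_iff)
qed

text \<open>Compactness of the sublevel set yields a minimizer. Stability is an open condition, so
  the minimizer is interior and its gradient vanishes; quadratic growth around it excludes a second
  one.\<close>

lemma minimizer:
  assumes st: "stable K0"
  obtains Ks where "stable Ks" "EK Ks = 0" "\<And>K. stable K \<Longrightarrow> cost Ks \<le> cost K"
    "\<And>K. stable K \<Longrightarrow> cost K \<le> cost Ks \<Longrightarrow> K = Ks"
proof -
  have cont: "continuous_on (sublevel (cost K0)) cost"
  proof (intro continuous_at_imp_continuous_on ballI)
    show "isCont cost K" if "K \<in> sublevel (cost K0)" for K
      using that has_derivative_continuous[OF cost_gderiv[unfolded gderiv_def]] by (simp add: sublevel_def)
  qed
  moreover have "K0 \<in> sublevel (cost K0)" using st by (simp add: sublevel_def)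
  ultimately obtain Ks where Ks: "Ks \<in> sublevel (cost K0)" "\<And>K. K \<in> sublevel (cost K0) \<Longrightarrow> cost Ks \<le> cost K"
    using continuous_attains_inf[OF compact_sublevel] by (metis empty_iff)
  have sts: "stable Ks" using Ks by (simp add: sublevel_def)
  have min: "cost Ks \<le> cost K" if "stable K" for K
    using Ks that by (cases "cost K \<le> cost K0") (auto simp: sublevel_def)
  obtain \<delta> where \<delta>: "0 < \<delta>" "\<And>K'. dist K' Ks < \<delta> \<Longrightarrow> K' \<in> sublevel (2 * cost Ks + 2)"
    using stable_neighborhood[OF sts] by blast
  have "(\<lambda>h. h \<bullet> grad Ks) = (\<lambda>h. 0)"
  proof (rule differential_zero_maxmin[of Ks "ball Ks \<delta>" cost])
    show "(cost has_derivative (\<lambda>h. h \<bullet> grad Ks)) (at Ks)"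
      using cost_gderiv[OF sts] by (simp add: gderiv_def)
    show "(\<forall>y\<in>ball Ks \<delta>. cost y \<le> cost Ks) \<or> (\<forall>y\<in>ball Ks \<delta>. cost Ks \<le> cost y)"
      using \<delta>(2) min by (auto simp: sublevel_def dist_commute)
  qed (use \<delta>(1) in auto)
  then have "grad Ks \<bullet> grad Ks = 0" by metis
  then have E: "EK Ks = 0" using EK_zero[OF sts] by simp
  have "K = Ks" if "stable K" "cost K \<le> cost Ks" for K
  proof -
    have "4 * \<kappa> (cost K) * (cost K - cost Ks) \<le> 0"
      using that kappa_pos[OF that(1) order_refl] by (intro mult_nonneg_nonpos) auto
    then have "lR * lS * (norm (K - Ks))\<^sup>2 \<le> 0"
      using quadratic_growth[OF that(1) order_refl sts E] by linarith
    then show ?thesis using min_eigenvalues_pos by (simp add: mult_le_0_iff)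
  qed
  then show ?thesis using that[OF sts E min] by blast
qed

end

section \<open>Ordinary differential equations with Lipschitz right-hand side\<close>

text \<open>McShane's extension: the infimum of the cones \<open>f y + L * dist x y\<close> over \<open>y \<in> S\<close>.\<close>

lemma lipschitz_extension_real:
  fixes f :: "'a::metric_space \<Rightarrow> real"
  assumes L: "0 \<le> L" and lip: "\<And>x y. x \<in> S \<Longrightarrow> y \<in> S \<Longrightarrow> \<bar>f x - f y\<bar> \<le> L * dist x y"
  shows "\<exists>g. (\<forall>x\<in>S. g x = f x) \<and> (\<forall>x y. \<bar>g x - g y\<bar> \<le> L * dist x y)"
proof (cases "S = {}")
  case True
  then show ?thesis using L by (intro exI[of _ "\<lambda>_. 0"]) auto
next
  case False
  define g where "g x = (INF y\<in>S. f y + L * dist x y)" for x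
  have low: "f y0 - L * dist x y0 \<le> f y + L * dist x y" if "y0 \<in> S" "y \<in> S" for x y y0
  proof -
    have "f y0 - f y \<le> L * dist y0 y" using lip[OF that] by linarith
    moreover have "L * dist y0 y \<le> L * (dist x y0 + dist x y)"
      using dist_triangle[of y0 y x] L by (intro mult_left_mono) (auto simp: dist_commute)
    ultimately show ?thesis by (simp add: algebra_simps)
  qed
  obtain y0 where y0: "y0 \<in> S" using False by blast
  have bdd: "bdd_below ((\<lambda>y. f y + L * dist x y) ` S)" for x
    using low[OF y0] by (intro bdd_belowI2) blast
  have "g x = f x" if x: "x \<in> S" for x
  proof (rule antisym)
    show "g x \<le> f x" unfolding g_def using cINF_lower[OF bdd[of x] x] by simp
    show "f x \<le> g x" unfolding g_def using low[OF x, of _ x] by (intro cINF_greatest False) auto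
  qed
  moreover have half: "g x - g z \<le> L * dist x z" for x z
  proof -
    have "g x - L * dist x z \<le> g z"
      unfolding g_def[of z]
    proof (rule cINF_greatest[OF False])
      fix y assume y: "y \<in> S"
      have "g x \<le> f y + L * dist x y" unfolding g_def by (rule cINF_lower[OF bdd y])
      also have "\<dots> \<le> f y + L * (dist x z + dist z y)"
        using L dist_triangle[of x y z] by (intro add_left_mono mult_left_mono) auto
      finally show "g x - L * dist x z \<le> f y + L * dist z y" by (simp add: algebra_simps)
    qed
    then show ?thesis by simp
  qed
  moreover have "\<bar>g x - g y\<bar> \<le> L * dist x y" for x y
    using half[of x y] half[of y x] by (simp add: dist_commute abs_le_iff)
  ultimately show ?thesis by blast
qed

text \<open>The scalar extension is applied to each coordinate. The loss of the factor
  \<open>DIM('b)\<close> is harmless: the differential equation is solved for any Lipschitz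
  constant.\<close>

lemma lipschitz_extension:
  fixes f :: "'a::metric_space \<Rightarrow> 'b::euclidean_space" and L :: real
  assumes L: "0 \<le> L" and lip: "\<And>x y. x \<in> S \<Longrightarrow> y \<in> S \<Longrightarrow> norm (f x - f y) \<le> L * dist x y"
  obtains g where "\<And>x. x \<in> S \<Longrightarrow> g x = f x" "\<And>x y. norm (g x - g y) \<le> DIM('b) * L * dist x y"
proof -
  have "\<exists>g. (\<forall>x\<in>S. g x = f x \<bullet> b) \<and> (\<forall>x y. \<bar>g x - g y\<bar> \<le> L * dist x y)" if b: "b \<in> Basis" for b
  proof (rule lipschitz_extension_real[OF L])
    fix x y assume "x \<in> S" "y \<in> S"
    then show "\<bar>f x \<bullet> b - f y \<bullet> b\<bar> \<le> L * dist x y"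
      using Basis_le_norm[OF b, of "f x - f y"] lip[of x y] by (simp add: inner_diff_left)
  qed
  then obtain h where h: "\<And>b x. b \<in> Basis \<Longrightarrow> x \<in> S \<Longrightarrow> h b x = f x \<bullet> b"
    "\<And>b x y. b \<in> Basis \<Longrightarrow> \<bar>h b x - h b y\<bar> \<le> L * dist x y" by metis
  define g where "g x = (\<Sum>b\<in>Basis. h b x *\<^sub>R b)" for x
  show ?thesis
  proof (rule that)
    show "g x = f x" if "x \<in> S" for x
      unfolding g_def by (subst (2) euclidean_representation[symmetric]) (simp add: h that)
    show "norm (g x - g y) \<le> DIM('b) * L * dist x y" for x y
    proof -
      have "norm (g x - g y) \<le> (\<Sum>b\<in>(Basis::'b set). norm ((h b x - h b y) *\<^sub>R b))"
        unfolding g_def sum_subtractf[symmetric] scaleR_diff_left[symmetric] by (rule norm_sum)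
      also have "\<dots> \<le> (\<Sum>b\<in>(Basis::'b set). L * dist x y)"
        by (rule sum_mono) (simp add: h(2))
      finally show ?thesis by simp
    qed
  qed
qed

text \<open>Picard iteration for \<open>z t = exp (- 2 * L * t) *\<^sub>R (x t - x0)\<close>: in this weight the iteration
  contracts on the whole half line.\<close>

lemma lipschitz_ode:
  fixes g :: "'v::euclidean_space \<Rightarrow> 'v"
  assumes lip0: "\<And>x y. norm (g x - g y) \<le> L0 * norm (x - y)"
  obtains x where "x 0 = x0" "\<And>t. 0 \<le> t \<Longrightarrow> (x has_vector_derivative g (x t)) (at t within {0..})"
proof -
  \<comment> \<open>A constant of at least 1 can be divided by, and gives
    \<open>r \<le> 2 * L * r\<close>, from which the weighted iterates are bounded.\<close>
  define L where "L = max L0 1"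
  have L: "1 \<le> L" by (simp add: L_def)
  have lip: "norm (g x - g y) \<le> L * norm (x - y)" for x y
    using lip0[of x y] by (rule order_trans) (simp add: L_def mult_right_mono)
  have gcont: "continuous_on UNIV g"
    by (rule lipschitz_on_continuous_on[of L], rule lipschitz_onI) (use lip L in \<open>auto simp: dist_norm\<close>)
  define u where "u z s = x0 + exp (2 * L * s) *\<^sub>R apply_bcontfun z s" for z :: "real \<Rightarrow>\<^sub>C 'v" and s
  have gu: "continuous_on S (\<lambda>s. g (u z s))" for S z
    unfolding u_def by (intro continuous_on_compose2[OF gcont] continuous_intros) auto
  define I where "I z t = integral {0..t} (\<lambda>s. g (u z s))" for z t
  \<comment> \<open>Negative times are clamped to 0, where the integral is zero, so that the iterate
    is a bounded continuous function on all reals.\<close>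
  define T where "T z t = exp (- 2 * L * max 0 t) *\<^sub>R I z (max 0 t)" for z t
  have exp_int: "((\<lambda>s. exp (2 * L * s)) has_integral (exp (2 * L * t) - 1) / (2 * L)) {0..t}" if "0 \<le> t" for t
  proof -
    have "((\<lambda>s. exp (2 * L * s)) has_integral exp (2 * L * t) / (2 * L) - exp (2 * L * 0) / (2 * L)) {0..t}"
      using L by (intro fundamental_theorem_of_calculus that)
        (auto intro!: derivative_eq_intros simp flip: has_real_derivative_iff_has_vector_derivative)
    then show ?thesis by (simp add: diff_divide_distrib)
  qed
  have I_deriv: "(I z has_vector_derivative g (u z t)) (at t within {0..})" if t: "0 \<le> t" for z t
    unfolding I_def at_within_atLeast[OF t]
    by (rule integral_has_vector_derivative[OF gu]) (use t in auto)
  have I_cont: "continuous_on {0..} (I z)" for z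
    using I_deriv by (intro continuous_on_vector_derivative) auto
  have I_bound: "norm (I z t) \<le> t * norm (g x0) + norm z * exp (2 * L * t) / 2" if t: "0 \<le> t" for z t
  proof -
    have "norm (I z t) \<le> integral {0..t} (\<lambda>s. norm (g x0) + L * norm z * exp (2 * L * s))"
      unfolding I_def
    proof (rule integral_norm_bound_integral)
      fix s
      have "norm (g (u z s)) \<le> norm (g x0) + norm (g (u z s) - g x0)" using norm_triangle_sub by blast
      also have "\<dots> \<le> norm (g x0) + L * norm (u z s - x0)" using lip by simp
      also have "norm (u z s - x0) = exp (2 * L * s) * norm (apply_bcontfun z s)" by (simp add: u_def)
      also have "\<dots> \<le> exp (2 * L * s) * norm z" by (intro mult_left_mono norm_bounded) auto
      finally show "norm (g (u z s)) \<le> norm (g x0) + L * norm z * exp (2 * L * s)" using L by (simp add: mult_ac)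
    qed (intro integrable_continuous_interval gu continuous_intros)+
    also have "\<dots> = t * norm (g x0) + L * norm z * ((exp (2 * L * t) - 1) / (2 * L))"
      using has_integral_add[OF has_integral_const_real[of "norm (g x0)" 0 t] has_integral_mult_right[OF exp_int[OF t], of "L * norm z"]] t
      by (intro integral_unique) simp
    also have "L * norm z * ((exp (2 * L * t) - 1) / (2 * L)) = norm z * (exp (2 * L * t) - 1) / 2"
      using L by simp
    also have "norm z * (exp (2 * L * t) - 1) / 2 \<le> norm z * exp (2 * L * t) / 2"
      by (intro divide_right_mono mult_left_mono) auto
    finally show ?thesis by simp
  qed
  have T_bcont: "T z \<in> bcontfun" for z
  proof (rule bcontfun_normI)
    show "continuous_on UNIV (T z)"
      unfolding T_def by (intro continuous_intros continuous_on_compose2[OF I_cont]) auto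
    show "norm (T z t) \<le> norm (g x0) + norm z" for t
    proof -
      define r where "r = max 0 t"
      have r: "0 \<le> r" by (simp add: r_def)
      have "norm (T z t) = exp (- (2 * L * r)) * norm (I z r)" by (simp add: T_def r_def)
      also have "\<dots> \<le> exp (- (2 * L * r)) * (r * norm (g x0) + norm z * exp (2 * L * r) / 2)"
        by (intro mult_left_mono I_bound r) auto
      also have "\<dots> = exp (- (2 * L * r)) * r * norm (g x0) + norm z / 2"
        by (simp add: algebra_simps flip: exp_add)
      also have "\<dots> \<le> 1 * norm (g x0) + norm z"
      proof (intro add_mono mult_right_mono)
        have "r \<le> 2 * L * r" using L r by (simp add: mult_le_cancel_right1)
        also have "\<dots> \<le> exp (2 * L * r)" using exp_ge_add_one_self[of "2 * L * r"] by linarith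
        finally show "exp (- (2 * L * r)) * r \<le> 1" by (simp add: exp_minus field_simps)
      qed auto
      finally show ?thesis by simp
    qed
  qed
  define P where "P z = Bcontfun (T z)" for z
  have P: "apply_bcontfun (P z) = T z" for z by (simp add: P_def Bcontfun_inverse[OF T_bcont])
  have contr: "dist (P z) (P w) \<le> 1/2 * dist z w" for z w
  proof (rule dist_bound)
    fix t :: real
    define r where "r = max 0 t"
    have r: "0 \<le> r" by (simp add: r_def)
    have "norm (I z r - I w r) = norm (integral {0..r} (\<lambda>s. g (u z s) - g (u w s)))"
      unfolding I_def by (subst integral_diff) (auto intro!: integrable_continuous_interval gu)
    also have "\<dots> \<le> integral {0..r} (\<lambda>s. L * dist z w * exp (2 * L * s))"
    proof (rule integral_norm_bound_integral)
      fix s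
      have "norm (g (u z s) - g (u w s)) \<le> L * norm (u z s - u w s)" by (rule lip)
      also have "norm (u z s - u w s) = exp (2 * L * s) * dist (apply_bcontfun z s) (apply_bcontfun w s)"
        by (simp add: u_def dist_norm flip: scaleR_diff_right)
      also have "\<dots> \<le> exp (2 * L * s) * dist z w" by (intro mult_left_mono dist_bounded) auto
      finally show "norm (g (u z s) - g (u w s)) \<le> L * dist z w * exp (2 * L * s)" using L by (simp add: mult_ac)
    qed (intro integrable_continuous_interval gu continuous_intros)+
    also have "\<dots> = L * dist z w * ((exp (2 * L * r) - 1) / (2 * L))"
      using has_integral_mult_right[OF exp_int[OF r], of "L * dist z w"] by (intro integral_unique) simp
    also have "\<dots> = dist z w * (exp (2 * L * r) - 1) / 2" using L by simp
    also have "\<dots> \<le> dist z w * exp (2 * L * r) / 2" by (simp add: right_diff_distrib)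
    finally have "norm (I z r - I w r) \<le> dist z w * exp (2 * L * r) / 2" .
    then have "exp (- (2 * L * r)) * norm (I z r - I w r) \<le> exp (- (2 * L * r)) * (dist z w * exp (2 * L * r) / 2)"
      by (intro mult_left_mono) auto
    also have "\<dots> = 1/2 * dist z w" by (simp add: algebra_simps flip: exp_add)
    finally show "dist (apply_bcontfun (P z) t) (apply_bcontfun (P w) t) \<le> 1/2 * dist z w"
      by (simp add: P T_def r_def dist_norm flip: scaleR_diff_right)
  qed
  obtain z where z: "P z = z"
    using banach_fix_type[of "1/2" P] contr by auto
  have x: "u z t = x0 + I z t" if "0 \<le> t" for t
  proof -
    have "apply_bcontfun z t = exp (- (2 * L * t)) *\<^sub>R I z t"
      using P[of z] that by (simp add: z T_def max_def)
    then show ?thesis by (simp add: u_def flip: exp_add)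
  qed
  show ?thesis
  proof (rule that[of "\<lambda>t. x0 + I z t"])
    show "x0 + I z 0 = x0" by (simp add: I_def)
    show "((\<lambda>t. x0 + I z t) has_vector_derivative g (x0 + I z t)) (at t within {0..})" if t: "0 \<le> t" for t
      using has_vector_derivative_add[OF has_vector_derivative_const I_deriv[OF t, of z]] x[OF t] by simp
  qed
qed

section \<open>The gradient flow\<close>

lemma nonincreasing_from_derivative:
  fixes f :: "real \<Rightarrow> real"
  assumes "a \<le> b" and "\<And>t. a \<le> t \<Longrightarrow> t \<le> b \<Longrightarrow> (f has_real_derivative f' t) (at t within {a..b})"
    and "\<And>t. a \<le> t \<Longrightarrow> t \<le> b \<Longrightarrow> f' t \<le> 0"
  shows "f b \<le> f a"
proof -
  have "\<exists>t\<in>{a..b}. f b - f a = f' t * (b - a)"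
    using assms(2) by (intro mvt_very_simple assms(1)) (auto simp: has_field_derivative_def)
  then obtain t where "t \<in> {a..b}" "f b - f a = f' t * (b - a)" by blast
  moreover have "f' t * (b - a) \<le> 0" if "t \<in> {a..b}" for t
    using assms(1,3) that by (intro mult_nonpos_nonneg) auto
  ultimately show ?thesis by force
qed

lemma exp_decay_tendsto: "0 < m \<Longrightarrow> ((\<lambda>t. c * exp (- t / m)) \<longlongrightarrow> 0) at_top"
  for c m :: real
  by real_asymp

context lq_problem
begin

lemma cost_along_curve:
  assumes "stable (x t)" "(x has_vector_derivative - grad (x t)) (at t within S)"
  shows "((\<lambda>t. cost (x t)) has_real_derivative - (norm (grad (x t)))\<^sup>2) (at t within S)"
proof -
  have "(cost has_derivative (\<lambda>h. h \<bullet> grad (x t))) (at (x t) within x ` S)"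
    using cost_gderiv[OF assms(1)] unfolding gderiv_def by (rule has_derivative_at_withinI)
  from vector_derivative_diff_chain_within[OF assms(2) this]
  show ?thesis
    by (simp add: o_def has_real_derivative_iff_has_vector_derivative power2_norm_eq_inner)
qed

definition flow :: "(real \<Rightarrow> real^'n^'m) \<Rightarrow> bool" where
  "flow x \<longleftrightarrow> (\<forall>t\<ge>0. stable (x t) \<and> (x has_vector_derivative - grad (x t)) (at t within {0..}))"

lemma cost_isCont: "stable K \<Longrightarrow> isCont cost K"
  using has_derivative_continuous[OF cost_gderiv[unfolded gderiv_def]] .

text \<open>The field is extended from the sublevel set of \<open>?c + 1\<close> and not of
  \<open>?c\<close>: the unit margin guarantees that the solution obeys the true gradient equation
  for a short while after any time at which it still lies in the smaller set.\<close>

lemma flow_exists: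
  assumes st: "stable K0"
  obtains x where "x 0 = K0" "flow x"
proof -
  let ?c = "cost K0"
  obtain b l where l: "0 \<le> b" "0 \<le> l" "\<And>K. K \<in> sublevel (?c + 1) \<Longrightarrow> norm (grad K) \<le> b"
    "\<And>K K'. K \<in> sublevel (?c + 1) \<Longrightarrow> K' \<in> sublevel (?c + 1) \<Longrightarrow> norm (grad K - grad K') \<le> l * norm (K - K')"
    using bounded_lipschitzE[OF bounded_lipschitz_grad] by blast
  have "norm (- grad K - - grad K') \<le> l * dist K K'" if "K \<in> sublevel (?c + 1)" "K' \<in> sublevel (?c + 1)" for K K'
    using l(4)[OF that] by (simp add: dist_norm norm_minus_commute)
  then obtain g L where g: "\<And>K. K \<in> sublevel (?c + 1) \<Longrightarrow> g K = - grad K"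
    "\<And>K K'. norm (g K - g K') \<le> L * norm (K - K')"
    using lipschitz_extension[OF l(2), of "sublevel (?c + 1)" "\<lambda>K. - grad K"] by (metis dist_norm)
  obtain x where x: "x 0 = K0" "\<And>t. 0 \<le> t \<Longrightarrow> (x has_vector_derivative g (x t)) (at t within {0..})"
    using lipschitz_ode[OF g(2)] by blast
  have cont: "continuous_on {0..} x"
    using x(2) by (intro continuous_on_vector_derivative) auto
  have x': "(x has_vector_derivative - grad (x t)) (at t within {0..})" if "0 \<le> t" "x t \<in> sublevel (?c + 1)" for t
    using x(2)[OF that(1)] g(1)[OF that(2)] by simp
  have stay: "x t \<in> sublevel ?c" if t: "0 \<le> t" for t
  proof (rule ccontr)
    assume n: "x t \<notin> sublevel ?c"
    \<comment> \<open>The times up to which the whole trajectory has stayed in the sublevel set. Its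
      supremum \<open>\<tau>\<close> is the supposed exit time; closedness of the sublevel set
      includes \<open>\<tau>\<close> itself.\<close>
    define T where "T = {s\<in>{0..t}. x ` {0..s} \<subseteq> sublevel ?c}"
    define \<tau> where "\<tau> = Sup T"
    have T0: "0 \<in> T" using t st x(1) by (auto simp: T_def sublevel_def)
    have bdd: "bdd_above T" by (rule bdd_aboveI[of _ t]) (simp add: T_def)
    have \<tau>: "0 \<le> \<tau>" "\<tau> \<le> t"
    proof -
      show "0 \<le> \<tau>" unfolding \<tau>_def by (rule cSup_upper[OF T0 bdd])
      show "\<tau> \<le> t" unfolding \<tau>_def using T0 by (intro cSup_least) (auto simp: T_def)
    qed
    have below: "x s \<in> sublevel ?c" if "0 \<le> s" "s < \<tau>" for s
    proof -
      obtain r where "r \<in> T" "s < r" using \<open>s < \<tau>\<close> less_cSup_iff[OF _ bdd] T0 by (auto simp: \<tau>_def)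
      then show ?thesis using that(1) by (auto simp: T_def image_subset_iff)
    qed
    have at: "x \<tau> \<in> sublevel ?c"
    proof (cases "\<tau> = 0")
      case False
      have cl: "closure {0..<\<tau>} = {0..\<tau>}" using False \<tau> by simp
      have "x ` {0..\<tau>} \<subseteq> sublevel ?c"
        unfolding cl[symmetric]
      proof (rule image_closure_subset[OF _ closed_sublevel])
        show "continuous_on (closure {0..<\<tau>}) x" unfolding cl by (rule continuous_on_subset[OF cont]) auto
        show "x ` {0..<\<tau>} \<subseteq> sublevel ?c" using below by (auto simp: image_subset_iff)
      qed
      then show ?thesis using \<tau> by (simp add: image_subset_iff)
    qed (use st x(1) in \<open>simp add: sublevel_def\<close>)
    have st\<tau>: "stable (x \<tau>)" and c\<tau>: "cost (x \<tau>) \<le> ?c" using at by (auto simp: sublevel_def)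
    obtain \<delta> where \<delta>: "0 < \<delta>" "\<And>K'. dist K' (x \<tau>) < \<delta> \<Longrightarrow> K' \<in> sublevel (2 * cost (x \<tau>) + 2)"
      using stable_neighborhood[OF st\<tau>] by blast
    have "\<forall>\<^sub>F K' in nhds (x \<tau>). stable K'"
      unfolding eventually_nhds_metric using \<delta> by (auto simp: sublevel_def intro!: exI[of _ \<delta>])
    moreover have "\<forall>\<^sub>F K' in nhds (x \<tau>). cost K' < ?c + 1"
      using cost_isCont[OF st\<tau>] c\<tau> unfolding isCont_def tendsto_at_iff_tendsto_nhds
      by (intro order_tendstoD(2)[of cost "cost (x \<tau>)"]) auto
    \<comment> \<open>Around \<open>x \<tau>\<close> the extended field is the true one, so the cost
      keeps decreasing beyond \<open>\<tau>\<close> and the trajectory stays in the smaller set past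
      its supposed exit.\<close>
    ultimately have "\<forall>\<^sub>F K' in nhds (x \<tau>). K' \<in> sublevel (?c + 1)"
      by eventually_elim (simp add: sublevel_def)
    then have "\<forall>\<^sub>F s in at \<tau> within {0..}. x s \<in> sublevel (?c + 1)"
      using cont \<tau>(1) unfolding continuous_on_def by (auto dest: filterlim_iff[THEN iffD1])
    then obtain \<epsilon> where \<epsilon>: "0 < \<epsilon>" "\<And>s. 0 \<le> s \<Longrightarrow> s \<noteq> \<tau> \<Longrightarrow> dist s \<tau> < \<epsilon> \<Longrightarrow> x s \<in> sublevel (?c + 1)"
      unfolding eventually_at by auto
    have after: "x s \<in> sublevel ?c" if s: "\<tau> \<le> s" "s < \<tau> + \<epsilon>" for s
    proof -
      have in_S: "x r \<in> sublevel (?c + 1)" if "\<tau> \<le> r" "r \<le> s" for r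
        using that s \<tau> st\<tau> c\<tau> \<epsilon>(2)[of r] by (cases "r = \<tau>") (auto simp: dist_real_def sublevel_def)
      have "cost (x s) \<le> cost (x \<tau>)"
      proof (rule nonincreasing_from_derivative[OF s(1)])
        fix r assume r: "\<tau> \<le> r" "r \<le> s"
        have "((\<lambda>t. cost (x t)) has_real_derivative - (norm (grad (x r)))\<^sup>2) (at r within {0..})"
          using in_S[OF r] r \<tau> by (intro cost_along_curve x') (auto simp: sublevel_def)
        then show "((\<lambda>t. cost (x t)) has_real_derivative - (norm (grad (x r)))\<^sup>2) (at r within {\<tau>..s})"
          by (rule DERIV_subset) (use \<tau> in auto)
      qed simp
      then show ?thesis using in_S[OF s(1) order_refl] c\<tau> by (simp add: sublevel_def)
    qed
    have sublevel: "x s \<in> sublevel ?c" if "0 \<le> s" "s < \<tau> + \<epsilon>" for s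
      using below[OF that(1)] after[OF _ that(2)] by linarith
    have "t \<ge> \<tau> + \<epsilon>" using sublevel[OF t] n by linarith
    then have "\<tau> + \<epsilon> / 2 \<in> T" using sublevel \<epsilon>(1) \<tau> by (auto simp: T_def)
    then show False using cSup_upper[OF _ bdd] \<epsilon>(1) by (fastforce simp: \<tau>_def)
  qed
  have "flow x"
    unfolding flow_def
  proof (intro allI impI conjI)
    fix t :: real assume t: "0 \<le> t"
    show "stable (x t)" using stay[OF t] by (simp add: sublevel_def)
    show "(x has_vector_derivative - grad (x t)) (at t within {0..})"
      using stay[OF t] by (intro x'[OF t]) (simp add: sublevel_def)
  qed
  then show ?thesis using that x(1) by blast
qed

context
  fixes x assumes fl: "flow x"
begin

lemma flow_stable: "0 \<le> t \<Longrightarrow> stable (x t)" using fl by (simp add: flow_def)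

lemma flow_cost_derivative:
  "0 \<le> t \<Longrightarrow> ((\<lambda>t. cost (x t)) has_real_derivative - (norm (grad (x t)))\<^sup>2) (at t within {0..})"
  using fl by (intro cost_along_curve) (auto simp: flow_def)

lemma flow_cost_mono: "0 \<le> s \<Longrightarrow> s \<le> t \<Longrightarrow> cost (x t) \<le> cost (x s)"
  by (rule nonincreasing_from_derivative[where f'="\<lambda>t. - (norm (grad (x t)))\<^sup>2"])
    (auto intro!: DERIV_subset[OF flow_cost_derivative])

lemma flow_sublevel: "0 \<le> t \<Longrightarrow> x t \<in> sublevel (cost (x 0))"
  using flow_cost_mono[of 0 t] flow_stable by (simp add: sublevel_def)

lemma flow_continuous: "continuous_on {0..} x"
  using fl unfolding flow_def by (intro continuous_on_vector_derivative) auto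

text \<open>By the mean value theorem the squared gradient norm equals, at some time, the mean
  decrease of the cost over \<open>{0..T}\<close>, and the cost stays positive. Continuity of the
  gradient along the flow makes the minimum attained.\<close>

lemma flow_min_gradient:
  assumes T: "0 < T"
  shows "\<exists>s\<in>{0..T}. (\<forall>t\<in>{0..T}. (norm (grad (x s)))\<^sup>2 \<le> (norm (grad (x t)))\<^sup>2) \<and>
    (norm (grad (x s)))\<^sup>2 \<le> cost (x 0) / T"
proof -
  have "continuous_on {0..T} (\<lambda>t. (norm (grad (x t)))\<^sup>2)"
    using flow_sublevel by (intro continuous_on_power continuous_on_norm
      continuous_on_compose2[OF bounded_lipschitz_continuous[OF bounded_lipschitz_grad]] continuous_on_subset[OF flow_continuous]) auto
  then obtain s where s: "s \<in> {0..T}" "\<And>t. t \<in> {0..T} \<Longrightarrow> (norm (grad (x s)))\<^sup>2 \<le> (norm (grad (x t)))\<^sup>2"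
    using continuous_attains_inf[of "{0..T}" "\<lambda>t. (norm (grad (x t)))\<^sup>2"] T by auto
  have "\<exists>r\<in>{0..T}. cost (x T) - cost (x 0) = - (norm (grad (x r)))\<^sup>2 * (T - 0)"
  proof (rule mvt_very_simple[where f="\<lambda>t. cost (x t)"])
    fix r assume r: "0 \<le> r" "r \<le> T"
    show "((\<lambda>t. cost (x t)) has_derivative (*) (- (norm (grad (x r)))\<^sup>2)) (at r within {0..T})"
      using DERIV_subset[OF flow_cost_derivative[OF r(1)], of "{0..T}"] by (simp add: has_field_derivative_def)
  qed (use T in simp)
  then obtain r where r: "r \<in> {0..T}" "cost (x T) - cost (x 0) = - (norm (grad (x r)))\<^sup>2 * T" by auto
  have "(norm (grad (x r)))\<^sup>2 * T \<le> cost (x 0)" using r(2) cost_pos[OF flow_stable, of T] T by simp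
  then have "(norm (grad (x r)))\<^sup>2 \<le> cost (x 0) / T" using T by (simp add: pos_le_divide_eq)
  with s(2)[OF r(1)] have "(norm (grad (x s)))\<^sup>2 \<le> cost (x 0) / T" by linarith
  with s show ?thesis by blast
qed

context
  fixes Ks
  assumes sts: "stable Ks" and EKs: "EK Ks = 0" and min: "\<And>K. stable K \<Longrightarrow> cost Ks \<le> cost K"
begin

lemma flow_mu_pos: "0 < \<mu> (cost (x 0))"
  using cost_pos[OF flow_stable, of 0] kappa_pos[OF flow_stable order_refl, of 0] min_eigenvalues_pos by (simp add: \<mu>_def)

text \<open>By gradient dominance the excess cost decreases at least at rate
  \<open>1 / \<mu>\<close> times itself, so its product with \<open>exp (t / \<mu>)\<close> does not
  increase. One constant serves all times because flow and minimizer stay in the initial sublevel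
  set.\<close>

lemma flow_cost_decay:
  assumes t: "0 \<le> t"
  shows "cost (x t) - cost Ks \<le> (cost (x 0) - cost Ks) * exp (- t / \<mu> (cost (x 0)))"
proof -
  let ?m = "\<mu> (cost (x 0))"
  define V where "V t = exp (t / ?m) * (cost (x t) - cost Ks)" for t
  have "V t \<le> V 0"
  proof (rule nonincreasing_from_derivative[OF t])
    fix s assume s: "0 \<le> s" "s \<le> t"
    show "(V has_real_derivative exp (s / ?m) * ((cost (x s) - cost Ks) / ?m - (norm (grad (x s)))\<^sup>2)) (at s within {0..t})"
      unfolding V_def using flow_mu_pos
      by (auto intro!: derivative_eq_intros DERIV_subset[OF flow_cost_derivative[OF s(1)]] simp: field_simps)
    have "cost (x s) - cost Ks \<le> ?m * (norm (grad (x s)))\<^sup>2"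
      using flow_stable s flow_cost_mono[of 0 s] min[of "x 0"] by (intro gradient_dominance sts) auto
    then have "(cost (x s) - cost Ks) / ?m - (norm (grad (x s)))\<^sup>2 \<le> 0"
      using flow_mu_pos by (simp add: pos_divide_le_eq mult.commute)
    then show "exp (s / ?m) * ((cost (x s) - cost Ks) / ?m - (norm (grad (x s)))\<^sup>2) \<le> 0"
      by (intro mult_nonneg_nonpos) auto
  qed
  then have "exp (t / ?m) * (cost (x t) - cost Ks) \<le> cost (x 0) - cost Ks" by (simp add: V_def)
  then have "exp (- t / ?m) * (exp (t / ?m) * (cost (x t) - cost Ks)) \<le> exp (- t / ?m) * (cost (x 0) - cost Ks)"
    by (intro mult_left_mono) auto
  then show ?thesis by (simp add: mult.commute flip: mult.assoc exp_add)
qed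

text \<open>Of \<open>L\<close> only the summand \<open>2 J0 \<lambda>\<^sub>n(R) / \<lambda>\<^sub>1(Q)\<close> matters: the rate follows from quadratic growth
  and not from a Lipschitz constant of the gradient.\<close>

lemma flow_distance_decay:
  assumes t: "0 \<le> t" and L: "2 * cost (x 0) / lQ * lR \<le> L"
  shows "norm (x t - Ks) \<le> 4 * \<mu> (cost (x 0)) * sqrt (L * (cost (x 0) - cost Ks)) * exp (- t / (2 * \<mu> (cost (x 0))))"
proof -
  let ?c = "cost (x 0)"
  let ?m = "\<mu> ?c" and ?k = "\<kappa> ?c" and ?d = "cost (x 0) - cost Ks"
  define e where "e = exp (- t / (2 * ?m))"
  have st0: "stable (x 0)" by (simp add: flow_stable)
  have c: "0 < ?c" by (rule cost_pos[OF st0])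
  have k: "0 < ?k" by (rule kappa_pos[OF st0 order_refl])
  have d: "0 \<le> ?d" using min[OF st0] by simp
  have m: "0 < ?m" by (rule flow_mu_pos)
  have L0: "0 \<le> L" using c min_eigenvalues_pos by (intro order_trans[OF _ L]) simp
  have e2: "exp (- t / ?m) = e\<^sup>2"
    unfolding e_def power2_eq_square exp_add[symmetric] using m by (intro arg_cong[of _ _ exp]) (simp add: field_simps)
  have "lR * lS * (norm (x t - Ks))\<^sup>2 \<le> 4 * ?k * (cost (x t) - cost Ks)"
    by (rule quadratic_growth[OF flow_stable[OF t] flow_cost_mono[OF order_refl t] sts EKs])
  also have "\<dots> \<le> 4 * ?k * (?d * e\<^sup>2)"
    using flow_cost_decay[OF t] k unfolding e2 by (intro mult_left_mono) auto
  finally have 1: "lR * lS * (norm (x t - Ks))\<^sup>2 \<le> 4 * ?k * (?d * e\<^sup>2)" .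
  have 2: "4 * ?k \<le> lR * lS * (16 * ?m\<^sup>2 * L)"
  proof -
    \<comment> \<open>With this ratio \<open>16 * ?m\<^sup>2 * (2 * ?c / lQ * lR)\<close> times
      \<open>lR * lS\<close> is \<open>4 * ?k\<close> times \<open>128 * (y * y * y)\<close>, and
      \<open>cost_lower\<close> says \<open>4 * y \<ge> 1\<close>. The stated constant thus exceeds
      the one that quadratic growth yields.\<close>
    define y where "y = ?c * ?k / (lQ * lS)"
    have y: "1 \<le> 4 * y" using cost_lower[OF st0 order_refl] min_eigenvalues_pos by (simp add: y_def field_simps)
    have "4 * ?k * 1 \<le> 4 * ?k * (128 * (y * y * y))"
    proof (rule mult_left_mono)
      have "1 * 1 \<le> (4 * y) * (4 * y)" using y by (intro mult_mono) auto
      then have "1 * 1 \<le> (4 * y) * (4 * y) * (4 * y)" using y by (intro mult_mono) auto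
      then show "1 \<le> 128 * (y * y * y)" by (simp add: mult_ac)
    qed (use k in simp)
    also have "\<dots> = lR * lS * (16 * ?m\<^sup>2 * (2 * ?c / lQ * lR))"
      using min_eigenvalues_pos k c by (simp add: y_def \<mu>_def field_simps power2_eq_square)
    also have "\<dots> \<le> lR * lS * (16 * ?m\<^sup>2 * L)"
      using min_eigenvalues_pos L by (intro mult_left_mono) auto
    finally show ?thesis by simp
  qed
  have "lR * lS * (norm (x t - Ks))\<^sup>2 \<le> lR * lS * ((4 * ?m * sqrt (L * ?d) * e)\<^sup>2)"
  proof -
    have "4 * ?k * (?d * e\<^sup>2) \<le> lR * lS * (16 * ?m\<^sup>2 * L) * (?d * e\<^sup>2)"
      using 2 d by (intro mult_right_mono) auto
    also have "\<dots> = lR * lS * ((4 * ?m * sqrt (L * ?d) * e)\<^sup>2)"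
      using L0 d by (simp add: power_mult_distrib mult_ac)
    finally show ?thesis using 1 by linarith
  qed
  then have "(norm (x t - Ks))\<^sup>2 \<le> (4 * ?m * sqrt (L * ?d) * e)\<^sup>2" using min_eigenvalues_pos by simp
  moreover have "0 \<le> 4 * ?m * sqrt (L * ?d) * e"
    using m L0 d by (intro mult_nonneg_nonneg) (auto simp: e_def)
  ultimately show ?thesis unfolding e_def[symmetric] by (rule power2_le_imp_le)
qed

lemma flow_tendsto: "(x \<longlongrightarrow> Ks) at_top"
proof -
  let ?L = "2 * cost (x 0) / lQ * lR" and ?m = "\<mu> (cost (x 0))"
  have "((\<lambda>t. 4 * ?m * sqrt (?L * (cost (x 0) - cost Ks)) * exp (- t / (2 * ?m))) \<longlongrightarrow> 0) at_top"
    using exp_decay_tendsto[of "2 * ?m" "4 * ?m * sqrt (?L * (cost (x 0) - cost Ks))"] flow_mu_pos by simp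
  then have "((\<lambda>t. norm (x t - Ks)) \<longlongrightarrow> 0) at_top"
  proof (rule real_tendsto_sandwich[OF _ _ tendsto_const, rotated 2])
    show "\<forall>\<^sub>F t in at_top. norm (x t - Ks) \<le> 4 * ?m * sqrt (?L * (cost (x 0) - cost Ks)) * exp (- t / (2 * ?m))"
      using eventually_ge_at_top[of 0] by eventually_elim (rule flow_distance_decay[OF _ order_refl])
  qed simp
  then show ?thesis by (rule LIM_zero_cancel[OF tendsto_norm_zero_cancel])
qed

lemma flow_gradient_tendsto: "((\<lambda>t. grad (x t)) \<longlongrightarrow> 0) at_top"
proof -
  have "grad Ks = 0" unfolding grad_def EKs by simp
  moreover have "((\<lambda>t. grad (x t)) \<longlongrightarrow> grad Ks) at_top"
  proof (rule continuous_on_tendsto_compose[OF bounded_lipschitz_continuous[OF bounded_lipschitz_grad[of "cost (x 0)"]] flow_tendsto])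
    show "Ks \<in> sublevel (cost (x 0))" using sts min[OF flow_stable[OF order_refl]] by (simp add: sublevel_def)
    show "\<forall>\<^sub>F t in at_top. x t \<in> sublevel (cost (x 0))"
      using eventually_ge_at_top[of 0] by eventually_elim (rule flow_sublevel)
  qed
  ultimately show ?thesis by simp
qed

end

end

end

section \<open>The stochastic cost\<close>

lemma DERIV_split:
  fixes f :: "real \<Rightarrow> real"
  assumes "(f has_real_derivative D) (at x within {..x})" "(f has_real_derivative D) (at x within {x..})"
  shows "(f has_real_derivative D) (at x)"
proof -
  have "(f has_real_derivative D) (at x within {..x} \<union> {x..})"
    using assms unfolding has_field_derivative_iff Lim_within_Un by blast
  moreover have "{..x} \<union> {x..} = UNIV" by auto
  ultimately show ?thesis by simp
qed

text \<open>The derivative at 0 is one-sided, while the fundamental theorem used here asks for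
  two-sided derivatives from 0 on. \<open>G\<close> continues \<open>F\<close> to the left of 0
  along its tangent, and \<open>g\<close> is continued by a constant.\<close>

lemma nn_integral_FTC_halfline:
  fixes f F :: "real \<Rightarrow> real"
  assumes deriv: "\<And>t. 0 \<le> t \<Longrightarrow> (F has_real_derivative f t) (at t within {0..})"
    and cont: "continuous_on {0..} f" and nonneg: "\<And>t. 0 \<le> t \<Longrightarrow> 0 \<le> f t" and lim: "(F \<longlongrightarrow> l) at_top"
  shows "(\<integral>\<^sup>+t\<in>{0..}. ennreal (f t) \<partial>lborel) = ennreal (l - F 0)"
proof -
  define g where "g t = f (max 0 t)" for t
  define G where "G t = (if t \<le> 0 then F 0 + t * f 0 else F t)" for t
  have G_pos: "G t = F t" if "0 \<le> t" for t using that by (auto simp: G_def)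
  have "(\<integral>\<^sup>+t. ennreal (g t) * indicator {0..} t \<partial>lborel) = ennreal (l - G 0)"
  proof (rule nn_integral_FTC_atLeast)
    have "continuous_on UNIV g"
      unfolding g_def by (intro continuous_on_compose2[OF cont] continuous_intros) auto
    then show "g \<in> borel_measurable borel" by (rule borel_measurable_continuous_onI)
    show "(G \<longlongrightarrow> l) at_top"
      using lim by (rule Lim_transform_eventually)
        (use eventually_ge_at_top[of 0] in \<open>eventually_elim, simp add: G_pos\<close>)
    fix t :: real assume t: "0 \<le> t"
    show "0 \<le> g t" using nonneg t by (simp add: g_def)
    have right: "(G has_real_derivative f t) (at t within {0..})"
      using deriv[OF t] by (rule has_field_derivative_transform_within[where d=1]) (use t in \<open>auto simp: G_pos\<close>)
    show "DERIV G t :> g t"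
    proof (cases "t = 0")
      case True
      have "((\<lambda>s. F 0 + s * f 0) has_real_derivative f 0) (at 0 within {..0})"
        by (auto intro!: derivative_eq_intros)
      then have "(G has_real_derivative f 0) (at 0 within {..0})"
        by (rule has_field_derivative_transform_within[where d=1]) (auto simp: G_def)
      then show ?thesis using DERIV_split right True by (simp add: g_def)
    next
      case False
      then have "at t within {0..} = at t" using t by (intro at_within_interior) simp
      then show ?thesis using right t by (simp add: g_def)
    qed
  qed
  moreover have "(\<integral>\<^sup>+t\<in>{0..}. ennreal (f t) \<partial>lborel) = (\<integral>\<^sup>+t. ennreal (g t) * indicator {0..} t \<partial>lborel)"
    by (intro nn_integral_cong) (simp add: g_def indicator_def)
  ultimately show ?thesis by (simp add: G_pos)
qed

lemma has_real_derivative_inner_matrix: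
  fixes S :: "real \<Rightarrow> real^'n^'m"
  assumes "\<And>i j. ((\<lambda>t. S t $ i $ j) has_vector_derivative Y $ i $ j) (at x within U)"
  shows "((\<lambda>t. P \<bullet> S t) has_real_derivative P \<bullet> Y) (at x within U)"
proof -
  have e: "P \<bullet> X = (\<Sum>i\<in>UNIV. \<Sum>j\<in>UNIV. P $ i $ j * X $ i $ j)" for X
    by (simp add: inner_vec_def)
  show ?thesis
    unfolding e
    by (intro DERIV_sum DERIV_cmult) (rule assms[folded has_real_derivative_iff_has_vector_derivative])
qed

lemma matrix_eqI_inner:
  fixes X Y :: "real^'n^'m"
  assumes "\<And>P. P \<bullet> X = P \<bullet> Y" shows "X = Y"
  using assms[of "X - Y"] by (metis inner_diff_right inner_eq_zero_iff eq_iff_diff_eq_0)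

lemma gradient_eqI:
  assumes "GDERIV f x :> g" shows "gradient f x = g"
  unfolding gradient_def
proof (rule the_equality)
  show "GDERIV f x :> g" by (rule assms)
  fix g' assume "GDERIV f x :> g'"
  then have "(\<lambda>h. h \<bullet> g') = (\<lambda>h. h \<bullet> g)"
    using assms has_derivative_unique unfolding gderiv_def by blast
  then have "(g' - g) \<bullet> g' = (g' - g) \<bullet> g" by (rule fun_cong)
  then have "(g' - g) \<bullet> (g' - g) = 0" by (simp only: inner_diff_right)
  then show "g' = g" by simp
qed

locale lq_regulator = brownian_basis M F W + lq_problem A C Q \<Sigma>0 B D R
  for M :: "'a measure" and F :: "real \<Rightarrow> 'a measure" and W :: "real \<Rightarrow> 'a \<Rightarrow> real"
    and A C Q \<Sigma>0 :: "real^'n^'n" and B D :: "real^'m^'n" and R :: "real^'m^'m" +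
  fixes X0 :: "'a \<Rightarrow> real^'n"
  assumes X0: "initial_state M F X0" and \<Sigma>0_moment: "\<Sigma>0 = second_moment M X0"
begin

abbreviation J :: "real^'n^'m \<Rightarrow> ennreal" where "J \<equiv> lq_cost M F W A B C D Q R X0"

text \<open>The matrix equation in weak form, tested against every \<open>P\<close>: all later uses
  pair the curve with a fixed matrix and need scalar derivatives only.\<close>

definition moment_curve :: "real^'n^'m \<Rightarrow> (real \<Rightarrow> real^'n^'n) \<Rightarrow> bool" where
  "moment_curve K S \<longleftrightarrow> S 0 = \<Sigma>0 \<and> (\<forall>t\<ge>0. psd (S t)) \<and>
    (\<forall>t\<ge>0. \<forall>P. ((\<lambda>t. P \<bullet> S t) has_real_derivative P \<bullet> lyap (Ak K) (Ck K) (S t)) (at t within {0..}))"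

lemma moment_curveD:
  assumes "moment_curve K S"
  shows "S 0 = \<Sigma>0" "\<And>t. 0 \<le> t \<Longrightarrow> psd (S t)"
    "\<And>t P. 0 \<le> t \<Longrightarrow> ((\<lambda>t. P \<bullet> S t) has_real_derivative P \<bullet> lyap (Ak K) (Ck K) (S t)) (at t within {0..})"
  using assms unfolding moment_curve_def by blast+

lemma moment_flow:
  obtains S :: "real \<Rightarrow> real^'n^'n" where "moment_curve K S"
    "\<And>t. 0 \<le> t \<Longrightarrow> (\<integral>\<^sup>+\<omega>. ennreal (closed_loop_state M F W A B C D K X0 t \<omega> \<bullet> closed_loop_state M F W A B C D K X0 t \<omega>) \<partial>M)
      = ennreal (mat 1 \<bullet> S t)"
    "J K = (\<integral>\<^sup>+t\<in>{0..}. ennreal (Qk K \<bullet> S t) \<partial>lborel)"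
proof -
  obtain S :: "real \<Rightarrow> real^'n^'n" where S: "S 0 = second_moment M X0"
    "\<And>t. 0 \<le> t \<Longrightarrow> transpose (S t) = S t"
    "\<And>t v. 0 \<le> t \<Longrightarrow> 0 \<le> v \<bullet> (S t *v v)"
    "\<And>t i j. 0 \<le> t \<Longrightarrow> ((\<lambda>t. S t $ i $ j) has_vector_derivative
      ((A + B ** K) ** S t + S t ** transpose (A + B ** K)
        + (C + D ** K) ** S t ** transpose (C + D ** K)) $ i $ j) (at t within {0..})"
    "\<And>t. 0 \<le> t \<Longrightarrow> (\<integral>\<^sup>+\<omega>. ennreal (closed_loop_state M F W A B C D K X0 t \<omega> \<bullet> closed_loop_state M F W A B C D K X0 t \<omega>) \<partial>M)
      = ennreal (mat 1 \<bullet> S t)"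
    "\<And>G. (\<And>v. 0 \<le> v \<bullet> (G *v v)) \<Longrightarrow>
      (\<integral>\<^sup>+\<omega>. (\<integral>\<^sup>+t\<in>{0..}. ennreal (closed_loop_state M F W A B C D K X0 t \<omega> \<bullet> (G *v closed_loop_state M F W A B C D K X0 t \<omega>)) \<partial>lborel) \<partial>M)
       = (\<integral>\<^sup>+t\<in>{0..}. ennreal (G \<bullet> S t) \<partial>lborel)"
    by (rule closed_loop_second_moment[OF X0 closed_loop_state_solution[OF X0]]) blast
  show ?thesis
  proof (rule that[of S])
    show "moment_curve K S"
      unfolding moment_curve_def
    proof (intro conjI allI impI)
      fix t :: real and P :: "real^'n^'n" assume "0 \<le> t"
      then show "((\<lambda>t. P \<bullet> S t) has_real_derivative P \<bullet> lyap (Ak K) (Ck K) (S t)) (at t within {0..})"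
        unfolding lyap_def Ak_def Ck_def by (intro has_real_derivative_inner_matrix S(4))
    qed (use S in \<open>auto simp: psd_def \<Sigma>0_moment\<close>)
    show "J K = (\<integral>\<^sup>+t\<in>{0..}. ennreal (Qk K \<bullet> S t) \<partial>lborel)"
      unfolding lq_cost_def Qk_def[symmetric] by (rule S(6)[OF Qk_nonneg])
  qed (rule S(5))
qed

text \<open>The integral of \<open>S\<close> over \<open>[0, T]\<close> is a Lyapunov certificate as soon as \<open>S T\<close> is smaller than
  \<open>S 0\<close>.\<close>

lemma stable_if_small_moment:
  assumes mc: "moment_curve K S" and T: "0 \<le> T" "mat 1 \<bullet> S T < lS"
  shows "stable K"
proof -
  note S = moment_curveD[OF mc]
  define G :: "real^'n^'n" where "G = integral {0..T} S"
  have inner_cont: "continuous_on {0..} (\<lambda>t. P \<bullet> S t)" for P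
    using S(3) by (intro DERIV_continuous_on) auto
  then have cont: "continuous_on {0..} S"
    unfolding continuous_on_componentwise[of _ S] by (simp add: inner_commute)
  then have S_int: "S integrable_on {0..T}"
    by (intro integrable_continuous_interval continuous_on_subset[OF cont]) auto
  have G_inner: "P \<bullet> G = integral {0..T} (\<lambda>t. P \<bullet> S t)" for P
    unfolding G_def using integral_linear[OF S_int bounded_linear_inner_right[of P]] by (simp add: o_def)
  have G: "psd G"
    unfolding psd_def
  proof (intro conjI allI)
    fix v
    have "0 \<le> outer v v \<bullet> G"
      unfolding G_inner
    proof (rule integral_nonneg)
      show "(\<lambda>t. outer v v \<bullet> S t) integrable_on {0..T}"
        by (intro integrable_continuous_interval continuous_on_subset[OF inner_cont]) auto
      show "0 \<le> outer v v \<bullet> S t" if "t \<in> {0..T}" for t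
        using S(2)[of t] that by (simp add: inner_commute[of "outer v v"] inner_outer psd_def)
    qed
    then show "0 \<le> v \<bullet> (G *v v)" by (simp add: inner_outer inner_commute[of "outer v v"])
    have "P \<bullet> transpose G = P \<bullet> G" for P
    proof -
      have "P \<bullet> transpose G = transpose P \<bullet> G" using inner_transpose[of "transpose P" G] by simp
      also have "\<dots> = P \<bullet> G"
        unfolding G_inner
      proof (rule integral_cong)
        fix t assume "t \<in> {0..T}"
        then have "transpose (S t) = S t" using S(2)[of t] by (simp add: psd_def)
        then show "transpose P \<bullet> S t = P \<bullet> S t" using inner_transpose[of P "S t"] by simp
      qed
      finally show ?thesis .
    qed
    then show "transpose G = G" by (rule matrix_eqI_inner)
  qed
  have "P \<bullet> lyap (Ak K) (Ck K) G = P \<bullet> (S T - \<Sigma>0)" for P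
  proof -
    have "((\<lambda>t. P \<bullet> lyap (Ak K) (Ck K) (S t)) has_integral P \<bullet> S T - P \<bullet> S 0) {0..T}"
    proof (rule fundamental_theorem_of_calculus[OF T(1)])
      fix t assume t: "t \<in> {0..T}"
      show "((\<lambda>t. P \<bullet> S t) has_vector_derivative P \<bullet> lyap (Ak K) (Ck K) (S t)) (at t within {0..T})"
        unfolding has_real_derivative_iff_has_vector_derivative[symmetric]
        by (rule DERIV_subset[OF S(3)]) (use t in auto)
    qed
    moreover have "P \<bullet> lyap (Ak K) (Ck K) X = lyap_adj (Ak K) (Ck K) P \<bullet> X" for X
      by (metis lyap_inner inner_commute)
    ultimately show ?thesis
      using G_inner[of "lyap_adj (Ak K) (Ck K) P"] S(1) by (simp add: inner_diff_right integral_unique)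
  qed
  then have LG: "lyap (Ak K) (Ck K) G = S T - \<Sigma>0" by (rule matrix_eqI_inner)
  have "lyap_stable (Ak K) (Ck K)"
    unfolding lyap_stable_def LG
  proof (intro exI[of _ G] conjI allI impI G)
    fix v :: "real^'n" assume "v \<noteq> 0"
    then have "0 < v \<bullet> v" by simp
    then have "(mat 1 \<bullet> S T) * (v \<bullet> v) < lS * (v \<bullet> v)" using T(2) by (rule mult_strict_right_mono[rotated])
    then show "v \<bullet> (lyap (Ak K) (Ck K) G *v v) < 0"
      using psd_quad_le_trace[OF S(2)[OF T(1)], of v] min_eigenvalues_le(3)[of v] by (simp add: LG quad_simps)
  qed
  then show ?thesis by (rule stableI)
qed

text \<open>Stabilization is applied to \<open>X0\<close>: the trace of its moments tends to 0 and
  at some time falls below \<open>lS\<close>, which is what a Lyapunov certificate requires.\<close>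

lemma stabilizer_stable:
  assumes "K \<in> mean_square_stabilizers M F W A B C D"
  shows "stable K"
proof -
  obtain S :: "real \<Rightarrow> real^'n^'n" where mc: "moment_curve K S" and
    nrm: "\<And>t. 0 \<le> t \<Longrightarrow> (\<integral>\<^sup>+\<omega>. ennreal (closed_loop_state M F W A B C D K X0 t \<omega> \<bullet> closed_loop_state M F W A B C D K X0 t \<omega>) \<partial>M)
      = ennreal (mat 1 \<bullet> S t)"
    using moment_flow[of K] by blast
  note S = moment_curveD[OF mc]
  have "((\<lambda>t. \<integral>\<^sup>+\<omega>. ennreal (closed_loop_state M F W A B C D K X0 t \<omega> \<bullet> closed_loop_state M F W A B C D K X0 t \<omega>) \<partial>M) \<longlongrightarrow> 0) at_top"
    using assms X0 by (simp add: mean_square_stabilizers_def)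
  then have "\<forall>\<^sub>F t in at_top. (\<integral>\<^sup>+\<omega>. ennreal (closed_loop_state M F W A B C D K X0 t \<omega> \<bullet> closed_loop_state M F W A B C D K X0 t \<omega>) \<partial>M) < ennreal lS"
    by (rule order_tendstoD) (use min_eigenvalues_pos in simp)
  then have "\<forall>\<^sub>F t in at_top. 0 \<le> t \<and> mat 1 \<bullet> S t < lS"
    using eventually_ge_at_top[of 0]
    by eventually_elim (simp add: nrm ennreal_less_iff psd_trace_nonneg S(2))
  then obtain T where "0 \<le> T" "mat 1 \<bullet> S T < lS"
    using eventually_happens'[OF trivial_limit_at_top_linorder] by blast
  then show ?thesis by (rule stable_if_small_moment[OF mc])
qed

text \<open>If the trace of the moments never fell below \<open>lS\<close>, the running cost would
  be at least \<open>lQ * lS\<close> at all times and the total cost infinite.\<close>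

lemma finite_cost_stable:
  assumes "J K < \<infinity>"
  shows "stable K"
proof -
  obtain S :: "real \<Rightarrow> real^'n^'n" where mc: "moment_curve K S" and
    J: "J K = (\<integral>\<^sup>+t\<in>{0..}. ennreal (Qk K \<bullet> S t) \<partial>lborel)"
    using moment_flow[of K] by blast
  note S = moment_curveD[OF mc]
  have "\<exists>T\<ge>0. mat 1 \<bullet> S T < lS"
  proof (rule ccontr)
    assume "\<not> ?thesis"
    then have big: "lS \<le> mat 1 \<bullet> S t" if "0 \<le> t" for t using that by force
    have q: "lQ * lS \<le> Qk K \<bullet> S t" if t: "0 \<le> t" for t
    proof -
      have "lQ * lS \<le> lQ * (mat 1 \<bullet> S t)" using big[OF t] min_eigenvalues_pos by (intro mult_left_mono) auto
      also have "\<dots> = (lQ *\<^sub>R mat 1) \<bullet> S t" by simp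
      also have "\<dots> \<le> Qk K \<bullet> S t" by (rule psd_inner_mono[OF S(2)[OF t] Qk_lower])
      finally show ?thesis .
    qed
    obtain r where r: "0 \<le> r" "J K = ennreal r" using assms by (cases "J K" rule: ennreal_cases) auto
    \<comment> \<open>The horizon is chosen so that the lower bound for the running cost accumulates
      to \<open>r + 1\<close>, more than the total \<open>r\<close>.\<close>
    define T where "T = (r + 1) / (lQ * lS)"
    have T: "0 \<le> T" "lQ * lS * T = r + 1" using min_eigenvalues_pos r by (auto simp: T_def)
    have "ennreal (r + 1) = (\<integral>\<^sup>+t. ennreal (lQ * lS) * indicator {0..T} t \<partial>lborel)"
      using T min_eigenvalues_pos by (simp add: nn_integral_cmult_indicator ennreal_mult[symmetric])
    also have "\<dots> \<le> J K"
      unfolding J using q by (intro nn_integral_mono) (auto simp: indicator_def intro!: ennreal_leI)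
    finally show False using r by simp
  qed
  then show ?thesis using stable_if_small_moment[OF mc] by blast
qed

text \<open>\<open>PK K \<bullet> S t\<close> is the cost still to come: by duality its derivative
  is minus the running cost. The running cost dominates a multiple of it, so it decays to 0, and the
  total cost is its initial value.\<close>

lemma stable_cost:
  assumes st: "stable K"
  shows "J K = ennreal (cost K)"
proof -
  obtain S :: "real \<Rightarrow> real^'n^'n" where mc: "moment_curve K S" and
    J: "J K = (\<integral>\<^sup>+t\<in>{0..}. ennreal (Qk K \<bullet> S t) \<partial>lborel)"
    using moment_flow[of K] by blast
  note S = moment_curveD[OF mc]
  let ?P = "PK K"
  have deriv: "((\<lambda>t. ?P \<bullet> S t) has_real_derivative - (Qk K \<bullet> S t)) (at t within {0..})" if t: "0 \<le> t" for t
  proof -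
    have "?P \<bullet> lyap (Ak K) (Ck K) (S t) = S t \<bullet> lyap_adj (Ak K) (Ck K) ?P"
      unfolding inner_commute[of ?P] by (rule lyap_inner)
    also have "\<dots> = - (Qk K \<bullet> S t)" by (simp add: PK_spec(2)[OF st] inner_commute)
    finally show ?thesis using S(3)[OF t, of ?P] by simp
  qed
  have nonneg: "0 \<le> ?P \<bullet> S t" if "0 \<le> t" for t
    using PK_psd[OF st] by (intro psd_inner_nonneg[OF S(2)[OF that]]) (simp add: psd_def)
  \<comment> \<open>Chosen so that \<open>?P\<close> lies below \<open>c\<close> times
    \<open>Qk K\<close>: the norm bounds \<open>?P\<close>, and \<open>lQ\<close> bounds
    \<open>Qk K\<close> from below. The summand 1 keeps \<open>c\<close> positive.\<close>
  define c where "c = (norm ?P + 1) / lQ"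
  have c: "0 < c" using min_eigenvalues_pos by (simp add: c_def add_nonneg_pos)
  have rate: "?P \<bullet> S t \<le> c * (Qk K \<bullet> S t)" if "0 \<le> t" for t
  proof -
    have "?P \<bullet> S t \<le> (c *\<^sub>R Qk K) \<bullet> S t"
    proof (rule psd_inner_mono[OF S(2)[OF that]])
      fix v
      have "v \<bullet> (?P *v v) \<le> (norm ?P + 1) * (v \<bullet> v)"
      proof -
        have "v \<bullet> (?P *v v) \<le> norm ?P * (v \<bullet> v)" using quad_le_norm[of v ?P] by linarith
        also have "\<dots> \<le> (norm ?P + 1) * (v \<bullet> v)" by (rule mult_right_mono) simp_all
        finally show ?thesis .
      qed
      also have "\<dots> = c * (lQ * (v \<bullet> v))" using min_eigenvalues_pos by (simp add: c_def)
      also have "\<dots> \<le> c * (v \<bullet> (Qk K *v v))"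
        using c Qk_lower[of v K] by (intro mult_left_mono) (auto simp: quad_simps)
      finally show "v \<bullet> (?P *v v) \<le> v \<bullet> ((c *\<^sub>R Qk K) *v v)" by (simp add: quad_simps)
    qed
    then show ?thesis by simp
  qed
  have decay: "?P \<bullet> S t \<le> cost K * exp (- t / c)" if t: "0 \<le> t" for t
  proof -
    have "exp (t / c) * (?P \<bullet> S t) \<le> exp (0 / c) * (?P \<bullet> S 0)"
    proof (rule nonincreasing_from_derivative[OF t])
      fix s assume s: "0 \<le> s" "s \<le> t"
      show "((\<lambda>t. exp (t / c) * (?P \<bullet> S t)) has_real_derivative exp (s / c) * ((?P \<bullet> S s) / c - Qk K \<bullet> S s)) (at s within {0..t})"
        using c by (auto intro!: derivative_eq_intros DERIV_subset[OF deriv[OF s(1)]] simp: field_simps)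
      show "exp (s / c) * ((?P \<bullet> S s) / c - Qk K \<bullet> S s) \<le> 0"
        using rate[OF s(1)] c by (intro mult_nonneg_nonpos) (auto simp: pos_divide_le_eq mult.commute)
    qed
    then have "exp (- t / c) * (exp (t / c) * (?P \<bullet> S t)) \<le> exp (- t / c) * cost K"
      by (intro mult_left_mono) (simp_all add: S(1) cost_PK[OF st])
    then show ?thesis by (simp add: mult.commute flip: mult.assoc exp_add)
  qed
  have "((\<lambda>t. ?P \<bullet> S t) \<longlongrightarrow> 0) at_top"
  proof (rule real_tendsto_sandwich[OF _ _ tendsto_const exp_decay_tendsto[OF c, of "cost K"]])
    show "\<forall>\<^sub>F t in at_top. 0 \<le> ?P \<bullet> S t"
      using eventually_ge_at_top[of 0] by eventually_elim (rule nonneg)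
    show "\<forall>\<^sub>F t in at_top. ?P \<bullet> S t \<le> cost K * exp (- t / c)"
      using eventually_ge_at_top[of 0] by eventually_elim (rule decay)
  qed
  then have lim: "((\<lambda>t. - (?P \<bullet> S t)) \<longlongrightarrow> 0) at_top" using tendsto_minus by fastforce
  have "J K = ennreal (0 - - (?P \<bullet> S 0))"
    unfolding J
  proof (rule nn_integral_FTC_halfline[OF _ _ _ lim])
    show "((\<lambda>t. - (?P \<bullet> S t)) has_real_derivative Qk K \<bullet> S t) (at t within {0..})" if "0 \<le> t" for t
      using DERIV_minus[OF deriv[OF that]] by simp
    show "continuous_on {0..} (\<lambda>t. Qk K \<bullet> S t)"
      using S(3) by (intro DERIV_continuous_on) auto
    show "0 \<le> Qk K \<bullet> S t" if "0 \<le> t" for t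
      by (rule psd_inner_nonneg[OF S(2)[OF that] Qk_nonneg])
  qed
  then show ?thesis by (simp add: S(1) cost_PK[OF st])
qed

text \<open>The real value of \<open>J\<close> agrees with \<open>cost\<close> on the stable
  feedbacks, an open set, and derivatives are local.\<close>

lemma cost_gradient:
  assumes st: "stable K"
  shows "GDERIV (\<lambda>K. enn2real (J K)) K :> grad K" "gradient (\<lambda>K. enn2real (J K)) K = grad K"
proof -
  obtain \<delta> where \<delta>: "0 < \<delta>" "\<And>K'. dist K' K < \<delta> \<Longrightarrow> K' \<in> sublevel (2 * cost K + 2)"
    using stable_neighborhood[OF st] by blast
  show G: "GDERIV (\<lambda>K. enn2real (J K)) K :> grad K"
    unfolding gderiv_def
  proof (rule has_derivative_transform_within[OF cost_gderiv[OF st, unfolded gderiv_def] \<delta>(1)])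
    show "cost K' = enn2real (J K')" if "dist K' K < \<delta>" for K'
      using \<delta>(2)[OF that] cost_pos[of K'] by (simp add: sublevel_def stable_cost)
  qed simp
  show "gradient (\<lambda>K. enn2real (J K)) K = grad K"
    by (rule gradient_eqI[OF G])
qed

text \<open>A minimizer among the stable feedbacks is a global one, because every other feedback has
  infinite cost.\<close>

lemma J_minimal:
  assumes "stable Ks" "\<And>K. stable K \<Longrightarrow> cost Ks \<le> cost K"
  shows "J Ks \<le> J K"
proof (cases "J K < \<infinity>")
  case True
  then have st: "stable K" by (rule finite_cost_stable)
  then show ?thesis using assms by (simp add: stable_cost ennreal_leI)
next
  case False
  then show ?thesis by (simp add: not_less top_unique)
qed

end

theorem theorem4p1:
  fixes M :: "'a measure" and F :: "real \<Rightarrow> 'a measure" and W :: "real \<Rightarrow> 'a \<Rightarrow> real"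
    and A C Q :: "real^'n^'n" and B D :: "real^'m^'n" and R :: "real^'m^'m"
    and X0 :: "'a \<Rightarrow> real^'n" and \<Sigma>0 :: "real^'n^'n" and K0 :: "real^'n^'m"
    and \<K> :: "(real^'n^'m) set" and J :: "real^'n^'m \<Rightarrow> ennreal" and Jr :: "real^'n^'m \<Rightarrow> real"
    and J0 \<mu> L \<xi> \<mu>' :: real
  assumes basis: "brownian_basis M F W"
    and B_nonzero: "B \<noteq> 0"
    and Q: "sym_pos_def Q" and R: "sym_pos_def R"
    and X0: "initial_state M F X0"
    and \<Sigma>0_def: "\<Sigma>0 = second_moment M X0" and \<Sigma>0: "sym_pos_def \<Sigma>0"
    and \<K>_def: "\<K> = mean_square_stabilizers M F W A B C D"
    and J_def: "J = lq_cost M F W A B C D Q R X0"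
    and Jr_def: "Jr = (\<lambda>K. enn2real (J K))"
    and K0: "K0 \<in> \<K>"
    and J0_def: "J0 = Jr K0"
    and \<mu>_def: "\<mu> = 4 * J0 / (min_eigenvalue R * min_eigenvalue Q * (min_eigenvalue \<Sigma>0)\<^sup>2) *
      (spectral_norm A + (spectral_norm B)\<^sup>2 * J0 / (min_eigenvalue R * min_eigenvalue \<Sigma>0))\<^sup>2"
    and \<mu>'_def: "\<mu>' = spectral_norm B + spectral_norm D * norm C
      + 2 * spectral_norm B * J0 * (spectral_norm D)\<^sup>2 / (min_eigenvalue \<Sigma>0 * min_eigenvalue R)
      + spectral_norm A * (spectral_norm D)\<^sup>2 / spectral_norm B"
    and \<xi>_def: "\<xi> = sqrt (real CARD('n)) * J0 / min_eigenvalue \<Sigma>0 *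
      (\<mu>' * J0 / (min_eigenvalue \<Sigma>0 * min_eigenvalue Q)
       + sqrt ((\<mu>' * J0 / (min_eigenvalue \<Sigma>0 * min_eigenvalue Q))\<^sup>2
               + max_eigenvalue R / min_eigenvalue Q))"
    and L_def: "L = 2 * J0 / min_eigenvalue Q *
      (max_eigenvalue R + J0 * (spectral_norm D)\<^sup>2 / min_eigenvalue \<Sigma>0
       + (spectral_norm B + spectral_norm C * spectral_norm D
          + 2 * spectral_norm B * (norm D)\<^sup>2 * J0 / (min_eigenvalue \<Sigma>0 * min_eigenvalue R)
          + spectral_norm A * (norm D)\<^sup>2 / spectral_norm B) * \<xi>)"
  shows "\<exists>K :: real \<Rightarrow> real^'n^'m.
    K 0 = K0 \<and> gradient_flow Jr K \<and>
    (\<forall>s t. 0 \<le> s \<longrightarrow> s \<le> t \<longrightarrow> J (K t) \<le> J (K s)) \<and>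
    (\<forall>t\<ge>0. K t \<in> {K'. J K' \<le> J K0}) \<and>
    ((\<lambda>t. gradient Jr (K t)) \<longlongrightarrow> 0) at_top \<and>
    (\<forall>T>0. \<exists>s\<in>{0..T}.
       (\<forall>t\<in>{0..T}. (norm (gradient Jr (K s)))\<^sup>2 \<le> (norm (gradient Jr (K t)))\<^sup>2) \<and>
       (norm (gradient Jr (K s)))\<^sup>2 \<le> J0 / T) \<and>
    (\<exists>Ks. (\<forall>K'. J Ks \<le> J K') \<and> (\<forall>K''. (\<forall>K'. J K'' \<le> J K') \<longrightarrow> K'' = Ks) \<and>
       (K \<longlongrightarrow> Ks) at_top \<and>
       (\<forall>t\<ge>0. Jr (K t) - Jr Ks \<le> (Jr K0 - Jr Ks) * exp (- t / \<mu>)) \<and>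
       (\<forall>t\<ge>0. norm (K t - Ks) \<le> 4 * \<mu> * sqrt (L * (Jr K0 - Jr Ks)) * exp (- t / (2 * \<mu>))))"
proof -
  interpret P: lq_regulator M F W A C Q \<Sigma>0 B D R X0
    by (intro lq_regulator.intro lq_problem.intro lq_regulator_axioms.intro basis B_nonzero Q R \<Sigma>0 X0 \<Sigma>0_def)
  have Jr: "Jr = (\<lambda>K. enn2real (lq_cost M F W A B C D Q R X0 K))" unfolding Jr_def J_def ..
  have st0: "P.stable K0" using K0 unfolding \<K>_def by (rule P.stabilizer_stable)
  have J_eq: "J K = ennreal (P.cost K)" if "P.stable K" for K
    unfolding J_def by (rule P.stable_cost[OF that])
  have Jr_eq: "Jr K = P.cost K" if "P.stable K" for K
    using P.cost_pos[OF that] by (simp add: Jr_def J_eq[OF that])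
  have J0: "J0 = P.cost K0" unfolding J0_def by (rule Jr_eq[OF st0])
  have J0_pos: "0 < J0" unfolding J0 by (rule P.cost_pos[OF st0])
  have \<mu>: "\<mu> = P.\<mu> J0" unfolding \<mu>_def P.\<mu>_def P.\<kappa>_def ..
  have nn: "0 \<le> spectral_norm U" for U :: "real^'i^'j" by (rule spectral_norm_nonneg)
  have maxR: "min_eigenvalue R \<le> max_eigenvalue R" by (rule min_le_max_eigenvalue[OF P.symmetric_data(2)])
  note pos = P.min_eigenvalues_pos J0_pos
  \<comment> \<open>Signs of the constants: once \<open>\<xi>\<close> is nonnegative, every summand
    in the bracket of \<open>L\<close> except \<open>max_eigenvalue R\<close> may be dropped, and
    that one is at least \<open>min_eigenvalue R\<close>.\<close>
  have "0 \<le> \<mu>'"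
    unfolding \<mu>'_def using pos by (intro add_nonneg_nonneg mult_nonneg_nonneg divide_nonneg_nonneg nn) auto
  then have "0 \<le> \<xi>"
    unfolding \<xi>_def using pos maxR
    by (intro mult_nonneg_nonneg divide_nonneg_nonneg add_nonneg_nonneg real_sqrt_ge_zero) auto
  then have "0 \<le> J0 * (spectral_norm D)\<^sup>2 / min_eigenvalue \<Sigma>0 + (spectral_norm B + spectral_norm C * spectral_norm D
          + 2 * spectral_norm B * (norm D)\<^sup>2 * J0 / (min_eigenvalue \<Sigma>0 * min_eigenvalue R)
          + spectral_norm A * (norm D)\<^sup>2 / spectral_norm B) * \<xi>"
    using pos by (intro add_nonneg_nonneg mult_nonneg_nonneg divide_nonneg_nonneg nn) auto
  then have L: "2 * J0 / min_eigenvalue Q * min_eigenvalue R \<le> L"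
    unfolding L_def using pos maxR by (intro mult_left_mono) auto
  obtain x where x: "x 0 = K0" "P.flow x" by (rule P.flow_exists[OF st0])
  obtain Ks where Ks: "P.stable Ks" "P.EK Ks = 0" "\<And>K. P.stable K \<Longrightarrow> P.cost Ks \<le> P.cost K"
    "\<And>K. P.stable K \<Longrightarrow> P.cost K \<le> P.cost Ks \<Longrightarrow> K = Ks"
    by (rule P.minimizer[OF st0]) blast
  have sx: "P.stable (x t)" if "0 \<le> t" for t by (rule P.flow_stable[OF x(2) that])
  have grad: "gradient Jr K = P.grad K" "GDERIV Jr K :> P.grad K" if "P.stable K" for K
    unfolding Jr by (rule P.cost_gradient[OF that])+
  have mono: "J (x t) \<le> J (x s)" if "0 \<le> s" "s \<le> t" for s t
    using P.flow_cost_mono[OF x(2) that] that by (simp add: J_eq sx ennreal_leI)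
  have J_min: "J Ks \<le> J K" for K
    unfolding J_def by (rule P.J_minimal[OF Ks(1,3)])
  show ?thesis
  proof (intro exI[of _ x] conjI)
    show "x 0 = K0" by (rule x(1))
    show "gradient_flow Jr x"
      unfolding gradient_flow_def using x(2) by (auto simp: grad P.flow_def)
    show "\<forall>s t. 0 \<le> s \<longrightarrow> s \<le> t \<longrightarrow> J (x t) \<le> J (x s)" using mono by blast
    show "\<forall>t\<ge>0. x t \<in> {K'. J K' \<le> J K0}" using mono[of 0] x(1) by simp
    \<comment> \<open>\<open>gradient\<close> is a definite description and has been computed at
      stable feedbacks only, so the two fields are compared along the trajectory at nonnegative
      times.\<close>
    have "\<forall>\<^sub>F t in at_top. P.grad (x t) = gradient Jr (x t)"
      using eventually_ge_at_top[of 0] by eventually_elim (simp add: grad sx)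
    moreover have "((\<lambda>t. P.grad (x t)) \<longlongrightarrow> 0) at_top"
      by (rule P.flow_gradient_tendsto[OF x(2) Ks(1-3)])
    ultimately show "((\<lambda>t. gradient Jr (x t)) \<longlongrightarrow> 0) at_top"
      by (rule Lim_transform_eventually[rotated])
    show "\<forall>T>0. \<exists>s\<in>{0..T}.
       (\<forall>t\<in>{0..T}. (norm (gradient Jr (x s)))\<^sup>2 \<le> (norm (gradient Jr (x t)))\<^sup>2) \<and>
       (norm (gradient Jr (x s)))\<^sup>2 \<le> J0 / T"
    proof (intro allI impI)
      fix T :: real assume "0 < T"
      from P.flow_min_gradient[OF x(2) this] obtain s where s: "s \<in> {0..T}"
        "\<And>t. t \<in> {0..T} \<Longrightarrow> (norm (P.grad (x s)))\<^sup>2 \<le> (norm (P.grad (x t)))\<^sup>2"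
        "(norm (P.grad (x s)))\<^sup>2 \<le> P.cost (x 0) / T" by blast
      have g: "gradient Jr (x t) = P.grad (x t)" if "t \<in> {0..T}" for t
        by (rule grad(1)[OF sx]) (use that in simp)
      show "\<exists>s\<in>{0..T}. (\<forall>t\<in>{0..T}. (norm (gradient Jr (x s)))\<^sup>2 \<le> (norm (gradient Jr (x t)))\<^sup>2) \<and>
         (norm (gradient Jr (x s)))\<^sup>2 \<le> J0 / T"
      proof (intro bexI[of _ s] conjI ballI s(1))
        show "(norm (gradient Jr (x s)))\<^sup>2 \<le> J0 / T"
          unfolding g[OF s(1)] J0 x(1)[symmetric] by (rule s(3))
        show "(norm (gradient Jr (x s)))\<^sup>2 \<le> (norm (gradient Jr (x t)))\<^sup>2" if "t \<in> {0..T}" for t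
          unfolding g[OF s(1)] g[OF that] by (rule s(2)[OF that])
      qed
    qed
    show "\<exists>Ks. (\<forall>K'. J Ks \<le> J K') \<and> (\<forall>K''. (\<forall>K'. J K'' \<le> J K') \<longrightarrow> K'' = Ks) \<and>
       (x \<longlongrightarrow> Ks) at_top \<and>
       (\<forall>t\<ge>0. Jr (x t) - Jr Ks \<le> (Jr K0 - Jr Ks) * exp (- t / \<mu>)) \<and>
       (\<forall>t\<ge>0. norm (x t - Ks) \<le> 4 * \<mu> * sqrt (L * (Jr K0 - Jr Ks)) * exp (- t / (2 * \<mu>)))"
    proof (intro exI[of _ Ks] conjI allI impI)
      show "J Ks \<le> J K'" for K' by (rule J_min)
      show "(x \<longlongrightarrow> Ks) at_top" by (rule P.flow_tendsto[OF x(2) Ks(1-3)])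
      show "K'' = Ks" if min: "\<forall>K'. J K'' \<le> J K'" for K''
      proof (rule Ks(4))
        \<comment> \<open>A competing minimizer could a priori be unstable. Its cost is at most that
          of \<open>Ks\<close>, hence finite, which forces stability and brings it into the scope of
          the uniqueness statement.\<close>
        have le: "J K'' \<le> ennreal (P.cost Ks)" using min J_eq[OF Ks(1)] by metis
        then have "J K'' < \<infinity>" using ennreal_less_top order_le_less_trans by (metis infinity_ennreal_def)
        then show st: "P.stable K''" unfolding J_def by (rule P.finite_cost_stable)
        show "P.cost K'' \<le> P.cost Ks"
          using le P.cost_pos[OF Ks(1)] by (simp add: J_eq[OF st])
      qed
      fix t :: real assume t: "0 \<le> t"
      show "Jr (x t) - Jr Ks \<le> (Jr K0 - Jr Ks) * exp (- t / \<mu>)"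
        using P.flow_cost_decay[OF x(2) Ks(1-3) t] by (simp add: Jr_eq sx t Ks(1) st0 \<mu> J0 x(1))
      show "norm (x t - Ks) \<le> 4 * \<mu> * sqrt (L * (Jr K0 - Jr Ks)) * exp (- t / (2 * \<mu>))"
        using P.flow_distance_decay[OF x(2) Ks(1-3) t, of L] L by (simp add: Jr_eq Ks(1) st0 \<mu> J0 x(1))
    qed
  qed
qed

end
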